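(* Assume (A1) and (A2). Fix $M>0$, $K\ge1$, and let $W_1\in\dot W^{2,\infty}$, $W_2\in\dot E_K$ with $\|W_1\|_{W^{2,\infty}},\|W_2\|_{W^{2,\infty}}\le M$. Then there is a constant $S>0$ depending only on $d,T,M,c_*,\phi_{\min},\|\phi\|_{H^d}$ (not on $K$) such that $$\|W_2-W_1\|_{L^2}\le\|W_1-W_{1,K}\|_{L^2}+S\,K^{3\zeta/2}\Big(\|\rho_{W_2}-\rho_{W_1}\|_{L^2([0,T];L^2)}+\|\rho_{W_2}-\rho_{W_1}\|_{H^1([0,T];H^{-2})}\Big),$$ where $W_{1,K}$ is the $L^2$-orthogonal projection of $W_1$ onto $\dot E_K$.
   Context: $\mathbb T^d=\mathbb R^d/\mathbb Z^d$. For $s\in\mathbb R$, $H^s=H^s(\mathbb T^d)$ is the periodic Sobolev space with norm $\|u\|_{H^s}^2=\sum_{k\in\mathbb Z^d}(1+|k|^2)^s|\hat u_k|^2$, $\hat u_k=\langle u,e^{2\pi ik\cdot x}\rangle$; $W^{2,\infty}$ is the Sobolev space with derivatives up to order 2 in $L^\infty$; a dot denotes mean-zero subspace. $L^2([0,T];B)$, $H^1([0,T];B)$ are Bochner spaces. $F_\beta:=L^2([0,T];H^{\beta+1})\cap H^1([0,T];H^{\beta-1})$. Assumption (A1): $\phi$ is a probability density on $\mathbb T^d$ with $\phi\in H^\beta$ for some even integer $\beta\ge3+d$. Assumption (A2): $\inf_x\phi(x)\ge\phi_{\min}>0$, and there are $c_*>0$ and $\zeta>\beta+d/2$ such that $|\hat\phi_k|\ge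 c_*|k|^{-\zeta}$ for all $k\in\mathbb Z^d\setminus\{0\}$. For $W\in\dot W^{2,\infty}$, $\rho_W$ denotes the unique solution in $F_\beta$ of $\partial_t\rho=\Delta\rho+\nabla\cdot(\rho\nabla W*\rho)$ on $[0,T]\times\mathbb T^d$, $\rho(0)=\phi$. $\dot E_K$ is the space of real mean-zero trigonometric polynomials of degree at most $K$: the real span of $\{\tau_k:k\in\mathbb Z^d,0<|k|\le K\}$, where $\tau_k(x)=\prod_{j=1}^dT_{k_j}(x_j)$ with $T_m(y)=\sqrt2\cos(2\pi my)$ for $m>0$, $T_0=1$, $T_m(y)=\sqrt2\sin(2\pi my)$ for $m<0$. *)

theory Defs
  imports "HOL-Analysis.Analysis"
begin

text \<open>The torus T^d is represented by Z^d-periodic functions on real^'d, d = CARD('d);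
  integrals over the torus are integrals over the unit cube.\<close>

definition cube :: "(real^'d) set" where
  "cube = cbox 0 One"

definition kvec :: "int^'d \<Rightarrow> real^'d" where
  "kvec k = (\<chi> j. real_of_int (k$j))"

definition periodic :: "(real^'d \<Rightarrow> 'a) \<Rightarrow> bool" where
  "periodic u \<longleftrightarrow> (\<forall>x k. u (x + kvec k) = u x)"

definition fcoef :: "(real^'d \<Rightarrow> real) \<Rightarrow> int^'d \<Rightarrow> complex" where
  "fcoef u k = (LINT x:cube|lborel. complex_of_real (u x) * cis (- 2 * pi * (kvec k \<bullet> x)))"

definition L2fun :: "(real^'d \<Rightarrow> real) \<Rightarrow> bool" where
  "L2fun u \<longleftrightarrow> u \<in> borel_measurable lborel \<and> periodic u \<and>
     set_integrable lborel cube (\<lambda>x. (u x)^2)"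

definition L2_norm :: "(real^'d \<Rightarrow> real) \<Rightarrow> real" where
  "L2_norm u = sqrt (LINT x:cube|lborel. (u x)^2)"

definition in_H :: "real \<Rightarrow> (real^'d \<Rightarrow> real) \<Rightarrow> bool" where
  "in_H s u \<longleftrightarrow> L2fun u \<and>
     (\<lambda>k. (1 + (norm (kvec k))^2) powr s * (cmod (fcoef u k))^2) summable_on UNIV"

definition H_norm :: "real \<Rightarrow> (real^'d \<Rightarrow> real) \<Rightarrow> real" where
  "H_norm s u = sqrt (\<Sum>\<^sub>\<infinity>k. (1 + (norm (kvec k))^2) powr s * (cmod (fcoef u k))^2)"

definition wderiv :: "(real^'d \<Rightarrow> real) \<Rightarrow> nat^'d \<Rightarrow> (real^'d \<Rightarrow> real) \<Rightarrow> bool" where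
  "wderiv u \<alpha> g \<longleftrightarrow> g \<in> borel_measurable lborel \<and> periodic g \<and> set_integrable lborel cube g \<and>
     (\<forall>k. fcoef g k = (\<Prod>j\<in>UNIV. (2 * pi * \<i> * of_int (k$j)) ^ (\<alpha>$j)) * fcoef u k)"

definition midx2 :: "(nat^'d) set" where
  "midx2 = {\<alpha>. (\<Sum>j\<in>UNIV. \<alpha>$j) \<le> 2}"

definition W2inf :: "(real^'d \<Rightarrow> real) \<Rightarrow> bool" where
  "W2inf W \<longleftrightarrow> W \<in> borel_measurable lborel \<and> periodic W \<and> set_integrable lborel cube W \<and>
     (\<forall>\<alpha>\<in>midx2. \<exists>g C. wderiv W \<alpha> g \<and> (AE x in lborel. x \<in> cube \<longrightarrow> \<bar>g x\<bar> \<le> C))"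

definition W2inf_norm :: "(real^'d \<Rightarrow> real) \<Rightarrow> real" where
  "W2inf_norm W = (\<Sum>\<alpha>\<in>midx2. Inf {C. 0 \<le> C \<and>
      (\<exists>g. wderiv W \<alpha> g \<and> (AE x in lborel. x \<in> cube \<longrightarrow> \<bar>g x\<bar> \<le> C))})"

definition Tfun :: "int \<Rightarrow> real \<Rightarrow> real" where
  "Tfun m y = (if m > 0 then sqrt 2 * cos (2 * pi * of_int m * y)
               else if m = 0 then 1 else sqrt 2 * sin (2 * pi * of_int m * y))"

definition tau :: "int^'d \<Rightarrow> real^'d \<Rightarrow> real" where
  "tau k x = (\<Prod>j\<in>UNIV. Tfun (k$j) (x$j))"

definition EK :: "nat \<Rightarrow> (real^'d \<Rightarrow> real) set" where
  "EK K = {f. \<exists>c. f = (\<lambda>x. \<Sum>k\<in>{k. 0 < norm (kvec k) \<and> norm (kvec k) \<le> real K}. c k * tau k x)}"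

definition is_L2proj :: "nat \<Rightarrow> (real^'d \<Rightarrow> real) \<Rightarrow> (real^'d \<Rightarrow> real) \<Rightarrow> bool" where
  "is_L2proj K W P \<longleftrightarrow> P \<in> EK K \<and>
     (\<forall>v\<in>EK K. (LINT x:cube|lborel. (W x - P x) * v x) = 0)"

definition L2H :: "real \<Rightarrow> real \<Rightarrow> (real \<Rightarrow> real^'d \<Rightarrow> real) \<Rightarrow> bool" where
  "L2H T s u \<longleftrightarrow> (\<forall>k. (\<lambda>t. fcoef (u t) k) \<in> borel_measurable (lebesgue_on {0..T})) \<and>
     (AE t in lebesgue_on {0..T}. in_H s (u t)) \<and>
     integrable (lebesgue_on {0..T}) (\<lambda>t. (H_norm s (u t))^2)"

definition tderiv :: "real \<Rightarrow> (real \<Rightarrow> real^'d \<Rightarrow> real) \<Rightarrow> (real \<Rightarrow> real^'d \<Rightarrow> real) \<Rightarrow> bool" where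
  "tderiv T u g \<longleftrightarrow> (\<forall>k. (\<lambda>s. fcoef (g s) k) integrable_on {0..T} \<and>
     (\<forall>t\<in>{0..T}. fcoef (u t) k = fcoef (u 0) k + integral {0..t} (\<lambda>s. fcoef (g s) k)))"

text \<open>rho in F_beta, with time derivative g, solves
  d_t rho = Lap rho + div (rho grad W * rho), rho(0) = phi (weak / Fourier form).\<close>
definition solves :: "nat \<Rightarrow> real \<Rightarrow> (real^'d \<Rightarrow> real) \<Rightarrow> (real^'d \<Rightarrow> real)
    \<Rightarrow> (real \<Rightarrow> real^'d \<Rightarrow> real) \<Rightarrow> (real \<Rightarrow> real^'d \<Rightarrow> real) \<Rightarrow> bool" where
  "solves \<beta> T W \<phi> \<rho> g \<longleftrightarrow>
     (\<forall>t\<in>{0..T}. L2fun (\<rho> t)) \<and>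
     L2H T (real \<beta> + 1) \<rho> \<and> L2H T (real \<beta> - 1) \<rho> \<and> L2H T (real \<beta> - 1) g \<and>
     tderiv T \<rho> g \<and>
     (AE x in lborel. x \<in> cube \<longrightarrow> \<rho> 0 x = \<phi> x) \<and>
     (\<forall>G. (\<forall>j. wderiv W (axis j 1) (G j)) \<longrightarrow>
        (AE t in lebesgue_on {0..T}. \<forall>k. fcoef (g t) k =
            - complex_of_real (4 * pi^2 * (norm (kvec k))^2) * fcoef (\<rho> t) k
            + (\<Sum>j\<in>UNIV. 2 * pi * \<i> * of_int (k$j) *
                 fcoef (\<lambda>x. \<rho> t x * (LINT y:cube|lborel. G j (x - y) * \<rho> t y)) k)))"

definition L2L2_norm :: "real \<Rightarrow> (real \<Rightarrow> real^'d \<Rightarrow> real) \<Rightarrow> real" where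
  "L2L2_norm T u = sqrt (LINT t:{0..T}|lborel. (L2_norm (u t))^2)"

definition H1H_norm :: "real \<Rightarrow> real \<Rightarrow> (real \<Rightarrow> real^'d \<Rightarrow> real) \<Rightarrow> (real \<Rightarrow> real^'d \<Rightarrow> real) \<Rightarrow> real" where
  "H1H_norm T s u g = sqrt (LINT t:{0..T}|lborel. (H_norm s (u t))^2 + (H_norm s (g t))^2)"

end

theory Submission
  imports Defs
begin

text \<open>In Fourier variables a solution is a curve of coefficients with
  \<open>b\<^sub>k' = - 4 \<pi>\<^sup>2 |k|\<^sup>2 b\<^sub>k - 4 \<pi>\<^sup>2 \<Sum>\<^sub>l (k \<bullet> l) b\<^bsub>k-l\<^esub> W\<^sub>l b\<^sub>l\<close>. When two such equations are subtracted,
  \<open>\<omega> = W\<^sub>2 - W\<^sub>1\<close> enters the equation of \<open>z = b - a\<close> through the matrix \<open>A(t)\<close> with entries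
  \<open>(k \<bullet> l) b\<^bsub>k-l\<^esub>(t)\<close>, applied to \<open>\<omega>\<^sub>l b\<^sub>l(t)\<close>. Up to a constant, \<open>A(t)\<close> is the elliptic operator
  \<open>u \<mapsto> - \<nabla> \<cdot> (\<rho>\<^sub>2 \<nabla> u)\<close>, which is coercive for short times because \<open>\<phi>\<close> is bounded below. Given \<open>y(t)\<close>,
  solve \<open>A(t) u(t) \<approx> y(t)\<close>, test the equation of \<open>z\<close> with \<open>u\<close> and integrate by parts in time: the
  integral of \<open>\<Sum>\<^sub>l \<omega>\<^sub>l b\<^sub>l cnj y\<^sub>l\<close> is bounded by the \<open>L\<^sup>2\<close> norm of \<open>z\<close> in space and time. Take
  \<open>y\<^sub>l(t) = \<chi>(t) exp (4 \<pi>\<^sup>2 |l|\<^sup>2 t) c\<^sub>l\<close> for \<open>|l| \<le> K\<close>, with a weight \<open>\<chi>\<close> on \<open>[0, \<tau>]\<close> whose moments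
  are \<open>1, 0, 0\<close>: then \<open>b\<^sub>l\<close> is extrapolated to its initial value \<open>\<phi>\<^sub>l\<close> with an error of order
  \<open>\<tau>\<^sup>3 K\<^sup>4\<close>. For \<open>\<tau>\<close> proportional to \<open>K\<close> to the power \<open>- (\<zeta> + 4) / 3\<close> the error is absorbed by the lower bound
  on \<open>|\<phi>\<^sub>l|\<close>, and \<open>c\<close> can be chosen so that the integral becomes \<open>\<Sum>\<^sub>l |\<omega>\<^sub>l|\<^sup>2\<close>. The \<open>L\<^sup>2\<close> norm in space and
  time alone controls the potentials; the \<open>H\<^sup>1 H\<^sup>-\<^sup>2\<close> term only enlarges the right-hand side.\<close>

section \<open>Weighted sequence spaces on the integer lattice\<close>

text \<open>The difference \<open>z\<close> is measured only in L2, so all derivatives must fall on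
  the test function \<open>u\<close>: this is why an H2 bound for \<open>u\<close> is proved and, by
  duality, an L2 bound for \<open>u'\<close> from the H^-2 size of \<open>y'\<close>. Boundary terms
  in time vanish because \<open>z\<close> starts at 0 and the weight ends at 0. The factor exp (4
  pi^2 |l|^2 t) undoes the heat decay: the derivative of its product with b_l is the exponential
  times the nonlinearity, which is bounded uniformly in l. Each further time derivative costs K^2,
  hence the error tau^3 K^4. The exponent 3 zeta / 2 arises as follows. Since c_l has size K^zeta
  |omega_l|, the H^-2 size of \<open>y'\<close> is K^(zeta - 2) / tau^2, and Cauchy-Schwarz in time
  returns tau^(1/2). With tau = K^(- (zeta + 4) / 3) the product K^(zeta - 2) tau^(-3/2) equals K^(3
  zeta / 2). For a weight with m moment conditions the same count gives zeta (1 + 3 / (2 m)) + 1 - 3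
  / m, and for zeta > 2 the order m = 3 is the smallest one that reaches 3 zeta / 2. Uniformity in K
  comes from coefficient bounds in H^d alone: on a short interval the H^d norm at most doubles and
  half of the coercivity survives, both independently of the truncation.\<close>

definition japb :: "int^'d \<Rightarrow> real" where
  "japb k = sqrt (1 + (norm (kvec k))^2)"

lemma kvec_add: "kvec (k + l) = kvec k + kvec l"
  and kvec_diff: "kvec (k - l) = kvec k - kvec l"
  and kvec_minus: "kvec (- k) = - kvec k"
  and kvec_zero [simp]: "kvec 0 = 0"
  by (simp_all add: kvec_def vec_eq_iff)

lemma kvec_nth: "kvec k $ j = real_of_int (k $ j)"
  by (simp add: kvec_def)

lemma norm_kvec_minus [simp]: "norm (kvec (- k)) = norm (kvec k)"
  by (simp add: kvec_minus)

lemma norm_kvec_diff_le: "norm (kvec (k - l)) \<le> norm (kvec k) + norm (kvec l)"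
  by (simp add: kvec_diff norm_triangle_ineq4)

lemma norm_kvec_le_diff_add: "norm (kvec k) \<le> norm (kvec (k - l)) + norm (kvec l)"
  by (metis kvec_diff norm_triangle_sub add.commute)

lemma norm_kvec_sq: "(norm (kvec k))^2 = (\<Sum>j\<in>UNIV. (real_of_int (k $ j))^2)"
  by (simp add: norm_eq_sqrt_inner inner_vec_def kvec_nth power2_eq_square sum_nonneg)

lemma norm_kvec_ge_1:
  assumes "k \<noteq> 0" shows "1 \<le> norm (kvec k)"
proof -
  obtain j where j: "k $ j \<noteq> 0" using assms by (auto simp: vec_eq_iff)
  have "1 \<le> \<bar>real_of_int (k $ j)\<bar>" using j by linarith
  also have "\<dots> \<le> norm (kvec k)" by (metis kvec_nth component_le_norm_cart real_norm_def)
  finally show ?thesis .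
qed

lemma japb_ge_1 [simp]: "1 \<le> japb k" by (simp add: japb_def)
lemma japb_pos [simp]: "0 < japb k" using japb_ge_1[of k] by linarith
lemma japb_sq: "(japb k)^2 = 1 + (norm (kvec k))^2" by (simp add: japb_def)
lemma norm_le_japb: "norm (kvec k) \<le> japb k"
  by (simp add: japb_def real_le_rsqrt)
lemma japb_le_norm: assumes "k \<noteq> 0" shows "japb k \<le> 2 * norm (kvec k)"
proof -
  have "1 + (norm (kvec k))^2 \<le> (2 * norm (kvec k))^2"
    using one_le_power[OF norm_kvec_ge_1[OF assms], of 2] unfolding power_mult_distrib by simp
  thus ?thesis unfolding japb_def using real_le_lsqrt[of "2 * norm (kvec k)"] by simp
qed
lemma japb_minus [simp]: "japb (- k) = japb k" by (simp add: japb_def)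

lemma japb_add_le: "japb (k + l) \<le> japb k + japb l"
proof -
  have "norm (kvec (k + l)) \<le> norm (kvec k) + norm (kvec l)" by (simp add: kvec_add norm_triangle_ineq)
  hence "(norm (kvec (k+l)))^2 \<le> (norm (kvec k) + norm (kvec l))^2" by (intro power_mono) auto
  moreover have "norm (kvec k) * norm (kvec l) \<le> japb k * japb l"
    by (intro mult_mono norm_le_japb) (auto simp: less_imp_le)
  moreover have "(japb k + japb l)^2 = 2 + (norm (kvec k))^2 + (norm (kvec l))^2 + 2 * (japb k * japb l)"
    by (simp add: power2_sum japb_sq)
  ultimately have "1 + (norm (kvec (k+l)))^2 \<le> (japb k + japb l)^2" by (simp add: power2_sum)
  thus ?thesis unfolding japb_def[of "k+l"] using japb_pos[of k] japb_pos[of l]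
    by (intro real_le_lsqrt) linarith+
qed

lemma summable_on_int_powr:
  assumes "p > 1/2"
  shows "(\<lambda>n::int. (1 + (real_of_int n)^2) powr (-p)) summable_on UNIV"
proof -
  have s: "summable (\<lambda>n::nat. (1 + (real n)^2) powr (-p))"
  proof (rule summable_comparison_test)
    show "summable (\<lambda>n::nat. real n powr (-(2*p)))" using assms by (simp add: summable_real_powr_iff)
    show "\<exists>N. \<forall>n\<ge>N. norm ((1 + (real n)^2) powr (-p)) \<le> real n powr (-(2*p))"
    proof (intro exI[of _ 1] allI impI)
      fix n :: nat assume n: "1 \<le> n"
      have "(1 + (real n)^2) powr (-p) \<le> ((real n)^2) powr (-p)"
        using n assms by (intro powr_mono2') auto
      also have "\<dots> = real n powr (-(2*p))"
        using n by (simp add: powr_powr flip: powr_numeral)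
      finally show "norm ((1 + (real n)^2) powr (-p)) \<le> real n powr (-(2*p))" by simp
    qed
  qed
  hence sn: "(\<lambda>n::nat. (1 + (real n)^2) powr (-p)) summable_on UNIV"
    by (simp add: summable_on_UNIV_nonneg_real_iff)
  let ?f = "\<lambda>n::int. (1 + (real_of_int n)^2) powr (-p)"
  have 1: "?f summable_on (range int)"
    by (subst summable_on_reindex) (use sn in \<open>auto simp: o_def inj_on_def\<close>)
  have 2: "?f summable_on (range (\<lambda>n. - int n))"
    by (subst summable_on_reindex) (use sn in \<open>auto simp: o_def inj_on_def\<close>)
  have "?f summable_on (range int \<union> range (\<lambda>n. - int n))"
  proof -
    have "?f summable_on (range int \<union> (range (\<lambda>n. - int n) - range int))"
      by (intro summable_on_Un_disjoint 1 summable_on_subset_banach[OF 2]) auto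
    thus ?thesis by (simp add: Un_Diff_cancel)
  qed
  moreover have "(UNIV::int set) = range int \<union> range (\<lambda>n. - int n)"
  proof -
    have "x \<in> range int \<union> range (\<lambda>n. - int n)" for x :: int
      by (cases x rule: int_cases2) auto
    thus ?thesis by blast
  qed
  ultimately show ?thesis by simp
qed

lemma sum_prod_vec_box:
  fixes f :: "int \<Rightarrow> real"
  assumes "finite A"
  shows "(\<Sum>k\<in>{k::int^'d. \<forall>j. k $ j \<in> A}. \<Prod>j\<in>UNIV. f (k $ j)) = (\<Sum>n\<in>A. f n) ^ CARD('d)"
    and "finite {k::int^'d. \<forall>j. k $ j \<in> A}"
proof -
  have bij: "bij_betw (\<lambda>g. \<chi> j. g j) (PiE UNIV (\<lambda>_::'d. A)) {k::int^'d. \<forall>j. k $ j \<in> A}"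
    by (rule bij_betw_byWitness[where f' = "\<lambda>k j. k $ j"]) (auto simp: vec_eq_iff PiE_def)
  have "(\<Prod>j\<in>(UNIV::'d set). \<Sum>n\<in>A. f n) = (\<Sum>g\<in>PiE UNIV (\<lambda>_::'d. A). \<Prod>j\<in>UNIV. f (g j))"
    using assms by (intro prod_sum_PiE) auto
  also have "\<dots> = (\<Sum>k\<in>{k::int^'d. \<forall>j. k $ j \<in> A}. \<Prod>j\<in>UNIV. f (k $ j))"
    by (subst sum.reindex_bij_betw[OF bij, symmetric]) simp
  finally show "(\<Sum>k\<in>{k::int^'d. \<forall>j. k $ j \<in> A}. \<Prod>j\<in>UNIV. f (k $ j)) = (\<Sum>n\<in>A. f n) ^ CARD('d)" by simp
  show "finite {k::int^'d. \<forall>j. k $ j \<in> A}"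
    using bij_betw_finite[OF bij] assms by (simp add: finite_PiE)
qed

text \<open>The weight is split into d equal powers with exponent p = s / (2 d) > 1/2, and each of
  them is bounded by the weight of a single coordinate. A finite set lies in a box, over which the
  sum of products factorises into one-dimensional sums.\<close>

lemma japb_powr_summable:
  assumes s: "s > real CARD('d)"
  shows "(\<lambda>k::int^'d. japb k powr (-s)) summable_on UNIV"
proof -
  define p where "p = s / (2 * real CARD('d))"
  have p: "p > 1/2" using s by (simp add: p_def field_simps)
  let ?f = "\<lambda>n::int. (1 + (real_of_int n)^2) powr (-p)"
  obtain C where C: "C = infsum ?f UNIV" by simp
  have C0: "\<And>A. finite A \<Longrightarrow> sum ?f A \<le> C"
    unfolding C by (intro finite_sum_le_infsum summable_on_int_powr p) auto
  have pw: "japb k powr (-s) \<le> (\<Prod>j\<in>UNIV. ?f (k $ j))" for k :: "int^'d"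
  proof -
    have "japb k powr (-s) = (1 + (norm (kvec k))^2) powr (- (s/2))"
      by (simp add: japb_def powr_powr flip: powr_half_sqrt)
    also have "\<dots> = (\<Prod>j\<in>(UNIV::'d set). (1 + (norm (kvec k))^2) powr (- p))"
    proof -
      let ?x = "1 + (norm (kvec k))^2"
      have x: "0 < ?x powr (-p)" by (smt (verit) powr_gt_zero zero_le_power2)
      have "(?x powr (-p)) ^ CARD('d) = (?x powr (-p)) powr real CARD('d)" using x by (rule powr_realpow[symmetric])
      also have "\<dots> = ?x powr (- p * real CARD('d))" by (rule powr_powr)
      also have "- p * real CARD('d) = - (s/2)" by (simp add: p_def)
      finally show ?thesis by simp
    qed
    also have "\<dots> \<le> (\<Prod>j\<in>UNIV. ?f (k $ j))"
    proof (intro prod_mono conjI)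
      fix j :: 'd
      have "(real_of_int (k $ j))^2 \<le> (norm (kvec k))^2"
        by (metis kvec_nth component_le_norm_cart power_mono abs_ge_zero power2_abs)
      thus "(1 + (norm (kvec k))^2) powr (- p) \<le> ?f (k $ j)"
        using p by (intro powr_mono2') (auto intro: add_pos_nonneg)
    qed auto
    finally show ?thesis .
  qed
  show ?thesis
  proof (intro nonneg_bdd_above_summable_on)
    show "bdd_above (sum (\<lambda>k::int^'d. japb k powr (-s)) ` {F. F \<subseteq> UNIV \<and> finite F})"
    proof (rule bdd_aboveI2)
      fix F :: "(int^'d) set" assume "F \<in> {F. F \<subseteq> UNIV \<and> finite F}"
      hence F: "finite F" by simp
      define A where "A = (\<Union>k\<in>F. range (\<lambda>j. k $ j))"
      have A: "finite A" using F by (simp add: A_def)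
      have "sum (\<lambda>k. japb k powr (-s)) F \<le> (\<Sum>k\<in>F. \<Prod>j\<in>UNIV. ?f (k $ j))"
        by (intro sum_mono pw)
      also have "\<dots> \<le> (\<Sum>k\<in>{k::int^'d. \<forall>j. k $ j \<in> A}. \<Prod>j\<in>UNIV. ?f (k $ j))"
        by (intro sum_mono2 sum_prod_vec_box(2) A) (auto simp: A_def intro!: prod_nonneg)
      also have "\<dots> = (\<Sum>n\<in>A. ?f n) ^ CARD('d)" by (rule sum_prod_vec_box(1)[OF A])
      also have "\<dots> \<le> C ^ CARD('d)" by (intro power_mono C0 A sum_nonneg) auto
      finally show "sum (\<lambda>k. japb k powr (-s)) F \<le> C ^ CARD('d)" .
    qed
  qed auto
qed

text \<open>Bounds in \<open>l\<^sup>2\<close> and \<open>l\<^sup>1\<close> are stated on finite sets, which avoids the value \<open>0\<close> of divergent infinite sums.\<close>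

definition l2bd :: "('a \<Rightarrow> real) \<Rightarrow> real \<Rightarrow> bool" where
  "l2bd f C \<longleftrightarrow> (\<forall>F. finite F \<longrightarrow> L2_set f F \<le> C)"

definition l1bd :: "('a \<Rightarrow> real) \<Rightarrow> real \<Rightarrow> bool" where
  "l1bd f C \<longleftrightarrow> (\<forall>F. finite F \<longrightarrow> (\<Sum>k\<in>F. f k) \<le> C)"

lemma l2bdD: "l2bd f C \<Longrightarrow> L2_set f F \<le> C"
  unfolding l2bd_def by (cases "finite F") (auto dest: spec[of _ "{}"])

lemma l2bd_nonneg: "l2bd f C \<Longrightarrow> 0 \<le> C"
  unfolding l2bd_def by (metis L2_set_empty finite.emptyI)

lemma l1bd_nonneg: "l1bd f C \<Longrightarrow> 0 \<le> C"
  unfolding l1bd_def by (metis sum.empty finite.emptyI)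

lemma l2bd_mono: "l2bd f C \<Longrightarrow> (\<And>k. \<bar>g k\<bar> \<le> f k) \<Longrightarrow> C \<le> D \<Longrightarrow> l2bd g D"
  unfolding l2bd_def
proof (intro allI impI)
  fix F assume h: "\<forall>F. finite F \<longrightarrow> L2_set f F \<le> C" "\<And>k. \<bar>g k\<bar> \<le> f k" "C \<le> D" "finite (F::'a set)"
  have "L2_set g F = L2_set (\<lambda>k. \<bar>g k\<bar>) F" by (simp add: L2_set_def)
  also have "\<dots> \<le> L2_set f F" by (intro L2_set_mono h) auto
  finally show "L2_set g F \<le> D" using h(1,3,4) by fastforce
qed

lemma l2bd_cmult: "l2bd f C \<Longrightarrow> 0 \<le> c \<Longrightarrow> l2bd (\<lambda>k. c * f k) (c * C)"
  unfolding l2bd_def by (simp add: L2_set_right_distrib[symmetric] mult_left_mono)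

lemma l2bd_add: "l2bd f C \<Longrightarrow> l2bd g D \<Longrightarrow> l2bd (\<lambda>k. f k + g k) (C + D)"
  unfolding l2bd_def by (auto intro!: order_trans[OF L2_set_triangle_ineq] add_mono)

lemma l2bd_reflect: "l2bd f C \<Longrightarrow> l2bd (\<lambda>k::'a::group_add. f (- k)) C"
  unfolding l2bd_def
proof (intro allI impI)
  fix F :: "'a set" assume h: "\<forall>F. finite F \<longrightarrow> L2_set f F \<le> C" "finite F"
  have "L2_set (\<lambda>k. f (- k)) F = L2_set f (uminus ` F)"
    unfolding L2_set_def by (subst sum.reindex) (auto simp: inj_on_def)
  thus "L2_set (\<lambda>k. f (- k)) F \<le> C" using h by simp
qed

lemma l2bd_member: "l2bd f C \<Longrightarrow> \<bar>f k\<bar> \<le> C"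
  using l2bdD[of f C "{k}"] by (simp add: L2_set_def)

lemma l2bd_mult_l1: "l2bd f C \<Longrightarrow> l2bd g D \<Longrightarrow> l1bd (\<lambda>k. \<bar>f k\<bar> * \<bar>g k\<bar>) (C * D)"
  unfolding l1bd_def
proof (intro allI impI)
  fix F assume h: "l2bd f C" "l2bd g D" "finite (F::'a set)"
  have "(\<Sum>k\<in>F. \<bar>f k\<bar> * \<bar>g k\<bar>) \<le> L2_set f F * L2_set g F" by (rule L2_set_mult_ineq)
  also have "\<dots> \<le> C * D" using h l2bd_nonneg[OF h(1)] by (intro mult_mono l2bdD) auto
  finally show "(\<Sum>k\<in>F. \<bar>f k\<bar> * \<bar>g k\<bar>) \<le> C * D" .
qed

section \<open>Convolution inequalities and the bilinear Sobolev estimate\<close>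

lemma sum_shift_le:
  fixes p :: "'a::ab_group_add \<Rightarrow> real"
  assumes "l1bd p P" "finite F"
  shows "(\<Sum>k\<in>F. p (k - l)) \<le> P" "(\<Sum>k\<in>F. p (l - k)) \<le> P"
proof -
  have "(\<Sum>k\<in>F. p (k - l)) = (\<Sum>m\<in>(\<lambda>k. k - l) ` F. p m)" by (subst sum.reindex) (auto simp: inj_on_def)
  thus "(\<Sum>k\<in>F. p (k - l)) \<le> P" using assms by (simp add: l1bd_def)
  have "(\<Sum>k\<in>F. p (l - k)) = (\<Sum>m\<in>(\<lambda>k. l - k) ` F. p m)" by (subst sum.reindex) (auto simp: inj_on_def)
  thus "(\<Sum>k\<in>F. p (l - k)) \<le> P" using assms by (simp add: l1bd_def)
qed

lemma L2_shift_le: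
  fixes p :: "'a::ab_group_add \<Rightarrow> real"
  assumes "l2bd p P" "finite F"
  shows "L2_set (\<lambda>k. p (k - l)) F \<le> P"
proof -
  have "L2_set (\<lambda>k. p (k - l)) F = L2_set p ((\<lambda>k. k - l) ` F)"
    unfolding L2_set_def by (subst sum.reindex) (auto simp: inj_on_def)
  thus ?thesis using assms by (simp add: l2bd_def)
qed

text \<open>Splitting \<open>p\<close> as sqrt p * sqrt p and applying Cauchy-Schwarz on the product
  set leaves only the row and column sums of \<open>p (k - l)\<close>, and both are at most
  \<open>P\<close>.\<close>

lemma young_l1_l2:
  fixes p q r :: "'a::ab_group_add \<Rightarrow> real"
  assumes F: "finite F" "finite G" and nn: "\<And>k. 0 \<le> p k" and P: "l1bd p P"
  shows "(\<Sum>k\<in>F. \<Sum>l\<in>G. p (k - l) * \<bar>q l\<bar> * \<bar>r k\<bar>) \<le> P * L2_set q G * L2_set r F"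
proof -
  have P0: "0 \<le> P" using l1bd_nonneg[OF P] .
  let ?a = "\<lambda>(k,l). sqrt (p (k - l)) * q l" and ?b = "\<lambda>(k,l). sqrt (p (k - l)) * r k"
  have "(\<Sum>k\<in>F. \<Sum>l\<in>G. p (k - l) * \<bar>q l\<bar> * \<bar>r k\<bar>) = (\<Sum>x\<in>F \<times> G. \<bar>?a x\<bar> * \<bar>?b x\<bar>)"
    by (simp add: sum.cartesian_product, rule sum.cong, simp)
      (auto simp: abs_mult nn algebra_simps)
  also have "\<dots> \<le> L2_set ?a (F \<times> G) * L2_set ?b (F \<times> G)" by (rule L2_set_mult_ineq)
  also have "\<dots> \<le> (sqrt P * L2_set q G) * (sqrt P * L2_set r F)"
  proof (intro mult_mono)
    have "(\<Sum>x\<in>F \<times> G. (?a x)^2) = (\<Sum>k\<in>F. \<Sum>l\<in>G. p (k - l) * (q l)^2)"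
      by (subst sum.cartesian_product, rule sum.cong, simp) (auto simp: power_mult_distrib nn)
    also have "\<dots> = (\<Sum>l\<in>G. (\<Sum>k\<in>F. p (k - l)) * (q l)^2)"
      by (subst sum.swap) (simp add: sum_distrib_right)
    also have "\<dots> \<le> (\<Sum>l\<in>G. P * (q l)^2)"
      by (intro sum_mono mult_right_mono sum_shift_le P F) auto
    finally have "(\<Sum>x\<in>F \<times> G. (?a x)^2) \<le> P * (\<Sum>l\<in>G. (q l)^2)" by (simp add: sum_distrib_left)
    thus "L2_set ?a (F \<times> G) \<le> sqrt P * L2_set q G"
      unfolding L2_set_def real_sqrt_mult[symmetric] by (rule real_sqrt_le_mono)
    have "(\<Sum>x\<in>F \<times> G. (?b x)^2) = (\<Sum>k\<in>F. (\<Sum>l\<in>G. p (k - l)) * (r k)^2)"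
      by (subst sum_distrib_right, subst sum.cartesian_product, rule sum.cong, simp) (auto simp: power_mult_distrib nn)
    also have "\<dots> \<le> (\<Sum>k\<in>F. P * (r k)^2)"
      by (intro sum_mono mult_right_mono sum_shift_le P F) auto
    finally have "(\<Sum>x\<in>F \<times> G. (?b x)^2) \<le> P * (\<Sum>k\<in>F. (r k)^2)" by (simp add: sum_distrib_left)
    thus "L2_set ?b (F \<times> G) \<le> sqrt P * L2_set r F"
      unfolding L2_set_def real_sqrt_mult[symmetric] by (rule real_sqrt_le_mono)
  qed (auto simp: P0)
  also have "\<dots> = P * L2_set q G * L2_set r F" using P0 by (simp add: algebra_simps)
  finally show ?thesis .
qed

text \<open>The roles are exchanged: a shift preserves the square sum of \<open>p\<close>, so each
  fixed \<open>l\<close> contributes at most \<open>P * L2_set r F\<close> by Cauchy-Schwarz in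
  \<open>k\<close>.\<close>

lemma young_l2_l1:
  fixes p q r :: "'a::ab_group_add \<Rightarrow> real"
  assumes F: "finite F" "finite G" and nn: "\<And>k. 0 \<le> p k" and P: "l2bd p P"
  shows "(\<Sum>k\<in>F. \<Sum>l\<in>G. p (k - l) * \<bar>q l\<bar> * \<bar>r k\<bar>) \<le> P * (\<Sum>l\<in>G. \<bar>q l\<bar>) * L2_set r F"
proof -
  have "(\<Sum>k\<in>F. \<Sum>l\<in>G. p (k - l) * \<bar>q l\<bar> * \<bar>r k\<bar>) = (\<Sum>l\<in>G. \<bar>q l\<bar> * (\<Sum>k\<in>F. \<bar>p (k - l)\<bar> * \<bar>r k\<bar>))"
    by (subst sum.swap) (simp add: sum_distrib_left nn algebra_simps)
  also have "\<dots> \<le> (\<Sum>l\<in>G. \<bar>q l\<bar> * (P * L2_set r F))"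
  proof (intro sum_mono mult_left_mono)
    fix l
    have "(\<Sum>k\<in>F. \<bar>p (k - l)\<bar> * \<bar>r k\<bar>) \<le> L2_set (\<lambda>k. p (k - l)) F * L2_set r F" by (rule L2_set_mult_ineq)
    also have "\<dots> \<le> P * L2_set r F" by (intro mult_right_mono L2_shift_le P F) auto
    finally show "(\<Sum>k\<in>F. \<bar>p (k - l)\<bar> * \<bar>r k\<bar>) \<le> P * L2_set r F" .
  qed auto
  also have "\<dots> = P * (\<Sum>l\<in>G. \<bar>q l\<bar>) * L2_set r F" by (simp add: sum_distrib_right sum_distrib_left algebra_simps)
  finally show ?thesis .
qed

text \<open>The exponent d - 1/4 exceeds d/2 in every dimension d \<ge> 1, so the weights are square
  summable. It stays 1/4 below d so that a coefficient whose gradient lies in H^(d-1) costs the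
  other factor only 3/4 of a derivative, less than the full one that has to be absorbed.\<close>

definition sigJ :: "'d::finite itself \<Rightarrow> real" where
  "sigJ _ = sqrt (\<Sum>\<^sub>\<infinity>k::int^'d. (japb k powr (- (real CARD('d) - 1/4)))^2)"

lemma sigJ_l2bd: "l2bd (\<lambda>k::int^'d. japb k powr (- (real CARD('d) - 1/4))) (sigJ TYPE('d))"
  unfolding l2bd_def
proof (intro allI impI)
  fix F :: "(int^'d) set" assume F: "finite F"
  have c: "1 \<le> real CARD('d)" by (simp add: Suc_leI)
  have aux: "1 \<le> x \<Longrightarrow> x < 2 * (x - 1/4)" for x :: real by simp
  have "(\<lambda>k::int^'d. (japb k powr (- (real CARD('d) - 1/4)))^2) = (\<lambda>k. japb k powr (- (2 * (real CARD('d) - 1/4))))"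
    by (simp add: fun_eq_iff powr_powr algebra_simps flip: powr_numeral)
  moreover have "(\<lambda>k::int^'d. japb k powr (- (2 * (real CARD('d) - 1/4)))) summable_on UNIV"
    by (rule japb_powr_summable) (rule aux[OF c])
  ultimately have "(\<lambda>k::int^'d. (japb k powr (- (real CARD('d) - 1/4)))^2) summable_on UNIV" by simp
  thus "L2_set (\<lambda>k::int^'d. japb k powr (- (real CARD('d) - 1/4))) F \<le> sigJ TYPE('d)"
    unfolding L2_set_def sigJ_def by (intro real_sqrt_le_mono finite_sum_le_infsum F) auto
qed

lemma sigJ_ge_1: "1 \<le> sigJ TYPE('d::finite)"
  using l2bd_member[OF sigJ_l2bd, of "0::int^'d"] by (simp add: japb_def)

text \<open>For each pair of frequencies the available weight s1 + s2 is spent on the factor with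
  the smaller frequency. That factor becomes absolutely summable by Cauchy-Schwarz against the
  square summable weight, the other one stays in l2, and one of the two Young inequalities
  applies.\<close>

lemma bilinear_estimate:
  fixes p q r :: "int^'d \<Rightarrow> real"
  assumes F: "finite F" "finite G" and nn: "\<And>k. 0 \<le> p k"
    and s: "0 \<le> s1" "0 \<le> s2" "real CARD('d) - 1/4 \<le> s1 + s2"
    and P: "l2bd (\<lambda>k. japb k powr s1 * p k) P"
  shows "(\<Sum>k\<in>F. \<Sum>l\<in>G. p (k - l) * \<bar>q l\<bar> * \<bar>r k\<bar>)
    \<le> 2 * sigJ TYPE('d) * P * L2_set (\<lambda>l. japb l powr s2 * q l) G * L2_set r F"
proof -
  let ?s = "real CARD('d) - 1/4"
  let ?w = "\<lambda>k::int^'d. japb k powr (- ?s)"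
  let ?p = "\<lambda>k. japb k powr s1 * p k" and ?q = "\<lambda>l. japb l powr s2 * q l"
  have P0: "0 \<le> P" using l2bd_nonneg[OF P] .
  have pw: "p m * \<bar>q l\<bar> \<le> ?w m * ?p m * \<bar>?q l\<bar> + ?p m * \<bar>?w l * ?q l\<bar>" for m l
  proof -
    have key: "1 \<le> ?w m * japb m powr s1 * japb l powr s2 + japb m powr s1 * japb l powr s2 * ?w l"
    proof (cases "japb m \<le> japb l")
      case True
      have "1 \<le> japb m powr (s1 + s2 - ?s)" using s by (intro ge_one_powr_ge_zero) auto
      also have "\<dots> = ?w m * japb m powr s1 * japb m powr s2" by (simp add: algebra_simps flip: powr_add)
      also have "\<dots> \<le> ?w m * japb m powr s1 * japb l powr s2"
        using True s by (intro mult_left_mono powr_mono2) (auto simp: less_imp_le)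
      finally show ?thesis by (smt (verit) mult_nonneg_nonneg powr_ge_zero)
    next
      case False
      have "1 \<le> japb l powr (s1 + s2 - ?s)" using s by (intro ge_one_powr_ge_zero) auto
      also have "\<dots> = japb l powr s1 * (japb l powr s2 * ?w l)" by (simp add: algebra_simps flip: powr_add)
      also have "\<dots> \<le> japb m powr s1 * (japb l powr s2 * ?w l)"
        using False s by (intro mult_right_mono powr_mono2) (auto simp: less_imp_le)
      finally show ?thesis by (smt (verit) mult.assoc mult_nonneg_nonneg powr_ge_zero)
    qed
    have "p m * \<bar>q l\<bar> * 1 \<le> p m * \<bar>q l\<bar> * (?w m * japb m powr s1 * japb l powr s2 + japb m powr s1 * japb l powr s2 * ?w l)"
      by (intro mult_left_mono key) (auto simp: nn)
    thus ?thesis by (simp add: abs_mult algebra_simps)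
  qed
  have "(\<Sum>k\<in>F. \<Sum>l\<in>G. p (k - l) * \<bar>q l\<bar> * \<bar>r k\<bar>)
     \<le> (\<Sum>k\<in>F. \<Sum>l\<in>G. (?w (k-l) * ?p (k-l) * \<bar>?q l\<bar> + ?p (k-l) * \<bar>?w l * ?q l\<bar>) * \<bar>r k\<bar>)"
    by (intro sum_mono mult_right_mono pw) auto
  also have "\<dots> = (\<Sum>k\<in>F. \<Sum>l\<in>G. (\<lambda>m. ?w m * ?p m) (k-l) * \<bar>?q l\<bar> * \<bar>r k\<bar>)
      + (\<Sum>k\<in>F. \<Sum>l\<in>G. ?p (k-l) * \<bar>?w l * ?q l\<bar> * \<bar>r k\<bar>)"
    by (simp add: sum.distrib distrib_right)
  also have "\<dots> \<le> (sigJ TYPE('d) * P) * L2_set ?q G * L2_set r F + P * (\<Sum>l\<in>G. \<bar>?w l * ?q l\<bar>) * L2_set r F"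
  proof (intro add_mono young_l1_l2 young_l2_l1 F P)
    show "l1bd (\<lambda>m. ?w m * ?p m) (sigJ TYPE('d) * P)"
      using l2bd_mult_l1[OF sigJ_l2bd P] by (simp add: abs_mult nn)
  qed (auto simp: nn)
  also have "\<dots> \<le> (sigJ TYPE('d) * P) * L2_set ?q G * L2_set r F + P * (sigJ TYPE('d) * L2_set ?q G) * L2_set r F"
  proof -
    have "(\<Sum>l\<in>G. \<bar>?w l * ?q l\<bar>) \<le> L2_set ?w G * L2_set ?q G"
      unfolding abs_mult[of "?w _"] by (rule L2_set_mult_ineq)
    also have "\<dots> \<le> sigJ TYPE('d) * L2_set ?q G" by (intro mult_right_mono l2bdD sigJ_l2bd) auto
    finally show ?thesis using P0 by (intro add_left_mono mult_right_mono mult_left_mono) auto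
  qed
  also have "\<dots> = 2 * sigJ TYPE('d) * P * L2_set ?q G * L2_set r F" by (simp add: algebra_simps)
  finally show ?thesis .
qed

lemma japb_neq_0: "japb k \<noteq> 0" using japb_pos[of k] by linarith

section \<open>The Galerkin operator\<close>

text \<open>The truncation of \<open>u \<mapsto> - \<nabla> \<cdot> (b \<nabla> u) / (4 \<pi>\<^sup>2)\<close> to the modes in \<open>F\<close>.\<close>

definition Aop :: "(int^'d \<Rightarrow> complex) \<Rightarrow> (int^'d) set \<Rightarrow> (int^'d \<Rightarrow> complex) \<Rightarrow> int^'d \<Rightarrow> complex" where
  "Aop b F u k = (\<Sum>l\<in>F. of_real (kvec k \<bullet> kvec l) * b (k - l) * u l)"

definition cip :: "'a set \<Rightarrow> ('a \<Rightarrow> complex) \<Rightarrow> ('a \<Rightarrow> complex) \<Rightarrow> complex" where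
  "cip F v w = (\<Sum>k\<in>F. v k * cnj (w k))"

abbreviation nrm :: "'a set \<Rightarrow> ('a \<Rightarrow> complex) \<Rightarrow> real" where
  "nrm F v \<equiv> L2_set (\<lambda>k. cmod (v k)) F"

abbreviation nrm2 :: "(int^'d) set \<Rightarrow> (int^'d \<Rightarrow> complex) \<Rightarrow> real" where
  "nrm2 F v \<equiv> L2_set (\<lambda>k. (norm (kvec k))^2 * cmod (v k)) F"

text \<open>The Fourier form of the pointwise bound b \<ge> c: for the trigonometric polynomial with
  coefficients \<open>v\<close> the right-hand side is the integral of b |v|^2. It is asked for all
  finite sections at once, so that one constant serves every Galerkin truncation.\<close>

definition coercive :: "(int^'d \<Rightarrow> complex) \<Rightarrow> real \<Rightarrow> bool" where
  "coercive b c \<longleftrightarrow> (\<forall>F v. finite F \<longrightarrow>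
     c * (\<Sum>k\<in>F. (cmod (v k))^2) \<le> Re (\<Sum>k\<in>F. \<Sum>l\<in>F. b (k - l) * v l * cnj (v k)))"

lemma coerciveD:
  "coercive b c \<Longrightarrow> finite F \<Longrightarrow>
     c * (\<Sum>k\<in>F. (cmod (v k))^2) \<le> Re (\<Sum>k\<in>F. \<Sum>l\<in>F. b (k - l) * v l * cnj (v k))"
  by (simp only: coercive_def)

definition hermitian :: "('a::group_add \<Rightarrow> complex) \<Rightarrow> bool" where
  "hermitian b \<longleftrightarrow> (\<forall>k. b (- k) = cnj (b k))"

lemma nrm_sq: "(nrm F v)^2 = (\<Sum>k\<in>F. (cmod (v k))^2)"
  by (simp add: L2_set_def sum_nonneg)

lemma cip_self: "cip F v v = of_real ((nrm F v)^2)"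
  unfolding cip_def nrm_sq of_real_sum by (simp only: complex_norm_square)

lemma cip_bound_weighted:
  assumes "\<And>k. k \<in> F \<Longrightarrow> 0 < w k"
  shows "cmod (cip F v u) \<le> L2_set (\<lambda>k. cmod (v k) / w k) F * L2_set (\<lambda>k. w k * cmod (u k)) F"
proof -
  have "cmod (cip F v u) \<le> (\<Sum>k\<in>F. cmod (v k) * cmod (u k))"
    unfolding cip_def by (rule order_trans[OF norm_sum]) (simp add: norm_mult)
  also have "\<dots> = (\<Sum>k\<in>F. \<bar>cmod (v k) / w k\<bar> * \<bar>w k * cmod (u k)\<bar>)"
    by (rule sum.cong) (use assms in \<open>force simp: abs_mult abs_div_pos\<close>)+
  also have "\<dots> \<le> L2_set (\<lambda>k. cmod (v k) / w k) F * L2_set (\<lambda>k. w k * cmod (u k)) F"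
    by (rule L2_set_mult_ineq)
  finally show ?thesis .
qed

lemma cip_bound: "cmod (cip F v u) \<le> nrm F v * nrm F u"
  using cip_bound_weighted[of F "\<lambda>_. 1" v u] by simp

lemma nrm_triangle: "nrm F (\<lambda>k. v k + w k) \<le> nrm F v + nrm F w"
  by (rule order_trans[OF L2_set_mono L2_set_triangle_ineq]) (auto intro: norm_triangle_ineq)

lemma nrm_triangle_diff: "nrm F (\<lambda>k. v k - w k) \<le> nrm F v + nrm F w"
  by (rule order_trans[OF L2_set_mono L2_set_triangle_ineq]) (auto intro: norm_triangle_ineq4)

lemma nrm_scale: "0 \<le> c \<Longrightarrow> nrm F (\<lambda>k. of_real c * v k) = c * nrm F v"
  by (simp add: L2_set_right_distrib norm_mult)

lemma cip_add_left: "cip F (\<lambda>k. v k + w k) u = cip F v u + cip F w u"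
  by (simp add: cip_def sum.distrib algebra_simps)
lemma cip_diff_right: "cip F u (\<lambda>k. v k - w k) = cip F u v - cip F u w"
  by (simp add: cip_def sum_subtractf algebra_simps)

lemma Aop_add: "Aop b F (\<lambda>k. v k + w k) k = Aop b F v k + Aop b F w k"
  by (simp add: Aop_def sum.distrib algebra_simps)
lemma Aop_scale: "Aop b F (\<lambda>k. c * v k) k = c * Aop b F v k"
  by (simp add: Aop_def sum_distrib_left algebra_simps)

lemma hermitianD: "hermitian b \<Longrightarrow> cnj (b (k - l)) = b (l - k)"
  unfolding hermitian_def by (metis minus_diff_eq)

lemma Aop_sym:
  assumes "hermitian b"
  shows "cip F (Aop b F u) q = cip F u (Aop b F q)"
proof -
  have "cip F (Aop b F u) q = (\<Sum>k\<in>F. \<Sum>l\<in>F. of_real (kvec k \<bullet> kvec l) * b (k - l) * u l * cnj (q k))"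
    by (simp add: cip_def Aop_def sum_distrib_right)
  also have "\<dots> = (\<Sum>l\<in>F. \<Sum>k\<in>F. of_real (kvec k \<bullet> kvec l) * b (k - l) * u l * cnj (q k))"
    by (rule sum.swap)
  also have "\<dots> = cip F u (Aop b F q)"
    unfolding cip_def
  proof (rule sum.cong[OF refl])
    fix l
    have "cnj (Aop b F q l) = (\<Sum>k\<in>F. of_real (kvec l \<bullet> kvec k) * b (k - l) * cnj (q k))"
      unfolding Aop_def cnj_sum complex_cnj_mult complex_cnj_complex_of_real hermitianD[OF assms] ..
    also have "\<dots> = (\<Sum>k\<in>F. of_real (kvec k \<bullet> kvec l) * b (k - l) * cnj (q k))"
      by (simp only: inner_commute[of "kvec l"])
    finally show "(\<Sum>k\<in>F. of_real (kvec k \<bullet> kvec l) * b (k - l) * u l * cnj (q k)) = u l * cnj (Aop b F q l)"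
      by (simp only: sum_distrib_left mult_ac)
  qed
  finally show ?thesis .
qed

text \<open>Since k . l is the sum of k_j l_j, the quadratic form of the operator is the sum over j
  of the scalar forms at \<open>k_j * u_k\<close>, the components of the gradient; coercivity is
  used for each of them.\<close>

lemma coercive_Aop:
  assumes c: "coercive b c" and F: "finite F"
  shows "c * (L2_set (\<lambda>k. norm (kvec k) * cmod (u k)) F)^2 \<le> Re (cip F (Aop b F u) u)"
proof -
  have "c * (L2_set (\<lambda>k. norm (kvec k) * cmod (u k)) F)^2
      = c * (\<Sum>k\<in>F. (\<Sum>j\<in>UNIV. (cmod (of_real (of_int (k $ j)) * u k))^2))"
    by (simp add: L2_set_def sum_nonneg power_mult_distrib norm_kvec_sq norm_mult sum_distrib_right)
  also have "\<dots> = (\<Sum>j\<in>UNIV. c * (\<Sum>k\<in>F. (cmod (of_real (of_int (k $ j)) * u k))^2))"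
    by (subst sum.swap) (simp add: sum_distrib_left)
  also have "\<dots> \<le> (\<Sum>j\<in>UNIV. Re (\<Sum>k\<in>F. \<Sum>l\<in>F. b (k - l) * (of_real (of_int (l $ j)) * u l) * cnj (of_real (of_int (k $ j)) * u k)))"
    by (intro sum_mono coerciveD[OF c F])
  also have "\<dots> = Re (\<Sum>j\<in>UNIV. \<Sum>k\<in>F. \<Sum>l\<in>F. b (k - l) * (of_real (of_int (l $ j)) * u l) * cnj (of_real (of_int (k $ j)) * u k))"
    by simp
  also have "(\<Sum>j\<in>UNIV. \<Sum>k\<in>F. \<Sum>l\<in>F. b (k - l) * (of_real (of_int (l $ j)) * u l) * cnj (of_real (of_int (k $ j)) * u k))
     = (\<Sum>k\<in>F. \<Sum>j\<in>UNIV. \<Sum>l\<in>F. b (k - l) * (of_real (of_int (l $ j)) * u l) * cnj (of_real (of_int (k $ j)) * u k))"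
    by (rule sum.swap)
  also have "\<dots> = (\<Sum>k\<in>F. \<Sum>l\<in>F. \<Sum>j\<in>UNIV. b (k - l) * (of_real (of_int (l $ j)) * u l) * cnj (of_real (of_int (k $ j)) * u k))"
    by (rule sum.cong[OF refl], rule sum.swap)
  also have "\<dots> = cip F (Aop b F u) u"
    unfolding cip_def Aop_def sum_distrib_right inner_vec_def of_real_sum
    by (intro sum.cong refl) (simp add: kvec_nth)
  finally show ?thesis .
qed

lemma nrm_le_nrm1:
  assumes "0 \<notin> F"
  shows "nrm F u \<le> L2_set (\<lambda>k. norm (kvec k) * cmod (u k)) F"
    and "L2_set (\<lambda>k. norm (kvec k) * cmod (u k)) F \<le> nrm2 F u"
    and "L2_set (\<lambda>k. japb k powr 1 * (norm (kvec k) * cmod (u k))) F \<le> 2 * nrm2 F u"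
proof -
  have n: "1 \<le> norm (kvec k)" if "k \<in> F" for k using norm_kvec_ge_1[of k] that assms by auto
  show "nrm F u \<le> L2_set (\<lambda>k. norm (kvec k) * cmod (u k)) F"
    by (rule L2_set_mono) (auto intro: mult_right_mono[OF n, of _ "cmod _", simplified])
  show "L2_set (\<lambda>k. norm (kvec k) * cmod (u k)) F \<le> nrm2 F u"
    by (rule L2_set_mono) (auto intro!: mult_right_mono self_le_power n)
  have "L2_set (\<lambda>k. japb k powr 1 * (norm (kvec k) * cmod (u k))) F \<le> L2_set (\<lambda>k. 2 * ((norm (kvec k))^2 * cmod (u k))) F"
  proof (rule L2_set_mono)
    fix k assume "k \<in> F"
    hence "k \<noteq> 0" using assms by auto
    from japb_le_norm[OF this] have "japb k * (norm (kvec k) * cmod (u k)) \<le> (2 * norm (kvec k)) * (norm (kvec k) * cmod (u k))"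
      by (intro mult_right_mono) auto
    thus "japb k powr 1 * (norm (kvec k) * cmod (u k)) \<le> 2 * ((norm (kvec k))^2 * cmod (u k))"
      by (simp add: power2_eq_square algebra_simps less_imp_le)
  qed (auto simp: less_imp_le)
  thus "L2_set (\<lambda>k. japb k powr 1 * (norm (kvec k) * cmod (u k))) F \<le> 2 * nrm2 F u"
    by (simp add: L2_set_right_distrib)
qed

lemma l2bd_gradient:
  fixes b :: "int^'d \<Rightarrow> complex"
  assumes "l2bd (\<lambda>m. japb m powr real CARD('d) * cmod (b m)) R"
  shows "l2bd (\<lambda>m. japb m powr (real CARD('d) - 1) * (norm (kvec m) * cmod (b m))) R"
proof (rule l2bd_mono[OF assms _ order_refl])
  fix m :: "int^'d"
  have "japb m powr (real CARD('d) - 1) * norm (kvec m) \<le> japb m powr (real CARD('d) - 1) * japb m powr 1"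
    using norm_le_japb[of m] by (intro mult_left_mono) (auto simp: less_imp_le)
  also have "\<dots> = japb m powr real CARD('d)" by (simp only: powr_add[symmetric]) simp
  finally have "japb m powr (real CARD('d) - 1) * norm (kvec m) * cmod (b m) \<le> japb m powr real CARD('d) * cmod (b m)"
    by (intro mult_right_mono) auto
  thus "\<bar>japb m powr (real CARD('d) - 1) * (norm (kvec m) * cmod (b m))\<bar> \<le> japb m powr real CARD('d) * cmod (b m)"
    by (simp add: algebra_simps)
qed

text \<open>\<open>A\<close> is the constant of the commutator estimate. The parameter
  \<open>\<delta>\<close> is chosen such that 2 * A * \<delta> = c / 2, that is, the commutator
  consumes half of the coercivity; the other half produces the leading factor 2 / c, and 1 /
  \<delta>^3 is the price of the interpolation.\<close>

definition CH2 :: "'d::finite itself \<Rightarrow> real \<Rightarrow> real \<Rightarrow> real" where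
  "CH2 D R c = (let A = 2 * sigJ D * R; \<delta> = c / (4 * A) in (2 / c) * (1 + A / (\<delta>^3 * c)))"

lemma CH2_pos: "0 < R \<Longrightarrow> 0 < c \<Longrightarrow> 0 < CH2 TYPE('d::finite) R c"
  using sigJ_ge_1[where 'd = 'd] unfolding CH2_def Let_def
  by (intro mult_pos_pos divide_pos_pos add_pos_nonneg divide_nonneg_nonneg) auto

text \<open>With y = x powr (1/4): if \<delta> y \<ge> 1 then y^3 \<le> \<delta> y^4, otherwise y^3
  \<le> 1 / \<delta>^3.\<close>

lemma interpolation_powr:
  assumes x: "1 \<le> (x::real)" and \<delta>: "0 < \<delta>"
  shows "x powr (3/4) \<le> \<delta> * x + 1 / \<delta>^3"
proof -
  define y where "y = x powr (1/4)"
  have y: "0 < y" using x by (simp add: y_def)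
  have x4: "x = y^4" and x3: "x powr (3/4) = y^3" using x by (simp_all add: y_def powr_powr flip: powr_numeral)
  show ?thesis
  proof (cases "1 \<le> \<delta> * y")
    case True
    have "1 * y^3 \<le> (\<delta> * y) * y^3" using True y by (intro mult_right_mono) auto
    also have "\<dots> = \<delta> * x" unfolding x4 by (simp add: eval_nat_numeral)
    finally show ?thesis using \<delta> x3 by (simp add: add_increasing2)
  next
    case False
    have "(\<delta> * y)^3 \<le> 1" using False \<delta> y by (intro power_le_one) auto
    hence "y^3 \<le> 1 / \<delta>^3" using \<delta> by (simp add: field_simps power_mult_distrib)
    thus ?thesis using \<delta> x x3 by (simp add: add_increasing)
  qed
qed

text \<open>Test with \<open>u\<close> and with its Laplacian. The commutator
  is of lower order because the gradient of \<open>b\<close> is in \<open>H\<^sup>d\<^sup>-\<^sup>1\<close>, and it is absorbed by interpolation.\<close>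

lemma elliptic_H2:
  fixes b u :: "int^'d \<Rightarrow> complex"
  assumes c: "coercive b c" "0 < c" and R: "0 < R" "l2bd (\<lambda>m. japb m powr real CARD('d) * cmod (b m)) R"
    and F: "finite F" "0 \<notin> F"
  shows "nrm2 F u \<le> CH2 TYPE('d) R c * nrm F (Aop b F u)"
proof -
  define h where "h = nrm F (Aop b F u)"
  define X where "X = L2_set (\<lambda>k. norm (kvec k) * cmod (u k)) F"
  define Y where "Y = nrm2 F u"
  define A where "A = 2 * sigJ TYPE('d) * R"
  define \<delta> where "\<delta> = c / (4 * A)"
  define Z where "Z = L2_set (\<lambda>k. japb k powr (3/4) * (norm (kvec k) * cmod (u k))) F"
  have A: "0 < A" using sigJ_ge_1[where 'd = 'd] R by (simp add: A_def)
  have \<delta>: "0 < \<delta>" using A c by (simp add: \<delta>_def)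
  have nn: "0 \<le> h" "0 \<le> X" "0 \<le> Y" by (simp_all add: h_def X_def Y_def)
  have X: "c * X \<le> h"
  proof -
    have "c * X^2 \<le> cmod (cip F (Aop b F u) u)"
      unfolding X_def by (rule order_trans[OF coercive_Aop[OF c(1) F(1)] complex_Re_le_cmod])
    also have "\<dots> \<le> h * nrm F u" unfolding h_def by (rule cip_bound)
    also have "\<dots> \<le> h * X" unfolding X_def using nn by (intro mult_left_mono nrm_le_nrm1 F)
    finally have "(c * X) * X \<le> h * X" by (simp add: power2_eq_square)
    thus ?thesis using nn by (cases "X = 0") auto
  qed
  let ?v = "\<lambda>k. of_real ((norm (kvec k))^2) * u k"
  have vY: "nrm F ?v = Y" by (simp only: Y_def norm_mult norm_of_real abs_power2)
  have "c * Y^2 \<le> Re (\<Sum>k\<in>F. \<Sum>l\<in>F. b (k - l) * ?v l * cnj (?v k))"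
    unfolding vY[symmetric] nrm_sq by (rule coerciveD[OF c(1) F(1)])
  \<comment> \<open>The identity |l|^2 = k . l - (k - l) . l separates the operator itself from a
    commutator in which the frequency k - l, that is the gradient, falls on
    \<open>b\<close>.\<close>
  also have "(\<Sum>k\<in>F. \<Sum>l\<in>F. b (k - l) * ?v l * cnj (?v k)) = cip F (Aop b F u) ?v
      - (\<Sum>k\<in>F. \<Sum>l\<in>F. of_real (kvec (k - l) \<bullet> kvec l) * b (k - l) * u l * cnj (?v k))"
    unfolding cip_def Aop_def sum_distrib_right sum_subtractf[symmetric] kvec_diff inner_diff_left
    by (intro sum.cong refl) (simp add: algebra_simps dot_square_norm)
  also have "Re \<dots> \<le> h * Y + A * Z * Y"
  proof -
    have "cmod (cip F (Aop b F u) ?v) \<le> h * Y" using cip_bound[of F "Aop b F u" ?v] vY h_def by simp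
    moreover have "cmod (\<Sum>k\<in>F. \<Sum>l\<in>F. of_real (kvec (k - l) \<bullet> kvec l) * b (k - l) * u l * cnj (?v k))
       \<le> (\<Sum>k\<in>F. \<Sum>l\<in>F. (\<lambda>m. norm (kvec m) * cmod (b m)) (k - l) * \<bar>norm (kvec l) * cmod (u l)\<bar> * \<bar>(norm (kvec k))^2 * cmod (u k)\<bar>)"
    proof (intro sum_norm_le)
      fix k l
      have "\<bar>kvec (k - l) \<bullet> kvec l\<bar> * (cmod (b (k-l)) * cmod (u l) * ((norm (kvec k))^2 * cmod (u k)))
         \<le> (norm (kvec (k-l)) * norm (kvec l)) * (cmod (b (k-l)) * cmod (u l) * ((norm (kvec k))^2 * cmod (u k)))"
        by (intro mult_right_mono Cauchy_Schwarz_ineq2) auto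
      thus "cmod (of_real (kvec (k - l) \<bullet> kvec l) * b (k - l) * u l * cnj (?v k))
        \<le> (\<lambda>m. norm (kvec m) * cmod (b m)) (k - l) * \<bar>norm (kvec l) * cmod (u l)\<bar> * \<bar>(norm (kvec k))^2 * cmod (u k)\<bar>"
        by (simp add: norm_mult norm_power algebra_simps)
    qed
    moreover have "\<dots> \<le> 2 * sigJ TYPE('d) * R * L2_set (\<lambda>l. japb l powr (3/4) * (norm (kvec l) * cmod (u l))) F * L2_set (\<lambda>k. (norm (kvec k))^2 * cmod (u k)) F"
    proof (rule bilinear_estimate[OF F(1) F(1), where ?s1.0 = "real CARD('d) - 1"])
      show "l2bd (\<lambda>k. japb k powr (real CARD('d) - 1) * (norm (kvec k) * cmod (b k))) R"
        by (rule l2bd_gradient[OF R(2)])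
      have "1 \<le> real CARD('d)" by (simp add: Suc_leI)
      thus "0 \<le> real CARD('d) - 1" by linarith
    qed auto
    ultimately have "cmod (cip F (Aop b F u) ?v) + cmod (\<Sum>k\<in>F. \<Sum>l\<in>F. of_real (kvec (k - l) \<bullet> kvec l) * b (k - l) * u l * cnj (?v k)) \<le> h * Y + A * Z * Y"
      unfolding A_def Z_def Y_def by linarith
    thus ?thesis by (smt (verit) complex_Re_le_cmod norm_triangle_ineq4)
  qed
  finally have "(c * Y) * Y \<le> (h + A * Z) * Y" by (simp add: power2_eq_square algebra_simps)
  moreover have "0 \<le> Z" by (simp add: Z_def)
  ultimately have Y1: "c * Y \<le> h + A * Z" using nn A by (cases "Y = 0") auto
  have "Z \<le> L2_set (\<lambda>k. 2 * \<delta> * ((norm (kvec k))^2 * cmod (u k)) + 1 / \<delta>^3 * (norm (kvec k) * cmod (u k))) F"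
    unfolding Z_def
  proof (rule L2_set_mono)
    fix k assume k: "k \<in> F"
    hence "k \<noteq> 0" using F by auto
    have "japb k powr (3/4) \<le> \<delta> * japb k + 1 / \<delta>^3" by (rule interpolation_powr) (use \<delta> in auto)
    also have "\<dots> \<le> \<delta> * (2 * norm (kvec k)) + 1 / \<delta>^3" using japb_le_norm[OF \<open>k \<noteq> 0\<close>] \<delta> by simp
    finally have "japb k powr (3/4) * (norm (kvec k) * cmod (u k)) \<le> (\<delta> * (2 * norm (kvec k)) + 1 / \<delta>^3) * (norm (kvec k) * cmod (u k))"
      by (intro mult_right_mono) auto
    thus "japb k powr (3/4) * (norm (kvec k) * cmod (u k)) \<le> 2 * \<delta> * ((norm (kvec k))^2 * cmod (u k)) + 1 / \<delta>^3 * (norm (kvec k) * cmod (u k))"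
      by (simp add: algebra_simps power2_eq_square)
  qed auto
  also have "\<dots> \<le> 2 * \<delta> * Y + 1 / \<delta>^3 * X"
    unfolding Y_def X_def
    by (rule order_trans[OF L2_set_triangle_ineq], subst (1 2) L2_set_right_distrib) (use \<delta> in auto)
  also have "\<dots> \<le> 2 * \<delta> * Y + 1 / \<delta>^3 * (h / c)" using X c \<delta> by (intro add_left_mono mult_left_mono) (auto simp: field_simps)
  finally have "A * Z \<le> A * (2 * \<delta> * Y + 1 / \<delta>^3 * (h / c))" using A by (intro mult_left_mono) auto
  moreover have "A * (2 * \<delta> * Y + 1 / \<delta>^3 * (h / c)) = c / 2 * Y + A / \<delta>^3 * (h / c)"
  proof -
    have "A * \<delta> = c / 4" using A by (simp add: \<delta>_def)
    hence "A * (2 * \<delta> * Y) = c / 2 * Y" by (simp add: algebra_simps)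
    thus ?thesis by (simp add: distrib_left)
  qed
  ultimately have "c / 2 * Y \<le> h + A / \<delta>^3 * (h / c)" using Y1 by linarith
  hence "(2 / c) * (c / 2 * Y) \<le> (2 / c) * (h + A / \<delta>^3 * (h / c))" using c by (intro mult_left_mono) auto
  hence "Y \<le> (2 / c) * (h + A / \<delta>^3 * (h / c))" using c by simp
  also have "\<dots> = CH2 TYPE('d) R c * h"
    unfolding CH2_def Let_def A_def[symmetric] \<delta>_def[symmetric] by (simp add: algebra_simps)
  finally show ?thesis by (simp add: Y_def h_def)
qed

text \<open>Here \<open>b'\<close> stands for the time derivative of \<open>b\<close>, which is one
  derivative worse than the H^(d-1) sequence \<open>\<beta>\<close>. By |k - l| \<le> |k| + |l| this
  derivative is moved to \<open>u\<close> or to \<open>q\<close>, so that one of them carries two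
  derivatives and the other one carries one, with the second left for the bilinear estimate. The two
  sums are exchanged by transposition, which reflects \<open>\<beta>\<close>.\<close>

lemma trilinear_H2:
  fixes b' u q :: "int^'d \<Rightarrow> complex"
  assumes b': "\<And>m. cmod (b' m) \<le> norm (kvec m) * \<beta> m" and \<beta>: "\<And>m. 0 \<le> \<beta> m"
    and C: "l2bd (\<lambda>m. japb m powr (real CARD('d) - 1) * \<beta> m) C" and F: "finite F" "0 \<notin> F"
  shows "cmod (cip F (Aop b' F u) q) \<le> 8 * sigJ TYPE('d) * C * nrm2 F u * nrm2 F q"
proof -
  have d1: "0 \<le> real CARD('d) - 1"
  proof - have "1 \<le> real CARD('d)" by (simp add: Suc_leI) thus ?thesis by linarith qed
  let ?u1 = "\<lambda>l. norm (kvec l) * cmod (u l)" and ?u2 = "\<lambda>l. (norm (kvec l))^2 * cmod (u l)"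
  let ?q1 = "\<lambda>l. norm (kvec l) * cmod (q l)" and ?q2 = "\<lambda>l. (norm (kvec l))^2 * cmod (q l)"
  have C0: "0 \<le> C" by (rule l2bd_nonneg[OF C])
  have s0: "0 \<le> sigJ TYPE('d)" using sigJ_ge_1[where 'd = 'd] by linarith
  have "cmod (cip F (Aop b' F u) q) \<le> (\<Sum>k\<in>F. \<Sum>l\<in>F. \<beta> (k - l) * \<bar>?u1 l\<bar> * \<bar>?q2 k\<bar> + \<beta> (k - l) * \<bar>?u2 l\<bar> * \<bar>?q1 k\<bar>)"
    unfolding cip_def Aop_def sum_distrib_right
  proof (intro sum_norm_le)
    fix k l
    have "cmod (of_real (kvec k \<bullet> kvec l) * b' (k - l) * u l * cnj (q k))
       = \<bar>kvec k \<bullet> kvec l\<bar> * cmod (b' (k - l)) * (cmod (u l) * cmod (q k))" by (simp add: norm_mult)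
    also have "\<dots> \<le> (norm (kvec k) * norm (kvec l)) * (norm (kvec (k - l)) * \<beta> (k - l)) * (cmod (u l) * cmod (q k))"
      by (intro mult_right_mono mult_mono Cauchy_Schwarz_ineq2 b') (auto simp: \<beta>)
    also have "\<dots> \<le> (norm (kvec k) * norm (kvec l)) * ((norm (kvec k) + norm (kvec l)) * \<beta> (k - l)) * (cmod (u l) * cmod (q k))"
      by (intro mult_right_mono mult_left_mono norm_kvec_diff_le) (auto simp: \<beta>)
    also have "\<dots> = \<beta> (k - l) * \<bar>?u1 l\<bar> * \<bar>?q2 k\<bar> + \<beta> (k - l) * \<bar>?u2 l\<bar> * \<bar>?q1 k\<bar>"
      by (simp add: abs_mult power2_eq_square algebra_simps)
    finally show "cmod (of_real (kvec k \<bullet> kvec l) * b' (k - l) * u l * cnj (q k)) \<le> \<dots>" .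
  qed
  also have "\<dots> = (\<Sum>k\<in>F. \<Sum>l\<in>F. \<beta> (k - l) * \<bar>?u1 l\<bar> * \<bar>?q2 k\<bar>) + (\<Sum>k\<in>F. \<Sum>l\<in>F. \<beta> (k - l) * \<bar>?u2 l\<bar> * \<bar>?q1 k\<bar>)"
    by (simp add: sum.distrib)
  also have "(\<Sum>k\<in>F. \<Sum>l\<in>F. \<beta> (k - l) * \<bar>?u2 l\<bar> * \<bar>?q1 k\<bar>) = (\<Sum>k\<in>F. \<Sum>l\<in>F. (\<lambda>m. \<beta> (- m)) (k - l) * \<bar>?q1 l\<bar> * \<bar>?u2 k\<bar>)"
    by (subst sum.swap) (simp add: algebra_simps)
  also have "(\<Sum>k\<in>F. \<Sum>l\<in>F. \<beta> (k - l) * \<bar>?u1 l\<bar> * \<bar>?q2 k\<bar>) + \<dots>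
     \<le> 2 * sigJ TYPE('d) * C * L2_set (\<lambda>l. japb l powr 1 * ?u1 l) F * nrm2 F q
      + 2 * sigJ TYPE('d) * C * L2_set (\<lambda>l. japb l powr 1 * ?q1 l) F * nrm2 F u"
    using d1 l2bd_reflect[OF C]
    by (intro add_mono bilinear_estimate[where ?s1.0 = "real CARD('d) - 1"] F C) (auto simp: \<beta>)
  also have "\<dots> \<le> 2 * sigJ TYPE('d) * C * (2 * nrm2 F u) * nrm2 F q
      + 2 * sigJ TYPE('d) * C * (2 * nrm2 F q) * nrm2 F u"
    by (intro add_mono mult_right_mono mult_left_mono nrm_le_nrm1 F) (auto simp: C0 s0)
  also have "\<dots> = 8 * sigJ TYPE('d) * C * nrm2 F u * nrm2 F q" by (simp add: algebra_simps)
  finally show ?thesis .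
qed

text \<open>By |k| \<le> |k - l| + |l| the outer derivative falls either on \<open>b\<close> or on
  \<open>u\<close>. The output is measured on an arbitrary finite \<open>G\<close>, since a
  truncated input still produces frequencies outside \<open>F\<close>, and these have to be
  estimated later.\<close>

lemma Aop_l2:
  fixes b u :: "int^'d \<Rightarrow> complex"
  assumes R: "l2bd (\<lambda>m. japb m powr real CARD('d) * cmod (b m)) R" and F: "finite F" "0 \<notin> F" and G: "finite G"
  shows "nrm G (Aop b F u) \<le> 6 * sigJ TYPE('d) * R * nrm2 F u"
proof -
  have d1: "0 \<le> real CARD('d) - 1"
  proof - have "1 \<le> real CARD('d)" by (simp add: Suc_leI) thus ?thesis by linarith qed
  let ?u1 = "\<lambda>l. norm (kvec l) * cmod (u l)" and ?u2 = "\<lambda>l. (norm (kvec l))^2 * cmod (u l)"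
  let ?r = "\<lambda>k. cmod (Aop b F u k)"
  have R0: "0 \<le> R" by (rule l2bd_nonneg[OF R])
  have s0: "0 \<le> sigJ TYPE('d)" using sigJ_ge_1[where 'd = 'd] by linarith
  have "(nrm G (Aop b F u))^2 = (\<Sum>k\<in>G. ?r k * ?r k)" by (subst nrm_sq) (simp only: power2_eq_square)
  also have "\<dots> \<le> (\<Sum>k\<in>G. (\<Sum>l\<in>F. cmod (b (k - l)) * \<bar>?u2 l\<bar> + (\<lambda>m. norm (kvec m) * cmod (b m)) (k - l) * \<bar>?u1 l\<bar>) * \<bar>?r k\<bar>)"
  proof (intro sum_mono, simp only: abs_norm_cancel, rule mult_right_mono)
    fix k
    show "?r k \<le> (\<Sum>l\<in>F. cmod (b (k - l)) * \<bar>?u2 l\<bar> + (\<lambda>m. norm (kvec m) * cmod (b m)) (k - l) * \<bar>?u1 l\<bar>)"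
      unfolding Aop_def
    proof (rule sum_norm_le)
      fix l
      have "cmod (of_real (kvec k \<bullet> kvec l) * b (k - l) * u l) = \<bar>kvec k \<bullet> kvec l\<bar> * (cmod (b (k - l)) * cmod (u l))"
        by (simp add: norm_mult)
      also have "\<dots> \<le> (norm (kvec k) * norm (kvec l)) * (cmod (b (k - l)) * cmod (u l))"
        by (intro mult_right_mono Cauchy_Schwarz_ineq2) auto
      also have "\<dots> \<le> ((norm (kvec (k - l)) + norm (kvec l)) * norm (kvec l)) * (cmod (b (k - l)) * cmod (u l))"
        by (intro mult_right_mono norm_kvec_le_diff_add) auto
      finally show "cmod (of_real (kvec k \<bullet> kvec l) * b (k - l) * u l) \<le> cmod (b (k - l)) * \<bar>?u2 l\<bar> + (\<lambda>m. norm (kvec m) * cmod (b m)) (k - l) * \<bar>?u1 l\<bar>"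
        by (simp add: abs_mult power2_eq_square algebra_simps)
    qed
  qed auto
  also have "\<dots> = (\<Sum>k\<in>G. \<Sum>l\<in>F. cmod (b (k - l)) * \<bar>?u2 l\<bar> * \<bar>?r k\<bar>) + (\<Sum>k\<in>G. \<Sum>l\<in>F. (\<lambda>m. norm (kvec m) * cmod (b m)) (k - l) * \<bar>?u1 l\<bar> * \<bar>?r k\<bar>)"
    by (simp only: sum_distrib_right distrib_right sum.distrib)
  also have "\<dots> \<le> 2 * sigJ TYPE('d) * R * L2_set (\<lambda>l. japb l powr 0 * ?u2 l) F * nrm G (Aop b F u)
      + 2 * sigJ TYPE('d) * R * L2_set (\<lambda>l. japb l powr 1 * ?u1 l) F * nrm G (Aop b F u)"
    using d1 R
    by (intro add_mono bilinear_estimate[where ?s1.0 = "real CARD('d)" and ?s2.0 = 0]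
       bilinear_estimate[where ?s1.0 = "real CARD('d) - 1" and ?s2.0 = 1] F G l2bd_gradient) auto
  also have "\<dots> \<le> 2 * sigJ TYPE('d) * R * nrm2 F u * nrm G (Aop b F u)
      + 2 * sigJ TYPE('d) * R * (2 * nrm2 F u) * nrm G (Aop b F u)"
    by (intro add_mono mult_right_mono mult_left_mono nrm_le_nrm1 F) (auto simp: R0 s0 japb_neq_0)
  finally have "nrm G (Aop b F u) * nrm G (Aop b F u) \<le> (6 * sigJ TYPE('d) * R * nrm2 F u) * nrm G (Aop b F u)"
    by (simp add: power2_eq_square algebra_simps)
  thus ?thesis using R0 s0 by (cases "nrm G (Aop b F u) = 0") (auto intro!: mult_right_le_imp_le[of _ "nrm G (Aop b F u)"] simp: order_less_le)
qed

section \<open>Approximate Galerkin solutions that are differentiable in time\<close>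

lemma has_vector_derivative_continuous_on':
  "(\<And>t. t \<in> S \<Longrightarrow> (f has_vector_derivative f' t) (at t within S)) \<Longrightarrow> continuous_on S f"
  by (meson continuous_on_eq_continuous_within has_vector_derivative_continuous)

lemma nrm_sq_diff:
  "(nrm F (\<lambda>k. v k - of_real \<theta> * w k))^2 = (nrm F v)^2 - 2 * \<theta> * Re (cip F w v) + \<theta>^2 * (nrm F w)^2"
proof -
  have "(cmod (v k - of_real \<theta> * w k))^2 = (cmod (v k))^2 - 2 * \<theta> * Re (w k * cnj (v k)) + \<theta>^2 * (cmod (w k))^2" for k
    unfolding cmod_power2 by (simp add: power2_eq_square algebra_simps)
  thus ?thesis
    unfolding nrm_sq cip_def Re_sum sum_distrib_left sum.distrib[symmetric] sum_subtractf[symmetric] by simp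
qed

text \<open>Expanding the square gives the factor 1 - 2 \<theta> c + \<theta>^2 L^2, which is
  smallest at \<theta> = c / L^2.\<close>

lemma richardson_step:
  assumes F: "finite F" "0 \<notin> F" and c: "coercive b c" "0 < c"
    and L: "\<And>v. nrm F (Aop b F v) \<le> L * nrm F v" "c \<le> L"
  shows "nrm F (\<lambda>k. v k - of_real (c / L^2) * Aop b F v k) \<le> sqrt (1 - c^2 / L^2) * nrm F v"
proof -
  have L0: "0 < L" using L c by linarith
  have "c * (nrm F v)^2 \<le> c * (L2_set (\<lambda>k. norm (kvec k) * cmod (v k)) F)^2"
    using c by (intro mult_left_mono power_mono nrm_le_nrm1 F) auto
  also have "\<dots> \<le> Re (cip F (Aop b F v) v)" by (rule coercive_Aop[OF c(1) F(1)])
  finally have 1: "c * (nrm F v)^2 \<le> Re (cip F (Aop b F v) v)" .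
  have 2: "(nrm F (Aop b F v))^2 \<le> L^2 * (nrm F v)^2"
    using power_mono[OF L(1), of v 2] by (simp add: power_mult_distrib)
  have "(nrm F (\<lambda>k. v k - of_real (c / L^2) * Aop b F v k))^2
      = (nrm F v)^2 - 2 * (c / L^2) * Re (cip F (Aop b F v) v) + (c / L^2)^2 * (nrm F (Aop b F v))^2"
    by (rule nrm_sq_diff)
  also have "\<dots> \<le> (nrm F v)^2 - 2 * (c / L^2) * (c * (nrm F v)^2) + (c / L^2)^2 * (L^2 * (nrm F v)^2)"
    using 1 2 c L0 by (intro add_mono diff_mono mult_left_mono) auto
  also have "\<dots> = (1 - c^2 / L^2) * (nrm F v)^2"
    using L0 by (simp add: field_simps power2_eq_square)
  finally have "sqrt ((nrm F (\<lambda>k. v k - of_real (c / L^2) * Aop b F v k))^2) \<le> sqrt ((1 - c^2 / L^2) * (nrm F v)^2)"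
    by (rule real_sqrt_le_mono)
  thus ?thesis by (simp add: real_sqrt_mult)
qed

text \<open>Purely qualitative: the bound depends on the truncation \<open>F\<close>. It only makes
  the iteration converge and never reaches the final constants.\<close>

lemma Aop_bounded_in_time:
  fixes b :: "real \<Rightarrow> int^'d \<Rightarrow> complex"
  assumes F: "finite F" and b: "\<And>m. continuous_on {0..\<tau>} (\<lambda>t. b t m)"
  shows "\<exists>L. \<forall>t\<in>{0..\<tau>}. \<forall>v. nrm F (Aop (b t) F v) \<le> L * nrm F v"
proof -
  have "\<exists>B. \<forall>t\<in>{0..\<tau>}. cmod (b t m) \<le> B" for m
  proof -
    have "bounded ((\<lambda>t. b t m) ` {0..\<tau>})" by (intro compact_imp_bounded compact_continuous_image b) simp
    thus ?thesis by (auto simp: bounded_iff)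
  qed
  then obtain B where B: "\<And>m t. t \<in> {0..\<tau>} \<Longrightarrow> cmod (b t m) \<le> B m" by metis
  define L where "L = (\<Sum>k\<in>F. \<Sum>l\<in>F. \<bar>kvec k \<bullet> kvec l\<bar> * B (k - l))"
  have "nrm F (Aop (b t) F v) \<le> L * nrm F v" if t: "t \<in> {0..\<tau>}" for t v
  proof -
    have "nrm F (Aop (b t) F v) \<le> (\<Sum>k\<in>F. cmod (Aop (b t) F v k))" by (rule L2_set_le_sum) auto
    also have "\<dots> \<le> (\<Sum>k\<in>F. \<Sum>l\<in>F. \<bar>kvec k \<bullet> kvec l\<bar> * B (k - l) * nrm F v)"
      unfolding Aop_def
    proof (intro sum_mono sum_norm_le)
      fix k l assume "k \<in> F" "l \<in> F"
      have "cmod (v l) \<le> nrm F v" using F \<open>l \<in> F\<close> by (rule member_le_L2_set)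
      thus "cmod (of_real (kvec k \<bullet> kvec l) * b t (k - l) * v l) \<le> \<bar>kvec k \<bullet> kvec l\<bar> * B (k - l) * nrm F v"
        using B[OF t] order_trans[OF norm_ge_zero B[OF t]] by (auto simp: norm_mult intro!: mult_mono)
    qed
    also have "\<dots> = L * nrm F v" by (simp only: L_def sum_distrib_right)
    finally show ?thesis .
  qed
  thus ?thesis by blast
qed

text \<open>The residuals of the iteration started at 0: the \<open>n\<close>-th one equals y - A
  u_n, where u_n is \<theta> times the sum of the preceding residuals. Residuals rather than
  solutions are iterated because their decay is what has to be shown, for the value and for the time
  derivative.\<close>

primrec rich :: "real \<Rightarrow> (real \<Rightarrow> int^'d \<Rightarrow> complex) \<Rightarrow> (int^'d) set \<Rightarrow> (real \<Rightarrow> int^'d \<Rightarrow> complex) \<Rightarrow> nat \<Rightarrow> real \<Rightarrow> int^'d \<Rightarrow> complex" where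
  "rich \<theta> b F y 0 = y"
| "rich \<theta> b F y (Suc n) = (\<lambda>t k. rich \<theta> b F y n t k - of_real \<theta> * Aop (b t) F (rich \<theta> b F y n t) k)"

primrec rich' :: "real \<Rightarrow> (real \<Rightarrow> int^'d \<Rightarrow> complex) \<Rightarrow> (real \<Rightarrow> int^'d \<Rightarrow> complex) \<Rightarrow> (int^'d) set \<Rightarrow>
    (real \<Rightarrow> int^'d \<Rightarrow> complex) \<Rightarrow> (real \<Rightarrow> int^'d \<Rightarrow> complex) \<Rightarrow> nat \<Rightarrow> real \<Rightarrow> int^'d \<Rightarrow> complex" where
  "rich' \<theta> b b' F y y' 0 = y'"
| "rich' \<theta> b b' F y y' (Suc n) = (\<lambda>t k. rich' \<theta> b b' F y y' n t k
     - of_real \<theta> * (Aop (b' t) F (rich \<theta> b F y n t) k + Aop (b t) F (rich' \<theta> b b' F y y' n t) k))"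

lemma Aop_has_vector_derivative:
  assumes "\<And>m. ((\<lambda>t. b t m) has_vector_derivative b' t m) (at t within S)"
    and "\<And>m. ((\<lambda>t. u t m) has_vector_derivative u' t m) (at t within S)"
  shows "((\<lambda>t. Aop (b t) F (u t) k) has_vector_derivative (Aop (b' t) F (u t) k + Aop (b t) F (u' t) k)) (at t within S)"
proof -
  have "((\<lambda>t. Aop (b t) F (u t) k) has_vector_derivative
     (\<Sum>l\<in>F. of_real (kvec k \<bullet> kvec l) * (b t (k - l) * u' t l + b' t (k - l) * u t l))) (at t within S)"
    unfolding Aop_def mult.assoc
    by (intro has_vector_derivative_sum has_vector_derivative_mult_right has_vector_derivative_mult assms)
  thus ?thesis by (simp add: Aop_def sum.distrib algebra_simps)
qed

lemma Aop_continuous_on: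
  assumes "\<And>m. continuous_on S (\<lambda>t. b t m)" "\<And>m. continuous_on S (\<lambda>t. u t m)"
  shows "continuous_on S (\<lambda>t. Aop (b t) F (u t) k)"
  unfolding Aop_def by (intro continuous_intros assms)

text \<open>The derivative of a residual contracts by the same factor as the residual but is also
  fed by the preceding residual, which decays like q^n. The resonance costs one factor n, and n q^n
  still tends to 0.\<close>

lemma recursive_decay:
  fixes a :: "nat \<Rightarrow> real"
  assumes "a 0 \<le> Y" "\<And>n. a (Suc n) \<le> q * a n + D * q ^ n" "0 < q"
  shows "a n \<le> (Y + real n * (D / q)) * q ^ n"
proof (induction n)
  case 0 thus ?case using assms by simp
next
  case (Suc n)
  have "a (Suc n) \<le> q * ((Y + real n * (D / q)) * q ^ n) + D * q ^ n"
    using assms(2)[of n] mult_left_mono[OF Suc, of q] assms(3) by linarith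
  also have "\<dots> = (Y + real (Suc n) * (D / q)) * q ^ Suc n" using assms(3) by (simp add: field_simps)
  finally show ?case .
qed

text \<open>Richardson iteration avoids inverting \<open>A(t)\<close> and differentiating the inverse.\<close>

lemma galerkin_approx:
  fixes b b' y y' :: "real \<Rightarrow> int^'d \<Rightarrow> complex"
  assumes F: "finite F" "0 \<notin> F" and c: "0 < c" "\<And>t. t \<in> {0..\<tau>} \<Longrightarrow> coercive (b t) c"
    and b: "\<And>m t. t \<in> {0..\<tau>} \<Longrightarrow> ((\<lambda>t. b t m) has_vector_derivative b' t m) (at t within {0..\<tau>})"
    and b': "\<And>m. continuous_on {0..\<tau>} (\<lambda>t. b' t m)"
    and y: "\<And>m t. t \<in> {0..\<tau>} \<Longrightarrow> ((\<lambda>t. y t m) has_vector_derivative y' t m) (at t within {0..\<tau>})"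
    and y': "\<And>m. continuous_on {0..\<tau>} (\<lambda>t. y' t m)"
    and Y: "\<And>t. t \<in> {0..\<tau>} \<Longrightarrow> nrm F (y t) \<le> Y0" "\<And>t. t \<in> {0..\<tau>} \<Longrightarrow> nrm F (y' t) \<le> Y1"
    and \<epsilon>: "0 < \<epsilon>"
  obtains u u' :: "real \<Rightarrow> int^'d \<Rightarrow> complex" where
    "\<And>m t. t \<in> {0..\<tau>} \<Longrightarrow> ((\<lambda>t. u t m) has_vector_derivative u' t m) (at t within {0..\<tau>})"
    "\<And>m. continuous_on {0..\<tau>} (\<lambda>t. u' t m)"
    "\<And>t. t \<in> {0..\<tau>} \<Longrightarrow> nrm F (\<lambda>k. y t k - Aop (b t) F (u t) k) \<le> \<epsilon>"
    "\<And>t. t \<in> {0..\<tau>} \<Longrightarrow> nrm F (\<lambda>k. y' t k - Aop (b' t) F (u t) k - Aop (b t) F (u' t) k) \<le> \<epsilon>"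
    "\<And>k t. (\<And>l. y t l = 0) \<Longrightarrow> u t k = 0"
proof -
  have bc: "continuous_on {0..\<tau>} (\<lambda>t. b t m)" for m
    by (rule has_vector_derivative_continuous_on', rule b)
  obtain L0 where L0: "\<And>t v. t \<in> {0..\<tau>} \<Longrightarrow> nrm F (Aop (b t) F v) \<le> L0 * nrm F v"
    using Aop_bounded_in_time[OF F(1), of \<tau> b, OF bc] by blast
  obtain L1 where L1: "\<And>t v. t \<in> {0..\<tau>} \<Longrightarrow> nrm F (Aop (b' t) F v) \<le> L1 * nrm F v"
    using Aop_bounded_in_time[OF F(1), of \<tau> b', OF b'] by blast
  \<comment> \<open>The lower bound 2 * c makes c < L strict, hence the contraction factor
    \<open>q\<close> is positive and may be divided by in the decay estimate.\<close>
  define L where "L = max L0 (2 * c)"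
  have L: "nrm F (Aop (b t) F v) \<le> L * nrm F v" if "t \<in> {0..\<tau>}" for t v
    by (rule order_trans[OF L0[OF that]]) (auto simp: L_def intro!: mult_right_mono)
  have Lc: "2 * c \<le> L" "c \<le> L" "0 < L" using c by (auto simp: L_def)
  define \<theta> where "\<theta> = c / L^2"
  define q where "q = sqrt (1 - c^2 / L^2)"
  have th: "0 \<le> \<theta>" using c by (simp add: \<theta>_def)
  have "c^2 < L^2" using Lc c by (intro power_strict_mono) auto
  hence q: "0 < q" "q < 1" using Lc c by (auto simp: q_def field_simps)
  have step: "nrm F (\<lambda>k. v k - of_real \<theta> * Aop (b t) F v k) \<le> q * nrm F v" if "t \<in> {0..\<tau>}" for t v
    unfolding \<theta>_def q_def by (rule richardson_step[OF F c(2)[OF that] c(1) L[OF that] Lc(2)])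
  let ?r = "rich \<theta> b F y" and ?r' = "rich' \<theta> b b' F y y'"
  define u where "u n t k = (\<Sum>i<n. of_real \<theta> * ?r i t k)" for n t k
  define u' where "u' n t k = (\<Sum>i<n. of_real \<theta> * ?r' i t k)" for n t k
  have dr: "((\<lambda>t. ?r n t m) has_vector_derivative ?r' n t m) (at t within {0..\<tau>})" if "t \<in> {0..\<tau>}" for n t m
  proof (induction n arbitrary: m)
    case 0 thus ?case using y that by simp
  next
    case (Suc n)
    show ?case unfolding rich.simps rich'.simps
      by (intro has_vector_derivative_diff Suc has_vector_derivative_mult_right Aop_has_vector_derivative b that)
  qed
  have cr: "continuous_on {0..\<tau>} (\<lambda>t. ?r n t m)" for n m
    by (rule has_vector_derivative_continuous_on', rule dr)
  have cr': "continuous_on {0..\<tau>} (\<lambda>t. ?r' n t m)" for n m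
  proof (induction n arbitrary: m)
    case 0 thus ?case using y' by simp
  next
    case (Suc n)
    show ?case unfolding rich'.simps by (intro continuous_intros Suc Aop_continuous_on bc b' cr)
  qed
  have rn: "nrm F (?r n t) \<le> q ^ n * Y0" if t: "t \<in> {0..\<tau>}" for n t
  proof (induction n)
    case 0 thus ?case using Y t by simp
  next
    case (Suc n)
    have "nrm F (?r (Suc n) t) \<le> q * nrm F (?r n t)" unfolding rich.simps by (rule step[OF t])
    thus ?case using mult_left_mono[OF Suc, of q] q unfolding power_Suc mult.assoc by linarith
  qed
  define D where "D = \<theta> * (\<bar>L1\<bar> * Y0)"
  have rn': "nrm F (?r' n t) \<le> (Y1 + real n * (D / q)) * q ^ n" if t: "t \<in> {0..\<tau>}" for n t
  proof (rule recursive_decay)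
    show "nrm F (?r' 0 t) \<le> Y1" using Y t by simp
    fix n
    have "nrm F (?r' (Suc n) t) = nrm F (\<lambda>k. (?r' n t k - of_real \<theta> * Aop (b t) F (?r' n t) k) - of_real \<theta> * Aop (b' t) F (?r n t) k)"
      by (simp add: algebra_simps)
    also have "\<dots> \<le> nrm F (\<lambda>k. ?r' n t k - of_real \<theta> * Aop (b t) F (?r' n t) k) + nrm F (\<lambda>k. of_real \<theta> * Aop (b' t) F (?r n t) k)"
      by (rule nrm_triangle_diff)
    also have "\<dots> \<le> q * nrm F (?r' n t) + \<theta> * (\<bar>L1\<bar> * (q ^ n * Y0))"
    proof (intro add_mono step t)
      have "nrm F (Aop (b' t) F (?r n t)) \<le> \<bar>L1\<bar> * nrm F (?r n t)"
        by (rule order_trans[OF L1[OF t]]) (auto intro!: mult_right_mono)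
      also have "\<dots> \<le> \<bar>L1\<bar> * (q ^ n * Y0)" by (intro mult_left_mono rn t) auto
      finally show "nrm F (\<lambda>k. of_real \<theta> * Aop (b' t) F (?r n t) k) \<le> \<theta> * (\<bar>L1\<bar> * (q ^ n * Y0))"
        unfolding nrm_scale[OF th] by (rule mult_left_mono[OF _ th])
    qed
    also have "\<dots> = q * nrm F (?r' n t) + D * q ^ n" by (simp add: D_def)
    finally show "nrm F (?r' (Suc n) t) \<le> q * nrm F (?r' n t) + D * q ^ n" .
  qed (rule q)
  have res: "y t k - Aop (b t) F (u n t) k = ?r n t k" for n t k
  proof (induction n arbitrary: k)
    case 0 thus ?case by (simp add: u_def Aop_def)
  next
    case (Suc n)
    have "Aop (b t) F (u (Suc n) t) k = Aop (b t) F (u n t) k + of_real \<theta> * Aop (b t) F (?r n t) k"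
      unfolding u_def sum.lessThan_Suc Aop_add Aop_scale ..
    thus ?case using Suc[of k] by (simp add: algebra_simps)
  qed
  have res': "y' t k - Aop (b' t) F (u n t) k - Aop (b t) F (u' n t) k = ?r' n t k" for n t k
  proof (induction n arbitrary: k)
    case 0 thus ?case by (simp add: u_def u'_def Aop_def)
  next
    case (Suc n)
    have "Aop (b' t) F (u (Suc n) t) k = Aop (b' t) F (u n t) k + of_real \<theta> * Aop (b' t) F (?r n t) k"
      "Aop (b t) F (u' (Suc n) t) k = Aop (b t) F (u' n t) k + of_real \<theta> * Aop (b t) F (?r' n t) k"
      unfolding u_def u'_def sum.lessThan_Suc Aop_add Aop_scale by simp_all
    thus ?case using Suc[of k] by (simp add: algebra_simps)
  qed
  \<comment> \<open>At each fixed time the iteration acts linearly on \<open>y t\<close>, so the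
    approximate solution vanishes wherever \<open>y\<close> does. This is what removes the boundary
    term at the final time.\<close>
  have z: "?r n t k = 0" if "\<And>l. y t l = 0" for n t k
    by (induction n arbitrary: k) (use that in \<open>auto simp: Aop_def\<close>)
  have lim1: "(\<lambda>n. q ^ n * Y0) \<longlonglongrightarrow> 0"
    using q by (intro tendsto_mult_left_zero LIMSEQ_power_zero) auto
  have "(\<lambda>n. Y1 * q ^ n + (D / q) * (real n * q ^ n)) \<longlonglongrightarrow> Y1 * 0 + (D / q) * 0"
    using q by (intro tendsto_add tendsto_mult tendsto_const LIMSEQ_power_zero powser_times_n_limit_0) auto
  hence lim2: "(\<lambda>n. (Y1 + real n * (D / q)) * q ^ n) \<longlonglongrightarrow> 0"
    by (simp add: algebra_simps)
  have "eventually (\<lambda>n. q ^ n * Y0 < \<epsilon> \<and> (Y1 + real n * (D / q)) * q ^ n < \<epsilon>) sequentially"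
    using order_tendstoD(2)[OF lim1 \<epsilon>] order_tendstoD(2)[OF lim2 \<epsilon>] by eventually_elim simp
  then obtain n where n: "q ^ n * Y0 \<le> \<epsilon>" "(Y1 + real n * (D / q)) * q ^ n \<le> \<epsilon>"
    by (auto simp: eventually_sequentially dest!: less_imp_le intro: less_imp_le)
  show ?thesis
  proof (rule that)
    fix m t assume t: "t \<in> {0..\<tau>}"
    show "((\<lambda>t. u n t m) has_vector_derivative u' n t m) (at t within {0..\<tau>})"
      unfolding u_def u'_def by (intro has_vector_derivative_sum has_vector_derivative_mult_right dr t)
  next
    fix m show "continuous_on {0..\<tau>} (\<lambda>t. u' n t m)"
      unfolding u'_def by (intro continuous_intros cr')
  next
    fix t assume t: "t \<in> {0..\<tau>}"
    show "nrm F (\<lambda>k. y t k - Aop (b t) F (u n t) k) \<le> \<epsilon>" unfolding res by (rule order_trans[OF rn[OF t] n(1)])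
    show "nrm F (\<lambda>k. y' t k - Aop (b' t) F (u n t) k - Aop (b t) F (u' n t) k) \<le> \<epsilon>"
      unfolding res' by (rule order_trans[OF rn'[OF t] n(2)])
  next
    fix k t assume "\<And>l. y t l = 0"
    thus "u n t k = 0" by (simp add: u_def z)
  qed
qed

text \<open>The degenerate time interval {0..0} with constant data turns the time-dependent
  construction into an approximate solver for a single equation.\<close>

lemma galerkin_approx_static:
  fixes b q :: "int^'d \<Rightarrow> complex"
  assumes F: "finite F" "0 \<notin> F" and c: "0 < c" "coercive b c" and \<epsilon>: "0 < \<epsilon>"
  obtains Q where "nrm F (\<lambda>k. q k - Aop b F Q k) \<le> \<epsilon>"
  by (rule galerkin_approx[OF F c(1), of 0 "\<lambda>_. b" "\<lambda>_ _. 0" "\<lambda>_. q" "\<lambda>_ _. 0" "nrm F q" 0 \<epsilon>])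
    (use c(2) \<epsilon> in \<open>auto simp: L2_set_def\<close>)

text \<open>Duality: \<open>u'\<close> is paired with \<open>Aop b F Q\<close>, where
  \<open>Q\<close> solves the equation with right-hand side \<open>u'\<close> approximately. By
  symmetry the operator moves to \<open>u'\<close>, and the elliptic estimate puts two derivatives
  on \<open>Q\<close>. So the derivative of \<open>A u\<close> enters only in the H^-2 norm, and the
  commutator with \<open>b'\<close> is left to the trilinear estimate.\<close>

lemma galerkin_time_derivative_bound:
  fixes b b' u u' :: "int^'d \<Rightarrow> complex"
  assumes c: "coercive b c" "0 < c" and R: "0 < R" "l2bd (\<lambda>m. japb m powr real CARD('d) * cmod (b m)) R"
    and F: "finite F" "0 \<notin> F" and h: "hermitian b"
    and b': "\<And>m. cmod (b' m) \<le> norm (kvec m) * \<beta> m" and \<beta>: "\<And>m. 0 \<le> \<beta> m"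
    and C: "l2bd (\<lambda>m. japb m powr (real CARD('d) - 1) * \<beta> m) C"
  shows "nrm F u' \<le> 3 * CH2 TYPE('d) R c *
     (L2_set (\<lambda>k. cmod (Aop b F u' k + Aop b' F u k) / (norm (kvec k))^2) F + 8 * sigJ TYPE('d) * C * nrm2 F u)"
    (is "_ \<le> 3 * ?C * (?N + ?D * nrm2 F u)")
proof (cases "nrm F u' = 0")
  case True
  have "0 \<le> ?C" using CH2_pos[OF R(1) c(2), where 'd = 'd] by simp
  moreover have "0 \<le> ?N + ?D * nrm2 F u" using sigJ_ge_1[where 'd = 'd] l2bd_nonneg[OF C] by simp
  ultimately show ?thesis using True by simp
next
  case False
  hence pos: "0 < nrm F u'" by (simp add: order_less_le)
  have C2: "0 \<le> ?C" using CH2_pos[OF R(1) c(2), where 'd = 'd] by simp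
  \<comment> \<open>The tolerance is relative to the quantity to be estimated: its contribution is
    half of the square of \<open>nrm F u'\<close> and is absorbed on the left. Together with the 3/2
    below this makes the factor 3.\<close>
  obtain Q where Q: "nrm F (\<lambda>k. u' k - Aop b F Q k) \<le> nrm F u' / 2"
    using galerkin_approx_static[OF F c(2,1), of "nrm F u' / 2" u'] pos by auto
  have "nrm F (Aop b F Q) = nrm F (\<lambda>k. u' k - (u' k - Aop b F Q k))" by simp
  also have "\<dots> \<le> nrm F u' + nrm F u' / 2" by (rule order_trans[OF nrm_triangle_diff]) (use Q in simp)
  finally have AQ: "nrm F (Aop b F Q) \<le> 3/2 * nrm F u'" by simp
  have Q2: "nrm2 F Q \<le> ?C * (3/2 * nrm F u')"
    by (rule order_trans[OF elliptic_H2[OF c R F] mult_left_mono[OF AQ C2]])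
  have wk: "0 < (norm (kvec k))^2" if "k \<in> F" for k
  proof -
    have "k \<noteq> 0" using that F by auto
    thus ?thesis using norm_kvec_ge_1[of k] by (intro zero_less_power) linarith
  qed
  have "of_real ((nrm F u')^2) = cip F u' u'" by (rule cip_self[symmetric])
  also have "\<dots> = cip F u' (Aop b F Q) + cip F u' (\<lambda>k. u' k - Aop b F Q k)"
    by (simp add: cip_diff_right)
  also have "cip F u' (Aop b F Q) = cip F (\<lambda>k. Aop b F u' k + Aop b' F u k) Q - cip F (Aop b' F u) Q"
    by (simp add: cip_add_left Aop_sym[OF h])
  finally have "(nrm F u')^2 = cmod (cip F (\<lambda>k. Aop b F u' k + Aop b' F u k) Q - cip F (Aop b' F u) Q + cip F u' (\<lambda>k. u' k - Aop b F Q k))"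
    by (metis abs_of_nonneg norm_of_real zero_le_power2)
  also have "\<dots> \<le> cmod (cip F (\<lambda>k. Aop b F u' k + Aop b' F u k) Q) + cmod (cip F (Aop b' F u) Q) + cmod (cip F u' (\<lambda>k. u' k - Aop b F Q k))"
    by (meson add_mono norm_triangle_ineq norm_triangle_ineq4 order_refl order_trans)
  also have "\<dots> \<le> ?N * nrm2 F Q + ?D * nrm2 F u * nrm2 F Q + nrm F u' * (nrm F u' / 2)"
  proof (intro add_mono)
    show "cmod (cip F (\<lambda>k. Aop b F u' k + Aop b' F u k) Q) \<le> ?N * nrm2 F Q"
      by (rule cip_bound_weighted) (rule wk)
    show "cmod (cip F (Aop b' F u) Q) \<le> ?D * nrm2 F u * nrm2 F Q"
      by (rule trilinear_H2[OF b' \<beta> C F])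
    show "cmod (cip F u' (\<lambda>k. u' k - Aop b F Q k)) \<le> nrm F u' * (nrm F u' / 2)"
      by (rule order_trans[OF cip_bound mult_left_mono[OF Q]]) simp
  qed
  also have "?N * nrm2 F Q + ?D * nrm2 F u * nrm2 F Q = (?N + ?D * nrm2 F u) * nrm2 F Q" by (simp add: algebra_simps)
  also have "\<dots> \<le> (?N + ?D * nrm2 F u) * (?C * (3/2 * nrm F u'))"
    using sigJ_ge_1[where 'd = 'd] l2bd_nonneg[OF C] by (intro mult_left_mono Q2) simp
  finally have "nrm F u' * nrm F u' \<le> (3 * ?C * (?N + ?D * nrm2 F u)) * nrm F u'"
    by (simp add: power2_eq_square algebra_simps)
  thus ?thesis using pos by (rule mult_right_le_imp_le)
qed

section \<open>The equation in Fourier variables\<close>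

definition lam :: "int^'d \<Rightarrow> real" where
  "lam k = 4 * pi^2 * (norm (kvec k))^2"

definition hbd :: "real \<Rightarrow> (int^'d \<Rightarrow> complex) \<Rightarrow> real \<Rightarrow> bool" where
  "hbd s a R \<longleftrightarrow> l2bd (\<lambda>m. japb m powr s * cmod (a m)) R"

text \<open>The coefficients of - div (p grad q) / (4 pi^2), now with the sum over the whole
  lattice; \<open>Aop\<close> is its restriction to finitely many input modes.\<close>

definition Bl :: "(int^'d \<Rightarrow> complex) \<Rightarrow> (int^'d \<Rightarrow> complex) \<Rightarrow> int^'d \<Rightarrow> complex" where
  "Bl p q k = (\<Sum>\<^sub>\<infinity>l. of_real (kvec k \<bullet> kvec l) * p (k - l) * q l)"

definition cv :: "(int^'d \<Rightarrow> complex) \<Rightarrow> (int^'d \<Rightarrow> complex) \<Rightarrow> int^'d \<Rightarrow> real" where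
  "cv p q k = (\<Sum>\<^sub>\<infinity>l. cmod (p (k - l)) * cmod (q l))"

definition rhs :: "(int^'d \<Rightarrow> complex) \<Rightarrow> (int^'d \<Rightarrow> complex) \<Rightarrow> int^'d \<Rightarrow> complex" where
  "rhs W a k = - of_real (lam k) * a k - of_real (4 * pi^2) * Bl a (\<lambda>l. W l * a l) k"

text \<open>A potential enters the estimates through the supremum of the Fourier coefficients of its
  gradient. This is implied by a sup norm bound for the gradient and behaves well under
  differences.\<close>

definition potbd :: "(int^'d \<Rightarrow> complex) \<Rightarrow> real \<Rightarrow> bool" where
  "potbd W M \<longleftrightarrow> (\<forall>k. 2 * pi * norm (kvec k) * cmod (W k) \<le> M)"

lemma card_d_ge_1: "1 \<le> real CARD('d::finite)" by (simp add: Suc_leI)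

lemma hbd_mono: "hbd s a R \<Longrightarrow> s' \<le> s \<Longrightarrow> R \<le> R' \<Longrightarrow> hbd s' a R'"
  unfolding hbd_def by (erule l2bd_mono) (auto intro!: mult_right_mono powr_mono)

lemma hbd_nonneg: "hbd s a R \<Longrightarrow> 0 \<le> R"
  unfolding hbd_def by (rule l2bd_nonneg)

lemma hbd_0: "hbd 0 a R \<longleftrightarrow> l2bd (\<lambda>m. cmod (a m)) R"
  by (simp add: hbd_def japb_neq_0)

lemma hbd_l2: "hbd s a R \<Longrightarrow> 0 \<le> s \<Longrightarrow> l2bd (\<lambda>m. cmod (a m)) R"
  using hbd_mono[of s a R 0 R] by (simp add: hbd_0)

lemma hbd_diff: "hbd s a R \<Longrightarrow> hbd s b R' \<Longrightarrow> hbd s (\<lambda>m. a m - b m) (R + R')"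
  unfolding hbd_def
  by (erule (1) l2bd_mono[OF l2bd_add]) (auto simp: abs_mult distrib_left[symmetric] intro!: mult_left_mono norm_triangle_ineq4)

lemma l1bd_summable:
  assumes "l1bd f C" "\<And>k. 0 \<le> f k"
  shows "f summable_on UNIV"
  using assms by (intro nonneg_bdd_above_summable_on bdd_aboveI2[of _ _ C]) (auto simp: l1bd_def)

lemma l2bd_shift_reflect:
  fixes f :: "'a::ab_group_add \<Rightarrow> real"
  assumes "l2bd f C" shows "l2bd (\<lambda>l. f (k - l)) C"
  unfolding l2bd_def
proof (intro allI impI)
  fix F :: "'a set" assume "finite F"
  have "L2_set (\<lambda>l. f (k - l)) F = L2_set f ((\<lambda>l. k - l) ` F)"
    unfolding L2_set_def by (subst sum.reindex) (auto simp: inj_on_def)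
  thus "L2_set (\<lambda>l. f (k - l)) F \<le> C" using assms \<open>finite F\<close> by (simp add: l2bd_def)
qed

lemma cv_summable:
  assumes "hbd 0 p P" "hbd 0 q Q"
  shows "(\<lambda>l. cmod (p (k - l)) * cmod (q l)) summable_on UNIV"
proof (rule l1bd_summable)
  show "l1bd (\<lambda>l. cmod (p (k - l)) * cmod (q l)) (P * Q)"
    using l2bd_mult_l1[OF l2bd_shift_reflect[of "\<lambda>m. cmod (p m)" P k], of "\<lambda>m. cmod (q m)" Q] assms
    by (simp add: hbd_0)
qed auto

lemma cv_nonneg: "0 \<le> cv p q k"
  unfolding cv_def by (rule infsum_nonneg) auto

text \<open>The inner sum over \<open>l\<close> is infinite. Its finite truncations are estimated by
  testing them with themselves, and the bound passes to the limit along finite subsets.\<close>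

lemma cv_l2bdI:
  fixes p q :: "int^'d \<Rightarrow> complex"
  assumes pq: "hbd 0 p P" "hbd 0 q Q" and w: "\<And>k. 0 \<le> w k"
    and b: "\<And>F G r. finite F \<Longrightarrow> finite G \<Longrightarrow>
      (\<Sum>k\<in>F. \<Sum>l\<in>G. w k * (cmod (p (k - l)) * cmod (q l)) * \<bar>r k\<bar>) \<le> C * L2_set r F"
  shows "l2bd (\<lambda>k. w k * cv p q k) C"
  unfolding l2bd_def
proof (intro allI impI)
  fix F :: "(int^'d) set" assume F: "finite F"
  let ?g = "\<lambda>G k. w k * (\<Sum>l\<in>G. cmod (p (k - l)) * cmod (q l))"
  have C0: "0 \<le> C" using b[of "{0}" "{}" "\<lambda>_. 1"] by simp
  have le: "L2_set (?g G) F \<le> C" if G: "finite G" for G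
  proof -
    have "L2_set (?g G) F * L2_set (?g G) F = (\<Sum>k\<in>F. ?g G k * \<bar>?g G k\<bar>)"
      by (simp add: L2_set_def sum_nonneg w abs_mult power2_eq_square)
    also have "\<dots> = (\<Sum>k\<in>F. \<Sum>l\<in>G. w k * (cmod (p (k - l)) * cmod (q l)) * \<bar>?g G k\<bar>)"
      by (simp only: sum_distrib_left sum_distrib_right)
    also have "\<dots> \<le> C * L2_set (?g G) F" by (rule b[OF F G])
    finally show ?thesis using C0 by (cases "L2_set (?g G) F = 0") (auto intro!: mult_right_le_imp_le[of _ "L2_set (?g G) F"] simp: order_less_le)
  qed
  have "((\<lambda>G. L2_set (?g G) F) \<longlongrightarrow> L2_set (\<lambda>k. w k * cv p q k) F) (finite_subsets_at_top UNIV)"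
    unfolding L2_set_def cv_def
    by (intro tendsto_intros infsum_tendsto cv_summable[OF pq])
  moreover have "\<forall>\<^sub>F G in finite_subsets_at_top UNIV. L2_set (?g G) F \<le> C"
    by (rule eventually_finite_subsets_at_top_weakI) (rule le)
  ultimately show "L2_set (\<lambda>k. w k * cv p q k) F \<le> C"
    by (rule tendsto_upperbound) simp
qed

lemma cv_l2:
  fixes p q :: "int^'d \<Rightarrow> complex"
  assumes p: "hbd s1 p P" and q: "hbd s2 q Q" and s: "0 \<le> s1" "0 \<le> s2" "real CARD('d) - 1/4 \<le> s1 + s2"
  shows "l2bd (cv p q) (2 * sigJ TYPE('d) * P * Q)"
proof -
  have s0: "0 \<le> sigJ TYPE('d)" using sigJ_ge_1[where 'd = 'd] by linarith
  have "l2bd (\<lambda>k. 1 * cv p q k) (2 * sigJ TYPE('d) * P * Q)"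
  proof (rule cv_l2bdI[OF hbd_mono[OF p s(1) order_refl] hbd_mono[OF q s(2) order_refl]])
    fix F G :: "(int^'d) set" and r assume FG: "finite F" "finite G"
    have "(\<Sum>k\<in>F. \<Sum>l\<in>G. 1 * (cmod (p (k - l)) * cmod (q l)) * \<bar>r k\<bar>)
        = (\<Sum>k\<in>F. \<Sum>l\<in>G. cmod (p (k - l)) * \<bar>cmod (q l)\<bar> * \<bar>r k\<bar>)" by simp
    also have "\<dots> \<le> 2 * sigJ TYPE('d) * P * L2_set (\<lambda>l. japb l powr s2 * cmod (q l)) G * L2_set r F"
      by (rule bilinear_estimate[OF FG _ s]) (use p in \<open>auto simp: hbd_def\<close>)
    also have "\<dots> \<le> 2 * sigJ TYPE('d) * P * Q * L2_set r F"
      using q hbd_nonneg[OF p] s0 unfolding hbd_def by (intro mult_right_mono mult_left_mono l2bdD) auto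
    finally show "(\<Sum>k\<in>F. \<Sum>l\<in>G. 1 * (cmod (p (k - l)) * cmod (q l)) * \<bar>r k\<bar>) \<le> 2 * sigJ TYPE('d) * P * Q * L2_set r F" .
  qed auto
  thus ?thesis by simp
qed

definition calg :: "'d::finite itself \<Rightarrow> real" where
  "calg D = 2 powr real CARD('d) * (4 * sigJ D)"

lemma calg_pos: "0 < calg TYPE('d::finite)"
  unfolding calg_def using sigJ_ge_1[where 'd = 'd] by simp

lemma japb_powr_add_le: 
  assumes "0 \<le> s" shows "japb k powr s \<le> 2 powr s * (japb (k - l) powr s + japb l powr s)"
proof -
  have "japb k \<le> 2 * max (japb (k - l)) (japb l)" using japb_add_le[of "k - l" l] by simp
  hence "japb k powr s \<le> (2 * max (japb (k - l)) (japb l)) powr s"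
    using assms by (intro powr_mono2) (auto simp: less_imp_le)
  also have "\<dots> = 2 powr s * (max (japb (k - l)) (japb l)) powr s"
    by (rule powr_mult)
  also have "\<dots> \<le> 2 powr s * (japb (k - l) powr s + japb l powr s)"
    by (intro mult_left_mono) (auto simp: max_def)
  finally show ?thesis .
qed

text \<open>The algebra property of H^d, for coefficients replaced by their moduli: the weight at k
  is bounded by 2^d times the sum of the weights at k - l and l, and each of the two terms is a
  bilinear estimate in which all the regularity of the other factor is available.\<close>

lemma cv_algebra:
  fixes p q :: "int^'d \<Rightarrow> complex"
  assumes p: "hbd (real CARD('d)) p P" and q: "hbd (real CARD('d)) q Q"
  shows "l2bd (\<lambda>k. japb k powr real CARD('d) * cv p q k) (calg TYPE('d) * P * Q)"
proof -
  let ?d = "real CARD('d)"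
  have s0: "0 \<le> sigJ TYPE('d)" using sigJ_ge_1[where 'd = 'd] by linarith
  have PQ: "0 \<le> P" "0 \<le> Q" using p q by (auto intro: hbd_nonneg)
  show ?thesis
  proof (rule cv_l2bdI)
    show "hbd 0 p P" "hbd 0 q Q" using p q by (auto intro: hbd_mono)
    fix F G :: "(int^'d) set" and r :: "int^'d \<Rightarrow> real" assume FG: "finite F" "finite G"
    have pw: "japb k powr ?d * (cmod (p (k - l)) * cmod (q l)) * \<bar>r k\<bar>
       \<le> 2 powr ?d * ((\<lambda>m. japb m powr ?d * cmod (p m)) (k - l) * \<bar>cmod (q l)\<bar> * \<bar>r k\<bar>
          + cmod (p (k - l)) * \<bar>japb l powr ?d * cmod (q l)\<bar> * \<bar>r k\<bar>)" for k l
      using mult_right_mono[OF japb_powr_add_le[of ?d k l], of "cmod (p (k - l)) * cmod (q l) * \<bar>r k\<bar>"]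
      by (simp add: algebra_simps)
    have "(\<Sum>k\<in>F. \<Sum>l\<in>G. japb k powr ?d * (cmod (p (k - l)) * cmod (q l)) * \<bar>r k\<bar>)
      \<le> (\<Sum>k\<in>F. \<Sum>l\<in>G. 2 powr ?d * ((\<lambda>m. japb m powr ?d * cmod (p m)) (k - l) * \<bar>cmod (q l)\<bar> * \<bar>r k\<bar>
          + cmod (p (k - l)) * \<bar>japb l powr ?d * cmod (q l)\<bar> * \<bar>r k\<bar>))"
      by (intro sum_mono pw)
    also have "\<dots> = 2 powr ?d * ((\<Sum>k\<in>F. \<Sum>l\<in>G. (\<lambda>m. japb m powr ?d * cmod (p m)) (k - l) * \<bar>cmod (q l)\<bar> * \<bar>r k\<bar>)
       + (\<Sum>k\<in>F. \<Sum>l\<in>G. cmod (p (k - l)) * \<bar>japb l powr ?d * cmod (q l)\<bar> * \<bar>r k\<bar>))"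
      by (simp only: sum.distrib sum_distrib_left[symmetric])
    also have "\<dots> \<le> 2 powr ?d * (2 * sigJ TYPE('d) * P * L2_set (\<lambda>l. japb l powr ?d * cmod (q l)) G * L2_set r F
       + 2 * sigJ TYPE('d) * P * L2_set (\<lambda>l. japb l powr 0 * (japb l powr ?d * cmod (q l))) G * L2_set r F)"
      using p by (intro mult_left_mono add_mono bilinear_estimate[where ?s1.0 = 0 and ?s2.0 = ?d] bilinear_estimate[where ?s1.0 = ?d and ?s2.0 = 0] FG)
        (auto simp: hbd_def japb_neq_0)
    also have "\<dots> = 2 powr ?d * (4 * sigJ TYPE('d) * P * L2_set (\<lambda>l. japb l powr ?d * cmod (q l)) G * L2_set r F)"
      by (simp add: japb_neq_0)
    also have "\<dots> \<le> 2 powr ?d * (4 * sigJ TYPE('d) * P * Q * L2_set r F)"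
      using q PQ s0 unfolding hbd_def by (intro mult_right_mono mult_left_mono l2bdD) auto
    also have "\<dots> = calg TYPE('d) * P * Q * L2_set r F" by (simp add: calg_def)
    finally show "(\<Sum>k\<in>F. \<Sum>l\<in>G. japb k powr ?d * (cmod (p (k - l)) * cmod (q l)) * \<bar>r k\<bar>) \<le> calg TYPE('d) * P * Q * L2_set r F" .
  qed auto
qed

lemma potbd_nonneg: "potbd W M \<Longrightarrow> 0 \<le> M"
  unfolding potbd_def by (metis kvec_zero mult_eq_0_iff norm_zero)

text \<open>In |k . l| \<le> |k| |l| the factor |l| is absorbed by the potential, while |k| remains
  in front as the outer divergence.\<close>

lemma potbd_term:
  assumes W: "potbd W M"
  shows "cmod (of_real (kvec k \<bullet> kvec l) * p * (W l * q)) \<le> norm (kvec k) * (M / (2 * pi)) * (cmod p * cmod q)"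
proof -
  have "norm (kvec l) * cmod (W l) \<le> M / (2 * pi)"
    using W[unfolded potbd_def, rule_format, of l] by (simp add: field_simps)
  moreover have "cmod (of_real (kvec k \<bullet> kvec l) * p * (W l * q)) = \<bar>kvec k \<bullet> kvec l\<bar> * (cmod (W l) * (cmod p * cmod q))"
    by (simp add: norm_mult)
  moreover have "\<dots> \<le> (norm (kvec k) * norm (kvec l)) * (cmod (W l) * (cmod p * cmod q))"
    by (intro mult_right_mono Cauchy_Schwarz_ineq2) auto
  moreover have "(norm (kvec k) * norm (kvec l)) * (cmod (W l) * (cmod p * cmod q)) = norm (kvec k) * (norm (kvec l) * cmod (W l)) * (cmod p * cmod q)"
    by simp
  ultimately show ?thesis by (smt (verit, best) mult_left_mono mult_nonneg_nonneg mult_right_mono norm_ge_zero)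
qed

lemma Bl_abs_summable:
  assumes "potbd W M" "hbd 0 p P" "hbd 0 q Q"
  shows "(\<lambda>l. cmod (of_real (kvec k \<bullet> kvec l) * p (k - l) * (W l * q l))) summable_on UNIV"
proof -
  have "(\<lambda>l. norm (kvec k) * (M / (2 * pi)) * (cmod (p (k - l)) * cmod (q l))) summable_on UNIV"
    by (intro summable_on_cmult_right cv_summable[OF assms(2,3)])
  thus ?thesis
    by (rule summable_on_comparison_test) (rule potbd_term[OF assms(1)], rule norm_ge_zero)
qed

lemma Bl_summable:
  assumes "potbd W M" "hbd 0 p P" "hbd 0 q Q"
  shows "(\<lambda>l. of_real (kvec k \<bullet> kvec l) * p (k - l) * (W l * q l)) summable_on UNIV"
  by (rule abs_summable_summable) (rule Bl_abs_summable[OF assms])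

lemma Bl_bound:
  assumes "potbd W M" "hbd 0 p P" "hbd 0 q Q"
  shows "4 * pi^2 * cmod (Bl p (\<lambda>l. W l * q l) k) \<le> 2 * pi * norm (kvec k) * (M * cv p q k)"
proof -
  have "cmod (Bl p (\<lambda>l. W l * q l) k) \<le> (\<Sum>\<^sub>\<infinity>l. norm (kvec k) * (M / (2 * pi)) * (cmod (p (k - l)) * cmod (q l)))"
    unfolding Bl_def
    by (rule norm_infsum_le[OF has_sum_infsum[OF Bl_summable[OF assms]]
        has_sum_infsum[OF summable_on_cmult_right[OF cv_summable[OF assms(2,3)]]] potbd_term[OF assms(1)]])
  also have "\<dots> = norm (kvec k) * (M / (2 * pi)) * cv p q k"
    unfolding cv_def by (rule infsum_cmult_right') 
  finally have "4 * pi^2 * cmod (Bl p (\<lambda>l. W l * q l) k) \<le> 4 * pi^2 * (norm (kvec k) * (M / (2 * pi)) * cv p q k)"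
    by (intro mult_left_mono) auto
  also have "\<dots> = 2 * pi * norm (kvec k) * (M * cv p q k)" by (simp add: power2_eq_square field_simps)
  finally show ?thesis .
qed

lemma rhs_bound:
  assumes "potbd W M" "hbd 0 a P"
  shows "cmod (rhs W a k) \<le> norm (kvec k) * (4 * pi^2 * (norm (kvec k) * cmod (a k)) + 2 * pi * (M * cv a a k))"
proof -
  have "cmod (rhs W a k) \<le> lam k * cmod (a k) + 4 * pi^2 * cmod (Bl a (\<lambda>l. W l * a l) k)"
    unfolding rhs_def by (rule order_trans[OF norm_triangle_ineq4]) (simp add: norm_mult norm_power lam_def)
  also have "\<dots> \<le> lam k * cmod (a k) + 2 * pi * norm (kvec k) * (M * cv a a k)"
    using Bl_bound[OF assms(1,2,2), of k] by simp
  also have "\<dots> = norm (kvec k) * (4 * pi^2 * (norm (kvec k) * cmod (a k)) + 2 * pi * (M * cv a a k))"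
    by (simp add: lam_def power2_eq_square algebra_simps)
  finally show ?thesis .
qed

section \<open>Short-time persistence of the H^d bound and of coercivity\<close>

lemma has_real_derivative_cmod_sq:
  assumes "(f has_vector_derivative f') (at t within S)"
  shows "((\<lambda>t. (cmod (f t))^2) has_real_derivative 2 * Re (f' * cnj (f t))) (at t within S)"
proof -
  have "((\<lambda>t. f t \<bullet> f t) has_derivative (\<lambda>h. f t \<bullet> (h *\<^sub>R f') + (h *\<^sub>R f') \<bullet> f t)) (at t within S)"
    using assms unfolding has_vector_derivative_def by (intro has_derivative_inner)
  moreover have "(\<lambda>h. f t \<bullet> (h *\<^sub>R f') + (h *\<^sub>R f') \<bullet> f t) = (\<lambda>h. h * (2 * Re (f' * cnj (f t))))"
    by (simp add: fun_eq_iff inner_complex_def algebra_simps)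
  ultimately show ?thesis
    unfolding has_field_derivative_def power2_norm_eq_inner by (simp only: mult.commute[of _ "2 * Re (f' * cnj (f t))"])
qed

lemma increment_le:
  fixes g :: "real \<Rightarrow> real"
  assumes "s \<le> t" "\<And>x. s \<le> x \<Longrightarrow> x \<le> t \<Longrightarrow> (g has_real_derivative g' x) (at x within {s..t})"
    and "\<And>x. s \<le> x \<Longrightarrow> x \<le> t \<Longrightarrow> g' x \<le> D"
  shows "g t \<le> g s + D * (t - s)"
proof (cases "s = t")
  case False
  hence "s < t" using assms(1) by simp
  then obtain x where "x \<in> {s<..<t}" "g t - g s = g' x * (t - s)"
    using mvt_simple[of s t g "\<lambda>x h. g' x * h"] assms(2) by (auto simp: has_field_derivative_def)
  moreover have "g' x * (t - s) \<le> D * (t - s)"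
    using calculation(1) assms(1) by (intro mult_right_mono assms(3)) auto
  ultimately show ?thesis by linarith
qed simp

text \<open>The dissipation absorbs the derivative falling on the nonlinearity.\<close>

lemma short_time_bound:
  fixes a :: "real \<Rightarrow> int^'d \<Rightarrow> complex"
  assumes W: "potbd W M" and T: "0 \<le> T"
    and d: "\<And>t k. t \<in> {0..T} \<Longrightarrow> ((\<lambda>t. a t k) has_vector_derivative rhs W (a t) k) (at t within {0..T})"
    and C0: "\<And>t. t \<in> {0..T} \<Longrightarrow> hbd (real CARD('d)) (a t) C0"
    and h: "hbd (real CARD('d)) (a 0) h" "0 < h"
    and \<Theta>: "(calg TYPE('d) * M * (2 * h)^2)^2 / 2 * T \<le> h^2"
    and t: "t \<in> {0..T}"
  shows "hbd (real CARD('d)) (a t) (2 * h)"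
proof -
  let ?d = "real CARD('d)"
  let ?y = "\<lambda>F t. \<Sum>k\<in>F. (japb k powr ?d)^2 * (cmod (a t k))^2"
  let ?\<Theta> = "\<lambda>R. (calg TYPE('d) * M * R^2)^2 / 2"
  have hy: "hbd ?d (a t) R \<longleftrightarrow> (\<forall>F. finite F \<longrightarrow> ?y F t \<le> R^2)" if "0 \<le> R" for R t
  proof -
    have "L2_set (\<lambda>m. japb m powr ?d * cmod (a t m)) F \<le> R \<longleftrightarrow> ?y F t \<le> R^2" for F
      using that unfolding L2_set_def by (simp add: power_mult_distrib real_sqrt_le_iff[of _ "R^2", symmetric] del: real_sqrt_le_iff)
    thus ?thesis by (simp add: hbd_def l2bd_def)
  qed
  have grow: "?y F t2 \<le> ?y F t1 + ?\<Theta> R * (t2 - t1)"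
    if F: "finite F" and t12: "0 \<le> t1" "t1 \<le> t2" "t2 \<le> T" and R: "\<And>s. t1 \<le> s \<Longrightarrow> s \<le> t2 \<Longrightarrow> hbd ?d (a s) R" for F t1 t2 R
  proof (rule increment_le[where g' = "\<lambda>s. \<Sum>k\<in>F. (japb k powr ?d)^2 * (2 * Re (rhs W (a s) k * cnj (a s k)))"])
    show "t1 \<le> t2" by fact
    fix s assume s: "t1 \<le> s" "s \<le> t2"
    show "(?y F has_real_derivative (\<Sum>k\<in>F. (japb k powr ?d)^2 * (2 * Re (rhs W (a s) k * cnj (a s k))))) (at s within {t1..t2})"
    proof (intro DERIV_sum DERIV_cmult has_real_derivative_cmod_sq)
      fix k
      have "((\<lambda>t. a t k) has_vector_derivative rhs W (a s) k) (at s within {0..T})" using s t12 by (intro d) auto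
      thus "((\<lambda>t. a t k) has_vector_derivative rhs W (a s) k) (at s within {t1..t2})"
        by (rule has_vector_derivative_within_subset) (use t12 in auto)
    qed
    note Rs = R[OF s]
    have R0: "hbd 0 (a s) R" by (rule hbd_mono[OF Rs]) auto
    have "(\<Sum>k\<in>F. (japb k powr ?d)^2 * (2 * Re (rhs W (a s) k * cnj (a s k))))
       \<le> (\<Sum>k\<in>F. (japb k powr ?d)^2 * ((M * cv (a s) (a s) k)^2 / 2))"
    proof (intro sum_mono mult_left_mono)
      fix k
      \<comment> \<open>The square of \<open>x\<close> is the dissipation
        \<open>lam k * |a_k|^2\<close>, and \<open>x * n\<close> bounds the nonlinear term.
        Completing the square leaves n^2 / 4, which contains no derivative and is controlled by the
        algebra property.\<close>
      define n where "n = M * cv (a s) (a s) k"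
      define x where "x = 2 * pi * norm (kvec k) * cmod (a s k)"
      let ?B = "of_real (4 * pi^2) * Bl (a s) (\<lambda>l. W l * a s l) k"
      have "cmod (?B * cnj (a s k)) \<le> 2 * pi * norm (kvec k) * n * cmod (a s k)"
        using mult_right_mono[OF Bl_bound[OF W R0 R0, of k], of "cmod (a s k)"] by (simp add: n_def norm_mult norm_power)
      hence B: "- Re (?B * cnj (a s k)) \<le> x * n"
        using complex_Re_le_cmod[of "- (?B * cnj (a s k))"] by (simp add: x_def algebra_simps)
      have "rhs W (a s) k * cnj (a s k) = - of_real (lam k) * (a s k * cnj (a s k)) - ?B * cnj (a s k)"
        by (simp add: rhs_def algebra_simps)
      also have "a s k * cnj (a s k) = of_real ((cmod (a s k))^2)" by (simp only: complex_norm_square)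
      finally have "Re (rhs W (a s) k * cnj (a s k)) = - (x^2) - Re (?B * cnj (a s k))"
        by (simp add: x_def lam_def power_mult_distrib)
      hence "Re (rhs W (a s) k * cnj (a s k)) \<le> - (x^2) + x * n" using B by linarith
      moreover have "- (x^2) + x * n \<le> n^2 / 4" using zero_le_power2[of "x - n/2"] by (simp add: power2_eq_square algebra_simps)
      ultimately show "2 * Re (rhs W (a s) k * cnj (a s k)) \<le> (M * cv (a s) (a s) k)^2 / 2" by (simp add: n_def)
    qed auto
    also have "\<dots> = M^2 / 2 * (L2_set (\<lambda>k. japb k powr ?d * cv (a s) (a s) k) F)^2"
      by (simp add: L2_set_def sum_nonneg power_mult_distrib sum_distrib_left algebra_simps)
    also have "\<dots> \<le> M^2 / 2 * (calg TYPE('d) * R * R)^2"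
      by (intro mult_left_mono power_mono l2bdD cv_algebra Rs) auto
    also have "\<dots> = ?\<Theta> R" by (simp add: power_mult_distrib power2_eq_square algebra_simps)
    finally show "(\<Sum>k\<in>F. (japb k powr ?d)^2 * (2 * Re (rhs W (a s) k * cnj (a s k)))) \<le> ?\<Theta> R" .
  qed
  have y0: "?y F 0 \<le> h^2" if "finite F" for F using h hy[of h 0] that by auto
  obtain \<delta> where \<delta>: "0 < \<delta>" "?\<Theta> C0 * \<delta> \<le> h^2"
  proof (rule that)
    show "0 < h^2 / (?\<Theta> C0 + 1)" using h by (intro divide_pos_pos add_nonneg_pos) auto
    have "?\<Theta> C0 * (h^2 / (?\<Theta> C0 + 1)) = (?\<Theta> C0 / (?\<Theta> C0 + 1)) * h^2" by simp
    also have "\<dots> \<le> 1 * h^2" by (intro mult_right_mono) (auto simp: divide_le_eq_1 add_nonneg_pos)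
    finally show "?\<Theta> C0 * (h^2 / (?\<Theta> C0 + 1)) \<le> h^2" by simp
  qed
  \<comment> \<open>Continuity argument in steps of length \<open>\<delta>\<close>, without
    continuity of the H^d norm. Up to the beginning of a step the bound 2 h is known and gives 2 h^2
    for the weighted square sum; during the step the crude bound \<open>C0\<close> adds at most h^2;
    the total 3 h^2 is below (2 h)^2. The number of steps depends on \<open>C0\<close>, the result
    does not.\<close>
  have "\<forall>t\<in>{0..T}. t \<le> real n * \<delta> \<longrightarrow> hbd ?d (a t) (2 * h)" for n
  proof (induction n)
    case 0
    show ?case using h by (auto intro!: hbd_mono[OF h(1)])
  next
    case (Suc n)
    show ?case
    proof (intro ballI impI)
      fix t assume t: "t \<in> {0..T}" "t \<le> real (Suc n) * \<delta>"
      show "hbd ?d (a t) (2 * h)"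
      proof (cases "t \<le> real n * \<delta>")
        case True thus ?thesis using Suc t by blast
      next
        case False
        define s where "s = real n * \<delta>"
        have s: "0 \<le> s" "s \<le> t" "t - s \<le> \<delta>" "s \<le> T" using False t \<delta> by (auto simp: s_def algebra_simps)
        have "?y F t \<le> (2 * h)^2" if F: "finite F" for F
        proof -
          have "?y F s \<le> ?y F 0 + ?\<Theta> (2 * h) * (s - 0)"
            using Suc s t by (intro grow F) (auto simp: s_def)
          also have "\<dots> \<le> h^2 + ?\<Theta> (2 * h) * T"
            using s by (intro add_mono y0 F mult_left_mono) auto
          also have "\<dots> \<le> 2 * h^2" using \<Theta> by simp
          finally have ys: "?y F s \<le> 2 * h^2" .
          have "?y F t \<le> ?y F s + ?\<Theta> C0 * (t - s)"
            using s t by (intro grow F C0) auto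
          also have "\<dots> \<le> 2 * h^2 + ?\<Theta> C0 * \<delta>" using s by (intro add_mono ys mult_left_mono) auto
          also have "\<dots> \<le> 2 * h^2 + h^2" using \<delta>(2) by simp
          also have "\<dots> \<le> (2 * h)^2" by (simp add: power_mult_distrib)
          finally show ?thesis .
        qed
        thus ?thesis using hy[of "2 * h" t] h by simp
      qed
    qed
  qed
  moreover obtain n where "t \<le> real n * \<delta>" using reals_Archimedean3[OF \<delta>(1), rule_format, of t] less_imp_le by blast
  ultimately show ?thesis using t by blast
qed

text \<open>What is left of the bound for \<open>rhs\<close> after one factor |m| has been taken
  out. It lies in H^(d-1), so it can serve as the sequence \<open>\<beta>\<close> of the trilinear
  estimate when \<open>b'\<close> is the right-hand side of the equation.\<close>

definition majorant :: "real \<Rightarrow> (int^'d \<Rightarrow> complex) \<Rightarrow> int^'d \<Rightarrow> real" where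
  "majorant M a m = 4 * pi^2 * (norm (kvec m) * cmod (a m)) + 2 * pi * (M * cv a a m)"

definition C4 :: "'d::finite itself \<Rightarrow> real \<Rightarrow> real \<Rightarrow> real" where
  "C4 D M R = 4 * pi^2 * R + 2 * pi * (M * (calg D * R * R))"

lemma C4_nonneg: "0 \<le> M \<Longrightarrow> 0 \<le> R \<Longrightarrow> 0 \<le> C4 TYPE('d::finite) M R"
  unfolding C4_def using calg_pos[where 'd = 'd] by simp

lemma majorant_nonneg: "0 \<le> M \<Longrightarrow> 0 \<le> majorant M a m"
  unfolding majorant_def by (simp add: cv_nonneg)

lemma rhs_le_majorant:
  assumes "potbd W M" "hbd 0 a P"
  shows "cmod (rhs W a m) \<le> norm (kvec m) * majorant M a m"
  unfolding majorant_def by (rule rhs_bound[OF assms])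

lemma majorant_l2bd:
  fixes a :: "int^'d \<Rightarrow> complex"
  assumes M: "0 \<le> M" and a: "hbd (real CARD('d)) a R"
  shows "l2bd (\<lambda>m. japb m powr (real CARD('d) - 1) * majorant M a m) (C4 TYPE('d) M R)"
proof -
  let ?d = "real CARD('d)"
  have 1: "l2bd (\<lambda>m. 4 * pi^2 * (japb m powr (?d - 1) * (norm (kvec m) * cmod (a m)))) (4 * pi^2 * R)"
    by (intro l2bd_cmult l2bd_gradient) (use a in \<open>auto simp: hbd_def\<close>)
  have 2: "l2bd (\<lambda>m. (2 * pi * M) * (japb m powr ?d * cv a a m)) ((2 * pi * M) * (calg TYPE('d) * R * R))"
    by (intro l2bd_cmult cv_algebra a) (use M in auto)
  show ?thesis
    unfolding C4_def
  proof (rule l2bd_mono[OF l2bd_add[OF 1 2]])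
    fix m :: "int^'d"
    have le: "japb m powr (?d - 1) * (2 * pi * (M * cv a a m)) \<le> japb m powr ?d * (2 * pi * (M * cv a a m))"
      using M by (intro mult_right_mono powr_mono) (auto simp: cv_nonneg)
    show "\<bar>japb m powr (?d - 1) * majorant M a m\<bar> \<le> 4 * pi^2 * (japb m powr (?d - 1) * (norm (kvec m) * cmod (a m))) + (2 * pi * M) * (japb m powr ?d * cv a a m)"
    proof -
      have "\<bar>japb m powr (?d - 1) * majorant M a m\<bar> = japb m powr (?d - 1) * majorant M a m"
        using majorant_nonneg[OF M, of a m] by simp
      also have "\<dots> = 4 * pi^2 * (japb m powr (?d - 1) * (norm (kvec m) * cmod (a m))) + japb m powr (?d - 1) * (2 * pi * (M * cv a a m))"
        unfolding majorant_def by (simp only: distrib_left mult_ac)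
      finally show ?thesis using le by (simp only: mult_ac)
    qed
  qed simp
qed

text \<open>The l1 norm of the coefficients dominates the sup norm of a function, so an l1
  perturbation shifts the lower bound by at most its size.\<close>

lemma coercive_perturb:
  fixes b c :: "int^'d \<Rightarrow> complex"
  assumes c: "coercive c r" and P: "l1bd (\<lambda>m. cmod (b m - c m)) P"
  shows "coercive b (r - P)"
  unfolding coercive_def
proof (intro allI impI)
  fix F :: "(int^'d) set" and v :: "int^'d \<Rightarrow> complex" assume F: "finite F"
  have "cmod (\<Sum>k\<in>F. \<Sum>l\<in>F. (b (k - l) - c (k - l)) * v l * cnj (v k))
     \<le> (\<Sum>k\<in>F. \<Sum>l\<in>F. (\<lambda>m. cmod (b m - c m)) (k - l) * \<bar>cmod (v l)\<bar> * \<bar>cmod (v k)\<bar>)"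
    by (intro sum_norm_le) (simp add: norm_mult)
  also have "\<dots> \<le> P * nrm F v * nrm F v"
    by (rule young_l1_l2[OF F F _ P]) auto
  also have "\<dots> = P * (\<Sum>k\<in>F. (cmod (v k))^2)" unfolding nrm_sq[symmetric] by (simp only: power2_eq_square mult.assoc)
  finally have 1: "cmod (\<Sum>k\<in>F. \<Sum>l\<in>F. (b (k - l) - c (k - l)) * v l * cnj (v k)) \<le> P * (\<Sum>k\<in>F. (cmod (v k))^2)" .
  have "(\<Sum>k\<in>F. \<Sum>l\<in>F. b (k - l) * v l * cnj (v k)) = (\<Sum>k\<in>F. \<Sum>l\<in>F. c (k - l) * v l * cnj (v k))
     + (\<Sum>k\<in>F. \<Sum>l\<in>F. (b (k - l) - c (k - l)) * v l * cnj (v k))"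
    by (simp add: sum.distrib[symmetric] algebra_simps)
  hence "Re (\<Sum>k\<in>F. \<Sum>l\<in>F. b (k - l) * v l * cnj (v k)) \<ge> Re (\<Sum>k\<in>F. \<Sum>l\<in>F. c (k - l) * v l * cnj (v k))
     - cmod (\<Sum>k\<in>F. \<Sum>l\<in>F. (b (k - l) - c (k - l)) * v l * cnj (v k))"
    using abs_Re_le_cmod[of "\<Sum>k\<in>F. \<Sum>l\<in>F. (b (k - l) - c (k - l)) * v l * cnj (v k)"] by simp
  thus "(r - P) * (\<Sum>k\<in>F. (cmod (v k))^2) \<le> Re (\<Sum>k\<in>F. \<Sum>l\<in>F. b (k - l) * v l * cnj (v k))"
    using coerciveD[OF c F, of v] 1 unfolding left_diff_distrib by linarith
qed

lemma vector_derivative_bound: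
  fixes f :: "real \<Rightarrow> 'a::real_normed_vector"
  assumes "convex S" "\<And>x. x \<in> S \<Longrightarrow> (f has_vector_derivative f' x) (at x within S)"
    and "\<And>x. x \<in> S \<Longrightarrow> norm (f' x) \<le> B" "x \<in> S" "y \<in> S"
  shows "norm (f x - f y) \<le> B * norm (x - y)"
  by (rule differentiable_bound[where f' = "\<lambda>x h. h *\<^sub>R f' x"])
    (use assms in \<open>auto simp: has_vector_derivative_def mult.commute[of B] intro!: onorm_le mult_left_mono\<close>)

text \<open>Outside a finite set of modes the H^d bound makes the l1 norm small at all times; on the
  finite set the equation makes each coefficient Lipschitz in time. The resulting time depends on
  \<open>M\<close>, \<open>R\<close>, \<open>\<epsilon>\<close> and the dimension, not on the
  solution.\<close>

lemma short_time_l1: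
  fixes M R \<epsilon> :: real
  assumes M: "0 \<le> M" and R: "0 \<le> R" and \<epsilon>: "0 < \<epsilon>"
  shows "\<exists>\<tau>1>0. \<forall>W (a :: real \<Rightarrow> int^'d \<Rightarrow> complex) T. potbd W M \<longrightarrow> T \<le> \<tau>1 \<longrightarrow>
     (\<forall>t\<in>{0..T}. \<forall>k. ((\<lambda>t. a t k) has_vector_derivative rhs W (a t) k) (at t within {0..T})) \<longrightarrow>
     (\<forall>t\<in>{0..T}. hbd (real CARD('d)) (a t) R) \<longrightarrow>
     (\<forall>t\<in>{0..T}. l1bd (\<lambda>m. cmod (a t m - a 0 m)) \<epsilon>)"
proof -
  let ?d = "real CARD('d)"
  let ?C = "C4 TYPE('d) M R"
  \<comment> \<open>The tail is estimated by Cauchy-Schwarz against the bound 2 R for the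
    difference: sqrt \<eta> * 2 R is at most \<epsilon> / 2.\<close>
  define \<eta> where "\<eta> = (\<epsilon> / (4 * (R + 1)))^2"
  have \<eta>: "0 < \<eta>" using \<epsilon> R by (simp add: \<eta>_def)
  have C: "0 \<le> ?C" by (rule C4_nonneg[OF M R])
  have "(\<lambda>k::int^'d. japb k powr (- (2 * ?d))) summable_on UNIV"
    by (rule japb_powr_summable) (use card_d_ge_1[where 'd = 'd] in linarith)
  then obtain H :: "(int^'d) set" where H: "finite H" and tail: "\<And>G. finite G \<Longrightarrow> G \<inter> H = {} \<Longrightarrow> (\<Sum>k\<in>G. japb k powr (- (2 * ?d))) \<le> \<eta>"
  proof -
    assume s: "(\<lambda>k::int^'d. japb k powr (- (2 * ?d))) summable_on UNIV"
    let ?f = "\<lambda>k::int^'d. japb k powr (- (2 * ?d))"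
    have "(sum ?f \<longlongrightarrow> infsum ?f UNIV) (finite_subsets_at_top UNIV)" by (rule infsum_tendsto[OF s])
    hence "\<forall>\<^sub>F H in finite_subsets_at_top UNIV. infsum ?f UNIV - \<eta> < sum ?f H"
      by (rule order_tendstoD(1)) (use \<eta> in simp)
    then obtain H where H: "finite H" "infsum ?f UNIV - \<eta> < sum ?f H"
      unfolding eventually_finite_subsets_at_top by blast
    have "sum ?f G \<le> \<eta>" if "finite G" "G \<inter> H = {}" for G
    proof -
      have "sum ?f H + sum ?f G = sum ?f (H \<union> G)" using that H by (subst sum.union_disjoint) auto
      also have "\<dots> \<le> infsum ?f UNIV" using that H by (intro finite_sum_le_infsum s) auto
      finally show ?thesis using H(2) by linarith
    qed
    thus thesis using that H(1) by blast
  qed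
  define B where "B = (\<Sum>m\<in>H. norm (kvec m) * ?C)"
  have B: "0 \<le> B" using C by (auto simp: B_def intro!: sum_nonneg)
  define \<tau>1 where "\<tau>1 = \<epsilon> / (2 * (B + 1))"
  have \<tau>1: "0 < \<tau>1" using \<epsilon> B by (simp add: \<tau>1_def)
  have tb: "\<tau>1 * B \<le> \<epsilon> / 2"
  proof -
    have "\<tau>1 * B \<le> \<tau>1 * (B + 1)" using \<tau>1 by simp
    also have "\<dots> = \<epsilon> / 2" using B by (simp add: \<tau>1_def field_simps)
    finally show ?thesis .
  qed
  show ?thesis
  proof (intro exI[of _ \<tau>1] conjI \<tau>1 allI impI ballI)
    fix W and a :: "real \<Rightarrow> int^'d \<Rightarrow> complex" and T t
    assume W: "potbd W M" and T: "T \<le> \<tau>1"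
      and d: "\<forall>t\<in>{0..T}. \<forall>k. ((\<lambda>t. a t k) has_vector_derivative rhs W (a t) k) (at t within {0..T})"
      and h: "\<forall>t\<in>{0..T}. hbd ?d (a t) R" and t: "t \<in> {0..T}"
    have diff: "cmod (a t m - a 0 m) \<le> norm (kvec m) * ?C * \<tau>1" for m
    proof -
      have db: "cmod (rhs W (a s) m) \<le> norm (kvec m) * ?C" if s: "s \<in> {0..T}" for s
      proof -
        have hs: "hbd ?d (a s) R" using h s by blast
        have "majorant M (a s) m \<le> japb m powr (?d - 1) * majorant M (a s) m"
          using mult_right_mono[of 1 "japb m powr (?d - 1)", OF ge_one_powr_ge_zero[OF japb_ge_1] majorant_nonneg[OF M, of "a s" m]]
            card_d_ge_1[where 'd = 'd] by simp
        also have "\<dots> \<le> ?C" using l2bd_member[OF majorant_l2bd[OF M hs], of m] by linarith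
        finally have "norm (kvec m) * majorant M (a s) m \<le> norm (kvec m) * ?C" by (intro mult_left_mono) auto
        thus ?thesis using rhs_le_majorant[OF W hbd_mono[OF hs, of 0 R], of m] by simp
      qed
      have "norm (a t m - a 0 m) \<le> norm (kvec m) * ?C * norm (t - 0)"
        by (rule vector_derivative_bound[where f' = "\<lambda>s. rhs W (a s) m" and S = "{0..T}"]) (use d db t in auto)
      also have "\<dots> \<le> norm (kvec m) * ?C * \<tau>1" using t T C by (intro mult_left_mono) auto
      finally show ?thesis .
    qed
    show "l1bd (\<lambda>m. cmod (a t m - a 0 m)) \<epsilon>"
      unfolding l1bd_def
    proof (intro allI impI)
      fix F :: "(int^'d) set" assume F: "finite F"
      have "(\<Sum>m\<in>F. cmod (a t m - a 0 m)) = (\<Sum>m\<in>F \<inter> H. cmod (a t m - a 0 m)) + (\<Sum>m\<in>F - H. cmod (a t m - a 0 m))"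
        using F by (subst sum.union_disjoint[symmetric]) (auto intro: sum.cong)
      also have "(\<Sum>m\<in>F \<inter> H. cmod (a t m - a 0 m)) \<le> (\<Sum>m\<in>F \<inter> H. norm (kvec m) * ?C * \<tau>1)"
        by (intro sum_mono diff)
      also have "\<dots> \<le> (\<Sum>m\<in>H. norm (kvec m) * ?C * \<tau>1)"
        using C \<tau>1 H by (intro sum_mono2) auto
      also have "\<dots> = \<tau>1 * B" by (simp add: B_def sum_distrib_left algebra_simps)
      also have "\<dots> \<le> \<epsilon> / 2" by (rule tb)
      also have "(\<Sum>m\<in>F - H. cmod (a t m - a 0 m)) \<le> \<epsilon> / 2"
      proof -
        have hd: "hbd ?d (\<lambda>m. a t m - a 0 m) (R + R)"
          using h t by (intro hbd_diff) auto
        have "(\<Sum>m\<in>F - H. cmod (a t m - a 0 m)) = (\<Sum>m\<in>F - H. \<bar>japb m powr (- ?d)\<bar> * \<bar>japb m powr ?d * cmod (a t m - a 0 m)\<bar>)"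
          by (intro sum.cong refl) (simp add: abs_mult powr_minus field_simps japb_neq_0)
        also have "\<dots> \<le> L2_set (\<lambda>m. japb m powr (- ?d)) (F - H) * L2_set (\<lambda>m. japb m powr ?d * cmod (a t m - a 0 m)) (F - H)"
          by (rule L2_set_mult_ineq)
        also have "\<dots> \<le> (\<epsilon> / (4 * (R + 1))) * (R + R)"
        proof (intro mult_mono)
          have "(\<Sum>m\<in>F - H. (japb m powr (- ?d))^2) = (\<Sum>m\<in>F - H. japb m powr (- (2 * ?d)))"
            by (intro sum.cong refl) (simp add: power2_eq_square flip: powr_add)
          also have "\<dots> \<le> \<eta>" using F by (intro tail) auto
          finally show "L2_set (\<lambda>m. japb m powr (- ?d)) (F - H) \<le> \<epsilon> / (4 * (R + 1))"
            unfolding L2_set_def \<eta>_def using \<epsilon> R by (intro real_le_lsqrt) auto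
          show "L2_set (\<lambda>m. japb m powr ?d * cmod (a t m - a 0 m)) (F - H) \<le> R + R"
            using hd unfolding hbd_def by (rule l2bdD)
        qed (use \<epsilon> R in auto)
        also have "\<dots> \<le> \<epsilon> / 2" using \<epsilon> R by (simp add: field_simps)
        finally show ?thesis .
      qed
      finally show "(\<Sum>m\<in>F. cmod (a t m - a 0 m)) \<le> \<epsilon>" by simp
    qed
  qed
qed

section \<open>Observability\<close>

lemma infsum_sum_swap:
  fixes f :: "'b \<Rightarrow> 'a \<Rightarrow> complex"
  assumes "finite F" "\<And>k. k \<in> F \<Longrightarrow> f k summable_on A"
  shows "infsum (\<lambda>l. \<Sum>k\<in>F. f k l) A = (\<Sum>k\<in>F. infsum (f k) A)"
    and "(\<lambda>l. \<Sum>k\<in>F. f k l) summable_on A"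
proof -
  have "((\<lambda>l. \<Sum>k\<in>F. f k l) has_sum (\<Sum>k\<in>F. infsum (f k) A)) A"
    using assms by (induction F rule: finite_induct) (auto intro!: has_sum_add has_sum_infsum)
  thus "infsum (\<lambda>l. \<Sum>k\<in>F. f k l) A = (\<Sum>k\<in>F. infsum (f k) A)" "(\<lambda>l. \<Sum>k\<in>F. f k l) summable_on A"
    by (auto intro: infsumI has_sum_imp_summable)
qed

lemma potbd_diff: "potbd W M \<Longrightarrow> potbd W' M' \<Longrightarrow> potbd (\<lambda>k. W k - W' k) (M + M')"
  unfolding potbd_def
proof (intro allI)
  fix k assume h: "\<forall>k. 2 * pi * norm (kvec k) * cmod (W k) \<le> M" "\<forall>k. 2 * pi * norm (kvec k) * cmod (W' k) \<le> M'"
  have "2 * pi * norm (kvec k) * cmod (W k - W' k) \<le> 2 * pi * norm (kvec k) * (cmod (W k) + cmod (W' k))"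
    by (intro mult_left_mono norm_triangle_ineq4) auto
  thus "2 * pi * norm (kvec k) * cmod (W k - W' k) \<le> M + M'"
    using h[THEN spec, of k] by (simp add: distrib_left)
qed

lemma potbd_le: "potbd W M \<Longrightarrow> W 0 = 0 \<Longrightarrow> cmod (W k) \<le> M / 6"
proof -
  assume W: "potbd W M" "W 0 = 0"
  show ?thesis
  proof (cases "k = 0")
    case False
    have "6 * 1 \<le> 2 * pi * norm (kvec k)" using norm_kvec_ge_1[OF False] pi_gt3 by (intro mult_mono) auto
    hence "6 * 1 * cmod (W k) \<le> 2 * pi * norm (kvec k) * cmod (W k)" by (intro mult_right_mono) auto
    also have "\<dots> \<le> M" using W(1) unfolding potbd_def by blast
    finally show ?thesis by simp
  qed (use W potbd_nonneg[OF W(1)] in auto)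
qed

text \<open>Telescoping of the cubic expression: b W2 b - a W1 a = b (W2 - W1) b + b W1 (b - a) + (b
  - a) W1 a. Only the leading term contains the difference of the potentials, and it contains no
  \<open>a\<close>.\<close>

lemma rhs_diff:
  assumes W: "potbd W1 M" "potbd W2 M" and a: "hbd 0 a R" and b: "hbd 0 b R"
  shows "rhs W2 b k - rhs W1 a k = - of_real (lam k) * (b k - a k)
     - of_real (4 * pi^2) * (Bl b (\<lambda>l. (W2 l - W1 l) * b l) k + Bl b (\<lambda>l. W1 l * (b l - a l)) k
         + Bl (\<lambda>l. b l - a l) (\<lambda>l. W1 l * a l) k)"
proof -
  note z = hbd_diff[OF b a]
  let ?z = "\<lambda>l. b l - a l"
  let ?c = "\<lambda>l. of_real (kvec k \<bullet> kvec l) :: complex"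
  have hs: "((\<lambda>l. ?c l * p (k - l) * (V l * q l)) has_sum Bl p (\<lambda>l. V l * q l) k) UNIV"
    if "potbd V N" "hbd 0 p P" "hbd 0 q Q" for p q V N P Q
    unfolding Bl_def by (rule has_sum_infsum[OF Bl_summable[OF that]])
  have A: "((\<lambda>l. ?c l * b (k - l) * ((W2 l - W1 l) * b l) + ?c l * b (k - l) * (W1 l * ?z l)
       + ?c l * ?z (k - l) * (W1 l * a l) + ?c l * a (k - l) * (W1 l * a l)) has_sum
      (Bl b (\<lambda>l. (W2 l - W1 l) * b l) k + Bl b (\<lambda>l. W1 l * ?z l) k + Bl ?z (\<lambda>l. W1 l * a l) k
      + Bl a (\<lambda>l. W1 l * a l) k)) UNIV"
    by (intro has_sum_add hs[OF potbd_diff[OF W(2,1)] b b] hs[OF W(1) b z] hs[OF W(1) z a] hs[OF W(1) a a])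
  have B: "(\<lambda>l. ?c l * b (k - l) * ((W2 l - W1 l) * b l) + ?c l * b (k - l) * (W1 l * ?z l)
       + ?c l * ?z (k - l) * (W1 l * a l) + ?c l * a (k - l) * (W1 l * a l)) = (\<lambda>l. ?c l * b (k - l) * (W2 l * b l))"
    by (simp add: fun_eq_iff algebra_simps)
  have E: "Bl b (\<lambda>l. (W2 l - W1 l) * b l) k + Bl b (\<lambda>l. W1 l * ?z l) k + Bl ?z (\<lambda>l. W1 l * a l) k
      + Bl a (\<lambda>l. W1 l * a l) k = Bl b (\<lambda>l. W2 l * b l) k"
    by (rule has_sum_unique[OF A[unfolded B] hs[OF W(2) b b]])
  have aux: "- e * x - c * (A1 + A2 + A3 + A4) - (- e * y - c * A4) = - e * (x - y) - c * (A1 + A2 + A3)"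
    for e x y c A1 A2 A3 A4 :: complex by (simp add: algebra_simps)
  show ?thesis unfolding rhs_def E[symmetric] by (rule aux)
qed

text \<open>For real \<open>b\<close> the operator is symmetric, so it can be moved to the finitely
  supported test function. The sum on the right still runs over all modes, because multiplication by
  \<open>b\<close> spreads the support.\<close>

lemma Bl_adjoint:
  fixes b :: "int^'d \<Rightarrow> complex"
  assumes W: "potbd W M" and b: "hbd 0 b R" and q: "hbd 0 q Q" and h: "hermitian b" and F: "finite F"
  shows "(\<Sum>k\<in>F. Bl b (\<lambda>l. W l * q l) k * cnj (u k)) = (\<Sum>\<^sub>\<infinity>l. (W l * q l) * cnj (Aop b F u l))"
    and "(\<lambda>l. (W l * q l) * cnj (Aop b F u l)) summable_on UNIV"
proof -
  have s: "(\<lambda>l. of_real (kvec k \<bullet> kvec l) * b (k - l) * (W l * q l) * cnj (u k)) summable_on UNIV" for k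
    by (intro summable_on_cmult_left Bl_summable[OF W b q])
  have eq: "(\<Sum>k\<in>F. of_real (kvec k \<bullet> kvec l) * b (k - l) * (W l * q l) * cnj (u k)) = (W l * q l) * cnj (Aop b F u l)" for l
    unfolding Aop_def cnj_sum complex_cnj_mult complex_cnj_complex_of_real hermitianD[OF h] sum_distrib_left inner_commute[of "kvec l"]
    by (rule sum.cong) (simp_all only: mult_ac)
  show "(\<Sum>k\<in>F. Bl b (\<lambda>l. W l * q l) k * cnj (u k)) = (\<Sum>\<^sub>\<infinity>l. (W l * q l) * cnj (Aop b F u l))"
    unfolding Bl_def infsum_cmult_left'[symmetric] eq[symmetric]
    by (rule infsum_sum_swap(1)[symmetric]) (use F s in auto)
  show "(\<lambda>l. (W l * q l) * cnj (Aop b F u l)) summable_on UNIV"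
    unfolding eq[symmetric] by (rule infsum_sum_swap(2)) (use F s in auto)
qed

definition C6 :: "'d::finite itself \<Rightarrow> real \<Rightarrow> real \<Rightarrow> real" where
  "C6 D M R = 4 * pi^2 + 8 * pi * (M * sigJ D * R)"

lemma Bl_pair_bound:
  fixes p q :: "int^'d \<Rightarrow> complex"
  assumes W: "potbd W M" and pq: "hbd 0 p P" "hbd 0 q Q" and cv: "l2bd (cv p q) C" and F: "finite F" "0 \<notin> F"
  shows "4 * pi^2 * cmod (\<Sum>k\<in>F. Bl p (\<lambda>l. W l * q l) k * cnj (u k)) \<le> 2 * pi * (M * C * nrm2 F u)"
proof -
  have M: "0 \<le> M" by (rule potbd_nonneg[OF W])
  have "4 * pi^2 * cmod (\<Sum>k\<in>F. Bl p (\<lambda>l. W l * q l) k * cnj (u k)) \<le> 4 * pi^2 * (\<Sum>k\<in>F. cmod (Bl p (\<lambda>l. W l * q l) k) * cmod (u k))"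
    by (intro mult_left_mono sum_norm_le) (auto simp: norm_mult)
  also have "\<dots> = (\<Sum>k\<in>F. (4 * pi^2 * cmod (Bl p (\<lambda>l. W l * q l) k)) * cmod (u k))"
    by (simp only: sum_distrib_left mult.assoc)
  also have "\<dots> \<le> (\<Sum>k\<in>F. (2 * pi * norm (kvec k) * (M * cv p q k)) * cmod (u k))"
    by (intro sum_mono mult_right_mono Bl_bound[OF W pq]) auto
  also have "\<dots> = 2 * pi * M * (\<Sum>k\<in>F. \<bar>cv p q k\<bar> * \<bar>norm (kvec k) * cmod (u k)\<bar>)"
    unfolding sum_distrib_left by (intro sum.cong refl) (simp add: abs_mult cv_nonneg)
  also have "\<dots> \<le> 2 * pi * M * (L2_set (cv p q) F * L2_set (\<lambda>k. norm (kvec k) * cmod (u k)) F)"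
    using M by (intro mult_left_mono L2_set_mult_ineq) auto
  also have "\<dots> \<le> 2 * pi * M * (C * nrm2 F u)"
    using M l2bd_nonneg[OF cv] by (intro mult_left_mono mult_mono l2bdD[OF cv] nrm_le_nrm1 F) auto
  finally show ?thesis by (simp add: mult.assoc)
qed

text \<open>The equation of the difference at a fixed time, tested with \<open>u\<close>. Every term
  containing the difference is bounded with \<open>u\<close> in H2, so that the L2 bound
  \<open>Z\<close> suffices for it.\<close>

lemma pairing:
  fixes a b u y :: "int^'d \<Rightarrow> complex"
  assumes W: "potbd W1 M" "potbd W2 M" and ab: "hbd (real CARD('d)) a R" "hbd (real CARD('d)) b R" and h: "hermitian b"
    and F: "finite F" "0 \<notin> F" and z: "hbd 0 (\<lambda>k. b k - a k) Z"
    and V: "\<And>l. V l = (W2 l - W1 l) * b l" and VB: "l2bd (\<lambda>l. cmod (V l)) VB"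
    and tail: "\<And>G. finite G \<Longrightarrow> G \<inter> F = {} \<Longrightarrow> nrm G V \<le> \<eta>"
    and res: "nrm F (\<lambda>k. y k - Aop b F u k) \<le> \<epsilon>"
  shows "cmod ((\<Sum>k\<in>F. (rhs W2 b k - rhs W1 a k) * cnj (u k)) + of_real (4 * pi^2) * cip F V y)
     \<le> C6 TYPE('d) M R * Z * nrm2 F u + 4 * pi^2 * (VB * \<epsilon> + \<eta> * (6 * sigJ TYPE('d) * R * nrm2 F u))"
proof -
  let ?z = "\<lambda>k. b k - a k"
  have a0: "hbd 0 a R" and b0: "hbd 0 b R" using ab by (auto intro: hbd_mono)
  have nn: "0 \<le> R" "0 \<le> Z" "0 \<le> M" "0 \<le> VB"
    using hbd_nonneg[OF ab(1)] hbd_nonneg[OF z] potbd_nonneg[OF W(1)] l2bd_nonneg[OF VB] by auto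
  have \<eta>0: "0 \<le> \<eta>" using tail[of "{}"] by simp
  have V': "(\<lambda>l. (W2 l - W1 l) * b l) = V" by (simp add: V fun_eq_iff)
  \<comment> \<open>\<open>E0\<close> is the diffusion, \<open>E1\<close> and \<open>E2\<close> are
    the nonlinear terms with a factor b - a. \<open>E3\<close> collects the modes outside
    \<open>F\<close> that the truncation cannot see, and \<open>E4\<close> comes from solving the
    Galerkin equation only approximately.\<close>
  define E0 where "E0 = (\<Sum>k\<in>F. of_real (lam k) * ?z k * cnj (u k))"
  define E1 where "E1 = (\<Sum>k\<in>F. Bl b (\<lambda>l. W1 l * ?z l) k * cnj (u k))"
  define E2 where "E2 = (\<Sum>k\<in>F. Bl ?z (\<lambda>l. W1 l * a l) k * cnj (u k))"
  define E3 where "E3 = (\<Sum>\<^sub>\<infinity>l\<in>-F. V l * cnj (Aop b F u l))"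
  define E4 where "E4 = cip F V (\<lambda>k. y k - Aop b F u k)"
  note adj = Bl_adjoint[OF potbd_diff[OF W(2,1)] b0 b0 h F(1), of u, folded V]
  have sF: "(\<lambda>l. V l * cnj (Aop b F u l)) summable_on -F"
    by (rule summable_on_subset_banach[OF adj(2)]) auto
  have "(\<Sum>\<^sub>\<infinity>l. V l * cnj (Aop b F u l)) = cip F V (Aop b F u) + E3"
    unfolding E3_def cip_def
    using infsum_Un_disjoint[of "\<lambda>l. V l * cnj (Aop b F u l)" F "-F"] sF F(1) by (simp add: Compl_partition)
  hence main: "(\<Sum>k\<in>F. Bl b V k * cnj (u k)) = cip F V y - E4 + E3"
    by (simp add: adj(1) E4_def cip_diff_right)
  have eq1: "(\<Sum>k\<in>F. (rhs W2 b k - rhs W1 a k) * cnj (u k)) = - E0 - of_real (4 * pi^2) * ((\<Sum>k\<in>F. Bl b V k * cnj (u k)) + E1 + E2)"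
    unfolding rhs_diff[OF W a0 b0] V' E0_def E1_def E2_def sum_distrib_left sum.distrib[symmetric] sum_negf[symmetric] sum_subtractf[symmetric]
    by (intro sum.cong refl) (simp add: algebra_simps)
  have "(\<Sum>k\<in>F. (rhs W2 b k - rhs W1 a k) * cnj (u k)) + of_real (4 * pi^2) * cip F V y
     = - (E0 + of_real (4 * pi^2) * E1 + of_real (4 * pi^2) * E2 + of_real (4 * pi^2) * (E3 - E4))"
    unfolding eq1 main by (simp add: algebra_simps)
  hence "cmod ((\<Sum>k\<in>F. (rhs W2 b k - rhs W1 a k) * cnj (u k)) + of_real (4 * pi^2) * cip F V y)
     = cmod (E0 + of_real (4 * pi^2) * E1 + of_real (4 * pi^2) * E2 + of_real (4 * pi^2) * (E3 - E4))"
    by (simp only: norm_minus_cancel)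
  also have "\<dots> \<le> cmod E0 + 4 * pi^2 * cmod E1 + 4 * pi^2 * cmod E2 + 4 * pi^2 * (cmod E3 + cmod E4)"
  proof -
    have "cmod (of_real (4 * pi^2) * E) = 4 * pi^2 * cmod E" for E by (simp add: norm_mult norm_power)
    moreover have "4 * pi^2 * cmod (E3 - E4) \<le> 4 * pi^2 * (cmod E3 + cmod E4)"
      by (intro mult_left_mono norm_triangle_ineq4) auto
    ultimately show ?thesis
      by (smt (verit, best) norm_triangle_ineq)
  qed
  also have "\<dots> \<le> 4 * pi^2 * (Z * nrm2 F u) + 2 * pi * (M * (2 * sigJ TYPE('d) * R * Z) * nrm2 F u)
      + 2 * pi * (M * (2 * sigJ TYPE('d) * Z * R) * nrm2 F u) + 4 * pi^2 * (\<eta> * (6 * sigJ TYPE('d) * R * nrm2 F u) + VB * \<epsilon>)"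
  proof (intro add_mono mult_left_mono)
    have "cmod E0 \<le> (\<Sum>k\<in>F. 4 * pi^2 * (\<bar>cmod (?z k)\<bar> * \<bar>(norm (kvec k))^2 * cmod (u k)\<bar>))"
      unfolding E0_def by (intro sum_norm_le) (simp add: norm_mult norm_power lam_def)
    also have "\<dots> = 4 * pi^2 * (\<Sum>k\<in>F. \<bar>cmod (?z k)\<bar> * \<bar>(norm (kvec k))^2 * cmod (u k)\<bar>)"
      by (simp only: sum_distrib_left)
    also have "\<dots> \<le> 4 * pi^2 * (nrm F ?z * nrm2 F u)" by (intro mult_left_mono L2_set_mult_ineq) auto
    also have "\<dots> \<le> 4 * pi^2 * (Z * nrm2 F u)"
      using z unfolding hbd_0 by (intro mult_left_mono mult_right_mono l2bdD) auto
    finally show "cmod E0 \<le> 4 * pi^2 * (Z * nrm2 F u)" .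
    show "4 * pi^2 * cmod E1 \<le> 2 * pi * (M * (2 * sigJ TYPE('d) * R * Z) * nrm2 F u)"
      unfolding E1_def using card_d_ge_1[where 'd = 'd]
      by (intro Bl_pair_bound[OF W(1) b0 z _ F] cv_l2[OF ab(2) z]) auto
    show "4 * pi^2 * cmod E2 \<le> 2 * pi * (M * (2 * sigJ TYPE('d) * Z * R) * nrm2 F u)"
      unfolding E2_def using card_d_ge_1[where 'd = 'd]
      by (intro Bl_pair_bound[OF W(1) z a0 _ F] cv_l2[OF z ab(1)]) auto
    show "cmod E4 \<le> VB * \<epsilon>"
      unfolding E4_def by (rule order_trans[OF cip_bound]) (intro mult_mono l2bdD[OF VB] res nn; simp)
    show "cmod E3 \<le> \<eta> * (6 * sigJ TYPE('d) * R * nrm2 F u)"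
    proof (rule tendsto_upperbound)
      show "((\<lambda>G. cmod (\<Sum>l\<in>G. V l * cnj (Aop b F u l))) \<longlongrightarrow> cmod E3) (finite_subsets_at_top (-F))"
        unfolding E3_def by (intro tendsto_norm infsum_tendsto sF)
      show "\<forall>\<^sub>F G in finite_subsets_at_top (-F). cmod (\<Sum>l\<in>G. V l * cnj (Aop b F u l)) \<le> \<eta> * (6 * sigJ TYPE('d) * R * nrm2 F u)"
      proof (rule eventually_finite_subsets_at_top_weakI)
        fix G assume G: "finite G" "G \<subseteq> - F"
        have "cmod (\<Sum>l\<in>G. V l * cnj (Aop b F u l)) \<le> nrm G V * nrm G (Aop b F u)"
          using cip_bound[of G V "Aop b F u"] by (simp add: cip_def)
        also have "\<dots> \<le> \<eta> * (6 * sigJ TYPE('d) * R * nrm2 F u)"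
          using G ab(2) \<eta>0 unfolding hbd_def by (intro mult_mono tail Aop_l2 F) auto
        finally show "cmod (\<Sum>l\<in>G. V l * cnj (Aop b F u l)) \<le> \<eta> * (6 * sigJ TYPE('d) * R * nrm2 F u)" .
      qed
    qed simp
  qed auto
  also have "\<dots> = C6 TYPE('d) M R * Z * nrm2 F u + 4 * pi^2 * (VB * \<epsilon> + \<eta> * (6 * sigJ TYPE('d) * R * nrm2 F u))"
    by (simp add: C6_def algebra_simps)
  finally show ?thesis .
qed

lemma finite_kvec_ball: "finite {k::int^'d. norm (kvec k) \<le> r}"
proof (rule finite_subset[OF _ sum_prod_vec_box(2)])
  show "finite {- \<lceil>r\<rceil>..\<lceil>r\<rceil>}" by simp
  show "{k::int^'d. norm (kvec k) \<le> r} \<subseteq> {k. \<forall>j. k $ j \<in> {- \<lceil>r\<rceil>..\<lceil>r\<rceil>}}"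
  proof safe
    fix k :: "int^'d" and j assume "norm (kvec k) \<le> r"
    hence "\<bar>real_of_int (k $ j)\<bar> \<le> r" using component_le_norm_cart[of "kvec k" j] by (simp add: kvec_nth)
    hence "real_of_int \<bar>k $ j\<bar> \<le> of_int \<lceil>r\<rceil>" by linarith
    hence "\<bar>k $ j\<bar> \<le> \<lceil>r\<rceil>" by (simp only: of_int_le_iff)
    thus "k $ j \<in> {- \<lceil>r\<rceil>..\<lceil>r\<rceil>}" by auto
  qed
qed

text \<open>The summand \<open>C6 D M R * H\<close> belongs to the spatial terms, tested with
  \<open>u\<close> in H2. The other one belongs to the term with the time derivative of
  \<open>u\<close>: its factor 3 * H is that of the duality estimate, where the 1 accounts for
  \<open>y'\<close> and the product with \<open>C4\<close> for the moving coefficient.\<close>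

definition C8 :: "'d::finite itself \<Rightarrow> real \<Rightarrow> real \<Rightarrow> real \<Rightarrow> real" where
  "C8 D M R c = (let H = CH2 D R c in C6 D M R * H + 3 * H * (1 + 8 * sigJ D * C4 D M R * H))"

lemma C8_nonneg: "0 \<le> M \<Longrightarrow> 0 < R \<Longrightarrow> 0 < c \<Longrightarrow> 0 \<le> C8 TYPE('d::finite) M R c"
  unfolding C8_def C6_def Let_def
  using CH2_pos[of R c, where 'd = 'd] sigJ_ge_1[where 'd = 'd] C4_nonneg[of M R, where 'd = 'd]
  by (intro add_nonneg_nonneg mult_nonneg_nonneg) auto

lemma pot_diff_term_bd:
  assumes W: "potbd W1 M" "potbd W2 M" "W1 0 = 0" "W2 0 = 0"
  shows "cmod ((W2 l - W1 l) * q) \<le> M * cmod q"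
proof -
  have "cmod (W2 l - W1 l) \<le> (M + M) / 6" by (rule potbd_le[OF potbd_diff[OF W(2,1)]]) (use W in simp)
  also have "\<dots> \<le> M" using potbd_nonneg[OF W(1)] by simp
  finally show ?thesis unfolding norm_mult by (rule mult_right_mono) simp
qed

text \<open>The difference of the two equations is tested against \<open>u(t)\<close> with \<open>A(t) u(t) \<approx> y(t)\<close> and
  integrated by parts in time, so that no time derivative of the solutions appears on the right.\<close>

lemma observability:
  fixes a b y y' :: "real \<Rightarrow> int^'d \<Rightarrow> complex"
  assumes W: "potbd W1 M" "potbd W2 M" "W1 0 = 0" "W2 0 = 0" and R: "0 < R" and c: "0 < c" and \<tau>: "0 < \<tau>"
    and ab: "\<And>t. t \<in> {0..\<tau>} \<Longrightarrow> hbd (real CARD('d)) (a t) R" "\<And>t. t \<in> {0..\<tau>} \<Longrightarrow> hbd (real CARD('d)) (b t) R"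
    and herm: "\<And>t. t \<in> {0..\<tau>} \<Longrightarrow> hermitian (b t)" and coer: "\<And>t. t \<in> {0..\<tau>} \<Longrightarrow> coercive (b t) c"
    and da: "\<And>t k. t \<in> {0..\<tau>} \<Longrightarrow> ((\<lambda>t. a t k) has_vector_derivative rhs W1 (a t) k) (at t within {0..\<tau>})"
    and db: "\<And>t k. t \<in> {0..\<tau>} \<Longrightarrow> ((\<lambda>t. b t k) has_vector_derivative rhs W2 (b t) k) (at t within {0..\<tau>})"
    and cb: "\<And>k. continuous_on {0..\<tau>} (\<lambda>t. rhs W2 (b t) k)" and init: "a 0 = b 0"
    and Z: "continuous_on {0..\<tau>} Z" "\<And>t. t \<in> {0..\<tau>} \<Longrightarrow> hbd 0 (\<lambda>k. b t k - a t k) (Z t)"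
    and F0: "finite F0" "0 \<notin> F0"
    and y: "\<And>t k. t \<in> {0..\<tau>} \<Longrightarrow> ((\<lambda>t. y t k) has_vector_derivative y' t k) (at t within {0..\<tau>})"
    and y': "\<And>k. continuous_on {0..\<tau>} (\<lambda>t. y' t k)"
    and y0: "\<And>t k. k \<notin> F0 \<Longrightarrow> y t k = 0" "\<And>t k. k \<notin> F0 \<Longrightarrow> y' t k = 0" "\<And>k. y \<tau> k = 0"
    and Y: "\<And>t. t \<in> {0..\<tau>} \<Longrightarrow> nrm F0 (y t) \<le> Y0" "\<And>t. t \<in> {0..\<tau>} \<Longrightarrow> L2_set (\<lambda>k. cmod (y' t k) / (norm (kvec k))^2) F0 \<le> Y1"
  shows "4 * pi^2 * cmod (integral {0..\<tau>} (\<lambda>t. cip F0 (\<lambda>l. (W2 l - W1 l) * b t l) (y t)))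
    \<le> C8 TYPE('d) M R c * (Y0 + Y1) * integral {0..\<tau>} Z"
proof -
  let ?H = "CH2 TYPE('d) R c" and ?s = "sigJ TYPE('d)" and ?C4 = "C4 TYPE('d) M R" and ?C6 = "C6 TYPE('d) M R" and ?C8 = "C8 TYPE('d) M R c"
  define V where "V t l = (W2 l - W1 l) * b t l" for t l
  define IZ where "IZ = integral {0..\<tau>} Z"
  have M: "0 \<le> M" by (rule potbd_nonneg[OF W(1)])
  have H: "0 < ?H" by (rule CH2_pos[OF R c])
  have s: "0 \<le> ?s" using sigJ_ge_1[where 'd = 'd] by linarith
  have C4: "0 \<le> ?C4" by (rule C4_nonneg[OF M less_imp_le[OF R]])
  have C6: "0 \<le> ?C6" using M s R by (simp add: C6_def)
  have C8: "0 \<le> ?C8" by (rule C8_nonneg[OF M R c])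
  have Z0: "0 \<le> Z t" if "t \<in> {0..\<tau>}" for t by (rule hbd_nonneg[OF Z(2)[OF that]])
  have Zi: "Z integrable_on {0..\<tau>}" by (intro integrable_continuous_interval Z)
  have IZ: "0 \<le> IZ" unfolding IZ_def by (intro integral_nonneg Zi Z0)
  have Y0: "0 \<le> Y0" using Y(1)[of 0] \<tau> order_trans[OF L2_set_nonneg] by auto
  have Y1: "0 \<le> Y1" using Y(2)[of 0] \<tau> order_trans[OF L2_set_nonneg] by auto
  have cb0: "continuous_on {0..\<tau>} (\<lambda>t. b t k)" for k by (rule has_vector_derivative_continuous_on', rule db)
  have cy: "continuous_on {0..\<tau>} (\<lambda>t. y t k)" for k by (rule has_vector_derivative_continuous_on', rule y)
  define Q where "Q = 4 * pi^2 * (M * R + M * R * (6 * ?s * R * (?H * (Y0 + 1))))"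
  have main: "4 * pi^2 * cmod (integral {0..\<tau>} (\<lambda>t. cip F0 (V t) (y t))) \<le> ?C8 * (Y0 + Y1 + 2 * \<epsilon>) * IZ + \<epsilon> * Q * \<tau>"
    if \<epsilon>: "0 < \<epsilon>" "\<epsilon> \<le> 1" for \<epsilon>
  proof -
    \<comment> \<open>One parameter governs both approximations: the Galerkin residual is at most
      \<open>\<epsilon>\<close>, and outside the ball of radius 1 / \<epsilon> the H^d bound with d
      \<ge> 1 makes \<open>V t\<close> at most M * R * \<epsilon> in l2.\<close>
    define N where "N = 1 / \<epsilon>"
    have N: "1 \<le> N" using \<epsilon> by (simp add: N_def)
    define F where "F = F0 \<union> ({k. norm (kvec k) \<le> N} - {0})"
    have F: "finite F" "0 \<notin> F" "F0 \<subseteq> F" using F0 by (auto simp: F_def finite_kvec_ball)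
    have L2_ext: "L2_set g F = L2_set g F0" if "\<And>k. k \<notin> F0 \<Longrightarrow> g k = 0" for g
      unfolding L2_set_def using F that by (intro arg_cong[where f = sqrt] sum.mono_neutral_right) auto
    have nY: "nrm F (y t) \<le> Y0" if "t \<in> {0..\<tau>}" for t
      using Y(1)[OF that] by (subst L2_ext) (auto simp: y0)
    have nY1: "L2_set (\<lambda>k. cmod (y' t k) / (norm (kvec k))^2) F \<le> Y1" if "t \<in> {0..\<tau>}" for t
      using Y(2)[OF that] by (subst L2_ext) (auto simp: y0)
    obtain B where B: "\<And>t. t \<in> {0..\<tau>} \<Longrightarrow> nrm F (y' t) \<le> B"
    proof -
      have "compact ((\<lambda>t. nrm F (y' t)) ` {0..\<tau>})"
        unfolding L2_set_def by (intro compact_continuous_image continuous_intros y') auto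
      hence "bounded ((\<lambda>t. nrm F (y' t)) ` {0..\<tau>})" by (rule compact_imp_bounded)
      then obtain B where "\<forall>t\<in>{0..\<tau>}. norm (nrm F (y' t)) \<le> B" by (auto simp: bounded_iff)
      thus thesis using that[of B] by auto
    qed
    obtain u u' :: "real \<Rightarrow> int^'d \<Rightarrow> complex" where
      du: "\<And>m t. t \<in> {0..\<tau>} \<Longrightarrow> ((\<lambda>t. u t m) has_vector_derivative u' t m) (at t within {0..\<tau>})" and
      cu': "\<And>m. continuous_on {0..\<tau>} (\<lambda>t. u' t m)" and
      r1: "\<And>t. t \<in> {0..\<tau>} \<Longrightarrow> nrm F (\<lambda>k. y t k - Aop (b t) F (u t) k) \<le> \<epsilon>" and
      r2: "\<And>t. t \<in> {0..\<tau>} \<Longrightarrow> nrm F (\<lambda>k. y' t k - Aop (rhs W2 (b t)) F (u t) k - Aop (b t) F (u' t) k) \<le> \<epsilon>" and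
      uz: "\<And>k t. (\<And>l. y t l = 0) \<Longrightarrow> u t k = 0"
      by (rule galerkin_approx[OF F(1,2) c, of \<tau> b "\<lambda>t. rhs W2 (b t)" y y' Y0 B \<epsilon>])
        (use coer db cb y y' nY B \<epsilon>(1) in blast)+
    have u2: "nrm2 F (u t) \<le> ?H * (Y0 + \<epsilon>)" if t: "t \<in> {0..\<tau>}" for t
    proof -
      have "nrm F (Aop (b t) F (u t)) = nrm F (\<lambda>k. y t k - (y t k - Aop (b t) F (u t) k))" by simp
      also have "\<dots> \<le> Y0 + \<epsilon>" by (rule order_trans[OF nrm_triangle_diff add_mono[OF nY[OF t] r1[OF t]]])
      finally show ?thesis
        using elliptic_H2[OF coer[OF t] c R _ F(1,2), of "u t"] ab(2)[OF t, unfolded hbd_def] H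
        by (meson mult_left_mono order_trans less_imp_le)
    qed
    have u3: "nrm F (u' t) \<le> 3 * ?H * (Y1 + \<epsilon> + 8 * ?s * ?C4 * (?H * (Y0 + \<epsilon>)))" if t: "t \<in> {0..\<tau>}" for t
    proof -
      let ?b' = "rhs W2 (b t)"
      have h0: "hbd 0 (b t) R" by (rule hbd_mono[OF ab(2)[OF t]]) auto
      have "L2_set (\<lambda>k. cmod (Aop (b t) F (u' t) k + Aop ?b' F (u t) k) / (norm (kvec k))^2) F
        \<le> L2_set (\<lambda>k. cmod (y' t k) / (norm (kvec k))^2 + cmod (y' t k - Aop ?b' F (u t) k - Aop (b t) F (u' t) k)) F"
      proof (rule L2_set_mono)
        fix k assume k: "k \<in> F"
        hence "k \<noteq> 0" using F by auto
        hence n: "1 \<le> (norm (kvec k))^2" using norm_kvec_ge_1 by (intro one_le_power) auto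
        have "cmod (Aop (b t) F (u' t) k + Aop ?b' F (u t) k) = cmod (y' t k - (y' t k - Aop ?b' F (u t) k - Aop (b t) F (u' t) k))"
          by (simp add: algebra_simps)
        also have "\<dots> \<le> cmod (y' t k) + cmod (y' t k - Aop ?b' F (u t) k - Aop (b t) F (u' t) k)" by (rule norm_triangle_ineq4)
        finally have "cmod (Aop (b t) F (u' t) k + Aop ?b' F (u t) k) / (norm (kvec k))^2 \<le>
           cmod (y' t k) / (norm (kvec k))^2 + cmod (y' t k - Aop ?b' F (u t) k - Aop (b t) F (u' t) k) / (norm (kvec k))^2"
          by (simp add: divide_right_mono add_divide_distrib[symmetric])
        also have "cmod (y' t k - Aop ?b' F (u t) k - Aop (b t) F (u' t) k) / (norm (kvec k))^2 \<le> cmod (y' t k - Aop ?b' F (u t) k - Aop (b t) F (u' t) k) / 1"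
          by (rule divide_left_mono[OF n]) (use n in auto)
        finally show "cmod (Aop (b t) F (u' t) k + Aop ?b' F (u t) k) / (norm (kvec k))^2 \<le>
           cmod (y' t k) / (norm (kvec k))^2 + cmod (y' t k - Aop ?b' F (u t) k - Aop (b t) F (u' t) k)" by simp
      qed auto
      also have "\<dots> \<le> Y1 + \<epsilon>" by (rule order_trans[OF L2_set_triangle_ineq add_mono[OF nY1[OF t] r2[OF t]]])
      finally have 1: "L2_set (\<lambda>k. cmod (Aop (b t) F (u' t) k + Aop ?b' F (u t) k) / (norm (kvec k))^2) F \<le> Y1 + \<epsilon>" .
      have "nrm F (u' t) \<le> 3 * ?H * (L2_set (\<lambda>k. cmod (Aop (b t) F (u' t) k + Aop ?b' F (u t) k) / (norm (kvec k))^2) F + 8 * ?s * ?C4 * nrm2 F (u t))"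
        by (rule galerkin_time_derivative_bound[OF coer[OF t] c R _ F(1,2) herm[OF t] rhs_le_majorant[OF W(2) h0] majorant_nonneg[OF M] majorant_l2bd[OF M ab(2)[OF t]]])
          (use ab(2)[OF t] in \<open>simp add: hbd_def\<close>)
      also have "\<dots> \<le> 3 * ?H * (Y1 + \<epsilon> + 8 * ?s * ?C4 * (?H * (Y0 + \<epsilon>)))"
        using H s C4 by (intro mult_left_mono add_mono 1 u2 t) auto
      finally show ?thesis .
    qed
    define z where "z t k = b t k - a t k" for t k
    define z' where "z' t k = rhs W2 (b t) k - rhs W1 (a t) k" for t k
    define \<Psi>' where "\<Psi>' t = (\<Sum>k\<in>F. z t k * cnj (u' t k) + z' t k * cnj (u t k))" for t
    have dz: "((\<lambda>t. z t k) has_vector_derivative z' t k) (at t within {0..\<tau>})" if "t \<in> {0..\<tau>}" for t k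
      unfolding z_def z'_def by (intro has_vector_derivative_diff da db that)
    have "((\<lambda>t. \<Sum>k\<in>F. z t k * cnj (u t k)) has_vector_derivative \<Psi>' t) (at t within {0..\<tau>})" if t: "t \<in> {0..\<tau>}" for t
      unfolding \<Psi>'_def
      by (intro has_vector_derivative_sum has_vector_derivative_mult dz t bounded_linear.has_vector_derivative[OF bounded_linear_cnj] du)
    hence "(\<Psi>' has_integral ((\<Sum>k\<in>F. z \<tau> k * cnj (u \<tau> k)) - (\<Sum>k\<in>F. z 0 k * cnj (u 0 k)))) {0..\<tau>}"
      using \<tau> by (intro fundamental_theorem_of_calculus) auto
    \<comment> \<open>Both boundary terms of the integration by parts vanish: \<open>y\<close> and
      therefore \<open>u\<close> is zero at the final time, and the two solutions coincide at time
      0.\<close>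
    moreover have "u \<tau> k = 0" for k by (rule uz) (rule y0)
    moreover have "z 0 k = 0" for k by (simp add: z_def init)
    ultimately have \<Psi>: "(\<Psi>' has_integral 0) {0..\<tau>}" by simp
    have ccip: "continuous_on {0..\<tau>} (\<lambda>t. cip F (V t) (y t))"
      unfolding cip_def V_def by (intro continuous_intros cb0 cy)
    have icip: "((\<lambda>t. of_real (4 * pi^2) * cip F (V t) (y t)) has_integral of_real (4 * pi^2) * integral {0..\<tau>} (\<lambda>t. cip F (V t) (y t))) {0..\<tau>}"
      by (intro has_integral_mult_right integrable_integral integrable_continuous_interval ccip)
    define D where "D = ?C8 * (Y0 + Y1 + 2 * \<epsilon>)"
    have bd: "norm (\<Psi>' t + of_real (4 * pi^2) * cip F (V t) (y t)) \<le> Z t * D + \<epsilon> * Q" if t: "t \<in> {0..\<tau>}" for t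
    proof -
      have VB: "l2bd (\<lambda>l. cmod (V t l)) (M * R)"
      proof (rule l2bd_mono[OF l2bd_cmult[OF _ M]])
        show "l2bd (\<lambda>m. cmod (b t m)) R" by (rule hbd_l2[OF ab(2)[OF t]]) simp
        show "\<bar>cmod (V t k)\<bar> \<le> M * cmod (b t k)" for k
          unfolding V_def using pot_diff_term_bd[OF W] by simp
      qed simp
      have tail: "nrm G (V t) \<le> M * R * \<epsilon>" if G: "finite G" "G \<inter> F = {}" for G
      proof -
        have "nrm G (V t) \<le> L2_set (\<lambda>l. M * \<epsilon> * (japb l powr real CARD('d) * cmod (b t l))) G"
        proof (rule L2_set_mono)
          fix l assume l: "l \<in> G"
          show "cmod (V t l) \<le> M * \<epsilon> * (japb l powr real CARD('d) * cmod (b t l))"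
          proof (cases "l = 0")
            case True thus ?thesis using M \<epsilon> W by (simp add: V_def)
          next
            case False
            hence "N < norm (kvec l)" using l G by (auto simp: F_def)
            also have "\<dots> \<le> japb l powr 1" using norm_le_japb[of l] by (simp add: less_imp_le)
            also have "\<dots> \<le> japb l powr real CARD('d)" using card_d_ge_1[where 'd = 'd] by (intro powr_mono) auto
            finally have "1 \<le> \<epsilon> * japb l powr real CARD('d)" using \<epsilon> by (simp add: N_def field_simps)
            hence "M * cmod (b t l) * 1 \<le> M * cmod (b t l) * (\<epsilon> * japb l powr real CARD('d))"
              using M by (intro mult_left_mono) auto
            thus ?thesis using pot_diff_term_bd[OF W, of l "b t l"] unfolding V_def by (simp add: mult_ac)
          qed
        qed simp
        also have "\<dots> = M * \<epsilon> * L2_set (\<lambda>l. japb l powr real CARD('d) * cmod (b t l)) G"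
          using M \<epsilon> by (simp add: L2_set_right_distrib)
        also have "\<dots> \<le> M * \<epsilon> * R"
          using ab(2)[OF t] M \<epsilon> unfolding hbd_def by (intro mult_left_mono l2bdD) auto
        finally show ?thesis by (simp add: mult_ac)
      qed
      have P: "cmod ((\<Sum>k\<in>F. z' t k * cnj (u t k)) + of_real (4 * pi^2) * cip F (V t) (y t))
         \<le> ?C6 * Z t * nrm2 F (u t) + 4 * pi^2 * (M * R * \<epsilon> + M * R * \<epsilon> * (6 * ?s * R * nrm2 F (u t)))"
        unfolding z'_def
        by (rule pairing[OF W(1,2) ab(1)[OF t] ab(2)[OF t] herm[OF t] F(1,2) Z(2)[OF t] V_def VB tail r1[OF t]])
      also have "\<dots> \<le> ?C6 * Z t * (?H * (Y0 + \<epsilon>)) + 4 * pi^2 * (M * R * \<epsilon> + M * R * \<epsilon> * (6 * ?s * R * (?H * (Y0 + 1))))"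
      proof -
        have "nrm2 F (u t) \<le> ?H * (Y0 + 1)" using u2[OF t] H \<epsilon> by (smt (verit) mult_left_mono)
        thus ?thesis using C6 Z0[OF t] M R s \<epsilon> by (intro add_mono mult_left_mono u2 t) auto
      qed
      also have "\<dots> = ?C6 * Z t * (?H * (Y0 + \<epsilon>)) + \<epsilon> * Q" by (simp add: Q_def algebra_simps)
      finally have P: "cmod ((\<Sum>k\<in>F. z' t k * cnj (u t k)) + of_real (4 * pi^2) * cip F (V t) (y t)) \<le> ?C6 * Z t * (?H * (Y0 + \<epsilon>)) + \<epsilon> * Q" .
      have P2: "cmod (\<Sum>k\<in>F. z t k * cnj (u' t k)) \<le> Z t * (3 * ?H * (Y1 + \<epsilon> + 8 * ?s * ?C4 * (?H * (Y0 + \<epsilon>))))"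
      proof -
        have "cmod (\<Sum>k\<in>F. z t k * cnj (u' t k)) \<le> nrm F (z t) * nrm F (u' t)"
          using cip_bound[of F "z t" "u' t"] by (simp add: cip_def)
        also have "\<dots> \<le> Z t * (3 * ?H * (Y1 + \<epsilon> + 8 * ?s * ?C4 * (?H * (Y0 + \<epsilon>))))"
          using Z(2)[OF t] Z0[OF t] unfolding hbd_0 z_def by (intro mult_mono l2bdD u3 t) auto
        finally show ?thesis .
      qed
      have "\<Psi>' t + of_real (4 * pi^2) * cip F (V t) (y t) = (\<Sum>k\<in>F. z t k * cnj (u' t k)) + ((\<Sum>k\<in>F. z' t k * cnj (u t k)) + of_real (4 * pi^2) * cip F (V t) (y t))"
        by (simp add: \<Psi>'_def sum.distrib)
      hence "norm (\<Psi>' t + of_real (4 * pi^2) * cip F (V t) (y t)) \<le>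
         Z t * (3 * ?H * (Y1 + \<epsilon> + 8 * ?s * ?C4 * (?H * (Y0 + \<epsilon>)))) + (?C6 * Z t * (?H * (Y0 + \<epsilon>)) + \<epsilon> * Q)"
        by (metis norm_triangle_mono[OF P2 P])
      also have "\<dots> = Z t * (?C6 * ?H * (Y0 + \<epsilon>) + 3 * ?H * ((Y1 + \<epsilon>) + 8 * ?s * ?C4 * ?H * (Y0 + \<epsilon>))) + \<epsilon> * Q"
        by (simp add: algebra_simps)
      also have "\<dots> \<le> Z t * D + \<epsilon> * Q"
      proof -
        have y: "Y0 + \<epsilon> \<le> Y0 + Y1 + 2 * \<epsilon>" "Y1 + \<epsilon> \<le> Y0 + Y1 + 2 * \<epsilon>" using Y0 Y1 \<epsilon> by auto
        have "?C6 * ?H * (Y0 + \<epsilon>) + 3 * ?H * ((Y1 + \<epsilon>) + 8 * ?s * ?C4 * ?H * (Y0 + \<epsilon>))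
          \<le> ?C6 * ?H * (Y0 + Y1 + 2 * \<epsilon>) + 3 * ?H * ((Y0 + Y1 + 2 * \<epsilon>) + 8 * ?s * ?C4 * ?H * (Y0 + Y1 + 2 * \<epsilon>))"
          using C6 H s C4 by (intro add_mono mult_left_mono y) auto
        also have "\<dots> = D" by (simp add: D_def C8_def Let_def algebra_simps)
        finally show ?thesis using Z0[OF t] by (intro add_right_mono mult_left_mono)
      qed
      finally show ?thesis .
    qed
    have "norm (integral {0..\<tau>} (\<lambda>t. \<Psi>' t + of_real (4 * pi^2) * cip F (V t) (y t))) \<le> integral {0..\<tau>} (\<lambda>t. Z t * D + \<epsilon> * Q)"
    proof (rule integral_norm_bound_integral)
      show "(\<lambda>t. \<Psi>' t + of_real (4 * pi^2) * cip F (V t) (y t)) integrable_on {0..\<tau>}"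
        using has_integral_add[OF \<Psi> icip] by blast
      show "(\<lambda>t. Z t * D + \<epsilon> * Q) integrable_on {0..\<tau>}"
        by (intro integrable_continuous_interval continuous_intros Z)
    qed (rule bd)
    also have "integral {0..\<tau>} (\<lambda>t. \<Psi>' t + of_real (4 * pi^2) * cip F (V t) (y t)) = of_real (4 * pi^2) * integral {0..\<tau>} (\<lambda>t. cip F (V t) (y t))"
      using integral_unique[OF has_integral_add[OF \<Psi> icip]] by simp
    also have "(\<lambda>t. cip F (V t) (y t)) = (\<lambda>t. cip F0 (V t) (y t))"
      unfolding cip_def using F by (intro ext sum.mono_neutral_right) (auto simp: y0)
    also have "integral {0..\<tau>} (\<lambda>t. Z t * D + \<epsilon> * Q) = D * IZ + \<epsilon> * Q * \<tau>"
    proof -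
      have "integral {0..\<tau>} (\<lambda>t. Z t * D + \<epsilon> * Q) = integral {0..\<tau>} (\<lambda>t. Z t * D) + integral {0..\<tau>} (\<lambda>t. \<epsilon> * Q)"
        by (intro Henstock_Kurzweil_Integration.integral_add integrable_on_mult_left Zi integrable_const_ivl)
      thus ?thesis using \<tau> by (simp add: IZ_def)
    qed
    finally show ?thesis unfolding D_def by (simp add: norm_mult norm_power)
  qed
  \<comment> \<open>Neither \<open>C8\<close> nor \<open>Q\<close> depends on the truncation, so the
    limit \<epsilon> \<rightarrow> 0 removes the residual and the tail.\<close>
  have lim1: "((\<lambda>\<epsilon>. ?C8 * (Y0 + Y1 + 2 * \<epsilon>) * IZ + \<epsilon> * Q * \<tau>) \<longlongrightarrow> ?C8 * (Y0 + Y1 + 2 * 0) * IZ + 0 * Q * \<tau>) (at_right 0)"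
    by (intro tendsto_intros)
  have "4 * pi^2 * cmod (integral {0..\<tau>} (\<lambda>t. cip F0 (V t) (y t))) \<le> ?C8 * (Y0 + Y1 + 2 * 0) * IZ + 0 * Q * \<tau>"
  proof (rule tendsto_lowerbound[OF lim1])
    show "\<forall>\<^sub>F \<epsilon> in at_right 0. 4 * pi^2 * cmod (integral {0..\<tau>} (\<lambda>t. cip F0 (V t) (y t))) \<le> ?C8 * (Y0 + Y1 + 2 * \<epsilon>) * IZ + \<epsilon> * Q * \<tau>"
      unfolding eventually_at_right_field by (rule exI[of _ 1]) (use main in auto)
  qed simp
  moreover have "V t = (\<lambda>l. (W2 l - W1 l) * b t l)" for t by (simp add: V_def fun_eq_iff)
  ultimately show ?thesis by (simp add: IZ_def)
qed

section \<open>Extrapolation to the initial time\<close>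

text \<open>The nonlinearity for a potential supported in the finite set \<open>L\<close>. Being a
  finite sum of products it can be differentiated in time term by term and repeatedly, which the
  extrapolation requires.\<close>

definition NW :: "(int^'d) set \<Rightarrow> (int^'d \<Rightarrow> complex) \<Rightarrow> (int^'d \<Rightarrow> complex) \<Rightarrow> (int^'d \<Rightarrow> complex) \<Rightarrow> int^'d \<Rightarrow> complex" where
  "NW L W p q k = (\<Sum>l\<in>L. of_real (kvec k \<bullet> kvec l) * p (k - l) * (W l * q l))"

lemma Bl_eq_NW:
  assumes "finite L" "\<And>l. l \<notin> L \<Longrightarrow> W l = 0"
  shows "Bl p (\<lambda>l. W l * q l) k = NW L W p q k"
  unfolding Bl_def NW_def
  by (subst infsum_finite[OF assms(1), symmetric], rule infsum_cong_neutral) (use assms(2) in auto)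

lemma NW_has_vector_derivative:
  assumes "\<And>m. ((\<lambda>t. p t m) has_vector_derivative p' m) (at t within S)"
    and "\<And>m. ((\<lambda>t. q t m) has_vector_derivative q' m) (at t within S)"
  shows "((\<lambda>t. NW L W (p t) (q t) k) has_vector_derivative (NW L W p' (q t) k + NW L W (p t) q' k)) (at t within S)"
proof -
  have "((\<lambda>t. \<Sum>l\<in>L. of_real (kvec k \<bullet> kvec l) * W l * (p t (k - l) * q t l)) has_vector_derivative
     (\<Sum>l\<in>L. of_real (kvec k \<bullet> kvec l) * W l * (p t (k - l) * q' l + p' (k - l) * q t l))) (at t within S)"
    by (intro has_vector_derivative_sum has_vector_derivative_mult_right has_vector_derivative_mult assms)
  thus ?thesis by (simp add: NW_def sum.distrib algebra_simps)
qed

lemma NW_bound: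
  assumes "potbd W M"
  shows "4 * pi^2 * cmod (NW L W p q k) \<le> 2 * pi * norm (kvec k) * M * (\<Sum>l\<in>L. cmod (p (k - l)) * cmod (q l))"
proof -
  have "4 * pi^2 * cmod (NW L W p q k) \<le> 4 * pi^2 * (\<Sum>l\<in>L. norm (kvec k) * (M / (2 * pi)) * (cmod (p (k - l)) * cmod (q l)))"
    unfolding NW_def by (intro mult_left_mono sum_norm_le potbd_term[OF assms]) auto
  also have "\<dots> = 2 * pi * norm (kvec k) * M * (\<Sum>l\<in>L. cmod (p (k - l)) * cmod (q l))"
    unfolding sum_distrib_left by (intro sum.cong refl) (simp add: power2_eq_square field_simps)
  finally show ?thesis .
qed

section \<open>Time derivatives of the coefficients on frequency balls\<close>

abbreviation kball :: "real \<Rightarrow> (int^'d) set" where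
  "kball r \<equiv> {k. norm (kvec k) \<le> r}"

lemma kball_diff: "k \<in> kball r \<Longrightarrow> l \<in> kball s \<Longrightarrow> k - l \<in> kball (r + s)"
  using norm_kvec_diff_le[of k l] by auto

lemma L2_set_mono_set: "finite B \<Longrightarrow> A \<subseteq> B \<Longrightarrow> L2_set f A \<le> L2_set f B"
  unfolding L2_set_def by (intro real_sqrt_le_mono sum_mono2) auto

lemma L2_set_dualI:
  assumes "0 \<le> C" "\<And>r. (\<Sum>k\<in>F. g k * \<bar>r k\<bar>) \<le> C * L2_set r F" "\<And>k. 0 \<le> g k"
  shows "L2_set g F \<le> C"
proof -
  have "L2_set g F * L2_set g F = (\<Sum>k\<in>F. g k * \<bar>g k\<bar>)"
    using assms(3) by (simp add: L2_set_def sum_nonneg power2_eq_square)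
  also have "\<dots> \<le> C * L2_set g F" by (rule assms(2))
  finally show ?thesis using assms(1)
    by (cases "L2_set g F = 0") (auto intro!: mult_right_le_imp_le[of _ "L2_set g F"] simp: order_less_le)
qed

text \<open>For k in the ball of radius r and l in the ball of radius K only frequencies of
  \<open>p\<close> up to r + K occur, so a local l2 bound is enough. This matters because
  \<open>p\<close> will be a time derivative, for which H^d regularity of the solution gives no
  global l2 bound in low dimension.\<close>

lemma conv_l2_local:
  fixes p q :: "int^'d \<Rightarrow> complex"
  assumes K: "0 \<le> K" and p: "nrm (kball (r + K)) p \<le> P" and q: "hbd (real CARD('d)) q Q" and L: "L \<subseteq> kball K" and r: "0 \<le> r"
  shows "L2_set (\<lambda>k. \<Sum>l\<in>L. cmod (p (k - l)) * cmod (q l)) (kball r) \<le> 2 * sigJ TYPE('d) * P * Q"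
    and "L2_set (\<lambda>k. \<Sum>l\<in>L. cmod (q (k - l)) * cmod (p l)) (kball r) \<le> 2 * sigJ TYPE('d) * P * Q"
proof -
  have s: "0 \<le> sigJ TYPE('d)" using sigJ_ge_1[where 'd = 'd] by linarith
  have P: "0 \<le> P" using order_trans[OF L2_set_nonneg p] .
  have Q: "0 \<le> Q" by (rule hbd_nonneg[OF q])
  have fin: "finite L" by (rule finite_subset[OF L finite_kvec_ball])
  let ?p = "\<lambda>m. if m \<in> kball (r + K) then cmod (p m) else 0"
  have lp: "l2bd ?p P" unfolding l2bd_def
  proof (intro allI impI)
    fix F :: "(int^'d) set" assume F: "finite F"
    have "L2_set ?p F = L2_set (\<lambda>m. cmod (p m)) (F \<inter> kball (r + K))"
    proof -
      have "(\<Sum>i\<in>F. (?p i)^2) = (\<Sum>i\<in>F \<inter> kball (r + K). (cmod (p i))^2)"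
        by (rule sum.mono_neutral_cong_right) (use F in auto)
      thus ?thesis by (simp add: L2_set_def)
    qed
    also have "\<dots> \<le> nrm (kball (r + K)) p" by (intro L2_set_mono_set finite_kvec_ball) auto
    finally show "L2_set ?p F \<le> P" using p by linarith
  qed
  show "L2_set (\<lambda>k. \<Sum>l\<in>L. cmod (p (k - l)) * cmod (q l)) (kball r) \<le> 2 * sigJ TYPE('d) * P * Q"
  proof (rule L2_set_dualI)
    fix w :: "int^'d \<Rightarrow> real"
    have "(\<Sum>k\<in>kball r. (\<Sum>l\<in>L. cmod (p (k - l)) * cmod (q l)) * \<bar>w k\<bar>)
       = (\<Sum>k\<in>kball r. \<Sum>l\<in>L. ?p (k - l) * \<bar>cmod (q l)\<bar> * \<bar>w k\<bar>)"
      unfolding sum_distrib_right by (intro sum.cong refl) (use L kball_diff in fastforce)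
    also have "\<dots> \<le> 2 * sigJ TYPE('d) * P * L2_set (\<lambda>l. japb l powr real CARD('d) * cmod (q l)) L * L2_set w (kball r)"
      by (rule bilinear_estimate[where ?s1.0 = 0, OF finite_kvec_ball fin]) (use lp in \<open>auto simp: japb_neq_0\<close>)
    also have "\<dots> \<le> 2 * sigJ TYPE('d) * P * Q * L2_set w (kball r)"
      using q s P unfolding hbd_def by (intro mult_right_mono mult_left_mono l2bdD) auto
    finally show "(\<Sum>k\<in>kball r. (\<Sum>l\<in>L. cmod (p (k - l)) * cmod (q l)) * \<bar>w k\<bar>) \<le> 2 * sigJ TYPE('d) * P * Q * L2_set w (kball r)" .
  qed (use s P Q in \<open>auto intro: sum_nonneg\<close>)
  show "L2_set (\<lambda>k. \<Sum>l\<in>L. cmod (q (k - l)) * cmod (p l)) (kball r) \<le> 2 * sigJ TYPE('d) * P * Q"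
  proof (rule L2_set_dualI)
    fix w :: "int^'d \<Rightarrow> real"
    have "(\<Sum>k\<in>kball r. (\<Sum>l\<in>L. cmod (q (k - l)) * cmod (p l)) * \<bar>w k\<bar>)
       = (\<Sum>k\<in>kball r. \<Sum>l\<in>L. cmod (q (k - l)) * \<bar>cmod (p l)\<bar> * \<bar>w k\<bar>)"
      unfolding sum_distrib_right by simp
    also have "\<dots> \<le> 2 * sigJ TYPE('d) * Q * L2_set (\<lambda>l. japb l powr 0 * cmod (p l)) L * L2_set w (kball r)"
      by (rule bilinear_estimate[where ?s1.0 = "real CARD('d)", OF finite_kvec_ball fin]) (use q in \<open>auto simp: hbd_def\<close>)
    also have "\<dots> = 2 * sigJ TYPE('d) * Q * nrm L p * L2_set w (kball r)" by (simp add: japb_neq_0)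
    also have "\<dots> \<le> 2 * sigJ TYPE('d) * Q * P * L2_set w (kball r)"
    proof (intro mult_right_mono mult_left_mono)
      have "nrm L p \<le> nrm (kball (r + K)) p" using L r by (intro L2_set_mono_set finite_kvec_ball) auto
      thus "nrm L p \<le> P" using p by linarith
    qed (use s Q in auto)
    finally show "(\<Sum>k\<in>kball r. (\<Sum>l\<in>L. cmod (q (k - l)) * cmod (p l)) * \<bar>w k\<bar>) \<le> 2 * sigJ TYPE('d) * P * Q * L2_set w (kball r)"
      by (simp add: mult_ac)
  qed (use s P Q in \<open>auto intro: sum_nonneg\<close>)
qed

lemma conv_pointwise:
  fixes p q :: "int^'d \<Rightarrow> complex"
  assumes p: "nrm (kball r) p \<le> P" and q: "nrm L q \<le> Q" and L: "finite L" "\<And>l. l \<in> L \<Longrightarrow> k - l \<in> kball r"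
  shows "(\<Sum>l\<in>L. cmod (p (k - l)) * cmod (q l)) \<le> P * Q"
proof -
  have "(\<Sum>l\<in>L. cmod (p (k - l)) * cmod (q l)) \<le> L2_set (\<lambda>l. cmod (p (k - l))) L * nrm L q"
    using L2_set_mult_ineq[of "\<lambda>l. cmod (p (k - l))" "\<lambda>l. cmod (q l)" L] by simp
  also have "\<dots> \<le> P * Q"
  proof (intro mult_mono q)
    have "L2_set (\<lambda>l. cmod (p (k - l))) L = nrm ((\<lambda>l. k - l) ` L) p"
      unfolding L2_set_def by (subst sum.reindex) (auto simp: inj_on_def)
    also have "\<dots> \<le> nrm (kball r) p" using L by (intro L2_set_mono_set finite_kvec_ball) auto
    finally show "L2_set (\<lambda>l. cmod (p (k - l))) L \<le> P" using p by linarith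
    show "0 \<le> P" using order_trans[OF L2_set_nonneg p] .
  qed auto
  finally show ?thesis .
qed

text \<open>Constants of the successive time derivatives: K * \<open>G1\<close> bounds
  \<open>rhs\<close> on radius 3 K, K^2 * \<open>G2\<close> the derivative of the nonlinearity on
  radius 2 K, and K^4 * \<open>G3\<close> the third derivative on radius K once the heat decay is
  removed. The radius shrinks by K per derivative because a convolution with the potential sees
  frequencies larger by K.\<close>

definition G1 :: "'d::finite itself \<Rightarrow> real \<Rightarrow> real \<Rightarrow> real" where
  "G1 D M R = 12 * pi^2 * R + 2 * pi * (M * (calg D * R * R))"
definition G2 :: "'d::finite itself \<Rightarrow> real \<Rightarrow> real \<Rightarrow> real" where
  "G2 D M R = 16 * pi * M * sigJ D * G1 D M R * R"
definition G3 :: "'d::finite itself \<Rightarrow> real \<Rightarrow> real \<Rightarrow> real" where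
  "G3 D M R = 16 * pi^4 * (2 * pi * (M * (calg D * R * R))) + 8 * pi^2 * G2 D M R
     + 2 * pi * M * (2 * (16 * pi^2 * G1 D M R + G2 D M R) * R + 2 * (G1 D M R)^2)"

text \<open>Along the flow of \<open>rhs W\<close>: the first derivative of the nonlinearity, the second derivative of
  the coefficients and the second derivative of the nonlinearity.\<close>

definition nonlin_dt :: "(int^'d) set \<Rightarrow> (int^'d \<Rightarrow> complex) \<Rightarrow> (int^'d \<Rightarrow> complex) \<Rightarrow> int^'d \<Rightarrow> complex" where
  "nonlin_dt L W b k = - of_real (4 * pi^2) * (NW L W (rhs W b) b k + NW L W b (rhs W b) k)"
definition rhs_dt :: "(int^'d) set \<Rightarrow> (int^'d \<Rightarrow> complex) \<Rightarrow> (int^'d \<Rightarrow> complex) \<Rightarrow> int^'d \<Rightarrow> complex" where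
  "rhs_dt L W b k = - of_real (lam k) * rhs W b k + nonlin_dt L W b k"
definition nonlin_dt2 :: "(int^'d) set \<Rightarrow> (int^'d \<Rightarrow> complex) \<Rightarrow> (int^'d \<Rightarrow> complex) \<Rightarrow> int^'d \<Rightarrow> complex" where
  "nonlin_dt2 L W b k = - of_real (4 * pi^2) * (NW L W (rhs_dt L W b) b k + 2 * NW L W (rhs W b) (rhs W b) k + NW L W b (rhs_dt L W b) k)"

context
  fixes W b :: "int^'d \<Rightarrow> complex" and M R K :: real and L :: "(int^'d) set"
  assumes W: "potbd W M" and b: "hbd (real CARD('d)) b R" and K: "1 \<le> K" and L: "L \<subseteq> kball K" "\<And>l. l \<notin> L \<Longrightarrow> W l = 0"
begin

private lemma fin: "finite L" by (rule finite_subset[OF L(1) finite_kvec_ball])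

private lemma param_bounds: "0 \<le> M" "0 \<le> R" "0 \<le> sigJ TYPE('d)" "0 < calg TYPE('d)" "hbd 0 b R"
  using potbd_nonneg[OF W] hbd_nonneg[OF b] sigJ_ge_1[where 'd = 'd] calg_pos[where 'd = 'd] hbd_mono[OF b, of 0 R] by auto

private lemma G_nonneg: "0 \<le> G1 TYPE('d) M R" "0 \<le> G2 TYPE('d) M R"
proof -
  show "0 \<le> G1 TYPE('d) M R" using param_bounds by (simp add: G1_def)
  thus "0 \<le> G2 TYPE('d) M R" using param_bounds by (simp add: G2_def)
qed

private lemma nonlin_bound: "4 * pi^2 * cmod (NW L W b b k) \<le> norm (kvec k) * (2 * pi * (M * cv b b k))"
  using Bl_bound[OF W param_bounds(5) param_bounds(5), of k] Bl_eq_NW[OF fin L(2), where p = b and q = b] by (simp add: mult_ac)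

private lemma weighted_cv_l2bd: "l2bd (\<lambda>k. norm (kvec k) * (2 * pi * (M * cv b b k))) (2 * pi * (M * (calg TYPE('d) * R * R)))"
proof -
  have "l2bd (\<lambda>k. (2 * pi * M) * (japb k powr real CARD('d) * cv b b k)) ((2 * pi * M) * (calg TYPE('d) * R * R))"
    by (intro l2bd_cmult cv_algebra b) (use param_bounds in auto)
  thus ?thesis
  proof (rule l2bd_mono)
    fix k :: "int^'d"
    have "norm (kvec k) \<le> japb k powr 1" using norm_le_japb[of k] by (simp add: less_imp_le)
    also have "\<dots> \<le> japb k powr real CARD('d)" using card_d_ge_1[where 'd = 'd] by (intro powr_mono) auto
    finally have "norm (kvec k) * (2 * pi * (M * cv b b k)) \<le> japb k powr real CARD('d) * (2 * pi * (M * cv b b k))"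
      using param_bounds by (intro mult_right_mono) (auto simp: cv_nonneg)
    thus "\<bar>norm (kvec k) * (2 * pi * (M * cv b b k))\<bar> \<le> (2 * pi * M) * (japb k powr real CARD('d) * cv b b k)"
      using param_bounds by (simp add: cv_nonneg abs_mult mult_ac)
  qed simp
qed

private lemma nonlin_pointwise: "4 * pi^2 * cmod (NW L W b b k) \<le> 2 * pi * (M * (calg TYPE('d) * R * R))"
  using nonlin_bound[of k] l2bd_member[OF weighted_cv_l2bd, of k] by linarith

text \<open>Of the two derivatives in the diffusion one is bounded by 3 K and the other one is
  absorbed by the regularity of \<open>b\<close>, since d \<ge> 1; so the cost is K and not
  K^2.\<close>

private lemma rhs_l2_bound: "nrm (kball (3 * K)) (rhs W b) \<le> K * G1 TYPE('d) M R"
proof -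
  have "nrm (kball (3 * K)) (rhs W b) \<le> L2_set (\<lambda>k. 12 * pi^2 * K * (norm (kvec k) * cmod (b k)) + norm (kvec k) * (2 * pi * (M * cv b b k))) (kball (3 * K))"
  proof (rule L2_set_mono)
    fix k :: "int^'d" assume k: "k \<in> kball (3 * K)"
    have "cmod (rhs W b k) \<le> norm (kvec k) * (4 * pi^2 * (norm (kvec k) * cmod (b k)) + 2 * pi * (M * cv b b k))"
      by (rule rhs_bound[OF W param_bounds(5)])
    also have "\<dots> = norm (kvec k) * (4 * pi^2 * (norm (kvec k) * cmod (b k))) + norm (kvec k) * (2 * pi * (M * cv b b k))"
      by (rule distrib_left)
    also have "norm (kvec k) * (4 * pi^2 * (norm (kvec k) * cmod (b k))) \<le> 3 * K * (4 * pi^2 * (norm (kvec k) * cmod (b k)))"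
      using k by (intro mult_right_mono) auto
    finally show "cmod (rhs W b k) \<le> 12 * pi^2 * K * (norm (kvec k) * cmod (b k)) + norm (kvec k) * (2 * pi * (M * cv b b k))"
      by (simp add: mult_ac)
  qed auto
  also have "\<dots> \<le> L2_set (\<lambda>k. 12 * pi^2 * K * (norm (kvec k) * cmod (b k))) (kball (3 * K)) + 2 * pi * (M * (calg TYPE('d) * R * R))"
    by (rule order_trans[OF L2_set_triangle_ineq]) (intro add_left_mono l2bdD[OF weighted_cv_l2bd])
  also have "L2_set (\<lambda>k. 12 * pi^2 * K * (norm (kvec k) * cmod (b k))) (kball (3 * K)) = 12 * pi^2 * K * L2_set (\<lambda>k. norm (kvec k) * cmod (b k)) (kball (3 * K))"
    using K by (simp add: L2_set_right_distrib)
  also have "\<dots> \<le> 12 * pi^2 * K * R"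
  proof (intro mult_left_mono)
    have "l2bd (\<lambda>k. norm (kvec k) * cmod (b k)) R"
    proof (rule l2bd_mono[OF l2bd_gradient[OF b[unfolded hbd_def]]])
      show "\<bar>norm (kvec k) * cmod (b k)\<bar> \<le> japb k powr (real CARD('d) - 1) * (norm (kvec k) * cmod (b k))" for k
        using mult_right_mono[of 1 "japb k powr (real CARD('d) - 1)", OF ge_one_powr_ge_zero[OF japb_ge_1], of "norm (kvec k) * cmod (b k)"]
          card_d_ge_1[where 'd = 'd] by simp
    qed simp
    thus "L2_set (\<lambda>k. norm (kvec k) * cmod (b k)) (kball (3 * K)) \<le> R" by (rule l2bdD)
  qed (use K in auto)
  also have "12 * pi^2 * K * R + 2 * pi * (M * (calg TYPE('d) * R * R)) \<le> 12 * pi^2 * K * R + K * (2 * pi * (M * (calg TYPE('d) * R * R)))"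
    using mult_right_mono[OF K, of "2 * pi * (M * (calg TYPE('d) * R * R))"] param_bounds by simp
  finally show ?thesis by (simp add: G1_def algebra_simps)
qed

text \<open>One factor K is the outer divergence on the ball of radius 2 K, the other one is the
  bound for \<open>rhs\<close>, which is needed at the frequencies k - l up to 3 K.\<close>

private lemma nonlin_dt_bound: "nrm (kball (2 * K)) (nonlin_dt L W b) \<le> K^2 * G2 TYPE('d) M R"
proof -
  let ?s = "\<lambda>k. (\<Sum>l\<in>L. cmod ((rhs W b) (k - l)) * cmod (b l))" and ?t = "\<lambda>k. (\<Sum>l\<in>L. cmod (b (k - l)) * cmod ((rhs W b) l))"
  have g: "nrm (kball (2 * K + K)) (rhs W b) \<le> K * G1 TYPE('d) M R" using rhs_l2_bound by simp
  have "nrm (kball (2 * K)) (nonlin_dt L W b) \<le> L2_set (\<lambda>k. 4 * pi * K * M * (?s k + ?t k)) (kball (2 * K))"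
  proof (rule L2_set_mono)
    fix k :: "int^'d" assume k: "k \<in> kball (2 * K)"
    have "cmod ((nonlin_dt L W b) k) \<le> 4 * pi^2 * cmod (NW L W (rhs W b) b k) + 4 * pi^2 * cmod (NW L W b (rhs W b) k)"
      unfolding nonlin_dt_def using norm_triangle_ineq[of "NW L W (rhs W b) b k" "NW L W b (rhs W b) k"] 
      by (simp add: norm_mult norm_power distrib_left[symmetric] del: distrib_left_numeral)
    also have "\<dots> \<le> 2 * pi * norm (kvec k) * M * ?s k + 2 * pi * norm (kvec k) * M * ?t k"
      by (intro add_mono NW_bound[OF W])
    also have "\<dots> = 2 * pi * norm (kvec k) * M * (?s k + ?t k)" by (simp only: distrib_left)
    also have "\<dots> \<le> 2 * pi * (2 * K) * M * (?s k + ?t k)"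
      using k param_bounds by (intro mult_right_mono mult_left_mono add_nonneg_nonneg sum_nonneg) auto
    finally show "cmod ((nonlin_dt L W b) k) \<le> 4 * pi * K * M * (?s k + ?t k)" by (simp add: mult_ac)
  qed auto
  also have "\<dots> = 4 * pi * K * M * L2_set (\<lambda>k. ?s k + ?t k) (kball (2 * K))"
    using K param_bounds by (simp add: L2_set_right_distrib)
  also have "\<dots> \<le> 4 * pi * K * M * (2 * sigJ TYPE('d) * (K * G1 TYPE('d) M R) * R + 2 * sigJ TYPE('d) * (K * G1 TYPE('d) M R) * R)"
    using K param_bounds
    by (intro mult_left_mono order_trans[OF L2_set_triangle_ineq add_mono[OF conv_l2_local(1)[OF _ g b L(1)] conv_l2_local(2)[OF _ g b L(1)]]]) auto
  also have "\<dots> = K^2 * G2 TYPE('d) M R" by (simp add: G2_def power2_eq_square)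
  finally show ?thesis .
qed

private lemma rhs_dt_bound: "nrm (kball (2 * K)) (rhs_dt L W b) \<le> K^3 * (16 * pi^2 * G1 TYPE('d) M R + G2 TYPE('d) M R)"
proof -
  have "nrm (kball (2 * K)) (rhs_dt L W b) \<le> nrm (kball (2 * K)) (\<lambda>k. - of_real (lam k) * (rhs W b) k) + nrm (kball (2 * K)) (nonlin_dt L W b)"
    unfolding rhs_dt_def by (rule nrm_triangle)
  also have "nrm (kball (2 * K)) (\<lambda>k. - of_real (lam k) * (rhs W b) k) \<le> L2_set (\<lambda>k. 16 * pi^2 * K^2 * cmod ((rhs W b) k)) (kball (2 * K))"
  proof (rule L2_set_mono)
    fix k :: "int^'d" assume k: "k \<in> kball (2 * K)"
    have "(norm (kvec k))^2 \<le> (2 * K)^2" using k by (intro power_mono) auto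
    hence "lam k \<le> 16 * pi^2 * K^2" unfolding lam_def by (simp add: power_mult_distrib)
    hence "lam k * cmod ((rhs W b) k) \<le> 16 * pi^2 * K^2 * cmod ((rhs W b) k)" by (intro mult_right_mono) auto
    moreover have "0 \<le> lam k" by (simp add: lam_def)
    ultimately show "cmod (- of_real (lam k) * (rhs W b) k) \<le> 16 * pi^2 * K^2 * cmod ((rhs W b) k)" by (simp add: norm_mult)
  qed auto
  also have "\<dots> = 16 * pi^2 * K^2 * nrm (kball (2 * K)) (rhs W b)" using K by (simp add: L2_set_right_distrib)
  also have "\<dots> \<le> 16 * pi^2 * K^2 * (K * G1 TYPE('d) M R)"
  proof (intro mult_left_mono)
    have "nrm (kball (2 * K)) (rhs W b) \<le> nrm (kball (3 * K)) (rhs W b)" using K by (intro L2_set_mono_set finite_kvec_ball) auto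
    thus "nrm (kball (2 * K)) (rhs W b) \<le> K * G1 TYPE('d) M R" using rhs_l2_bound by simp
  qed auto
  also have "nrm (kball (2 * K)) (nonlin_dt L W b) \<le> K^3 * G2 TYPE('d) M R"
    using order_trans[OF nonlin_dt_bound mult_right_mono[OF power_increasing[of 2 3 K] G_nonneg(2)]] K by simp
  finally show ?thesis by (simp add: algebra_simps power2_eq_square power3_eq_cube)
qed

text \<open>The outer divergence costs K and the second derivative of the coefficients K^3; the
  product of two derivatives \<open>rhs\<close> costs only K^2 and is estimated by the larger
  power.\<close>

private lemma nonlin_dt2_pointwise:
  assumes k: "k \<in> kball K"
  shows "cmod ((nonlin_dt2 L W b) k) \<le> K^4 * (2 * pi * M * (2 * (16 * pi^2 * G1 TYPE('d) M R + G2 TYPE('d) M R) * R + 2 * (G1 TYPE('d) M R)^2))"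
proof -
  let ?G = "16 * pi^2 * G1 TYPE('d) M R + G2 TYPE('d) M R" and ?G1 = "G1 TYPE('d) M R"
  have G: "0 \<le> ?G" using G_nonneg by simp
  have kl: "k - l \<in> kball (2 * K)" if "l \<in> L" for l
    using kball_diff[OF k, of l K] that L(1) by auto
  have L2: "L \<subseteq> kball (2 * K)" using L(1) K by auto
  have b0: "nrm F b \<le> R" for F using param_bounds(5) unfolding hbd_0 by (rule l2bdD)
  have g1: "nrm (kball (2 * K)) (rhs W b) \<le> K * ?G1"
  proof -
    have "nrm (kball (2 * K)) (rhs W b) \<le> nrm (kball (3 * K)) (rhs W b)" using K by (intro L2_set_mono_set finite_kvec_ball) auto
    thus ?thesis using rhs_l2_bound by simp
  qed
  have sub: "nrm L f \<le> nrm (kball (2 * K)) f" for f :: "int^'d \<Rightarrow> complex" by (intro L2_set_mono_set finite_kvec_ball L2)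
  have "cmod ((nonlin_dt2 L W b) k) \<le> 4 * pi^2 * cmod (NW L W (rhs_dt L W b) b k) + 2 * (4 * pi^2 * cmod (NW L W (rhs W b) (rhs W b) k)) + 4 * pi^2 * cmod (NW L W b (rhs_dt L W b) k)"
  proof -
    have "cmod ((nonlin_dt2 L W b) k) = 4 * pi^2 * cmod (NW L W (rhs_dt L W b) b k + 2 * NW L W (rhs W b) (rhs W b) k + NW L W b (rhs_dt L W b) k)"
      by (simp add: nonlin_dt2_def norm_mult norm_power)
    also have "\<dots> \<le> 4 * pi^2 * (cmod (NW L W (rhs_dt L W b) b k) + 2 * cmod (NW L W (rhs W b) (rhs W b) k) + cmod (NW L W b (rhs_dt L W b) k))"
      by (intro mult_left_mono order_trans[OF norm_triangle_ineq] add_mono) (auto simp: norm_mult intro: order_trans[OF norm_triangle_ineq])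
    finally show ?thesis by (simp only: distrib_left mult_ac)
  qed
  also have "\<dots> \<le> 2 * pi * norm (kvec k) * M * (K^3 * ?G * R) + 2 * (2 * pi * norm (kvec k) * M * ((K * ?G1) * (K * ?G1))) + 2 * pi * norm (kvec k) * M * (R * (K^3 * ?G))"
    using param_bounds
    by (intro add_mono mult_left_mono order_trans[OF NW_bound[OF W]] conv_pointwise[OF rhs_dt_bound b0 fin kl]
        conv_pointwise[OF g1 order_trans[OF sub g1] fin kl] conv_pointwise[OF b0 order_trans[OF sub rhs_dt_bound] fin kl]) auto
  also have "\<dots> = norm (kvec k) * (2 * pi * M * (2 * K^3 * ?G * R + 2 * K^2 * ?G1^2))"
    by (simp add: algebra_simps power2_eq_square)
  also have "\<dots> \<le> K * (2 * pi * M * (2 * K^3 * ?G * R + 2 * K^3 * ?G1^2))"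
  proof (intro mult_mono mult_left_mono add_mono mult_right_mono)
    show "K^2 \<le> K^3" using K by (intro power_increasing) auto
  qed (use k param_bounds K G G_nonneg in auto)
  also have "\<dots> = K^4 * (2 * pi * M * (2 * ?G * R + 2 * ?G1^2))"
    by (simp add: algebra_simps eval_nat_numeral)
  finally show ?thesis .
qed

private lemma nonlin_dt_pointwise: "k \<in> kball K \<Longrightarrow> cmod ((nonlin_dt L W b) k) \<le> K^2 * G2 TYPE('d) M R"
  using member_le_L2_set[OF finite_kvec_ball, of k "2 * K" "\<lambda>k. cmod ((nonlin_dt L W b) k)"] nonlin_dt_bound K by fastforce

text \<open>For the nonlinearity n the third derivative of exp (\<lambda> t) b_k is exp (\<lambda>
  t) (\<lambda>^2 n + 2 \<lambda> n' + n''). With \<lambda> of order K^2 and n, n', n'' of order 1,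
  K^2, K^4 all three terms have order K^4.\<close>

lemma third_derivative_bound:
  assumes k: "k \<in> kball K"
  shows "cmod (of_real ((lam k)^2) * (- of_real (4 * pi^2) * NW L W b b k) + of_real (2 * lam k) * (nonlin_dt L W b) k + (nonlin_dt2 L W b) k) \<le> K^4 * G3 TYPE('d) M R"
proof -
  have l0: "0 \<le> lam k" by (simp add: lam_def)
  have "(norm (kvec k))^2 \<le> K^2" using k by (intro power_mono) auto
  hence lK: "lam k \<le> 4 * pi^2 * K^2" unfolding lam_def by simp
  have "cmod (of_real ((lam k)^2) * (- of_real (4 * pi^2) * NW L W b b k) + of_real (2 * lam k) * (nonlin_dt L W b) k + (nonlin_dt2 L W b) k)
     \<le> (lam k)^2 * (4 * pi^2 * cmod (NW L W b b k)) + 2 * lam k * cmod ((nonlin_dt L W b) k) + cmod ((nonlin_dt2 L W b) k)"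
    by (intro order_trans[OF norm_triangle_ineq] add_mono order_refl) (use l0 in \<open>auto simp: norm_mult norm_power\<close>)
  also have "\<dots> \<le> (4 * pi^2 * K^2)^2 * (2 * pi * (M * (calg TYPE('d) * R * R))) + 2 * (4 * pi^2 * K^2) * (K^2 * G2 TYPE('d) M R)
      + K^4 * (2 * pi * M * (2 * (16 * pi^2 * G1 TYPE('d) M R + G2 TYPE('d) M R) * R + 2 * (G1 TYPE('d) M R)^2))"
    by (intro add_mono mult_mono power_mono nonlin_pointwise nonlin_dt_pointwise nonlin_dt2_pointwise lK l0 k) (use l0 in auto)
  also have "\<dots> = K^4 * G3 TYPE('d) M R"
  proof -
    have "(4 * pi^2 * K^2)^2 = K^4 * (16 * pi^4)" "K^2 * K^2 = K^4" by (simp_all add: power_mult_distrib flip: power_mult power_add)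
    thus ?thesis unfolding G3_def by (simp add: algebra_simps)
  qed
  finally show ?thesis .
qed

end

text \<open>A cubic weight on \<open>[0, \<tau>]\<close> that vanishes at \<open>\<tau>\<close> and has moments \<open>1, 0, 0\<close>: it extrapolates
  a function to time \<open>0\<close> up to an error of order \<open>\<tau>\<^sup>3\<close>.\<close>

definition chi :: "real \<Rightarrow> real \<Rightarrow> real" where
  "chi \<tau> t = (12 - 72 * (t / \<tau>) + 120 * (t / \<tau>)^2 - 60 * (t / \<tau>)^3) / \<tau>"

definition chi' :: "real \<Rightarrow> real \<Rightarrow> real" where
  "chi' \<tau> t = (- 72 + 240 * (t / \<tau>) - 180 * (t / \<tau>)^2) / \<tau>^2"

lemma chi_deriv: "0 < \<tau> \<Longrightarrow> (chi \<tau> has_real_derivative chi' \<tau> t) (at t within S)"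
  unfolding chi_def[abs_def] chi'_def
  by (auto intro!: derivative_eq_intros simp: field_simps power2_eq_square eval_nat_numeral)

lemma chi_end: "0 < \<tau> \<Longrightarrow> chi \<tau> \<tau> = 0" by (simp add: chi_def)

text \<open>The numbers are sums of absolute values of coefficients: 264 = 12 + 72 + 120 + 60 and
  492 = 72 + 240 + 180.\<close>

lemma chi_bound:
  assumes "0 < \<tau>" "t \<in> {0..\<tau>}"
  shows "\<bar>chi \<tau> t\<bar> \<le> 264 / \<tau>" "\<bar>chi' \<tau> t\<bar> \<le> 492 / \<tau>^2"
proof -
  define s where "s = t / \<tau>"
  have s: "0 \<le> s" "s \<le> 1" using assms by (auto simp: s_def)
  have s2: "0 \<le> s^2" "s^2 \<le> 1" "0 \<le> s^3" "s^3 \<le> 1" using s by (auto intro: power_le_one)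
  have "\<bar>12 - 72 * s + 120 * s^2 - 60 * s^3\<bar> \<le> 264" using s s2 by linarith
  thus "\<bar>chi \<tau> t\<bar> \<le> 264 / \<tau>" using assms by (simp add: chi_def s_def[symmetric] divide_right_mono)
  have "\<bar>- 72 + 240 * s - 180 * s^2\<bar> \<le> 492" using s s2 by linarith
  thus "\<bar>chi' \<tau> t\<bar> \<le> 492 / \<tau>^2" using assms by (simp add: chi'_def s_def[symmetric] divide_right_mono)
qed

lemma chi_moments:
  assumes \<tau>: "0 < \<tau>"
  shows "(chi \<tau> has_integral 1) {0..\<tau>}" "((\<lambda>t. chi \<tau> t * t) has_integral 0) {0..\<tau>}"
    "((\<lambda>t. chi \<tau> t * t^2) has_integral 0) {0..\<tau>}"
proof -
  have ftc: "(f has_integral (P \<tau> - P 0)) {0..\<tau>}" if "\<And>t. (P has_real_derivative f t) (at t within {0..\<tau>})" for f P :: "real \<Rightarrow> real"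
    using \<tau> that by (intro fundamental_theorem_of_calculus) (auto simp: has_real_derivative_iff_has_vector_derivative[symmetric])
  have "(chi \<tau> has_integral ((\<lambda>t. 12 * (t/\<tau>) - 36 * (t/\<tau>)^2 + 40 * (t/\<tau>)^3 - 15 * (t/\<tau>)^4) \<tau> - (\<lambda>t. 12 * (t/\<tau>) - 36 * (t/\<tau>)^2 + 40 * (t/\<tau>)^3 - 15 * (t/\<tau>)^4) 0)) {0..\<tau>}"
    by (rule ftc, unfold chi_def) (use \<tau> in \<open>auto intro!: derivative_eq_intros simp: field_simps eval_nat_numeral\<close>)
  thus "(chi \<tau> has_integral 1) {0..\<tau>}" using \<tau> by simp
  have "((\<lambda>t. chi \<tau> t * t) has_integral ((\<lambda>t. \<tau> * (6 * (t/\<tau>)^2 - 24 * (t/\<tau>)^3 + 30 * (t/\<tau>)^4 - 12 * (t/\<tau>)^5)) \<tau> - (\<lambda>t. \<tau> * (6 * (t/\<tau>)^2 - 24 * (t/\<tau>)^3 + 30 * (t/\<tau>)^4 - 12 * (t/\<tau>)^5)) 0)) {0..\<tau>}"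
    by (rule ftc, unfold chi_def) (use \<tau> in \<open>auto intro!: derivative_eq_intros simp: field_simps eval_nat_numeral\<close>)
  thus "((\<lambda>t. chi \<tau> t * t) has_integral 0) {0..\<tau>}" using \<tau> by simp
  have "((\<lambda>t. chi \<tau> t * t^2) has_integral ((\<lambda>t. \<tau>^2 * (4 * (t/\<tau>)^3 - 18 * (t/\<tau>)^4 + 24 * (t/\<tau>)^5 - 10 * (t/\<tau>)^6)) \<tau> - (\<lambda>t. \<tau>^2 * (4 * (t/\<tau>)^3 - 18 * (t/\<tau>)^4 + 24 * (t/\<tau>)^5 - 10 * (t/\<tau>)^6)) 0)) {0..\<tau>}"
    by (rule ftc, unfold chi_def) (use \<tau> in \<open>auto intro!: derivative_eq_intros simp: field_simps eval_nat_numeral\<close>)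
  thus "((\<lambda>t. chi \<tau> t * t^2) has_integral 0) {0..\<tau>}" using \<tau> by simp
qed

text \<open>The quadratic Taylor polynomial of \<open>f\<close> at 0 is integrated against the
  weight exactly to \<open>f 0\<close>. The remainder is at most B * \<tau>^3 and the weight at most
  264 / \<tau> on an interval of length \<tau>.\<close>

lemma chi_extrapolation:
  fixes f f1 f2 f3 :: "real \<Rightarrow> complex"
  assumes \<tau>: "0 < \<tau>"
    and d: "\<And>t. t \<in> {0..\<tau>} \<Longrightarrow> (f has_vector_derivative f1 t) (at t within {0..\<tau>})"
    "\<And>t. t \<in> {0..\<tau>} \<Longrightarrow> (f1 has_vector_derivative f2 t) (at t within {0..\<tau>})"
    "\<And>t. t \<in> {0..\<tau>} \<Longrightarrow> (f2 has_vector_derivative f3 t) (at t within {0..\<tau>})"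
    and B: "\<And>t. t \<in> {0..\<tau>} \<Longrightarrow> cmod (f3 t) \<le> B"
  shows "cmod (integral {0..\<tau>} (\<lambda>t. of_real (chi \<tau> t) * f t) - f 0) \<le> 264 * B * \<tau>^3"
proof -
  have B0: "0 \<le> B" using B[of 0] \<tau> order_trans[OF norm_ge_zero] by auto
  define r2 where "r2 t = f2 t - f2 0" for t
  define r1 where "r1 t = f1 t - f1 0 - of_real t * f2 0" for t
  define r where "r t = f t - f 0 - of_real t * f1 0 - of_real (t^2) * (f2 0 / 2)" for t
  have did: "((\<lambda>t. of_real t :: complex) has_vector_derivative 1) (at t within S)" for t :: real and S
    using has_vector_derivative_of_real[OF DERIV_ident, of "at t within S"] by simp
  have dsq: "((\<lambda>t. of_real (t^2) :: complex) has_vector_derivative of_real (2 * t)) (at t within S)" for t :: real and S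
    by (rule has_vector_derivative_of_real) (auto intro!: derivative_eq_intros)
  have grow: "cmod (g t) \<le> C * \<tau>"
    if "\<And>t. t \<in> {0..\<tau>} \<Longrightarrow> (g has_vector_derivative g' t) (at t within {0..\<tau>})" "\<And>t. t \<in> {0..\<tau>} \<Longrightarrow> cmod (g' t) \<le> C" "g 0 = 0" "t \<in> {0..\<tau>}" "0 \<le> C"
    for g g' :: "real \<Rightarrow> complex" and C t
  proof -
    have "norm (g t - g 0) \<le> C * norm (t - 0)"
      by (rule vector_derivative_bound[where S = "{0..\<tau>}"]) (use that \<tau> in auto)
    also have "\<dots> \<le> C * \<tau>" using that by (intro mult_left_mono) auto
    finally show ?thesis using that by simp
  qed
  have r2b: "cmod (r2 t) \<le> B * \<tau>" if "t \<in> {0..\<tau>}" for t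
    by (rule grow[where g' = f3]) (use that d(3) B B0 in \<open>auto simp: r2_def has_vector_derivative_diff_const\<close>)
  have dr1: "(r1 has_vector_derivative r2 t) (at t within {0..\<tau>})" if "t \<in> {0..\<tau>}" for t
  proof -
    have "(r1 has_vector_derivative (f2 t - 0 - 1 * f2 0)) (at t within {0..\<tau>})"
      unfolding r1_def by (intro has_vector_derivative_diff has_vector_derivative_mult_left did d(2) that has_vector_derivative_const)
    thus ?thesis by (simp add: r2_def)
  qed
  have r1b: "cmod (r1 t) \<le> B * \<tau> * \<tau>" if "t \<in> {0..\<tau>}" for t
    by (rule grow[OF dr1 r2b]) (use that B0 \<tau> in \<open>auto simp: r1_def\<close>)
  have dr: "(r has_vector_derivative r1 t) (at t within {0..\<tau>})" if "t \<in> {0..\<tau>}" for t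
  proof -
    have "(r has_vector_derivative (f1 t - 0 - 1 * f1 0 - of_real (2 * t) * (f2 0 / 2))) (at t within {0..\<tau>})"
      unfolding r_def by (intro has_vector_derivative_diff has_vector_derivative_mult_left did dsq d(1) that has_vector_derivative_const)
    thus ?thesis by (simp add: r1_def)
  qed
  have rb: "cmod (r t) \<le> B * \<tau> * \<tau> * \<tau>" if "t \<in> {0..\<tau>}" for t
    by (rule grow[OF dr r1b]) (use that B0 \<tau> in \<open>auto simp: r_def\<close>)
  have cr: "continuous_on {0..\<tau>} r"
    unfolding r_def by (intro continuous_intros has_vector_derivative_continuous_on'[OF d(1)])
  have cc: "continuous_on {0..\<tau>} (chi \<tau>)"
    unfolding chi_def using \<tau> by (intro continuous_intros) auto
  have ir: "((\<lambda>t. of_real (chi \<tau> t) * r t) has_integral integral {0..\<tau>} (\<lambda>t. of_real (chi \<tau> t) * r t)) {0..\<tau>}"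
    by (intro integrable_integral integrable_continuous_interval continuous_intros cr cc)
  have c: "((\<lambda>t. of_real (g t) * w) has_integral of_real G * w) {0..\<tau>}" if "(g has_integral G) {0..\<tau>}" for g G and w :: complex
    by (intro has_integral_mult_left has_integral_of_real that)
  have "((\<lambda>t. of_real (chi \<tau> t) * f 0 + of_real (chi \<tau> t * t) * f1 0 + of_real (chi \<tau> t * t^2) * (f2 0 / 2) + of_real (chi \<tau> t) * r t)
      has_integral of_real 1 * f 0 + of_real 0 * f1 0 + of_real 0 * (f2 0 / 2) + integral {0..\<tau>} (\<lambda>t. of_real (chi \<tau> t) * r t)) {0..\<tau>}"
    by (intro has_integral_add c chi_moments[OF \<tau>] ir)
  moreover have "(\<lambda>t. of_real (chi \<tau> t) * f 0 + of_real (chi \<tau> t * t) * f1 0 + of_real (chi \<tau> t * t^2) * (f2 0 / 2) + of_real (chi \<tau> t) * r t)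
     = (\<lambda>t. of_real (chi \<tau> t) * f t)"
    by (simp add: r_def fun_eq_iff algebra_simps)
  ultimately have "integral {0..\<tau>} (\<lambda>t. of_real (chi \<tau> t) * f t) - f 0 = integral {0..\<tau>} (\<lambda>t. of_real (chi \<tau> t) * r t)"
    by (simp add: integral_unique)
  also have "cmod \<dots> \<le> integral {0..\<tau>} (\<lambda>t. 264 / \<tau> * (B * \<tau> * \<tau> * \<tau>))"
  proof (rule integral_norm_bound_integral)
    show "(\<lambda>t. of_real (chi \<tau> t) * r t) integrable_on {0..\<tau>}" using ir by blast
    fix t assume t: "t \<in> {0..\<tau>}"
    show "norm (of_real (chi \<tau> t) * r t) \<le> 264 / \<tau> * (B * \<tau> * \<tau> * \<tau>)"
      unfolding norm_mult norm_of_real using chi_bound(1)[OF \<tau> t] rb[OF t] \<tau> by (intro mult_mono) auto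
  qed (rule integrable_const_ivl)
  also have "\<dots> = 264 * B * \<tau>^3" using \<tau> by (simp add: eval_nat_numeral)
  finally show ?thesis .
qed

text \<open>Extrapolation applied to exp (\<lambda> t) b_k, where the hypothesis \<open>E\<close>
  bounds the exponential by 3. Continuity of \<open>rhs\<close> comes along because for a finitely
  supported potential it is itself differentiable.\<close>

lemma mode_extrapolation:
  fixes b :: "real \<Rightarrow> int^'d \<Rightarrow> complex"
  assumes W: "potbd W M" and K: "1 \<le> K" and L: "L \<subseteq> kball K" "\<And>l. l \<notin> L \<Longrightarrow> W l = 0" and \<tau>: "0 < \<tau>"
    and bR: "\<And>t. t \<in> {0..\<tau>} \<Longrightarrow> hbd (real CARD('d)) (b t) R"
    and db: "\<And>t k. t \<in> {0..\<tau>} \<Longrightarrow> ((\<lambda>t. b t k) has_vector_derivative rhs W (b t) k) (at t within {0..\<tau>})"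
    and k: "k \<in> kball K" and E: "exp (lam k * \<tau>) \<le> 3"
  shows "cmod (integral {0..\<tau>} (\<lambda>t. of_real (chi \<tau> t) * (of_real (exp (lam k * t)) * b t k)) - b 0 k) \<le> 264 * (3 * (K^4 * G3 TYPE('d) M R)) * \<tau>^3"
    and "continuous_on {0..\<tau>} (\<lambda>t. rhs W (b t) m)"
proof -
  have fin: "finite L" by (rule finite_subset[OF L(1) finite_kvec_ball])
  have rh: "rhs W (b t) m = - of_real (lam m) * b t m + - of_real (4 * pi^2) * NW L W (b t) (b t) m" for t m
    unfolding rhs_def using Bl_eq_NW[OF fin L(2)] by simp
  let ?n = "\<lambda>t m. - of_real (4 * pi^2) * NW L W (b t) (b t) m"
  have dn: "((\<lambda>t. ?n t m) has_vector_derivative nonlin_dt L W (b t) m) (at t within {0..\<tau>})" if "t \<in> {0..\<tau>}" for t m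
    unfolding nonlin_dt_def by (intro has_vector_derivative_mult_right NW_has_vector_derivative db that)
  have rh_fun: "(\<lambda>t. rhs W (b t) m) = (\<lambda>t. - of_real (lam m) * b t m + ?n t m)" for m
    by (rule ext) (rule rh)
  have dr: "((\<lambda>t. rhs W (b t) m) has_vector_derivative rhs_dt L W (b t) m) (at t within {0..\<tau>})" if "t \<in> {0..\<tau>}" for t m
    unfolding rhs_dt_def rh_fun
    by (intro has_vector_derivative_add has_vector_derivative_mult_right dn db that)
  have d1: "((\<lambda>t. nonlin_dt L W (b t) m) has_vector_derivative nonlin_dt2 L W (b t) m) (at t within {0..\<tau>})" if "t \<in> {0..\<tau>}" for t m
  proof -
    have "((\<lambda>t. nonlin_dt L W (b t) m) has_vector_derivative - of_real (4 * pi^2) * ((NW L W (rhs_dt L W (b t)) (b t) m + NW L W (rhs W (b t)) (rhs W (b t)) m)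
       + (NW L W (rhs W (b t)) (rhs W (b t)) m + NW L W (b t) (rhs_dt L W (b t)) m))) (at t within {0..\<tau>})"
      unfolding nonlin_dt_def by (intro has_vector_derivative_mult_right has_vector_derivative_add NW_has_vector_derivative dr db that)
    thus ?thesis by (simp add: nonlin_dt2_def algebra_simps)
  qed
  show "continuous_on {0..\<tau>} (\<lambda>t. rhs W (b t) m)" by (rule has_vector_derivative_continuous_on', rule dr)
  let ?l = "of_real (lam k) :: complex" and ?e = "\<lambda>t. of_real (exp (lam k * t)) :: complex"
  have de: "(?e has_vector_derivative ?l * ?e t) (at t within {0..\<tau>})" for t
  proof -
    have "((\<lambda>t. exp (lam k * t)) has_real_derivative lam k * exp (lam k * t)) (at t within {0..\<tau>})"
      by (auto intro!: derivative_eq_intros)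
    from has_vector_derivative_of_real[OF this] show ?thesis by simp
  qed
  have pr: "((\<lambda>t. ?e t * g t) has_vector_derivative ?e t * (?l * g t + g')) (at t within {0..\<tau>})"
    if "(g has_vector_derivative g') (at t within {0..\<tau>})" for g g' t
    using has_vector_derivative_mult[OF de that] by (simp add: algebra_simps)
  have "cmod (integral {0..\<tau>} (\<lambda>t. of_real (chi \<tau> t) * (?e t * b t k)) - ?e 0 * b 0 k) \<le> 264 * (3 * (K^4 * G3 TYPE('d) M R)) * \<tau>^3"
  proof (rule chi_extrapolation[OF \<tau>, where ?f1.0 = "\<lambda>t. ?e t * ?n t k" and ?f2.0 = "\<lambda>t. ?e t * (?l * ?n t k + nonlin_dt L W (b t) k)"
      and ?f3.0 = "\<lambda>t. ?e t * (of_real ((lam k)^2) * ?n t k + of_real (2 * lam k) * nonlin_dt L W (b t) k + nonlin_dt2 L W (b t) k)"])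
    fix t assume t: "t \<in> {0..\<tau>}"
    show "((\<lambda>t. ?e t * b t k) has_vector_derivative ?e t * ?n t k) (at t within {0..\<tau>})"
      using pr[OF db[OF t, of k]] unfolding rh by simp
    show "((\<lambda>t. ?e t * ?n t k) has_vector_derivative ?e t * (?l * ?n t k + nonlin_dt L W (b t) k)) (at t within {0..\<tau>})"
      by (rule pr[OF dn[OF t]])
    have "((\<lambda>t. ?l * ?n t k + nonlin_dt L W (b t) k) has_vector_derivative ?l * nonlin_dt L W (b t) k + nonlin_dt2 L W (b t) k) (at t within {0..\<tau>})"
      by (intro has_vector_derivative_add has_vector_derivative_mult_right dn d1 t)
    from pr[OF this] show "((\<lambda>t. ?e t * (?l * ?n t k + nonlin_dt L W (b t) k)) has_vector_derivative
       ?e t * (of_real ((lam k)^2) * ?n t k + of_real (2 * lam k) * nonlin_dt L W (b t) k + nonlin_dt2 L W (b t) k)) (at t within {0..\<tau>})"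
      by (simp add: algebra_simps power2_eq_square)
    have "lam k * t \<le> lam k * \<tau>" using t by (intro mult_left_mono) (auto simp: lam_def)
    hence "exp (lam k * t) \<le> 3" using E order_trans[of "exp (lam k * t)" "exp (lam k * \<tau>)" 3] by simp
    thus "cmod (?e t * (of_real ((lam k)^2) * ?n t k + of_real (2 * lam k) * nonlin_dt L W (b t) k + nonlin_dt2 L W (b t) k)) \<le> 3 * (K^4 * G3 TYPE('d) M R)"
      unfolding norm_mult[of "?e t"] by (intro mult_mono third_derivative_bound[OF W bR[OF t] K L k]) auto
  qed
  thus "cmod (integral {0..\<tau>} (\<lambda>t. of_real (chi \<tau> t) * (?e t * b t k)) - b 0 k) \<le> 264 * (3 * (K^4 * G3 TYPE('d) M R)) * \<tau>^3" by simp
qed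

text \<open>Cauchy-Schwarz on an interval, read off from the nonnegative integral of (Z - m)^2 with
  m the mean value of \<open>Z\<close>.\<close>

lemma integral_sq_bound:
  fixes Z :: "real \<Rightarrow> real"
  assumes \<tau>: "0 < \<tau>" and zi: "Z integrable_on {0..\<tau>}" "(\<lambda>t. (Z t)^2) integrable_on {0..\<tau>}" and E: "integral {0..\<tau>} (\<lambda>t. (Z t)^2) \<le> E^2" "0 \<le> E"
  shows "integral {0..\<tau>} Z \<le> sqrt \<tau> * E"
proof -
  define I where "I = integral {0..\<tau>} Z"
  define m where "m = I / \<tau>"
  have "((\<lambda>t. (Z t)^2 + (- (2 * m)) * Z t + m^2) has_integral integral {0..\<tau>} (\<lambda>t. (Z t)^2) + (- (2 * m)) * I + m^2 * \<tau>) {0..\<tau>}"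
    unfolding I_def using \<tau> has_integral_const_real[of "m^2" 0 \<tau>]
    by (intro has_integral_add has_integral_mult_right integrable_integral zi) (simp add: mult.commute)
  moreover have "(\<lambda>t. (Z t)^2 + (- (2 * m)) * Z t + m^2) = (\<lambda>t. (Z t - m)^2)"
    by (simp add: fun_eq_iff power2_diff algebra_simps)
  ultimately have "0 \<le> integral {0..\<tau>} (\<lambda>t. (Z t)^2) + (- (2 * m)) * I + m^2 * \<tau>"
    by (auto elim!: has_integral_nonneg)
  also have "\<dots> = integral {0..\<tau>} (\<lambda>t. (Z t)^2) - I^2 / \<tau>"
    using \<tau> by (simp add: m_def field_simps power2_eq_square)
  finally have "I^2 / \<tau> \<le> E^2" using E by linarith
  hence "I^2 \<le> \<tau> * E^2" using \<tau> by (simp add: pos_divide_le_eq mult.commute)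
  hence "sqrt (I^2) \<le> sqrt (\<tau> * E^2)" by (rule real_sqrt_le_mono)
  thus ?thesis using E by (simp add: I_def real_sqrt_mult)
qed

section \<open>Stability of the Fourier flow\<close>

text \<open>The bound in the last clause is qualitative: it starts the continuity argument for the
  H^d norm, whose conclusion no longer contains it.\<close>

definition fourier_flow :: "real \<Rightarrow> (int^'d \<Rightarrow> complex) \<Rightarrow> (real \<Rightarrow> int^'d \<Rightarrow> complex) \<Rightarrow> bool" where
  "fourier_flow T W a \<longleftrightarrow>
     (\<forall>t\<in>{0..T}. \<forall>k. ((\<lambda>t. a t k) has_vector_derivative rhs W (a t) k) (at t within {0..T})) \<and>
     (\<forall>t\<in>{0..T}. hermitian (a t)) \<and> (\<exists>C. \<forall>t\<in>{0..T}. hbd (real CARD('d)) (a t) C)"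

lemma fourier_flow_restrict:
  "fourier_flow T W a \<Longrightarrow> \<tau> \<le> T \<Longrightarrow> fourier_flow \<tau> W a"
  unfolding fourier_flow_def
  by (fastforce intro: has_vector_derivative_within_subset[where S = "{0..T}" and T = "{0..\<tau>}"])

lemma powr_K_le_1: "1 \<le> (K::real) \<Longrightarrow> s \<le> 0 \<Longrightarrow> K powr s \<le> 1"
  using powr_mono[of s 0 K] by simp

text \<open>The length \<open>\<tau>\<close> balances the extrapolation error \<open>\<tau>\<^sup>3 K\<^sup>4\<close> against the lower bound for the modes of \<open>b 0\<close>,
  of order \<open>K\<close> to the power \<open>- \<zeta>\<close>.\<close>

lemma observability_on_modes:
  fixes a b :: "real \<Rightarrow> int^'d \<Rightarrow> complex" and K \<zeta> :: real
  assumes pos: "0 < c" "0 < h" "0 < cst" and \<kappa>: "0 < \<kappa>" "\<kappa> \<le> 1 / 64" "1584 * G3 TYPE('d) M (2 * h) * \<kappa> \<le> cst"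
    and \<tau>_def: "\<tau> = \<kappa> * K powr (- ((\<zeta> + 4) / 3))" and \<zeta>: "2 < \<zeta>" and K: "1 \<le> K"
    and W: "potbd W1 M" "potbd W2 M" "W1 0 = 0" "W2 0 = 0" and supp: "\<And>k. K < norm (kvec k) \<Longrightarrow> W2 k = 0"
    and fl: "fourier_flow \<tau> W1 a" "fourier_flow \<tau> W2 b" and init: "a 0 = b 0"
    and ab: "\<And>t. t \<in> {0..\<tau>} \<Longrightarrow> hbd (real CARD('d)) (a t) (2 * h)" "\<And>t. t \<in> {0..\<tau>} \<Longrightarrow> hbd (real CARD('d)) (b t) (2 * h)"
    and coer: "\<And>t. t \<in> {0..\<tau>} \<Longrightarrow> coercive (b t) c"
    and low: "\<And>k. k \<noteq> 0 \<Longrightarrow> cst * norm (kvec k) powr (- \<zeta>) \<le> cmod (b 0 k)"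
    and Z: "continuous_on {0..\<tau>} Z" "\<And>t. t \<in> {0..\<tau>} \<Longrightarrow> hbd 0 (\<lambda>k. b t k - a t k) (Z t)"
    and E: "integral {0..\<tau>} (\<lambda>t. (Z t)^2) \<le> E^2" "0 \<le> E"
  shows "nrm {k. 0 < norm (kvec k) \<and> norm (kvec k) \<le> K} (\<lambda>k. W2 k - W1 k)
    \<le> C8 TYPE('d) M (2 * h) c * (105912 / cst) * \<kappa> powr (- (3 / 2)) * K powr (3 * \<zeta> / 2) * E"
proof -
  let ?C8 = "C8 TYPE('d) M (2 * h) c" and ?G = "G3 TYPE('d) M (2 * h)"
  define F0 where "F0 = {k::int^'d. 0 < norm (kvec k) \<and> norm (kvec k) \<le> K}"
  define \<omega> where "\<omega> k = W2 k - W1 k" for k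
  define \<Omega> where "\<Omega> = nrm F0 \<omega>"
  have F0: "finite F0" "0 \<notin> F0" "F0 \<subseteq> kball K"
    unfolding F0_def by (auto intro: finite_subset[OF _ finite_kvec_ball[of K]])
  have suppF: "W2 l = 0" if "l \<notin> F0" for l
  proof (cases "l = 0")
    case False
    hence "0 < norm (kvec l)" using norm_kvec_ge_1[of l] by linarith
    thus ?thesis using that supp[of l] by (auto simp: F0_def not_le)
  qed (use W in simp)
  have M: "0 \<le> M" by (rule potbd_nonneg[OF W(1)])
  have \<tau>: "0 < \<tau>" using \<kappa> K by (simp add: \<tau>_def)
  have G0: "0 \<le> ?G" unfolding G3_def G2_def G1_def
    using M pos sigJ_ge_1[where 'd = 'd] calg_pos[where 'd = 'd]
    by (intro add_nonneg_nonneg mult_nonneg_nonneg zero_le_power) auto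
  have C8: "0 \<le> ?C8" using M pos by (intro C8_nonneg) auto
  have K2: "K^2 = K powr 2" using K by (simp add: powr_numeral)
  have \<tau>K: "\<tau> * K^2 \<le> \<kappa>"
  proof -
    have "\<tau> * K^2 = \<kappa> * K powr (2 - (\<zeta> + 4) / 3)" unfolding \<tau>_def K2 mult.assoc powr_add[symmetric] by (simp only: add.commute[of _ "2::real"] diff_conv_add_uminus)
    also have "\<dots> \<le> \<kappa> * 1" using \<kappa> K \<zeta> by (intro mult_left_mono powr_K_le_1) auto
    finally show ?thesis by simp
  qed
  have \<tau>3: "\<tau>^3 * K^4 = \<kappa>^3 * K powr (- \<zeta>)"
  proof -
    have "\<tau>^3 = \<kappa>^3 * (K powr (- ((\<zeta> + 4) / 3)))^3" by (simp add: \<tau>_def power_mult_distrib)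
    also have "(K powr (- ((\<zeta> + 4) / 3)))^3 = K powr (- (\<zeta> + 4))"
    proof -
      have "(K powr (- ((\<zeta> + 4) / 3)))^3 = K powr (- ((\<zeta> + 4) / 3) * 3)"
        unfolding powr_powr[symmetric] using K by (subst powr_numeral) auto
      also have "- ((\<zeta> + 4) / 3) * 3 = - (\<zeta> + 4)" by (simp add: field_simps)
      finally show ?thesis .
    qed
    finally show ?thesis using K powr_add[of K "- (\<zeta> + 4)" 4] by (simp flip: powr_numeral)
  qed
  have lam0: "0 \<le> lam k" for k :: "int^'d" by (simp add: lam_def)
  have pi64: "4 * pi^2 \<le> 64"
  proof -
    have "pi^2 \<le> 4^2" using pi_less_4 by (intro power_mono) auto
    thus ?thesis by simp
  qed
  have lamK: "lam k * \<tau> \<le> 1" if "k \<in> F0" for k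
  proof -
    have "(norm (kvec k))^2 \<le> K^2" using that by (intro power_mono) (auto simp: F0_def)
    hence "lam k \<le> 64 * K^2" unfolding lam_def using pi64 by (intro mult_mono) auto
    hence "lam k * \<tau> \<le> 64 * K^2 * \<tau>" using \<tau> by (intro mult_right_mono) auto
    also have "\<dots> \<le> 64 * \<kappa>" using \<tau>K by (simp add: mult_ac)
    finally show ?thesis using \<kappa> by simp
  qed
  have e3: "exp (lam k * t) \<le> 3" if "k \<in> F0" "t \<in> {0..\<tau>}" for k t
  proof -
    have "lam k * t \<le> lam k * \<tau>" using that by (intro mult_left_mono lam0) auto
    hence "lam k * t \<le> 1" using lamK[OF that(1)] by linarith
    hence "exp (lam k * t) \<le> exp 1" by simp
    thus ?thesis using exp_le by linarith
  qed
  note db = fl(2)[unfolded fourier_flow_def, THEN conjunct1, rule_format]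
  note da = fl(1)[unfolded fourier_flow_def, THEN conjunct1, rule_format]
  define X where "X k = integral {0..\<tau>} (\<lambda>t. of_real (chi \<tau> t) * (of_real (exp (lam k * t)) * b t k))" for k
  have cb: "continuous_on {0..\<tau>} (\<lambda>t. rhs W2 (b t) k)" for k
    by (rule mode_extrapolation(2)[OF W(2) K F0(3) suppF \<tau> ab(2) db, where ?k = 0]) (use K in \<open>auto simp: lam_def\<close>)
  \<comment> \<open>The extrapolation error is 792 * \<open>?G\<close> * \<kappa> at most, with 792
    = 3 * 264; the condition on \<open>\<kappa>\<close> with 1584 = 2 * 792 makes it half of the
    lower bound for the initial mode. The cube of \<open>\<kappa>\<close> is wasted, since \<kappa>
    \<le> 1.\<close>
  have Xlow: "cst / 2 * norm (kvec k) powr (- \<zeta>) \<le> cmod (X k)" if k: "k \<in> F0" for k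
  proof -
    have k1: "k \<in> kball K" "k \<noteq> 0" "0 < norm (kvec k)" "norm (kvec k) \<le> K" using k by (auto simp: F0_def)
    have "cmod (X k - b 0 k) \<le> 264 * (3 * (K^4 * ?G)) * \<tau>^3"
      unfolding X_def
      by (rule mode_extrapolation(1)[OF W(2) K F0(3) suppF \<tau> ab(2) db k1(1)]) (use e3[OF k, of \<tau>] \<tau> in auto)
    also have "\<dots> = 792 * ?G * (\<tau>^3 * K^4)" by simp
    also have "\<dots> = 792 * ?G * \<kappa>^3 * K powr (- \<zeta>)" unfolding \<tau>3 by simp
    also have "\<dots> \<le> 792 * ?G * \<kappa> * norm (kvec k) powr (- \<zeta>)"
    proof (intro mult_mono mult_left_mono)
      show "\<kappa>^3 \<le> \<kappa>" using \<kappa> power_decreasing[of 1 3 \<kappa>] by simp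
      show "K powr (- \<zeta>) \<le> norm (kvec k) powr (- \<zeta>)" using k1 \<zeta> by (intro powr_mono2') auto
    qed (use G0 \<kappa> in auto)
    also have "\<dots> \<le> cst / 2 * norm (kvec k) powr (- \<zeta>)" using \<kappa>(3) by (intro mult_right_mono) auto
    finally have 1: "cmod (X k - b 0 k) \<le> cst / 2 * norm (kvec k) powr (- \<zeta>)" .
    have "cmod (b 0 k) \<le> cmod (X k) + cmod (X k - b 0 k)" by (metis norm_minus_commute norm_triangle_sub add.commute)
    thus ?thesis using 1 low[OF k1(2)] by (simp add: field_simps)
  qed
  \<comment> \<open>The dual weight: its conjugate times \<open>X k\<close> is the conjugate of
    \<open>\<omega> k\<close>, so the space-time pairing becomes exactly the square sum of
    \<open>\<omega>\<close> over the modes.\<close>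
  define cc where "cc k = (if k \<in> F0 then \<omega> k / cnj (X k) else 0)" for k
  have Xpos: "0 < cmod (X k)" if "k \<in> F0" for k
  proof -
    have "0 < norm (kvec k)" using that by (simp add: F0_def)
    hence "0 < cst / 2 * norm (kvec k) powr (- \<zeta>)" using pos by simp
    thus ?thesis using Xlow[OF that] by linarith
  qed
  have ccb: "cmod (cc k) \<le> 2 / cst * norm (kvec k) powr \<zeta> * cmod (\<omega> k)" if k: "k \<in> F0" for k
  proof -
    have n: "0 < norm (kvec k)" using k by (simp add: F0_def)
    have "cmod (cc k) = cmod (\<omega> k) / cmod (X k)" using k by (simp add: cc_def norm_divide)
    also have "\<dots> \<le> cmod (\<omega> k) / (cst / 2 * norm (kvec k) powr (- \<zeta>))"
      using Xlow[OF k] Xpos[OF k] n pos by (intro divide_left_mono mult_pos_pos) auto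
    also have "\<dots> = 2 / cst * norm (kvec k) powr \<zeta> * cmod (\<omega> k)" using n pos by (simp add: powr_minus field_simps)
    finally show ?thesis .
  qed
  define y where "y t k = (cc k * of_real (exp (lam k * t) * chi \<tau> t))" for t k
  define y' where "y' t k = (cc k * of_real (exp (lam k * t) * (lam k * chi \<tau> t + chi' \<tau> t)))" for t k
  \<comment> \<open>The scale of \<open>y'\<close> in H^-2. It also dominates the scale K^\<zeta> /
    \<tau> of \<open>y\<close>, because \<tau> K^2 \<le> \<kappa> \<le> 1.\<close>
  define A where "A = 2 / cst * K powr (\<zeta> - 2) / \<tau>^2"
  have A0: "0 \<le> A" using pos by (simp add: A_def)
  have KA: "2 / cst * K powr \<zeta> / \<tau> \<le> A"
  proof -
    have "2 / cst * K powr \<zeta> / \<tau> = A * (\<tau> * K^2)"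
      unfolding A_def K2 using \<tau> K by (simp add: powr_diff power2_eq_square field_simps)
    also have "\<dots> \<le> A * 1" using \<tau>K \<kappa> by (intro mult_left_mono A0) linarith
    finally show ?thesis by simp
  qed
  have yb: "nrm F0 (y t) \<le> 792 * A * \<Omega>" if t: "t \<in> {0..\<tau>}" for t
  proof -
    have "nrm F0 (y t) \<le> L2_set (\<lambda>k. 792 * A * cmod (\<omega> k)) F0"
    proof (rule L2_set_mono)
      fix k assume k: "k \<in> F0"
      have "norm (kvec k) powr \<zeta> \<le> K powr \<zeta>" using k \<zeta> by (intro powr_mono2) (auto simp: F0_def)
      have "cmod (y t k) = cmod (cc k) * (exp (lam k * t) * \<bar>chi \<tau> t\<bar>)" by (simp add: y_def norm_mult abs_mult)
      also have "\<dots> \<le> (2 / cst * K powr \<zeta> * cmod (\<omega> k)) * (3 * (264 / \<tau>))"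
      proof (intro mult_mono e3 k t chi_bound[OF \<tau> t])
        have "2 / cst * norm (kvec k) powr \<zeta> * cmod (\<omega> k) \<le> 2 / cst * K powr \<zeta> * cmod (\<omega> k)"
          using pos by (intro mult_right_mono mult_left_mono \<open>norm (kvec k) powr \<zeta> \<le> K powr \<zeta>\<close>) auto
        thus "cmod (cc k) \<le> 2 / cst * K powr \<zeta> * cmod (\<omega> k)" using ccb[OF k] by linarith
      qed (use pos \<tau> in auto)
      also have "\<dots> = 792 * (2 / cst * K powr \<zeta> / \<tau>) * cmod (\<omega> k)" by simp
      also have "\<dots> \<le> 792 * A * cmod (\<omega> k)" by (intro mult_right_mono mult_left_mono KA) auto
      finally show "cmod (y t k) \<le> 792 * A * cmod (\<omega> k)" .
    qed auto
    thus ?thesis using A0 by (simp add: L2_set_right_distrib \<Omega>_def)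
  qed
  \<comment> \<open>Here |k|^\<zeta> / |k|^2 must be kept together: for \<zeta> > 2 it is increasing
    in |k| and at most K^(\<zeta> - 2), which saves K^2 on the derivative of the weight. The number
    is 3 * 64 * 264 + 3 * 492.\<close>
  have y'b: "L2_set (\<lambda>k. cmod (y' t k) / (norm (kvec k))^2) F0 \<le> 52164 * A * \<Omega>" if t: "t \<in> {0..\<tau>}" for t
  proof -
    have "L2_set (\<lambda>k. cmod (y' t k) / (norm (kvec k))^2) F0 \<le> L2_set (\<lambda>k. 52164 * A * cmod (\<omega> k)) F0"
    proof (rule L2_set_mono)
      fix k assume k: "k \<in> F0"
      define n where "n = norm (kvec k)"
      have n: "0 < n" "n \<le> K" using k by (auto simp: F0_def n_def)
      have p1: "n powr \<zeta> \<le> K powr \<zeta>" using n \<zeta> by (intro powr_mono2) auto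
      have p2: "n powr \<zeta> / n^2 \<le> K powr (\<zeta> - 2)"
      proof -
        have "n powr \<zeta> / n^2 = n powr (\<zeta> - 2)" using n by (simp add: powr_diff powr_numeral)
        also have "\<dots> \<le> K powr (\<zeta> - 2)" using n \<zeta> by (intro powr_mono2) auto
        finally show ?thesis .
      qed
      have l: "lam k \<le> 64 * n^2" unfolding lam_def n_def using pi64 by (intro mult_right_mono) auto
      have "cmod (y' t k) = cmod (cc k) * (exp (lam k * t) * \<bar>lam k * chi \<tau> t + chi' \<tau> t\<bar>)"
        by (simp add: y'_def norm_mult abs_mult del: of_real_add)
      also have "\<dots> \<le> (2 / cst * n powr \<zeta> * cmod (\<omega> k)) * (3 * (64 * n^2 * (264 / \<tau>) + 492 / \<tau>^2))"
      proof (intro mult_mono e3 k t)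
        show "cmod (cc k) \<le> 2 / cst * n powr \<zeta> * cmod (\<omega> k)" using ccb[OF k] by (simp add: n_def)
        have "\<bar>lam k * chi \<tau> t + chi' \<tau> t\<bar> \<le> lam k * \<bar>chi \<tau> t\<bar> + \<bar>chi' \<tau> t\<bar>" using lam0[of k] by (metis abs_mult abs_of_nonneg abs_triangle_ineq)
        also have "\<dots> \<le> 64 * n^2 * (264 / \<tau>) + 492 / \<tau>^2" by (intro add_mono mult_mono l chi_bound[OF \<tau> t]) auto
        finally show "\<bar>lam k * chi \<tau> t + chi' \<tau> t\<bar> \<le> 64 * n^2 * (264 / \<tau>) + 492 / \<tau>^2" .
      qed (use pos \<tau> in auto)
      finally have "cmod (y' t k) / n^2 \<le> (2 / cst * n powr \<zeta> * cmod (\<omega> k)) * (3 * (64 * n^2 * (264 / \<tau>) + 492 / \<tau>^2)) / n^2"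
        by (rule divide_right_mono) simp
      also have "\<dots> = 2 / cst * cmod (\<omega> k) * (50688 / \<tau> * n powr \<zeta> + 1476 / \<tau>^2 * (n powr \<zeta> / n^2))"
        using n pos(3) \<tau> by (simp add: field_simps)
      also have "\<dots> \<le> 2 / cst * cmod (\<omega> k) * (50688 / \<tau> * K powr \<zeta> + 1476 / \<tau>^2 * K powr (\<zeta> - 2))"
        using pos \<tau> by (intro mult_left_mono add_mono p1 p2) auto
      also have "\<dots> = cmod (\<omega> k) * (50688 * (2 / cst * K powr \<zeta> / \<tau>) + 1476 * A)"
        unfolding A_def by (simp add: algebra_simps)
      also have "\<dots> \<le> cmod (\<omega> k) * (50688 * A + 1476 * A)"
        by (intro mult_left_mono add_mono KA) auto
      finally show "cmod (y' t k) / (norm (kvec k))^2 \<le> 52164 * A * cmod (\<omega> k)" by (simp add: n_def mult.commute)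
    qed auto
    thus ?thesis using A0 by (simp add: L2_set_right_distrib \<Omega>_def)
  qed
  have dy: "((\<lambda>t. y t k) has_vector_derivative y' t k) (at t within {0..\<tau>})" for t k
  proof -
    have "((\<lambda>t. exp (lam k * t) * chi \<tau> t) has_real_derivative exp (lam k * t) * (lam k * chi \<tau> t + chi' \<tau> t)) (at t within {0..\<tau>})"
      by (auto intro!: derivative_eq_intros chi_deriv[OF \<tau>] simp: algebra_simps)
    thus ?thesis unfolding y_def y'_def by (intro has_vector_derivative_mult_right has_vector_derivative_of_real)
  qed
  have cy': "continuous_on {0..\<tau>} (\<lambda>t. y' t k)" for k
    unfolding y'_def chi_def chi'_def using \<tau> by (intro continuous_intros) auto
  have obs: "4 * pi^2 * cmod (integral {0..\<tau>} (\<lambda>t. cip F0 (\<lambda>l. (W2 l - W1 l) * b t l) (y t)))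
    \<le> ?C8 * (792 * A * \<Omega> + 52164 * A * \<Omega>) * integral {0..\<tau>} Z"
  proof (rule observability[OF W _ pos(1) \<tau> ab _ coer da db cb init Z F0(1,2) dy cy'])
    show "hermitian (b t)" if "t \<in> {0..\<tau>}" for t using fl(2) that by (simp add: fourier_flow_def)
    show "y t k = 0" "y' t k = 0" if "k \<notin> F0" for t k using that by (auto simp: y_def y'_def cc_def)
    show "y \<tau> k = 0" for k by (simp add: y_def chi_end[OF \<tau>])
  qed (use pos yb y'b in auto)
  have cb0: "continuous_on {0..\<tau>} (\<lambda>t. b t k)" for k by (rule has_vector_derivative_continuous_on', rule db)
  have int_eq: "integral {0..\<tau>} (\<lambda>t. cip F0 (\<lambda>l. (W2 l - W1 l) * b t l) (y t)) = of_real (\<Omega>^2)"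
  proof -
    have "integral {0..\<tau>} (\<lambda>t. cip F0 (\<lambda>l. (W2 l - W1 l) * b t l) (y t))
      = (\<Sum>k\<in>F0. integral {0..\<tau>} (\<lambda>t. \<omega> k * cnj (cc k) * (of_real (chi \<tau> t) * (of_real (exp (lam k * t)) * b t k))))"
      unfolding cip_def y_def chi_def \<omega>_def
      by (subst integral_sum[OF F0(1), symmetric])
        (use \<tau> in \<open>auto intro!: integrable_continuous_interval continuous_intros cb0 simp: mult_ac\<close>)
    also have "\<dots> = (\<Sum>k\<in>F0. \<omega> k * cnj (cc k) * X k)" unfolding X_def by (simp only: integral_mult_right)
    also have "\<dots> = (\<Sum>k\<in>F0. of_real ((cmod (\<omega> k))^2))"
    proof (rule sum.cong[OF refl])
      fix k assume k: "k \<in> F0"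
      have "\<omega> k * cnj (cc k) * X k = \<omega> k * cnj (\<omega> k)" using Xpos[OF k] k by (auto simp: cc_def)
      thus "\<omega> k * cnj (cc k) * X k = of_real ((cmod (\<omega> k))^2)" by (simp only: complex_norm_square)
    qed
    also have "\<dots> = of_real (\<Omega>^2)" unfolding \<Omega>_def nrm_sq by simp
    finally show ?thesis .
  qed
  have IZ: "integral {0..\<tau>} Z \<le> sqrt \<tau> * E" by (rule integral_sq_bound[OF \<tau> _ _ E]) (intro integrable_continuous_interval continuous_intros Z(1))+
  have O0: "0 \<le> \<Omega>" by (simp add: \<Omega>_def)
  have "1 * \<Omega>^2 \<le> 4 * pi^2 * \<Omega>^2"
  proof (rule mult_right_mono)
    have "1^2 \<le> pi^2" using pi_gt3 by (intro power_mono) auto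
    thus "1 \<le> 4 * pi^2" by simp
  qed simp
  also have "\<dots> \<le> ?C8 * (792 * A * \<Omega> + 52164 * A * \<Omega>) * integral {0..\<tau>} Z" using obs unfolding int_eq by (simp add: norm_power)
  also have "\<dots> = ?C8 * (52956 * A * \<Omega>) * integral {0..\<tau>} Z" by simp
  also have "\<dots> \<le> ?C8 * (52956 * A * \<Omega>) * (sqrt \<tau> * E)"
    using C8 A0 O0 by (intro mult_left_mono IZ) auto
  finally have "\<Omega> * \<Omega> \<le> (?C8 * 52956 * A * (sqrt \<tau> * E)) * \<Omega>" by (simp add: power2_eq_square algebra_simps)
  moreover have "0 \<le> ?C8 * 52956 * A * (sqrt \<tau> * E)" using C8 A0 E \<tau> by simp
  ultimately have "\<Omega> \<le> ?C8 * 52956 * A * (sqrt \<tau> * E)"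
    using O0 by (cases "\<Omega> = 0") (auto intro!: mult_right_le_imp_le[of _ \<Omega>] simp: order_less_le)
  \<comment> \<open>105912 = 2 * (792 + 52164), where the 2 is the one in \<open>A\<close>. The
    remaining powers of \<tau> are those of \<open>A\<close> and of Cauchy-Schwarz in time.\<close>
  also have "\<dots> = ?C8 * (105912 / cst) * (K powr (\<zeta> - 2) * (sqrt \<tau> / \<tau>^2)) * E" by (simp add: A_def)
  also have "sqrt \<tau> / \<tau>^2 = \<tau> powr (- (3/2))"
    using \<tau> powr_diff[of \<tau> "1/2" 2] by (simp add: powr_half_sqrt powr_numeral)
  also have "\<tau> powr (- (3/2)) = \<kappa> powr (- (3/2)) * K powr ((\<zeta> + 4) / 2)"
  proof -
    have "- ((\<zeta> + 4) / 3) * - (3/2) = (\<zeta> + 4) / 2" by (simp add: field_simps)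
    from this show ?thesis unfolding \<tau>_def powr_mult powr_powr by (simp only:)
  qed
  also have "K powr (\<zeta> - 2) * (\<kappa> powr (- (3/2)) * K powr ((\<zeta> + 4) / 2)) = \<kappa> powr (- (3/2)) * K powr (3 * \<zeta> / 2)"
    by (simp add: powr_add[symmetric] mult.left_commute) (simp add: field_simps)
  finally show ?thesis by (simp add: \<Omega>_def \<omega>_def F0_def mult_ac)
qed

text \<open>The order of quantifiers carries the uniformity: \<open>S\<close> is fixed before
  \<zeta> and K, which influence the argument only through the length \<tau>. The function
  \<open>Z\<close> may be any continuous bound for the l2 distance of the two flows.\<close>

lemma stability_fourier:
  fixes T M cst c h :: real
  assumes pos: "0 < T" "0 < M" "0 < cst" "0 < c" "0 < h"
  shows "\<exists>S>0. \<forall>\<zeta> K W1 W2 (a :: real \<Rightarrow> int^'d \<Rightarrow> complex) b Z E.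
    2 < \<zeta> \<longrightarrow> 1 \<le> K \<longrightarrow> potbd W1 M \<longrightarrow> potbd W2 M \<longrightarrow> W1 0 = 0 \<longrightarrow> W2 0 = 0 \<longrightarrow> (\<forall>k. K < norm (kvec k) \<longrightarrow> W2 k = 0) \<longrightarrow>
    fourier_flow T W1 a \<longrightarrow> fourier_flow T W2 b \<longrightarrow> a 0 = b 0 \<longrightarrow> hbd (real CARD('d)) (b 0) h \<longrightarrow> coercive (b 0) c \<longrightarrow>
    (\<forall>k. k \<noteq> 0 \<longrightarrow> cst * norm (kvec k) powr (- \<zeta>) \<le> cmod (b 0 k)) \<longrightarrow>
    continuous_on {0..T} Z \<longrightarrow> (\<forall>t\<in>{0..T}. hbd 0 (\<lambda>k. b t k - a t k) (Z t)) \<longrightarrow>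
    integral {0..T} (\<lambda>t. (Z t)^2) \<le> E^2 \<longrightarrow> 0 \<le> E \<longrightarrow>
    nrm {k. 0 < norm (kvec k) \<and> norm (kvec k) \<le> K} (\<lambda>k. W2 k - W1 k) \<le> S * K powr (3 * \<zeta> / 2) * E"
proof -
  let ?d = "real CARD('d)"
  define \<Theta> where "\<Theta> = (calg TYPE('d) * M * (2 * h)^2)^2 / 2"
  have \<Theta>: "0 \<le> \<Theta>" by (simp add: \<Theta>_def)
  obtain \<tau>1 where \<tau>1: "0 < \<tau>1" and l1: "\<And>W (a :: real \<Rightarrow> int^'d \<Rightarrow> complex) T t. potbd W M \<Longrightarrow> T \<le> \<tau>1 \<Longrightarrow>
     (\<forall>t\<in>{0..T}. \<forall>k. ((\<lambda>t. a t k) has_vector_derivative rhs W (a t) k) (at t within {0..T})) \<Longrightarrow>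
     (\<forall>t\<in>{0..T}. hbd ?d (a t) (2 * h)) \<Longrightarrow> t \<in> {0..T} \<Longrightarrow> l1bd (\<lambda>m. cmod (a t m - a 0 m)) (c / 2)"
    using short_time_l1[of M "2 * h" "c / 2", where 'd = 'd] pos by (auto simp del: atLeastAtMost_iff)
  let ?G = "G3 TYPE('d) M (2 * h)"
  have G0: "0 \<le> ?G" unfolding G3_def G2_def G1_def
    using pos sigJ_ge_1[where 'd = 'd] calg_pos[where 'd = 'd]
    by (intro add_nonneg_nonneg mult_nonneg_nonneg zero_le_power) auto
  \<comment> \<open>Five smallness conditions: the interval stays in [0, T], the H^d norm at most
    doubles, half of the coercivity survives, the exponentials stay below 3 (4 pi^2 \<le> 64), and
    the extrapolation error is at most half of the initial mode.\<close>
  define \<kappa> where "\<kappa> = min (min T (h^2 / (\<Theta> + 1))) (min \<tau>1 (min (1 / 64) (cst / (1584 * (?G + 1)))))"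
  have \<kappa>: "0 < \<kappa>" "\<kappa> \<le> T" "\<kappa> \<le> h^2 / (\<Theta> + 1)" "\<kappa> \<le> \<tau>1" "\<kappa> \<le> 1 / 64" "\<kappa> \<le> cst / (1584 * (?G + 1))"
  proof -
    show "0 < \<kappa>" using pos \<Theta> \<tau>1 G0 by (simp add: \<kappa>_def add_nonneg_pos)
  qed (unfold \<kappa>_def, simp_all only: min_le_iff_disj order_refl simp_thms)
  have \<kappa>G: "1584 * ?G * \<kappa> \<le> cst"
  proof -
    have "1584 * ?G * \<kappa> \<le> 1584 * (?G + 1) * \<kappa>" using \<kappa>(1) by (intro mult_right_mono) auto
    also have "\<dots> \<le> cst" using \<kappa>(6) G0 by (simp add: field_simps)
    finally show ?thesis .
  qed
  define S where "S = C8 TYPE('d) M (2 * h) (c / 2) * (105912 / cst) * \<kappa> powr (- (3 / 2)) + 1"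
  have S: "0 < S" unfolding S_def using C8_nonneg[of M "2 * h" "c / 2", where 'd = 'd] pos
    by (intro add_nonneg_pos mult_nonneg_nonneg) auto
  show ?thesis
  proof (intro exI[of _ S] conjI S allI impI)
    fix \<zeta> K :: real and W1 W2 and a b :: "real \<Rightarrow> int^'d \<Rightarrow> complex" and Z and E :: real
    assume h: "2 < \<zeta>" "1 \<le> K" and W: "potbd W1 M" "potbd W2 M" "W1 0 = 0" "W2 0 = 0" and supp: "\<forall>k. K < norm (kvec k) \<longrightarrow> W2 k = 0"
      and fl: "fourier_flow T W1 a" "fourier_flow T W2 b" and init: "a 0 = b 0" "hbd ?d (b 0) h" and coer: "coercive (b 0) c"
      and low: "\<forall>k. k \<noteq> 0 \<longrightarrow> cst * norm (kvec k) powr (- \<zeta>) \<le> cmod (b 0 k)"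
      and Z: "continuous_on {0..T} Z" "\<forall>t\<in>{0..T}. hbd 0 (\<lambda>k. b t k - a t k) (Z t)"
      and E: "integral {0..T} (\<lambda>t. (Z t)^2) \<le> E^2" "0 \<le> E"
    define \<tau> where "\<tau> = \<kappa> * K powr (- ((\<zeta> + 4) / 3))"
    have \<tau>: "0 < \<tau>" using \<kappa>(1) h by (simp add: \<tau>_def)
    have "\<tau> \<le> \<kappa> * 1" unfolding \<tau>_def using \<kappa>(1) h by (intro mult_left_mono powr_K_le_1) auto
    hence \<tau>\<kappa>: "\<tau> \<le> \<kappa>" by simp
    have \<tau>T: "\<tau> \<le> T" using \<tau>\<kappa> \<kappa> by linarith
    have fl': "fourier_flow \<tau> W1 a" "fourier_flow \<tau> W2 b" using fl \<tau>T by (auto intro: fourier_flow_restrict)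
    have \<Theta>\<tau>: "(calg TYPE('d) * M * (2 * h)^2)^2 / 2 * \<tau> \<le> h^2"
    proof -
      have "\<Theta> * \<tau> \<le> (\<Theta> + 1) * (h^2 / (\<Theta> + 1))" using \<Theta> \<tau> \<tau>\<kappa> \<kappa>(3) by (intro mult_mono) auto
      also have "\<dots> = h^2" using \<Theta> by simp
      finally show ?thesis by (simp only: \<Theta>_def)
    qed
    have bd: "hbd ?d (u t) (2 * h)" if u: "fourier_flow \<tau> W u" "potbd W M" "hbd ?d (u 0) h" and t: "t \<in> {0..\<tau>}" for u :: "real \<Rightarrow> int^'d \<Rightarrow> complex" and W t
    proof -
      obtain C0 where C0: "\<forall>t\<in>{0..\<tau>}. hbd ?d (u t) C0" using u(1) unfolding fourier_flow_def by blast
      show ?thesis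
        by (rule short_time_bound[OF u(2) less_imp_le[OF \<tau>] u(1)[unfolded fourier_flow_def, THEN conjunct1, rule_format] C0[rule_format] u(3) pos(5) \<Theta>\<tau> t])
    qed
    have "coercive (b t) (c / 2)" if t: "t \<in> {0..\<tau>}" for t
    proof -
      have "l1bd (\<lambda>m. cmod (b t m - b 0 m)) (c / 2)"
        by (rule l1[OF W(2) _ fl'(2)[unfolded fourier_flow_def, THEN conjunct1] _ t]) (use \<tau>\<kappa> \<kappa>(4) bd[OF fl'(2) W(2) init(2)] in auto)
      from coercive_perturb[OF coer this] show ?thesis by simp
    qed
    note coer' = this
    have "integral {0..\<tau>} (\<lambda>t. (Z t)^2) \<le> integral {0..T} (\<lambda>t. (Z t)^2)"
      using \<tau>T Z(1) by (intro integral_subset_le integrable_continuous_interval continuous_intros continuous_on_subset[OF Z(1)]) auto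
    hence E': "integral {0..\<tau>} (\<lambda>t. (Z t)^2) \<le> E^2" using E by linarith
    have "nrm {k. 0 < norm (kvec k) \<and> norm (kvec k) \<le> K} (\<lambda>k. W2 k - W1 k)
      \<le> C8 TYPE('d) M (2 * h) (c / 2) * (105912 / cst) * \<kappa> powr (- (3 / 2)) * K powr (3 * \<zeta> / 2) * E"
    proof (rule observability_on_modes[OF _ pos(5,3) \<kappa>(1,5) \<kappa>G \<tau>_def h W _ fl' init(1) _ _ coer'])
      show "hbd ?d (a t) (2 * h)" if "t \<in> {0..\<tau>}" for t using bd[OF fl'(1) W(1) _ that] init by simp
      show "hbd ?d (b t) (2 * h)" if "t \<in> {0..\<tau>}" for t using bd[OF fl'(2) W(2) init(2) that] .
      show "continuous_on {0..\<tau>} Z" by (rule continuous_on_subset[OF Z(1)]) (use \<tau>T in auto)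
      show "hbd 0 (\<lambda>k. b t k - a t k) (Z t)" if "t \<in> {0..\<tau>}" for t using Z(2) that \<tau>T by auto
    qed (use pos supp low E' E in auto)
    also have "\<dots> \<le> S * K powr (3 * \<zeta> / 2) * E" unfolding S_def using E(2) by (intro mult_right_mono) auto
    finally show "nrm {k. 0 < norm (kvec k) \<and> norm (kvec k) \<le> K} (\<lambda>k. W2 k - W1 k) \<le> S * K powr (3 * \<zeta> / 2) * E" .
  qed
qed

section \<open>Fourier analysis on the torus\<close>

text \<open>A density on the whole space instead of a restricted space: the space remains
  \<open>UNIV\<close> and measurability remains Borel measurability, so translated periodic
  functions can be handled without change of measure space.\<close>

definition torus :: "(real^'d) measure" where
  "torus = density lborel (indicator cube)"

lemma sets_torus [simp, measurable_cong]: "sets torus = sets borel" by (simp add: torus_def)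
lemma space_torus [simp]: "space torus = UNIV" by (simp add: torus_def)

lemma cube_measurable [measurable, simp]: "cube \<in> sets borel" by (simp add: cube_def)

lemma cube_alt: "cube = {x::real^'d. \<forall>j. 0 \<le> x $ j \<and> x $ j \<le> 1}"
proof -
  have "(One::real^'d) $ j = 1" for j
    using inner_axis[of One j "1::real"] inner_sum_left_Basis[of "axis j (1::real)"] by (simp add: axis_in_Basis_iff)
  thus ?thesis by (auto simp: cube_def mem_box_cart)
qed

lemma torus_alt: "torus = density lborel (\<lambda>x. ennreal (indicator cube x))"
  by (simp add: torus_def ennreal_indicator)

lemma measure_cube: "emeasure lborel (cube :: (real^'d) set) = 1"
proof -
  have "emeasure lborel (cbox 0 (One::real^'d)) = (\<Prod>b\<in>(Basis::(real^'d) set). (One - 0) \<bullet> b)"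
    by (subst emeasure_lborel_cbox) (auto simp: inner_sum_left_Basis)
  also have "\<dots> = 1" by (simp add: inner_sum_left_Basis)
  finally show ?thesis by (simp add: cube_def)
qed

lemma emeasure_torus_UNIV: "emeasure torus (UNIV :: (real^'d) set) = 1"
  by (simp add: torus_def emeasure_density measure_cube)

lemma measure_torus_UNIV [simp]: "measure (torus :: (real^'d) measure) UNIV = 1"
  by (simp add: measure_def emeasure_torus_UNIV)

lemma finite_measure_torus: "finite_measure (torus :: (real^'d) measure)"
  by (rule finite_measureI) (simp add: emeasure_torus_UNIV)

lemma AE_torus:
  fixes P :: "real^'d \<Rightarrow> bool"
  shows "(AE x in torus. P x) \<longleftrightarrow> (AE x in lborel. x \<in> cube \<longrightarrow> P x)"
proof -
  have "(0 < (indicator cube x :: ennreal)) = (x \<in> cube)" for x :: "real^'d" by (simp add: indicator_def)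
  thus ?thesis unfolding torus_def by (subst AE_density) simp_all
qed

lemma
  fixes f :: "real^'d \<Rightarrow> 'b::{banach, second_countable_topology}"
  assumes [measurable]: "f \<in> borel_measurable borel"
  shows set_integrable_cube: "set_integrable lborel cube f \<longleftrightarrow> integrable torus f"
    and set_integral_cube: "(LINT x:cube|lborel. f x) = integral\<^sup>L torus f"
  unfolding set_integrable_def set_lebesgue_integral_def torus_alt
  by (simp_all add: integrable_density integral_density)

definition ek :: "int^'d \<Rightarrow> real^'d \<Rightarrow> complex" where
  "ek k x = cis (2 * pi * (kvec k \<bullet> x))"

lemma ek_add: "ek (k + l) x = ek k x * ek l x"
  by (simp add: ek_def kvec_add inner_add_left cis_mult distrib_left)
lemma ek_minus: "ek (- k) x = cnj (ek k x)"
  by (simp add: ek_def kvec_minus cis_cnj)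
lemma ek_0 [simp]: "ek 0 x = 1" by (simp add: ek_def)
lemma cmod_ek [simp]: "cmod (ek k x) = 1" by (simp add: ek_def)
lemma ek_shift: "ek k (x + y) = ek k x * ek k y"
  by (simp add: ek_def inner_add_right cis_mult distrib_left)
lemma ek_neg_arg: "ek k (- x) = cnj (ek k x)"
  by (simp add: ek_def cis_cnj)

lemma kvec_inner_int: "kvec k \<bullet> kvec l = of_int (\<Sum>j\<in>UNIV. k $ j * l $ j)"
  by (simp add: inner_vec_def kvec_nth)

lemma ek_kvec: "ek k (kvec l) = 1"
  unfolding ek_def kvec_inner_int by (rule cis_multiple_2pi) (rule Ints_of_int)

lemma continuous_on_ek: "continuous_on S (ek k)"
  unfolding ek_def by (intro continuous_intros)

lemma ek_measurable [measurable]: "ek k \<in> borel_measurable borel"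
  by (intro borel_measurable_continuous_onI continuous_on_ek)

lemma cnj_ek_measurable [measurable]: "(\<lambda>x. cnj (ek k x)) \<in> borel_measurable borel"
proof -
  have "ek (- k) = (\<lambda>x. cnj (ek k x))" by (simp add: fun_eq_iff ek_minus)
  thus ?thesis using ek_measurable[of "- k"] by simp
qed

lemma fcoef_eq:
  fixes u :: "real^'d \<Rightarrow> real"
  assumes [measurable]: "u \<in> borel_measurable borel"
  shows "fcoef u k = (\<integral>x. of_real (u x) * cnj (ek k x) \<partial>torus)"
proof -
  have "cis (- 2 * pi * (kvec k \<bullet> x)) = cnj (ek k x)" for x by (simp add: ek_def cis_cnj)
  thus ?thesis unfolding fcoef_def by (simp only:) (rule set_integral_cube, measurable)
qed

text \<open>The shifted half-open cells tile the space; hence the integral over one period is invariant under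
  translation and reflection.\<close>

definition cell :: "(real^'d) set" where
  "cell = {x. \<forall>j. 0 \<le> x $ j \<and> x $ j < 1}"

lemma cell_measurable [measurable]: "cell \<in> sets borel"
proof -
  have "(cell :: (real^'d) set) = (\<Inter>j. {x. 0 \<le> x $ j} \<inter> {x. x $ j < 1})" by (auto simp: cell_def)
  also have "\<dots> \<in> sets borel"
    by (intro sets.countable_INT'' sets.Int borel_closed borel_open closed_halfspace_component_ge_cart open_halfspace_component_lt_cart) auto
  finally show ?thesis .
qed

lemma AE_cell_cube: "AE x in lborel. (x \<in> cell) \<longleftrightarrow> (x \<in> (cube :: (real^'d) set))"
proof -
  have "AE x in lborel. x $ j \<noteq> (1::real)" for j :: 'd
  proof -
    have "negligible {x::real^'d. x $ j = 1}" using negligible_standard_hyperplane[of "axis j (1::real)" 1] by (simp add: inner_axis axis_in_Basis_iff)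
    hence "{x::real^'d. x $ j = 1} \<in> null_sets lebesgue" by (simp add: negligible_iff_null_sets)
    moreover have "{x::real^'d. x $ j = 1} \<in> sets borel"
      by (intro borel_closed closed_Collect_eq continuous_intros)
    ultimately have "{x::real^'d. x $ j = 1} \<in> null_sets lborel"
      by (simp add: null_sets_def)
    thus ?thesis by (rule AE_I'[where N = "{x::real^'d. x $ j = 1}"]) auto
  qed
  hence "AE x::real^'d in lborel. \<forall>j\<in>UNIV. x $ j \<noteq> (1::real)" by (intro AE_finite_allI) auto
  thus ?thesis by eventually_elim (auto simp: cell_def cube_alt order_less_le)
qed

lemma torus_cell: "torus = density lborel (indicator cell)"
  unfolding torus_def
proof (rule density_cong)
  show "AE x in lborel. indicator cube x = (indicator cell x :: ennreal)"
    using AE_cell_cube by eventually_elim (auto simp: indicator_def)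
qed auto

lemma cell_unique: "\<exists>!k. x + kvec k \<in> (cell :: (real^'d) set)"
proof (rule ex1I)
  show "x + kvec (\<chi> j. - \<lfloor>x $ j\<rfloor>) \<in> cell"
    unfolding cell_def mem_Collect_eq
  proof
    fix j
    show "0 \<le> (x + kvec (\<chi> j. - \<lfloor>x $ j\<rfloor>)) $ j \<and> (x + kvec (\<chi> j. - \<lfloor>x $ j\<rfloor>)) $ j < 1"
    proof -
      have "0 \<le> x $ j - of_int \<lfloor>x $ j\<rfloor>" "x $ j - of_int \<lfloor>x $ j\<rfloor> < 1" by linarith+
      thus ?thesis by (simp add: kvec_nth)
    qed
  qed
next
  fix k assume h: "x + kvec k \<in> (cell :: (real^'d) set)"
  have "k $ j = - \<lfloor>x $ j\<rfloor>" for j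
  proof -
    have "0 \<le> x $ j + of_int (k $ j)" "x $ j + of_int (k $ j) < 1" using h by (auto simp: cell_def kvec_nth)
    hence "\<lfloor>x $ j\<rfloor> = - (k $ j)" unfolding floor_eq_iff by simp
    thus ?thesis by simp
  qed
  thus "k = (\<chi> j. - \<lfloor>x $ j\<rfloor>)" by (simp add: vec_eq_iff)
qed

lemma cell_tiling: "(\<integral>\<^sup>+k. indicator cell (x + kvec k) \<partial>count_space UNIV) = (1::ennreal)"
proof -
  obtain k0 where k0: "x + kvec k0 \<in> cell" "\<And>k. x + kvec k \<in> cell \<Longrightarrow> k = k0" using cell_unique[of x] by blast
  have "(indicator cell (x + kvec k) :: ennreal) = indicator {k0} k" for k
  proof (cases "k = k0")
    case False
    hence "x + kvec k \<notin> cell" using k0(2)[of k] by blast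
    thus ?thesis using False by simp
  qed (use k0(1) in simp)
  thus ?thesis by (simp add: nn_integral_indicator)
qed

lemma nn_integral_lborel_affine_pm:
  fixes f :: "real^'d \<Rightarrow> ennreal"
  assumes [measurable]: "f \<in> borel_measurable borel" and s: "\<bar>s\<bar> = 1"
  shows "(\<integral>\<^sup>+x. f (a + s *\<^sub>R x) \<partial>lborel) = (\<integral>\<^sup>+x. f x \<partial>lborel)"
proof -
  have "(\<integral>\<^sup>+x. f x \<partial>lborel) = (\<integral>\<^sup>+x. f x \<partial>(density (distr lborel borel (\<lambda>x. a + s *\<^sub>R x)) (\<lambda>_. \<bar>s\<bar>^DIM(real^'d))))"
    using lborel_affine[of s a] s by (metis abs_zero zero_neq_one)
  also have "\<dots> = (\<integral>\<^sup>+x. f x \<partial>(distr lborel borel (\<lambda>x. a + s *\<^sub>R x)))" using s by (simp add: density_1)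
  also have "\<dots> = (\<integral>\<^sup>+x. f (a + s *\<^sub>R x) \<partial>lborel)" by (subst nn_integral_distr) auto
  finally show ?thesis by simp
qed

text \<open>Unfolding and refolding: the sum of the cell indicators at all translates is inserted as
  1, each term is transformed by the affine map, where periodicity absorbs the lattice shift, and
  the sum over translates of the other cell is collapsed to 1 again.\<close>

lemma nn_integral_torus_affine:
  fixes u :: "real^'d \<Rightarrow> ennreal"
  assumes u[measurable]: "u \<in> borel_measurable borel" and p: "\<And>x k. u (x + kvec k) = u x" and s: "s = 1 \<or> s = - 1"
  shows "(\<integral>\<^sup>+x. u (a + s *\<^sub>R x) \<partial>torus) = (\<integral>\<^sup>+x. u x \<partial>torus)"
proof -
  let ?I = "indicator cell :: real^'d \<Rightarrow> ennreal"
  have s2: "s * s = 1" "\<bar>s\<bar> = 1" using s by auto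
  have "(\<integral>\<^sup>+x. u (a + s *\<^sub>R x) \<partial>torus) = (\<integral>\<^sup>+x. ?I x * u (a + s *\<^sub>R x) * (\<integral>\<^sup>+k. ?I ((a + s *\<^sub>R x) + kvec k) \<partial>count_space UNIV) \<partial>lborel)"
    unfolding torus_cell cell_tiling by (subst nn_integral_density) auto
  also have "\<dots> = (\<integral>\<^sup>+x. (\<integral>\<^sup>+k. ?I x * u (a + s *\<^sub>R x) * ?I ((a + s *\<^sub>R x) + kvec k) \<partial>count_space UNIV) \<partial>lborel)"
    by (simp add: nn_integral_cmult)
  also have "\<dots> = (\<integral>\<^sup>+k. (\<integral>\<^sup>+x. ?I x * u (a + s *\<^sub>R x) * ?I ((a + s *\<^sub>R x) + kvec k) \<partial>lborel) \<partial>count_space UNIV)"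
    by (rule nn_integral_count_space_nn_integral) auto
  also have "\<dots> = (\<integral>\<^sup>+k. (\<integral>\<^sup>+y. ?I (s *\<^sub>R (y - a) + kvec k) * u y * ?I y \<partial>lborel) \<partial>count_space UNIV)"
  proof -
    have "(\<integral>\<^sup>+x. ?I x * u (a + s *\<^sub>R x) * ?I ((a + s *\<^sub>R x) + kvec k) \<partial>lborel)
      = (\<integral>\<^sup>+y. ?I (s *\<^sub>R (y - (a + kvec k))) * u y * ?I y \<partial>lborel)" for k
    proof -
      have "(\<integral>\<^sup>+y. ?I (s *\<^sub>R (y - (a + kvec k))) * u y * ?I y \<partial>lborel)
        = (\<integral>\<^sup>+x. ?I (s *\<^sub>R ((a + kvec k) + s *\<^sub>R x - (a + kvec k))) * u ((a + kvec k) + s *\<^sub>R x) * ?I ((a + kvec k) + s *\<^sub>R x) \<partial>lborel)"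
        by (rule nn_integral_lborel_affine_pm[where a = "a + kvec k" and s = s, symmetric]) (use s2 in auto)
      also have "\<dots> = (\<integral>\<^sup>+x. ?I x * u (a + s *\<^sub>R x) * ?I ((a + s *\<^sub>R x) + kvec k) \<partial>lborel)"
        using s2 p[of "a + s *\<^sub>R x" k for x] by (simp add: add_ac)
      finally show ?thesis by simp
    qed
    moreover have "(\<integral>\<^sup>+k. (\<integral>\<^sup>+y. ?I (s *\<^sub>R (y - (a + kvec k))) * u y * ?I y \<partial>lborel) \<partial>count_space UNIV)
      = (\<integral>\<^sup>+k. (\<integral>\<^sup>+y. ?I (s *\<^sub>R (y - a) + kvec k) * u y * ?I y \<partial>lborel) \<partial>count_space UNIV)"
    proof (cases "s = 1")
      case True
      have b: "bij_betw (uminus :: int^'d \<Rightarrow> int^'d) UNIV UNIV" by (rule bij_uminus)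
      show ?thesis
        by (subst nn_integral_bij_count_space[OF b, symmetric]) (simp add: True kvec_minus algebra_simps)
    next
      case False
      hence "s = -1" using s by simp
      thus ?thesis by (simp add: algebra_simps)
    qed
    ultimately show ?thesis by simp
  qed
  also have "\<dots> = (\<integral>\<^sup>+y. (\<integral>\<^sup>+k. ?I (s *\<^sub>R (y - a) + kvec k) * u y * ?I y \<partial>count_space UNIV) \<partial>lborel)"
    by (rule nn_integral_count_space_nn_integral[symmetric]) auto
  also have "\<dots> = (\<integral>\<^sup>+y. (u y * ?I y) * (\<integral>\<^sup>+k. ?I (s *\<^sub>R (y - a) + kvec k) \<partial>count_space UNIV) \<partial>lborel)"
    by (subst nn_integral_cmult[symmetric]) (auto simp: mult_ac)
  also have "\<dots> = (\<integral>\<^sup>+x. u x \<partial>torus)"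
    unfolding torus_cell cell_tiling by (subst nn_integral_density) (auto simp: mult.commute)
  finally show ?thesis .
qed

definition frc :: "real^'d \<Rightarrow> real^'d" where
  "frc x = x + kvec (\<chi> j. - \<lfloor>x $ j\<rfloor>)"

lemma frc_measurable [measurable]: "(frc :: real^'d \<Rightarrow> real^'d) \<in> borel_measurable borel"
proof -
  have "(\<lambda>x::real^'d. frc x $ j) \<in> borel_measurable borel" for j :: 'd
  proof -
    have [measurable]: "(\<lambda>x::real^'d. x $ j) \<in> borel_measurable borel"
      by (intro borel_measurable_continuous_onI continuous_intros)
    have "(\<lambda>x::real^'d. x $ j + of_int (- \<lfloor>x $ j\<rfloor>)) \<in> borel_measurable borel" by measurable
    thus ?thesis by (simp add: frc_def kvec_nth)
  qed
  hence "(\<lambda>x::real^'d. frc x \<bullet> b) \<in> borel_measurable borel" if "b \<in> Basis" for b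
    using that by (auto simp: Basis_vec_def inner_axis)
  thus ?thesis by (subst borel_measurable_euclidean_space) blast
qed

lemma frc_periodic: "frc (x + kvec k) = frc x"
  by (simp add: frc_def vec_eq_iff kvec_nth)

lemma periodic_frc: "periodic u \<Longrightarrow> u (frc x) = u x"
  by (simp add: periodic_def frc_def)

text \<open>Invariance for indicators of periodic sets identifies two image measures on the cell. A
  periodic function factors through \<open>frc\<close>, so integrability and integrals of
  vector-valued functions follow by comparing these images.\<close>

lemma distr_torus_affine:
  fixes a :: "real^'d"
  assumes s: "s = 1 \<or> s = - 1"
  shows "distr torus borel (\<lambda>x. frc (a + s *\<^sub>R x)) = distr torus borel frc"
proof (rule measure_eqI)
  fix A :: "(real^'d) set" assume "A \<in> sets (distr torus borel (\<lambda>x. frc (a + s *\<^sub>R x)))"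
  hence A[measurable]: "A \<in> sets borel" by simp
  have em: "emeasure (distr torus borel g) A = (\<integral>\<^sup>+x. indicator A (g x) \<partial>torus)"
    if [measurable]: "g \<in> borel_measurable borel" for g :: "real^'d \<Rightarrow> real^'d"
    by (subst nn_integral_indicator[symmetric], simp, subst nn_integral_distr) auto
  have "emeasure (distr torus borel (\<lambda>x. frc (a + s *\<^sub>R x))) A = (\<integral>\<^sup>+x. indicator A (frc (a + s *\<^sub>R x)) \<partial>torus)"
    by (rule em) measurable
  also have "\<dots> = (\<integral>\<^sup>+x. indicator A (frc x) \<partial>torus)"
    by (rule nn_integral_torus_affine[where u = "\<lambda>x. indicator A (frc x)"]) (use s in \<open>auto simp: frc_periodic\<close>)
  also have "\<dots> = emeasure (distr torus borel frc) A"
    by (rule em[symmetric]) measurable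
  finally show "emeasure (distr torus borel (\<lambda>x. frc (a + s *\<^sub>R x))) A = emeasure (distr torus borel frc) A" .
qed simp

lemma
  fixes f :: "real^'d \<Rightarrow> 'b::{banach, second_countable_topology}"
  assumes f[measurable]: "f \<in> borel_measurable borel" and p: "periodic f" and s: "s = 1 \<or> s = - 1"
  shows integrable_torus_affine: "integrable torus (\<lambda>x. f (a + s *\<^sub>R x)) \<longleftrightarrow> integrable torus f"
    and integral_torus_affine: "(\<integral>x. f (a + s *\<^sub>R x) \<partial>torus) = (\<integral>x. f x \<partial>torus)"
proof -
  have 1: "integrable torus (\<lambda>x. f (a + s *\<^sub>R x)) \<longleftrightarrow> integrable (distr torus borel (\<lambda>x. frc (a + s *\<^sub>R x))) f"
    by (subst integrable_distr_eq) (auto simp: periodic_frc[OF p])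
  have 2: "integrable torus f \<longleftrightarrow> integrable (distr torus borel frc) f"
    by (subst integrable_distr_eq) (auto simp: periodic_frc[OF p])
  show "integrable torus (\<lambda>x. f (a + s *\<^sub>R x)) \<longleftrightarrow> integrable torus f"
    unfolding 1 2 distr_torus_affine[OF s] ..
  have 3: "(\<integral>x. f (a + s *\<^sub>R x) \<partial>torus) = integral\<^sup>L (distr torus borel (\<lambda>x. frc (a + s *\<^sub>R x))) f"
    by (subst integral_distr) (auto simp: periodic_frc[OF p])
  have 4: "(\<integral>x. f x \<partial>torus) = integral\<^sup>L (distr torus borel frc) f"
    by (subst integral_distr) (auto simp: periodic_frc[OF p])
  show "(\<integral>x. f (a + s *\<^sub>R x) \<partial>torus) = (\<integral>x. f x \<partial>torus)"
    unfolding 3 4 distr_torus_affine[OF s] ..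
qed

section \<open>Characters, trigonometric polynomials and uniqueness of Fourier coefficients\<close>

lemma periodic_ek: "periodic (ek k)"
  by (simp add: periodic_def ek_shift ek_kvec)

lemma integrable_torus_bounded:
  fixes f :: "real^'d \<Rightarrow> 'b::{banach, second_countable_topology}"
  assumes "f \<in> borel_measurable borel" "\<And>x. norm (f x) \<le> B"
  shows "integrable torus f"
proof -
  interpret finite_measure "torus :: (real^'d) measure" by (rule finite_measure_torus)
  show ?thesis by (rule integrable_const_bound[where B = B]) (use assms in auto)
qed

text \<open>A shift by half a wavelength in a coordinate with k_j \<noteq> 0 changes the sign of the
  character but not its integral.\<close>

lemma integral_ek: "(\<integral>x. ek (k::int^'d) x \<partial>torus) = (if k = 0 then 1 else 0)"
proof (cases "k = 0")
  case True thus ?thesis by simp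
next
  case False
  then obtain j where j: "k $ j \<noteq> 0" by (auto simp: vec_eq_iff)
  define a :: "real^'d" where "a = axis j (1 / (2 * of_int (k $ j)))"
  have "kvec k \<bullet> a = 1 / 2" using j by (simp add: a_def inner_axis kvec_nth)
  hence ea: "ek k a = - 1" unfolding ek_def by (simp only:) simp
  have "(\<integral>x. ek k x \<partial>torus) = (\<integral>x. ek k (a + 1 *\<^sub>R x) \<partial>torus)"
    by (rule integral_torus_affine[symmetric]) (auto simp: periodic_ek)
  also have "\<dots> = - (\<integral>x. ek k x \<partial>torus)" by (simp add: ek_shift ea)
  finally show ?thesis using False by simp
qed

text \<open>The set \<open>A\<close> contains all frequencies that may occur. Products then live on
  sumsets, and coefficients outside \<open>A\<close> vanish by induction, without any normal form
  for the polynomial.\<close>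

inductive trigp :: "(int^'d) set \<Rightarrow> (real^'d \<Rightarrow> complex) \<Rightarrow> bool" for A where
  trigp_zero: "trigp A (\<lambda>x. 0)"
| trigp_ek: "k \<in> A \<Longrightarrow> trigp A (ek k)"
| trigp_scale: "trigp A f \<Longrightarrow> trigp A (\<lambda>x. c * f x)"
| trigp_add: "trigp A f \<Longrightarrow> trigp A g \<Longrightarrow> trigp A (\<lambda>x. f x + g x)"

lemma trigp_mono: "trigp A f \<Longrightarrow> A \<subseteq> B \<Longrightarrow> trigp B f"
  by (induction rule: trigp.induct) (auto intro: trigp.intros)

lemma trigp_const: "0 \<in> A \<Longrightarrow> trigp A (\<lambda>x. c)"
  using trigp_scale[OF trigp_ek, of 0 A c] by (simp add: ek_0[abs_def])

lemma trigp_ek_mult: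
  assumes "trigp B g" "k \<in> A" shows "trigp {a + b |a b. a \<in> A \<and> b \<in> B} (\<lambda>x. ek k x * g x)"
  using assms(1)
proof induction
  case (trigp_ek l)
  have eq: "(\<lambda>x. ek k x * ek l x) = ek (k + l)" by (simp add: fun_eq_iff ek_add)
  show ?case unfolding eq by (rule trigp.trigp_ek) (use trigp_ek assms(2) in blast)
next
  case (trigp_scale f c)
  thus ?case using trigp.trigp_scale[OF trigp_scale.IH, of c] by (simp add: mult.left_commute)
next
  case (trigp_add f g)
  thus ?case using trigp.trigp_add[OF trigp_add.IH] by (simp add: distrib_left)
qed (simp add: trigp.trigp_zero)

lemma trigp_mult:
  assumes "trigp A f" "trigp B g" shows "trigp {a + b |a b. a \<in> A \<and> b \<in> B} (\<lambda>x. f x * g x)"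
  using assms(1)
proof induction
  case (trigp_ek k) thus ?case by (rule trigp_ek_mult[OF assms(2)])
next
  case (trigp_scale f c)
  thus ?case using trigp.trigp_scale[OF trigp_scale.IH, of c] by (simp add: mult.assoc)
next
  case (trigp_add f g)
  thus ?case using trigp.trigp_add[OF trigp_add.IH] by (simp add: distrib_right)
qed (simp add: trigp.trigp_zero)

lemma trigp_sum: "(\<And>i. i \<in> I \<Longrightarrow> trigp A (f i)) \<Longrightarrow> trigp A (\<lambda>x. \<Sum>i\<in>I. f i x)"
  by (induction I rule: infinite_finite_induct) (auto intro: trigp.intros)

lemma trigp_measurable: "trigp A f \<Longrightarrow> f \<in> borel_measurable borel"
  by (induction rule: trigp.induct) auto

lemma trigp_integral_zero:
  fixes f :: "real^'d \<Rightarrow> complex"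
  assumes f: "integrable torus f" and z: "\<And>k. (\<integral>x. f x * ek k x \<partial>torus) = 0"
  shows "trigp A p \<Longrightarrow> integrable torus (\<lambda>x. f x * p x) \<and> (\<integral>x. f x * p x \<partial>torus) = 0"
proof (induction rule: trigp.induct)
  case (trigp_ek k)
  have "integrable torus (\<lambda>x. f x * ek k x)"
    by (rule Bochner_Integration.integrable_bound[OF f]) (use f in \<open>auto simp: norm_mult\<close>)
  thus ?case using z by simp
next
  case (trigp_scale p c)
  hence "integrable torus (\<lambda>x. c * (f x * p x))" "(\<integral>x. c * (f x * p x) \<partial>torus) = 0" by auto
  thus ?case by (simp add: mult.left_commute)
next
  case (trigp_add p q)
  thus ?case by (simp add: distrib_left)
qed simp

text \<open>Maps the torus to a compact subset of C^d, where real polynomials approximate continuous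
  functions; composed with this map they are trigonometric polynomials.\<close>

definition circ :: "real^'d \<Rightarrow> complex^'d" where
  "circ x = (\<chi> j. cis (2 * pi * x $ j))"

lemma continuous_on_circ: "continuous_on S circ"
  unfolding circ_def by (intro continuous_intros)

lemma ek_axis: "ek (axis j 1) x = cis (2 * pi * x $ j)"
proof -
  have "kvec (axis j 1) = axis j (1::real)" by (simp add: kvec_def vec_eq_iff axis_def)
  thus ?thesis by (simp add: ek_def inner_axis')
qed

lemma trigp_circ_component:
  assumes "b \<in> Basis" shows "trigp UNIV (\<lambda>x. of_real (circ x \<bullet> b))"
proof -
  obtain j u where b: "b = axis j u" "u \<in> (Basis :: complex set)" using assms by (auto simp: Basis_vec_def)
  have c: "circ x \<bullet> b = cis (2 * pi * x $ j) \<bullet> u" for x by (simp add: b circ_def inner_axis)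
  let ?p = "ek (axis j 1) :: real^_ \<Rightarrow> complex" and ?m = "ek (- axis j 1) :: real^_ \<Rightarrow> complex"
  have m: "?m x = cnj (cis (2 * pi * x $ j))" for x by (simp add: ek_minus ek_axis)
  have "u = 1 \<or> u = \<i>" using b by (simp add: Basis_complex_def)
  thus ?thesis
  proof
    assume u: "u = 1"
    have e: "(\<lambda>x. of_real (circ x \<bullet> b)) = (\<lambda>x. (1/2) * ?p x + (1/2) * ?m x)"
      unfolding c m ek_axis u by (auto simp: fun_eq_iff complex_eq_iff inner_complex_def)
    show ?thesis unfolding e by (intro trigp_add trigp_scale trigp_ek UNIV_I)
  next
    assume u: "u = \<i>"
    have e: "(\<lambda>x. of_real (circ x \<bullet> b)) = (\<lambda>x. (- \<i>/2) * ?p x + (\<i>/2) * ?m x)"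
      unfolding c m ek_axis u by (auto simp: fun_eq_iff complex_eq_iff inner_complex_def)
    show ?thesis unfolding e by (intro trigp_add trigp_scale trigp_ek UNIV_I)
  qed
qed

lemma trigp_UNIV_mult: "trigp UNIV f \<Longrightarrow> trigp UNIV g \<Longrightarrow> trigp UNIV (\<lambda>x. f x * g x)"
  by (rule trigp_mono[OF trigp_mult]) auto

lemma trigp_polynomial:
  fixes p :: "complex^'d \<Rightarrow> real"
  shows "real_polynomial_function p \<Longrightarrow> trigp UNIV (\<lambda>x. of_real (p (circ x)))"
proof (induction rule: real_polynomial_function.induct)
  case (linear f)
  interpret bounded_linear f by fact
  have fz: "f z = (\<Sum>b\<in>Basis. (z \<bullet> b) * f b)" for z
    by (subst euclidean_representation[of z, symmetric]) (simp add: sum scaleR)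
  have "(\<lambda>x. of_real (f (circ x)) :: complex) = (\<lambda>x. \<Sum>b\<in>Basis. of_real (f b) * of_real (circ x \<bullet> b))"
    unfolding fz[of "circ _"] of_real_sum of_real_mult by (simp only: mult.commute)
  thus ?case by (auto intro!: trigp_sum trigp_scale trigp_circ_component)
next
  case (add f g) thus ?case using trigp_add by fastforce
next
  case (mult f g) thus ?case using trigp_UNIV_mult by fastforce
qed (auto intro: trigp_const)

lemma AE_torus_interior: "AE x in (torus :: (real^'d) measure). \<forall>j. 0 < x $ j \<and> x $ j < 1"
proof -
  have "AE x in lborel. x $ j \<noteq> (c::real)" for j :: 'd and c
  proof -
    have "negligible {x::real^'d. x $ j = c}" using negligible_standard_hyperplane[of "axis j (1::real)" c]
      by (simp add: inner_axis axis_in_Basis_iff)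
    hence "{x::real^'d. x $ j = c} \<in> null_sets lebesgue" by (simp add: negligible_iff_null_sets)
    moreover have "{x::real^'d. x $ j = c} \<in> sets borel"
      by (intro borel_closed closed_Collect_eq continuous_intros)
    ultimately have "{x::real^'d. x $ j = c} \<in> null_sets lborel" by (simp add: null_sets_def)
    thus ?thesis by (rule AE_I'[where N = "{x::real^'d. x $ j = c}"]) auto
  qed
  hence "AE x::real^'d in lborel. \<forall>j\<in>UNIV. x $ j \<noteq> (1::real)" "AE x::real^'d in lborel. \<forall>j\<in>UNIV. x $ j \<noteq> (0::real)"
    by (intro AE_finite_allI; auto)+
  thus ?thesis unfolding AE_torus by eventually_elim (auto simp: cube_alt order_less_le)
qed

lemma circ_inj:
  fixes x y :: "real^'d"
  assumes "circ x = circ y" "\<forall>j. 0 < x $ j \<and> x $ j < 1" "y \<in> cube"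
  shows "x = y"
proof -
  have "x $ j = y $ j" for j
  proof -
    have "cis (2 * pi * x $ j) = cis (2 * pi * y $ j)" using assms(1) by (auto simp: circ_def vec_eq_iff)
    hence "sin (2 * pi * x $ j) = sin (2 * pi * y $ j) \<and> cos (2 * pi * x $ j) = cos (2 * pi * y $ j)"
      by (simp add: complex_eq_iff)
    then obtain n :: int where "2 * pi * x $ j = 2 * pi * y $ j + 2 * pi * n"
      unfolding sin_cos_eq_iff by blast
    hence "2 * pi * (x $ j) = 2 * pi * (y $ j + of_int n)" by (simp only: distrib_left)
    hence n: "x $ j = y $ j + of_int n" by simp
    moreover have "0 < x $ j" "x $ j < 1" "0 \<le> y $ j" "y $ j \<le> 1" using assms by (auto simp: cube_alt)
    ultimately have "- 1 < (of_int n :: real)" "(of_int n :: real) < 1" by linarith+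
    hence "n = 0" by linarith
    thus ?thesis using n by simp
  qed
  thus ?thesis by (simp add: vec_eq_iff)
qed

lemma circ_measurable [measurable]: "(circ :: real^'d \<Rightarrow> complex^'d) \<in> borel_measurable borel"
  by (intro borel_measurable_continuous_onI continuous_on_circ)

text \<open>Stone--Weierstrass on the image of the cube in the product of circles.\<close>

lemma fourier_unique:
  fixes f :: "real^'d \<Rightarrow> real"
  assumes f: "integrable torus f" and z: "\<And>k. (\<integral>x. of_real (f x) * ek k x \<partial>torus) = 0"
  shows "AE x in torus. f x = 0"
proof -
  have fm [measurable]: "f \<in> borel_measurable borel" using f by (auto dest: borel_measurable_integrable)
  define T where "T = (circ ` cube :: (complex^'d) set)"
  have compT: "compact T" unfolding T_def cube_def by (intro compact_continuous_image continuous_on_circ) simp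
  have cubeT: "AE x in torus. circ x \<in> T" unfolding AE_torus T_def by simp
  have f_int: "integrable torus (\<lambda>x. f x * g x)" if [measurable]: "g \<in> borel_measurable borel" and "AE x in torus. \<bar>g x\<bar> \<le> B" for g :: "real^'d \<Rightarrow> real" and B
  proof (rule Bochner_Integration.integrable_bound)
    show "integrable torus (\<lambda>x. B * f x)" using f by simp
    show "AE x in torus. norm (f x * g x) \<le> norm (B * f x)"
      using that(2) by eventually_elim (auto simp: abs_mult mult.commute[of "\<bar>f _\<bar>"] intro!: mult_right_mono)
  qed measurable
  have cont: "(\<integral>x. f x * h (circ x) \<partial>torus) = 0" if h: "continuous_on UNIV h" for h :: "complex^'d \<Rightarrow> real"
  proof -
    have hm [measurable]: "h \<in> borel_measurable borel" by (intro borel_measurable_continuous_onI h)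
    have "bounded (h ` T)" by (intro compact_imp_bounded compact_continuous_image compT continuous_on_subset[OF h]) auto
    then obtain B where B: "\<And>w. w \<in> T \<Longrightarrow> \<bar>h w\<bar> \<le> B" by (auto simp: bounded_iff)
    have ih: "integrable torus (\<lambda>x. f x * h (circ x))"
      by (rule f_int[of _ B]) (use cubeT B in \<open>auto elim: AE_mp\<close>)
    have "\<bar>\<integral>x. f x * h (circ x) \<partial>torus\<bar> \<le> e * (\<integral>x. \<bar>f x\<bar> \<partial>torus)" if e: "0 < e" for e
    proof -
      obtain p where p: "real_polynomial_function p" "\<And>w. w \<in> T \<Longrightarrow> \<bar>h w - p w\<bar> < e"
        using Stone_Weierstrass_real_polynomial_function[OF compT continuous_on_subset[OF h subset_UNIV] e] by blast
      have "integrable torus (\<lambda>x. complex_of_real (f x) * of_real (p (circ x))) \<and> (\<integral>x. complex_of_real (f x) * of_real (p (circ x)) \<partial>torus) = 0"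
        by (rule trigp_integral_zero[OF _ z trigp_polynomial[OF p(1)]]) (use f in simp)
      hence ip: "integrable torus (\<lambda>x. f x * p (circ x))" and p0: "(\<integral>x. f x * p (circ x) \<partial>torus) = 0"
        by (simp_all only: of_real_mult[symmetric] integral_complex_of_real complex_of_real_integrable_eq of_real_eq_0_iff)
      have "(\<integral>x. f x * h (circ x) \<partial>torus) = (\<integral>x. f x * h (circ x) - f x * p (circ x) \<partial>torus)"
        using ih ip p0 by simp
      also have "\<bar>\<dots>\<bar> \<le> (\<integral>x. \<bar>f x * h (circ x) - f x * p (circ x)\<bar> \<partial>torus)" by (rule integral_abs_bound)
      also have "\<dots> \<le> (\<integral>x. e * \<bar>f x\<bar> \<partial>torus)"
      proof (rule integral_mono_AE)
        show "AE x in torus. \<bar>f x * h (circ x) - f x * p (circ x)\<bar> \<le> e * \<bar>f x\<bar>"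
          using cubeT
        proof eventually_elim
          case (elim x)
          have "\<bar>f x * h (circ x) - f x * p (circ x)\<bar> = \<bar>h (circ x) - p (circ x)\<bar> * \<bar>f x\<bar>"
            by (simp add: abs_mult[symmetric] algebra_simps)
          also have "\<dots> \<le> e * \<bar>f x\<bar>" using p(2)[OF elim] by (intro mult_right_mono) auto
          finally show ?case .
        qed
      qed (use ih ip f in auto)
      finally show ?thesis by simp
    qed
    note e = this
    have "\<bar>\<integral>x. f x * h (circ x) \<partial>torus\<bar> \<le> 0"
    proof (rule field_le_epsilon)
      fix \<epsilon> :: real assume "0 < \<epsilon>"
      define I where "I = (\<integral>x. \<bar>f x\<bar> \<partial>torus)"
      have I: "0 \<le> I" by (simp add: I_def)
      have "\<bar>\<integral>x. f x * h (circ x) \<partial>torus\<bar> \<le> \<epsilon> / (I + 1) * I" unfolding I_def by (rule e) (use \<open>0 < \<epsilon>\<close> I in \<open>simp add: I_def add_nonneg_pos\<close>)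
      also have "\<dots> \<le> \<epsilon>" using I \<open>0 < \<epsilon>\<close> by (simp add: field_simps)
      finally show "\<bar>\<integral>x. f x * h (circ x) \<partial>torus\<bar> \<le> 0 + \<epsilon>" by simp
    qed
    thus ?thesis by simp
  qed
  \<comment> \<open>The indicator of the compact image \<open>D\<close> is the pointwise limit of
    the continuous functions max 0 (1 - n dist), so dominated convergence carries the vanishing of
    the integrals from continuous functions to closed sets.\<close>
  have closed0: "(\<integral>x\<in>C. f x \<partial>torus) = 0" if C: "closed C" for C :: "(real^'d) set"
  proof (cases "C \<inter> cube = {}")
    case True
    have "(\<integral>x\<in>C. f x \<partial>torus) = (\<integral>x. 0 \<partial>(torus :: (real^'d) measure))"
      unfolding set_lebesgue_integral_def
    proof (rule integral_cong_AE)
      show "AE x in torus. indicat_real C x *\<^sub>R f x = 0" unfolding AE_torus using True by (auto simp: indicator_def)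
    qed (use borel_closed[OF C] in auto)
    thus ?thesis by simp
  next
    case False
    define D where "D = circ ` (C \<inter> cube)"
    have "compact (C \<inter> cube)" unfolding cube_def using C by (intro closed_Int_compact) auto
    hence D: "compact D" "closed D" "D \<noteq> {}"
      unfolding D_def using False by (auto intro!: compact_continuous_image continuous_on_circ compact_imp_closed)
    define h where "h n w = max 0 (1 - real n * infdist w D)" for n and w :: "complex^'d"
    have ch: "continuous_on UNIV (h n)" for n unfolding h_def by (intro continuous_intros)
    have hm [measurable]: "h n \<in> borel_measurable borel" for n by (intro borel_measurable_continuous_onI ch)
    have D_meas [measurable]: "D \<in> sets borel" using D by simp
    have lim: "(\<lambda>n. h n w) \<longlonglongrightarrow> indicator D w" for w
    proof (cases "w \<in> D")
      case True
      hence "infdist w D = 0" by simp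
      thus ?thesis using True by (simp add: h_def)
    next
      case False
      hence i: "0 < infdist w D" by (intro infdist_pos_not_in_closed D)
      obtain N where N: "1 < real N * infdist w D" using reals_Archimedean3[OF i, rule_format, of 1] by blast
      have "h n w = 0" if "N \<le> n" for n
      proof -
        have "real N * infdist w D \<le> real n * infdist w D" using that i by (intro mult_right_mono) auto
        thus ?thesis using N by (simp add: h_def)
      qed
      hence "\<forall>\<^sub>F n in sequentially. h n w = 0" by (auto simp: eventually_sequentially)
      hence "(\<lambda>n. h n w) \<longlonglongrightarrow> 0" by (rule tendsto_eventually)
      thus ?thesis using False by simp
    qed
    have "(\<lambda>n. \<integral>x. f x * h n (circ x) \<partial>torus) \<longlonglongrightarrow> (\<integral>x. f x * indicator D (circ x) \<partial>torus)"
    proof (rule integral_dominated_convergence[where w = "\<lambda>x. \<bar>f x\<bar>"])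
      show "AE x in torus. (\<lambda>n. f x * h n (circ x)) \<longlonglongrightarrow> f x * indicator D (circ x)"
        by (intro AE_I2 tendsto_intros lim)
      show "AE x in torus. norm (f x * h n (circ x)) \<le> \<bar>f x\<bar>" for n
      proof (rule AE_I2)
        fix x
        have "\<bar>h n (circ x)\<bar> \<le> 1" by (auto simp: h_def infdist_nonneg)
        thus "norm (f x * h n (circ x)) \<le> \<bar>f x\<bar>" using mult_left_mono[of "\<bar>h n (circ x)\<bar>" 1 "\<bar>f x\<bar>"] by (simp add: abs_mult)
      qed
      show "(\<lambda>x. f x * indicator D (circ x)) \<in> borel_measurable torus" by measurable
      show "(\<lambda>x. f x * h n (circ x)) \<in> borel_measurable torus" for n by measurable
    qed (use f in auto)
    hence "(\<integral>x. f x * indicator D (circ x) \<partial>torus) = 0" using cont[OF ch] LIMSEQ_unique[OF tendsto_const] by fastforce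
    moreover have "(\<integral>x\<in>C. f x \<partial>torus) = (\<integral>x. f x * indicator D (circ x) \<partial>torus)"
      unfolding set_lebesgue_integral_def
    proof (rule integral_cong_AE)
      have "AE x in (torus :: (real^'d) measure). x \<in> cube" unfolding AE_torus by simp
      \<comment> \<open>The map \<open>circ\<close> identifies opposite faces of the cube, hence it
        recovers membership in \<open>C\<close> only at interior points; the faces are a null
        set.\<close>
      with AE_torus_interior show "AE x in torus. indicat_real C x *\<^sub>R f x = f x * indicator D (circ x)"
      proof eventually_elim
        case (elim x)
        have "circ x \<in> D \<longleftrightarrow> x \<in> C" using elim circ_inj[of x] by (auto simp: D_def)
        thus ?case by (simp add: indicator_def)
      qed
    qed (use borel_closed[OF C] in measurable)
    ultimately show ?thesis by simp
  qed
  have all: "(\<integral>x\<in>A. f x \<partial>torus) = 0" if "A \<in> sets borel" for A :: "(real^'d) set"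
  proof -
    have "Int_stable (Collect closed :: (real^'d) set set)" "Collect closed \<subseteq> Pow (UNIV :: (real^'d) set)"
      by (auto simp: Int_stable_def)
    moreover have "A \<in> sigma_sets UNIV (Collect closed)" using that by (simp add: borel_eq_closed)
    ultimately show ?thesis
    proof (induction rule: sigma_sets_induct_disjoint)
      case (compl A)
      have A: "A \<in> sets borel" using compl by (simp add: borel_eq_closed)
      have "(\<integral>x\<in>UNIV - A. f x \<partial>torus) = (\<integral>x\<in>UNIV. f x \<partial>torus) - (\<integral>x\<in>A. f x \<partial>torus)"
      proof -
        have "(\<integral>x\<in>UNIV - A. f x \<partial>torus) = (\<integral>x. f x - indicator A x *\<^sub>R f x \<partial>torus)"
          unfolding set_lebesgue_integral_def by (rule Bochner_Integration.integral_cong) (auto simp: indicator_def)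
        also have "\<dots> = (\<integral>x. f x \<partial>torus) - (\<integral>x. indicator A x *\<^sub>R f x \<partial>torus)"
          using f A by (intro Bochner_Integration.integral_diff integrable_mult_indicator) auto
        finally show ?thesis by (simp add: set_lebesgue_integral_def)
      qed
      thus ?case using compl closed0[of UNIV] by simp
    next
      case (union A)
      have A: "A i \<in> sets torus" for i using union by (auto simp: borel_eq_closed)
      have "(\<integral>x\<in>(\<Union>i. A i). f x \<partial>torus) = (\<Sum>i. \<integral>x\<in>A i. f x \<partial>torus)"
      proof (rule lebesgue_integral_countable_add[OF A])
        show "A i \<inter> A j = {}" if "i \<noteq> j" for i j using union(1) that by (auto simp: disjoint_family_on_def)
        show "set_integrable torus (\<Union>i. A i) f" unfolding set_integrable_def using f A by (intro integrable_mult_indicator) auto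
      qed
      thus ?case using union by simp
    qed (auto simp: closed0)
  qed
  show ?thesis by (rule density_unique_real[OF f, of "\<lambda>_. 0"]) (use all in auto)
qed

section \<open>Absolutely convergent Fourier series\<close>

definition fser :: "(int^'d \<Rightarrow> complex) \<Rightarrow> real^'d \<Rightarrow> complex" where
  "fser c x = (\<Sum>\<^sub>\<infinity>l. c l * ek l x)"

abbreviation abs_sum :: "(int^'d \<Rightarrow> complex) \<Rightarrow> bool" where
  "abs_sum c \<equiv> (\<lambda>l. cmod (c l)) summable_on UNIV"

lemma fser_uniform:
  assumes "abs_sum c"
  shows "uniform_limit UNIV (\<lambda>F x. \<Sum>l\<in>F. c l * ek l x) (fser c) (finite_subsets_at_top UNIV)"
  unfolding fser_def[abs_def]
  by (rule Weierstrass_m_test_general[OF _ assms]) (simp add: norm_mult)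

lemma fser_continuous: "abs_sum c \<Longrightarrow> continuous_on UNIV (fser c)"
  by (rule uniform_limit_theorem[OF _ fser_uniform])
    (auto intro!: always_eventually continuous_intros continuous_on_ek)

lemma fser_measurable: "abs_sum c \<Longrightarrow> fser c \<in> borel_measurable borel"
  by (intro borel_measurable_continuous_onI fser_continuous)

lemma fser_bound: "abs_sum c \<Longrightarrow> cmod (fser c x) \<le> (\<Sum>\<^sub>\<infinity>l. cmod (c l))"
  unfolding fser_def
  using norm_infsum_bound[of "\<lambda>l. c l * ek l x" UNIV] by (simp add: norm_mult)

lemma integrable_mult_bounded:
  fixes w g :: "real^'d \<Rightarrow> complex"
  assumes "integrable torus w" "g \<in> borel_measurable borel" "\<And>x. cmod (g x) \<le> B"
  shows "integrable torus (\<lambda>x. w x * g x)"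
proof (rule Bochner_Integration.integrable_bound)
  show "integrable torus (\<lambda>x. of_real B * w x)" using assms(1) by simp
  show "(\<lambda>x. w x * g x) \<in> borel_measurable torus"
    using assms(1,2) by (intro borel_measurable_times) (auto dest: borel_measurable_integrable)
  show "AE x in torus. norm (w x * g x) \<le> norm (complex_of_real B * w x)"
  proof (rule AE_I2)
    fix x
    have "0 \<le> B" using assms(3)[of x] norm_ge_zero order_trans by blast
    thus "norm (w x * g x) \<le> norm (complex_of_real B * w x)"
      using mult_right_mono[OF assms(3)[of x], of "cmod (w x)"] by (simp add: norm_mult mult.commute)
  qed
qed

text \<open>Uniform convergence of the partial sums permits the exchange of sum and integral against
  any integrable \<open>w\<close>.\<close>

lemma fser_integral:
  fixes w :: "real^'d \<Rightarrow> complex"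
  assumes c: "abs_sum c" and w: "integrable torus w"
  shows "integrable torus (\<lambda>x. w x * fser c x)"
    and "((\<lambda>l. c l * (\<integral>x. w x * ek l x \<partial>torus)) has_sum (\<integral>x. w x * fser c x \<partial>torus)) UNIV"
proof -
  show int: "integrable torus (\<lambda>x. w x * fser c x)"
    by (rule integrable_mult_bounded[OF w fser_measurable[OF c] fser_bound[OF c]])
  have iek: "integrable torus (\<lambda>x. w x * ek l x)" for l
    by (rule integrable_mult_bounded[OF w, of _ 1]) auto
  define I where "I = (\<integral>x. cmod (w x) \<partial>torus)"
  have I: "0 \<le> I" by (simp add: I_def)
  show "((\<lambda>l. c l * (\<integral>x. w x * ek l x \<partial>torus)) has_sum (\<integral>x. w x * fser c x \<partial>torus)) UNIV"
    unfolding has_sum_def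
  proof (rule tendstoI)
    fix e :: real assume e: "0 < e"
    define e' where "e' = e / (I + 1)"
    have e': "0 < e'" using e I by (simp add: e'_def add_nonneg_pos)
    have "\<forall>\<^sub>F F in finite_subsets_at_top UNIV. \<forall>x\<in>UNIV. dist (\<Sum>l\<in>F. c l * ek l x) (fser c x) < e'"
      by (rule uniform_limitD[OF fser_uniform[OF c] e'])
    thus "\<forall>\<^sub>F F in finite_subsets_at_top UNIV. dist (\<Sum>l\<in>F. c l * (\<integral>x. w x * ek l x \<partial>torus)) (\<integral>x. w x * fser c x \<partial>torus) < e"
    proof eventually_elim
      case (elim F)
      have "(\<Sum>l\<in>F. c l * (\<integral>x. w x * ek l x \<partial>torus)) = (\<integral>x. (\<Sum>l\<in>F. c l * (w x * ek l x)) \<partial>torus)"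
        using iek by (subst Bochner_Integration.integral_sum) auto
      also have "\<dots> = (\<integral>x. w x * (\<Sum>l\<in>F. c l * ek l x) \<partial>torus)"
        by (simp add: sum_distrib_left mult.left_commute)
      finally have eq: "(\<Sum>l\<in>F. c l * (\<integral>x. w x * ek l x \<partial>torus)) = (\<integral>x. w x * (\<Sum>l\<in>F. c l * ek l x) \<partial>torus)" .
      have isum: "integrable torus (\<lambda>x. w x * (\<Sum>l\<in>F. c l * ek l x))"
        using iek by (simp add: sum_distrib_left mult.left_commute[of "w _"])
      have "dist (\<Sum>l\<in>F. c l * (\<integral>x. w x * ek l x \<partial>torus)) (\<integral>x. w x * fser c x \<partial>torus)
         = cmod (\<integral>x. w x * (\<Sum>l\<in>F. c l * ek l x) - w x * fser c x \<partial>torus)"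
        unfolding dist_norm eq using isum int by simp
      also have "\<dots> \<le> (\<integral>x. cmod (w x * (\<Sum>l\<in>F. c l * ek l x) - w x * fser c x) \<partial>torus)" by (rule integral_norm_bound)
      also have "\<dots> \<le> (\<integral>x. e' * cmod (w x) \<partial>torus)"
      proof (rule integral_mono)
        fix x
        have "cmod (w x * (\<Sum>l\<in>F. c l * ek l x) - w x * fser c x) = cmod (w x) * dist (\<Sum>l\<in>F. c l * ek l x) (fser c x)"
          by (simp add: dist_norm norm_mult[symmetric] right_diff_distrib)
        also have "\<dots> \<le> cmod (w x) * e'" using elim[rule_format, of x] by (intro mult_left_mono) auto
        finally show "cmod (w x * (\<Sum>l\<in>F. c l * ek l x) - w x * fser c x) \<le> e' * cmod (w x)" by (simp add: mult.commute)
      qed (use isum int w in auto)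
      also have "\<dots> = e' * I" by (simp add: I_def)
      also have "\<dots> < e" using e I by (simp add: e'_def field_simps)
      finally show ?case .
    qed
  qed
qed

lemma integral_ek_cnj: "(\<integral>x. cnj (ek k x) * ek l x \<partial>torus) = (if l = k then 1 else 0)"
  for k l :: "int^'d"
proof -
  have "cnj (ek k x) * ek l x = ek (l - k) x" for x
    using ek_add[of "l" "- k" x] by (simp add: ek_minus mult.commute)
  thus ?thesis by (simp add: integral_ek)
qed

lemma fser_coef:
  fixes k :: "int^'d"
  assumes c: "abs_sum c" shows "(\<integral>x. cnj (ek k x) * fser c x \<partial>torus) = c k"
proof -
  have "((\<lambda>l. c l * (if l = k then 1 else 0)) has_sum (\<integral>x. cnj (ek k x) * fser c x \<partial>torus)) UNIV"
    unfolding integral_ek_cnj[symmetric]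
    by (rule fser_integral(2)[OF c]) (rule integrable_torus_bounded[where B = 1], auto)
  moreover have "((\<lambda>l. c l * (if l = k then 1 else 0)) has_sum c k) UNIV"
    by (rule has_sum_finite_neutralI[of "{k}"]) auto
  ultimately show ?thesis by (rule has_sum_unique)
qed

lemma torus_integral_cnj: "cnj (\<integral>x. f x \<partial>torus) = (\<integral>x. cnj (f x) \<partial>torus)"
  by (rule integral_bounded_linear'[symmetric, OF bounded_linear_cnj bounded_linear_cnj]) simp

lemma fcoef_herm:
  fixes u :: "real^'d \<Rightarrow> real"
  assumes [measurable]: "u \<in> borel_measurable borel"
  shows "fcoef u (- k) = cnj (fcoef u k)"
  by (simp add: fcoef_eq ek_minus torus_integral_cnj)

text \<open>The conjugate of \<open>d\<close> also has vanishing coefficients, with k replaced by -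
  k, so the real and the imaginary part have vanishing coefficients and the real statement applies
  to both.\<close>

lemma complex_fourier_unique:
  fixes d :: "real^'d \<Rightarrow> complex"
  assumes d: "integrable torus d" and z: "\<And>k. (\<integral>x. d x * ek k x \<partial>torus) = 0"
  shows "AE x in torus. d x = 0"
proof -
  have i: "integrable torus (\<lambda>x. d x * ek k x)" for k by (rule integrable_mult_bounded[OF d, of _ 1]) auto
  have ic: "integrable torus (\<lambda>x. cnj (d x) * ek k x)" for k
    by (rule integrable_mult_bounded[of _ _ 1]) (use d in auto)
  have zc: "(\<integral>x. cnj (d x) * ek k x \<partial>torus) = 0" for k
  proof -
    have "(\<integral>x. cnj (d x) * ek k x \<partial>torus) = cnj (\<integral>x. d x * ek (- k) x \<partial>torus)"
      by (simp add: ek_minus torus_integral_cnj)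
    thus ?thesis by (simp add: z)
  qed
  have "AE x in torus. Re (d x) = 0"
  proof (rule fourier_unique)
    show "integrable torus (\<lambda>x. Re (d x))" using d by simp
    fix k
    have "(\<integral>x. of_real (Re (d x)) * ek k x \<partial>torus) = (\<integral>x. (1/2) * (d x * ek k x + cnj (d x) * ek k x) \<partial>torus)"
      by (rule Bochner_Integration.integral_cong) (auto simp: complex_eq_iff field_simps)
    also have "\<dots> = 0" using i ic z zc by simp
    finally show "(\<integral>x. of_real (Re (d x)) * ek k x \<partial>torus) = 0" .
  qed
  moreover have "AE x in torus. Im (d x) = 0"
  proof (rule fourier_unique)
    show "integrable torus (\<lambda>x. Im (d x))" using d by simp
    fix k
    have "(\<integral>x. of_real (Im (d x)) * ek k x \<partial>torus) = (\<integral>x. (- \<i>/2) * (d x * ek k x - cnj (d x) * ek k x) \<partial>torus)"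
      by (rule Bochner_Integration.integral_cong) (auto simp: complex_eq_iff field_simps)
    also have "\<dots> = 0" using i ic z zc by simp
    finally show "(\<integral>x. of_real (Im (d x)) * ek k x \<partial>torus) = 0" .
  qed
  ultimately show ?thesis by eventually_elim (simp add: complex_eq_iff)
qed

text \<open>The function and the continuous sum of its series have the same coefficients, and
  coefficients determine an integrable function almost everywhere.\<close>

lemma fourier_series:
  fixes f :: "real^'d \<Rightarrow> real"
  assumes f: "integrable torus f" and c: "abs_sum (fcoef f)"
  shows "AE x in torus. of_real (f x) = fser (fcoef f) x"
proof -
  have [measurable]: "f \<in> borel_measurable borel" using f by (auto dest: borel_measurable_integrable)
  have iS: "integrable torus (fser (fcoef f))"
    by (rule integrable_torus_bounded[OF fser_measurable[OF c] fser_bound[OF c]])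
  have iSe: "integrable torus (\<lambda>x. fser (fcoef f) x * ek k x)" and ife: "integrable torus (\<lambda>x. of_real (f x) * ek k x)" for k
    by (rule integrable_mult_bounded[of _ _ 1], use iS f in auto)+
  have "AE x in torus. of_real (f x) - fser (fcoef f) x = 0"
  proof (rule complex_fourier_unique)
    show "integrable torus (\<lambda>x. of_real (f x) - fser (fcoef f) x)" using f iS by simp
    fix k :: "int^'d"
    have "(\<integral>x. (of_real (f x) - fser (fcoef f) x) * ek k x \<partial>torus) = (\<integral>x. of_real (f x) * ek k x \<partial>torus) - (\<integral>x. fser (fcoef f) x * ek k x \<partial>torus)"
      using iSe ife by (simp add: left_diff_distrib)
    also have "(\<integral>x. of_real (f x) * ek k x \<partial>torus) = fcoef f (- k)" by (simp add: fcoef_eq ek_minus)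
    also have "(\<integral>x. fser (fcoef f) x * ek k x \<partial>torus) = fcoef f (- k)"
      using fser_coef[OF c, of "- k"] by (simp add: ek_minus mult.commute)
    finally show "(\<integral>x. (of_real (f x) - fser (fcoef f) x) * ek k x \<partial>torus) = 0" by simp
  qed
  thus ?thesis by eventually_elim simp
qed

text \<open>The product rule for coefficients with an asymmetric requirement: one factor has an
  absolutely convergent series, the other one is merely integrable. This is what permits an
  integrable derivative of the potential later.\<close>

lemma fcoef_times_fser:
  fixes u v :: "real^'d \<Rightarrow> real"
  assumes u: "integrable torus u" and v: "v \<in> borel_measurable borel" and c: "abs_sum c" and eq: "AE x in torus. of_real (v x) = fser c x"
  shows "((\<lambda>l. c l * fcoef u (k - l)) has_sum fcoef (\<lambda>x. u x * v x) k) UNIV"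
proof -
  have um [measurable]: "u \<in> borel_measurable borel" using u by (auto dest: borel_measurable_integrable)
  have vm [measurable]: "v \<in> borel_measurable borel" by fact
  let ?w = "\<lambda>x. of_real (u x) * cnj (ek k x)"
  have w: "integrable torus ?w" by (rule integrable_mult_bounded[of _ _ 1]) (use u in auto)
  have "(\<integral>x. ?w x * ek l x \<partial>torus) = fcoef u (k - l)" for l
  proof -
    have "cnj (ek (k - l) x) = cnj (ek k x) * ek l x" for x
      using ek_add[of k "- l" x] by (simp add: ek_minus)
    thus ?thesis by (simp add: fcoef_eq mult.assoc)
  qed
  moreover have "(\<integral>x. ?w x * fser c x \<partial>torus) = fcoef (\<lambda>x. u x * v x) k"
  proof -
    have [measurable]: "fser c \<in> borel_measurable borel" by (rule fser_measurable[OF c])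
    have "fcoef (\<lambda>x. u x * v x) k = (\<integral>x. of_real (u x * v x) * cnj (ek k x) \<partial>torus)" by (rule fcoef_eq) measurable
    also have "\<dots> = (\<integral>x. ?w x * fser c x \<partial>torus)"
    proof (rule integral_cong_AE)
      show "AE x in torus. of_real (u x * v x) * cnj (ek k x) = ?w x * fser c x"
        using eq by eventually_elim (simp add: mult_ac)
    qed measurable
    finally show ?thesis by simp
  qed
  ultimately show ?thesis using fser_integral(2)[OF c w] by simp
qed

text \<open>The coefficient at frequency 0 of the product of \<open>v\<close> with itself, where
  reality turns the coefficient at - l into the conjugate.\<close>

lemma parseval:
  fixes v :: "real^'d \<Rightarrow> real"
  assumes v: "integrable torus v" and c: "abs_sum (fcoef v)"
  shows "((\<lambda>l. (cmod (fcoef v l))^2) has_sum (LINT x:cube|lborel. (v x)^2)) UNIV"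
proof -
  have [measurable]: "v \<in> borel_measurable borel" using v by (auto dest: borel_measurable_integrable)
  have "((\<lambda>l. fcoef v l * fcoef v (0 - l)) has_sum fcoef (\<lambda>x. v x * v x) 0) UNIV"
    by (rule fcoef_times_fser[OF v _ c fourier_series[OF v c]]) measurable
  moreover have "fcoef v l * fcoef v (0 - l) = of_real ((cmod (fcoef v l))^2)" for l
    using fcoef_herm[of v l] by (simp only: complex_norm_square) simp
  moreover have "fcoef (\<lambda>x. v x * v x) 0 = of_real (LINT x:cube|lborel. (v x)^2)"
  proof -
    have "fcoef (\<lambda>x. v x * v x) 0 = (\<integral>x. complex_of_real ((v x)^2) \<partial>torus)"
      by (subst fcoef_eq) (simp_all add: power2_eq_square)
    thus ?thesis by (simp add: set_integral_cube del: of_real_power)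
  qed
  ultimately have "((\<lambda>l. complex_of_real ((cmod (fcoef v l))^2)) has_sum of_real (LINT x:cube|lborel. (v x)^2)) UNIV" by simp
  thus ?thesis using has_sum_of_real_iff by blast
qed

text \<open>The convolution is represented at every point by an absolutely convergent series, which
  yields its measurability at the same time; the product rule then gives the coefficients.\<close>

lemma fcoef_convolution_product:
  fixes G \<rho> :: "real^'d \<Rightarrow> real"
  assumes G: "integrable torus G" "periodic G" and \<rho>: "integrable torus \<rho>" and c: "abs_sum (fcoef \<rho>)"
    and B: "abs_sum (\<lambda>l. fcoef \<rho> l * fcoef G l)"
  shows "((\<lambda>l. fcoef \<rho> l * fcoef G l * fcoef \<rho> (k - l)) has_sum
     fcoef (\<lambda>x. \<rho> x * (LINT y:cube|lborel. G (x - y) * \<rho> y)) k) UNIV"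
proof -
  have Gm [measurable]: "G \<in> borel_measurable borel" using G by (auto dest: borel_measurable_integrable)
  have \<rho>m [measurable]: "\<rho> \<in> borel_measurable borel" using \<rho> by (auto dest: borel_measurable_integrable)
  define v where "v x = (LINT y:cube|lborel. G (x - y) * \<rho> y)" for x
  have vS: "of_real (v x) = fser (\<lambda>l. fcoef \<rho> l * fcoef G l) x" for x
  proof -
    have i: "integrable torus (\<lambda>y. complex_of_real (G (x - y)))"
      using integrable_torus_affine[OF Gm G(2), of "-1" x] G(1) by simp
    have "complex_of_real (v x) = (\<integral>y. complex_of_real (G (x - y)) * of_real (\<rho> y) \<partial>torus)"
      unfolding v_def by (subst set_integral_cube) (simp_all flip: of_real_mult)
    also have "\<dots> = (\<integral>y. complex_of_real (G (x - y)) * fser (fcoef \<rho>) y \<partial>torus)"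
    proof (rule integral_cong_AE)
      show "AE y in torus. complex_of_real (G (x - y)) * of_real (\<rho> y) = complex_of_real (G (x - y)) * fser (fcoef \<rho>) y"
        using fourier_series[OF \<rho> c] by eventually_elim simp
      have [measurable]: "fser (fcoef \<rho>) \<in> borel_measurable borel" by (rule fser_measurable[OF c])
      show "(\<lambda>y. complex_of_real (G (x - y)) * fser (fcoef \<rho>) y) \<in> borel_measurable torus" by measurable
      show "(\<lambda>y. complex_of_real (G (x - y)) * of_real (\<rho> y)) \<in> borel_measurable torus" by measurable
    qed
    finally have hs: "((\<lambda>l. fcoef \<rho> l * (\<integral>y. complex_of_real (G (x - y)) * ek l y \<partial>torus)) has_sum of_real (v x)) UNIV"
      using fser_integral(2)[OF c i] by simp
    have "(\<integral>y. complex_of_real (G (x - y)) * ek l y \<partial>torus) = fcoef G l * ek l x" for l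
    proof -
      let ?h = "\<lambda>z. complex_of_real (G z) * ek l (x - z)"
      have hm: "?h \<in> borel_measurable borel" by measurable
      have hp: "periodic ?h"
        unfolding periodic_def
      proof (intro allI)
        fix z k
        have e: "x - (z + kvec k) = (x - z) + kvec (- k)" by (simp add: kvec_minus)
        have "ek l (x - (z + kvec k)) = ek l (x - z)" unfolding e using periodic_ek[of l] by (simp only: periodic_def)
        moreover have "G (z + kvec k) = G z" using G(2) unfolding periodic_def by simp
        ultimately show "?h (z + kvec k) = ?h z" by simp
      qed
      have "(\<integral>y. complex_of_real (G (x - y)) * ek l y \<partial>torus) = (\<integral>y. ?h (x + (- 1) *\<^sub>R y) \<partial>torus)" by simp
      also have "\<dots> = (\<integral>z. ?h z \<partial>torus)" by (rule integral_torus_affine[OF hm hp]) simp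
      also have "\<dots> = (\<integral>z. (complex_of_real (G z) * cnj (ek l z)) * ek l x \<partial>torus)"
        using ek_shift[of l x "- z" for z] by (simp add: ek_neg_arg mult_ac)
      also have "\<dots> = fcoef G l * ek l x" by (simp add: fcoef_eq)
      finally show ?thesis .
    qed
    hence "((\<lambda>l. (fcoef \<rho> l * fcoef G l) * ek l x) has_sum of_real (v x)) UNIV" using hs by (simp add: mult.assoc)
    thus ?thesis unfolding fser_def by (simp add: infsumI)
  qed
  have vm: "v \<in> borel_measurable borel"
  proof -
    have "v = (\<lambda>x. Re (fser (\<lambda>l. fcoef \<rho> l * fcoef G l) x))" using vS by (metis Re_complex_of_real)
    thus ?thesis using fser_measurable[OF B] by simp
  qed
  have "((\<lambda>l. (fcoef \<rho> l * fcoef G l) * fcoef \<rho> (k - l)) has_sum fcoef (\<lambda>x. \<rho> x * v x) k) UNIV"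
    by (rule fcoef_times_fser[OF \<rho> vm B]) (simp add: vS)
  thus ?thesis by (simp add: v_def)
qed

section \<open>Trigonometric potentials and projections\<close>

lemma fcoef_diff:
  fixes u v :: "real^'d \<Rightarrow> real"
  assumes "integrable torus u" "integrable torus v"
  shows "fcoef (\<lambda>x. u x - v x) k = fcoef u k - fcoef v k"
proof -
  have [measurable]: "u \<in> borel_measurable borel" "v \<in> borel_measurable borel"
    using assms by (auto dest: borel_measurable_integrable)
  have "integrable torus (\<lambda>x. of_real (w x) * cnj (ek k x))" if "integrable torus w" for w :: "real^'d \<Rightarrow> real"
    by (rule integrable_mult_bounded[of _ _ 1]) (use that in auto)
  thus ?thesis using assms by (simp add: fcoef_eq left_diff_distrib)
qed

lemma fcoef_0_eq:
  fixes u :: "real^'d \<Rightarrow> real"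
  assumes "u \<in> borel_measurable borel"
  shows "fcoef u 0 = of_real (LINT x:cube|lborel. u x)"
  using assms by (simp add: fcoef_eq set_integral_cube)

lemma trigp_bounded: "trigp A f \<Longrightarrow> \<exists>B. \<forall>x. cmod (f x) \<le> B"
proof (induction rule: trigp.induct)
  case (trigp_scale f c)
  then obtain B where "\<forall>x. cmod (f x) \<le> B" by blast
  thus ?case by (intro exI[of _ "cmod c * B"]) (auto simp: norm_mult intro: mult_left_mono)
next
  case (trigp_add f g)
  then obtain B C where "\<forall>x. cmod (f x) \<le> B" "\<forall>x. cmod (g x) \<le> C" by blast
  thus ?case by (intro exI[of _ "B + C"]) (auto intro: norm_triangle_mono)
qed auto

lemma trigp_periodic: "trigp A f \<Longrightarrow> periodic f"
proof (induction rule: trigp.induct)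
  case (trigp_ek k) thus ?case using periodic_ek by blast
qed (auto simp: periodic_def)

lemma trigp_coef_zero:
  fixes k :: "int^'d"
  assumes k: "k \<notin> A"
  shows "trigp A f \<Longrightarrow> integrable torus (\<lambda>x. cnj (ek k x) * f x) \<and> (\<integral>x. cnj (ek k x) * f x \<partial>torus) = 0"
proof (induction rule: trigp.induct)
  case (trigp_ek l)
  have "integrable torus (\<lambda>x. cnj (ek k x) * ek l x)" by (rule integrable_torus_bounded[where B = 1]) (auto simp: norm_mult)
  thus ?case using trigp_ek k by (auto simp: integral_ek_cnj)
next
  case (trigp_scale p c)
  hence "integrable torus (\<lambda>x. c * (cnj (ek k x) * p x))" "(\<integral>x. c * (cnj (ek k x) * p x) \<partial>torus) = 0" by auto
  thus ?case by (simp add: mult.left_commute)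
next
  case (trigp_add p q)
  thus ?case by (simp add: distrib_left)
qed simp

lemma kvec_axis: "kvec (axis j m) = axis j (of_int m)"
  by (simp add: kvec_def vec_eq_iff axis_def)

lemma ek_axis_int: "ek (axis j m) x = cis (2 * pi * of_int m * x $ j)"
  by (simp add: ek_def kvec_axis inner_axis' mult.assoc)

lemma trigp_Tfun: "trigp {k. \<bar>k $ j\<bar> = \<bar>m\<bar> \<and> (\<forall>i. i \<noteq> j \<longrightarrow> k $ i = 0)} (\<lambda>x. of_real (Tfun m (x $ j)))"
proof -
  let ?A = "{k::int^'a. \<bar>k $ j\<bar> = \<bar>m\<bar> \<and> (\<forall>i. i \<noteq> j \<longrightarrow> k $ i = 0)}"
  have A: "axis j m \<in> ?A" "axis j (- m) \<in> ?A" by (auto simp: axis_def)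
  consider "m > 0" | "m = 0" | "m < 0" by linarith
  thus ?thesis
  proof cases
    case 1
    have e: "(\<lambda>x. of_real (Tfun m (x $ j))) = (\<lambda>x. of_real (sqrt 2 / 2) * ek (axis j m) x + of_real (sqrt 2 / 2) * ek (axis j (- m)) x)"
      unfolding ek_axis_int using 1 by (auto simp: fun_eq_iff complex_eq_iff Tfun_def)
    show ?thesis unfolding e by (intro trigp_add trigp_scale trigp_ek A)
  next
    case 2
    have e: "(\<lambda>x. of_real (Tfun m (x $ j))) = (\<lambda>x::real^'a. 1)" using 2 by (simp add: Tfun_def)
    show ?thesis unfolding e by (rule trigp_const) (simp add: 2)
  next
    case 3
    have e: "(\<lambda>x. of_real (Tfun m (x $ j))) = (\<lambda>x. (- \<i> * of_real (sqrt 2 / 2)) * ek (axis j m) x + (\<i> * of_real (sqrt 2 / 2)) * ek (axis j (- m)) x)"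
      unfolding ek_axis_int using 3 by (auto simp: fun_eq_iff complex_eq_iff Tfun_def)
    show ?thesis unfolding e by (intro trigp_add trigp_scale trigp_ek A)
  qed
qed

lemma trigp_tau_partial:
  fixes m :: "int^'d"
  assumes "finite J"
  shows "trigp {k. \<forall>i. if i \<in> J then \<bar>k $ i\<bar> = \<bar>m $ i\<bar> else k $ i = 0} (\<lambda>x. of_real (\<Prod>j\<in>J. Tfun (m $ j) (x $ j)))"
  using assms
proof induction
  case empty
  show ?case by (simp, rule trigp_const) simp
next
  case (insert j J)
  have e: "(\<lambda>x. complex_of_real (\<Prod>j\<in>insert j J. Tfun (m $ j) (x $ j)))
    = (\<lambda>x. of_real (Tfun (m $ j) (x $ j)) * of_real (\<Prod>j\<in>J. Tfun (m $ j) (x $ j)))"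
    using insert by simp
  show ?case unfolding e
  proof (rule trigp_mono[OF trigp_mult[OF trigp_Tfun insert.IH]], safe)
    fix a b :: "int^'d" and i
    assume h: "\<bar>a $ j\<bar> = \<bar>m $ j\<bar>" "\<forall>i. i \<noteq> j \<longrightarrow> a $ i = 0" "\<forall>i. if i \<in> J then \<bar>b $ i\<bar> = \<bar>m $ i\<bar> else b $ i = 0"
    show "if i \<in> insert j J then \<bar>(a + b) $ i\<bar> = \<bar>m $ i\<bar> else (a + b) $ i = 0"
      using h(1,2) h(3)[rule_format, of i] insert(2) by (cases "i = j") (auto split: if_splits)
  qed
qed

abbreviation modes :: "real \<Rightarrow> (int^'d) set" where
  "modes K \<equiv> {k. 0 < norm (kvec k) \<and> norm (kvec k) \<le> K}"

lemma finite_modes: "finite (modes K)"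
  by (rule finite_subset[OF _ finite_kvec_ball[of K]]) auto

text \<open>Expanding the sines and cosines produces only frequencies that differ from
  \<open>m\<close> by signs of the coordinates. They have the same Euclidean norm, so the real basis
  and the exponentials span the same modes.\<close>

lemma trigp_tau:
  fixes m :: "int^'d"
  assumes "m \<in> modes K" shows "trigp (modes K) (\<lambda>x. of_real (tau m x))"
  unfolding tau_def
proof (rule trigp_mono[OF trigp_tau_partial[OF finite]], safe)
  fix k :: "int^'d" assume "\<forall>i. if i \<in> UNIV then \<bar>k $ i\<bar> = \<bar>m $ i\<bar> else k $ i = 0"
  hence "\<bar>k $ i\<bar> = \<bar>m $ i\<bar>" for i by simp
  hence "(real_of_int (k $ i))^2 = (real_of_int (m $ i))^2" for i by (metis of_int_abs power2_abs)
  hence "(norm (kvec k))^2 = (norm (kvec m))^2" unfolding norm_kvec_sq by simp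
  hence "norm (kvec k) = norm (kvec m)" by simp
  thus "0 < norm (kvec k)" "norm (kvec k) \<le> K" using assms by auto
qed

lemma trigp_EK: "f \<in> EK K \<Longrightarrow> trigp (modes (real K)) (\<lambda>x. of_real (f x))"
proof -
  assume "f \<in> EK K"
  then obtain c where f: "f = (\<lambda>x. \<Sum>k\<in>modes (real K). c k * tau k x)" unfolding EK_def by blast
  show ?thesis unfolding f of_real_sum of_real_mult by (intro trigp_sum trigp_scale trigp_tau)
qed

lemma EK_diff: "f \<in> EK K \<Longrightarrow> g \<in> EK K \<Longrightarrow> (\<lambda>x. f x - g x) \<in> EK K"
  unfolding EK_def mem_Collect_eq
proof (elim exE)
  fix c d assume "f = (\<lambda>x. \<Sum>k\<in>modes (real K). c k * tau k x)" "g = (\<lambda>x. \<Sum>k\<in>modes (real K). d k * tau k x)"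
  thus "\<exists>c. (\<lambda>x. f x - g x) = (\<lambda>x. \<Sum>k\<in>modes (real K). c k * tau k x)"
    by (intro exI[of _ "\<lambda>k. c k - d k"]) (simp add: sum_subtractf left_diff_distrib)
qed

lemma real_trigp:
  fixes f :: "real^'d \<Rightarrow> real"
  assumes t: "trigp A (\<lambda>x. of_real (f x))"
  shows "f \<in> borel_measurable borel" "periodic f" "\<exists>B. \<forall>x. \<bar>f x\<bar> \<le> B" "integrable torus f"
    "k \<notin> A \<Longrightarrow> fcoef f k = 0"
proof -
  have "(\<lambda>x. Re (of_real (f x))) \<in> borel_measurable borel" using trigp_measurable[OF t] by measurable
  thus m: "f \<in> borel_measurable borel" by simp
  show "periodic f" using trigp_periodic[OF t] by (simp add: periodic_def)
  show b: "\<exists>B. \<forall>x. \<bar>f x\<bar> \<le> B" using trigp_bounded[OF t] by simp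
  then obtain B where "\<forall>x. \<bar>f x\<bar> \<le> B" by blast
  thus "integrable torus f" by (intro integrable_torus_bounded[OF m, of B]) auto
  show "fcoef f k = 0" if "k \<notin> A" using trigp_coef_zero[OF that t] by (simp add: fcoef_eq[OF m] mult.commute)
qed

section \<open>Weak derivatives of trigonometric potentials and Fourier bounds from the
  \<open>W2inf\<close> norm\<close>

lemma abs_sum_finite_support: "finite A \<Longrightarrow> (\<And>k. k \<notin> A \<Longrightarrow> c k = 0) \<Longrightarrow> abs_sum c"
  by (rule summable_on_cong_neutral[THEN iffD1, OF _ _ _ summable_on_finite[of A]]) auto

text \<open>The derivative is built by applying the multiplier to the finitely many coefficients.
  The multiplier at - k is the conjugate of that at k, so for real \<open>f\<close> taking the real
  part of the series does not change the coefficients.\<close>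

lemma trig_wderiv:
  fixes f :: "real^'d \<Rightarrow> real"
  assumes t: "trigp A (\<lambda>x. of_real (f x))" and A: "finite A"
  shows "\<exists>g C. wderiv f \<alpha> g \<and> (AE x in lborel. x \<in> cube \<longrightarrow> \<bar>g x\<bar> \<le> C)"
proof -
  note r = real_trigp[OF t]
  define m where "m k = (\<Prod>j\<in>UNIV. (2 * pi * \<i> * of_int (k$j)) ^ (\<alpha>$j))" for k :: "int^'d"
  define c where "c k = m k * fcoef f k" for k
  have mm: "m (- k) = cnj (m k)" for k
    unfolding m_def cnj_prod by (intro prod.cong refl) simp
  have cz: "c k = 0" if "k \<notin> A" for k using r(5)[OF that] by (simp add: c_def)
  have ac: "abs_sum c" by (rule abs_sum_finite_support[OF A cz])
  define g where "g x = Re (fser c x)" for x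
  have sm: "fser c \<in> borel_measurable borel" by (rule fser_measurable[OF ac])
  have gm: "g \<in> borel_measurable borel" unfolding g_def using sm by measurable
  define B where "B = (\<Sum>\<^sub>\<infinity>l. cmod (c l))"
  have gB: "\<bar>g x\<bar> \<le> B" for x
    unfolding g_def B_def by (rule order_trans[OF abs_Re_le_cmod fser_bound[OF ac]])
  have gi: "integrable torus g" by (rule integrable_torus_bounded[OF gm, of B]) (simp add: gB)
  have "fser c (x + kvec k) = fser c x" for x k unfolding fser_def by (simp add: ek_shift ek_kvec)
  hence gp: "periodic g" by (simp add: periodic_def g_def)
  have coef: "fcoef g k = c k" for k
  proof -
    have i1: "integrable torus (\<lambda>x. cnj (ek l x) * fser c x)" for l
      by (rule fser_integral(1)[OF ac]) (rule integrable_torus_bounded[where B = 1], auto)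
    have "integrable torus (\<lambda>x. cnj (cnj (ek (- k) x) * fser c x))" using i1[of "-k"] by (rule integrable_cnj)
    hence i2: "integrable torus (\<lambda>x. cnj (ek k x) * cnj (fser c x))" by (simp add: ek_minus)
    have "fcoef g k = (\<integral>x. (1/2) * (cnj (ek k x) * fser c x + cnj (ek k x) * cnj (fser c x)) \<partial>torus)"
      unfolding fcoef_eq[OF gm] g_def by (rule Bochner_Integration.integral_cong) (auto simp: complex_eq_iff field_simps)
    also have "\<dots> = (1/2) * ((\<integral>x. cnj (ek k x) * fser c x \<partial>torus) + (\<integral>x. cnj (ek k x) * cnj (fser c x) \<partial>torus))"
      using i1 i2 by simp
    also have "(\<integral>x. cnj (ek k x) * cnj (fser c x) \<partial>torus) = cnj (\<integral>x. cnj (ek (- k) x) * fser c x \<partial>torus)"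
      by (simp add: torus_integral_cnj ek_minus)
    also have "\<dots> = cnj (c (- k))" by (simp only: fser_coef[OF ac])
    also have "\<dots> = c k" using fcoef_herm[OF r(1), of k] by (simp add: c_def mm)
    finally show ?thesis by (simp add: fser_coef[OF ac])
  qed
  have "wderiv f \<alpha> g"
    unfolding wderiv_def using gm gp gi coef by (simp add: set_integrable_cube c_def m_def)
  thus ?thesis using gB by (intro exI[of _ g] exI[of _ B]) auto
qed

lemma finite_midx2: "finite (midx2 :: (nat^'d) set)"
proof (rule finite_imageD)
  show "finite ((\<lambda>v::nat^'d. \<chi> j. int (v $ j)) ` midx2)"
  proof (rule finite_subset[OF _ sum_prod_vec_box(2)[of "{0..2}"]])
    show "(\<lambda>v::nat^'d. \<chi> j. int (v $ j)) ` midx2 \<subseteq> {k. \<forall>j. k $ j \<in> {0..2}}"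
    proof safe
      fix v :: "nat^'d" and j assume "v \<in> midx2"
      hence "v $ j \<le> 2" using member_le_sum[of j UNIV "\<lambda>j. v $ j"] by (simp add: midx2_def)
      thus "(\<chi> j. int (v $ j)) $ j \<in> {0..2}" by simp
    qed
  qed simp
  show "inj_on (\<lambda>v::nat^'d. \<chi> j. int (v $ j)) midx2" by (auto simp: inj_on_def vec_eq_iff)
qed

lemma wderiv_axis_coef:
  "wderiv u (axis j 1) g \<Longrightarrow> fcoef g k = 2 * pi * \<i> * of_int (k $ j) * fcoef u k"
proof -
  assume w: "wderiv u (axis j 1) g"
  have "(\<Prod>i\<in>UNIV. (2 * pi * \<i> * of_int (k$i)) ^ ((axis j 1 :: nat^_)$i)) = (\<Prod>i\<in>UNIV. if i = j then 2 * pi * \<i> * of_int (k$j) else 1)"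
    by (intro prod.cong refl) (auto simp: axis_def)
  thus ?thesis using w by (simp add: wderiv_def)
qed

lemma fcoef_le_bound:
  fixes g :: "real^'d \<Rightarrow> real"
  assumes [measurable]: "g \<in> borel_measurable borel" and "AE x in lborel. x \<in> cube \<longrightarrow> \<bar>g x\<bar> \<le> C"
  shows "cmod (fcoef g k) \<le> C"
proof -
  have ae: "AE x in torus. \<bar>g x\<bar> \<le> C" using assms(2) by (simp add: AE_torus)
  interpret finite_measure "torus :: (real^'d) measure" by (rule finite_measure_torus)
  have "cmod (fcoef g k) \<le> (\<integral>x. cmod (of_real (g x) * cnj (ek k x)) \<partial>torus)" unfolding fcoef_eq[OF assms(1)] by (rule integral_norm_bound)
  also have "\<dots> \<le> (\<integral>x. C \<partial>(torus :: (real^'d) measure))"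
  proof (rule integral_mono_AE)
    show "AE x in torus. cmod (of_real (g x) * cnj (ek k x)) \<le> C" using ae by eventually_elim (simp add: norm_mult)
    show "integrable torus (\<lambda>x. cmod (of_real (g x) * cnj (ek k x)))"
    proof (rule integrable_const_bound[where B = C])
      show "AE x in torus. norm (cmod (of_real (g x) * cnj (ek k x))) \<le> C" using ae by eventually_elim (simp add: norm_mult)
    qed measurable
  qed simp
  finally show ?thesis by simp
qed

text \<open>Each summand of the norm is an infimum over a set that \<open>ex\<close> makes nonempty,
  hence a genuine nonnegative infimum, and a sup bound for a derivative bounds its coefficients. The
  factor d arises from estimating |k| by the sum of its coordinates.\<close>

lemma W2inf_norm_potbd:
  fixes W :: "real^'d \<Rightarrow> real"
  assumes ex: "\<And>\<alpha>. \<alpha> \<in> midx2 \<Longrightarrow> \<exists>g C. wderiv W \<alpha> g \<and> (AE x in lborel. x \<in> cube \<longrightarrow> \<bar>g x\<bar> \<le> C)"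
    and M: "W2inf_norm W \<le> M"
  shows "potbd (fcoef W) (real CARD('d) * M)"
proof -
  define N where "N \<alpha> = {C. 0 \<le> C \<and> (\<exists>g. wderiv W \<alpha> g \<and> (AE x in lborel. x \<in> cube \<longrightarrow> \<bar>g x\<bar> \<le> C))}" for \<alpha>
  have ne: "N \<alpha> \<noteq> {}" if \<alpha>: "\<alpha> \<in> midx2" for \<alpha>
  proof -
    obtain g C where "wderiv W \<alpha> g" "AE x in lborel. x \<in> cube \<longrightarrow> \<bar>g x\<bar> \<le> C" using ex[OF \<alpha>] by blast
    hence "\<bar>C\<bar> \<in> N \<alpha>" unfolding N_def by (auto intro!: exI[of _ g] elim: AE_mp)
    thus ?thesis by blast
  qed
  have Inf0: "0 \<le> Inf (N \<alpha>)" if "\<alpha> \<in> midx2" for \<alpha>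
    by (rule cInf_greatest[OF ne[OF that]]) (simp add: N_def)
  have comp: "2 * pi * \<bar>of_int (k $ j)\<bar> * cmod (fcoef W k) \<le> M" for k :: "int^'d" and j
  proof -
    have j: "axis j 1 \<in> (midx2 :: (nat^'d) set)" by (simp add: midx2_def axis_def)
    have "2 * pi * \<bar>of_int (k $ j)\<bar> * cmod (fcoef W k) \<le> Inf (N (axis j 1))"
    proof (rule cInf_greatest[OF ne[OF j]])
      fix C assume "C \<in> N (axis j 1)"
      then obtain g where g: "wderiv W (axis j 1) g" "AE x in lborel. x \<in> cube \<longrightarrow> \<bar>g x\<bar> \<le> C" by (auto simp: N_def)
      have "cmod (fcoef g k) \<le> C" by (rule fcoef_le_bound[OF _ g(2)]) (use g(1) in \<open>simp add: wderiv_def\<close>)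
      thus "2 * pi * \<bar>of_int (k $ j)\<bar> * cmod (fcoef W k) \<le> C"
        unfolding wderiv_axis_coef[OF g(1)] by (simp add: norm_mult)
    qed
    also have "\<dots> \<le> (\<Sum>\<alpha>\<in>midx2. Inf (N \<alpha>))"
      by (rule member_le_sum[OF j _ finite_midx2]) (use Inf0 in auto)
    also have "\<dots> \<le> M" using M by (simp add: W2inf_norm_def N_def)
    finally show ?thesis .
  qed
  show ?thesis unfolding potbd_def
  proof
    fix k :: "int^'d"
    have "norm (kvec k) \<le> (\<Sum>j\<in>UNIV. \<bar>kvec k $ j\<bar>)" by (rule norm_le_l1_cart)
    hence "2 * pi * norm (kvec k) * cmod (fcoef W k) \<le> 2 * pi * (\<Sum>j\<in>UNIV. \<bar>kvec k $ j\<bar>) * cmod (fcoef W k)"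
      by (intro mult_right_mono mult_left_mono) auto
    also have "\<dots> = (\<Sum>j\<in>UNIV. 2 * pi * \<bar>of_int (k $ j)\<bar> * cmod (fcoef W k))"
      by (simp add: sum_distrib_left sum_distrib_right kvec_nth)
    also have "\<dots> \<le> (\<Sum>j\<in>(UNIV::'d set). M)" by (intro sum_mono comp)
    finally show "2 * pi * norm (kvec k) * cmod (fcoef W k) \<le> real CARD('d) * M" by simp
  qed
qed

text \<open>\<open>Q\<close> = W2 - P is the projection of W2 - W1 to the trigonometric polynomials
  and is orthogonal to W1 - P. Pythagoras leaves the norm of \<open>Q\<close>, which is bounded by
  duality: its square is the inner product with W2 - W1, in which only the modes up to K
  contribute.\<close>

lemma projection_bound:
  fixes W1 W2 P :: "real^'d \<Rightarrow> real"
  assumes W2: "W2 \<in> EK K" and W1: "integrable torus W1" and P: "is_L2proj K W1 P"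
  shows "L2_norm (\<lambda>x. W2 x - W1 x) \<le> L2_norm (\<lambda>x. W1 x - P x) + nrm (modes (real K)) (\<lambda>k. fcoef W2 k - fcoef W1 k)"
proof (cases "integrable torus (\<lambda>x. (W2 x - W1 x)^2)")
  case False
  have [measurable]: "W1 \<in> borel_measurable borel" using W1 by (auto dest: borel_measurable_integrable)
  have [measurable]: "W2 \<in> borel_measurable borel" by (rule real_trigp[OF trigp_EK[OF W2]])
  \<comment> \<open>If the square is not integrable, the integral has the default value 0 and the
    left-hand side of the claim is 0.\<close>
  have "(LINT x:cube|lborel. (W2 x - W1 x)^2) = 0"
    by (subst set_integral_cube) (use False in \<open>simp_all add: not_integrable_integral_eq\<close>)
  hence z: "L2_norm (\<lambda>x. W2 x - W1 x) = 0" by (simp add: L2_norm_def)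
  have [measurable]: "P \<in> borel_measurable borel"
    by (rule real_trigp(1)[OF trigp_EK[of P K]]) (use P in \<open>simp add: is_L2proj_def\<close>)
  have n: "0 \<le> L2_norm (\<lambda>x. W1 x - P x)"
    unfolding L2_norm_def by (subst set_integral_cube) simp_all
  show ?thesis unfolding z using n by simp
next
  case True
  have PE: "P \<in> EK K" using P by (simp add: is_L2proj_def)
  define Q where "Q x = W2 x - P x" for x
  have QE: "Q \<in> EK K" unfolding Q_def[abs_def] by (rule EK_diff[OF W2 PE])
  note q = real_trigp[OF trigp_EK[OF QE]] and w2 = real_trigp[OF trigp_EK[OF W2]] and pp = real_trigp[OF trigp_EK[OF PE]]
  have [measurable]: "W1 \<in> borel_measurable borel" using W1 by (auto dest: borel_measurable_integrable)
  have [measurable]: "Q \<in> borel_measurable borel" "W2 \<in> borel_measurable borel" "P \<in> borel_measurable borel" by (rule q w2 pp)+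
  obtain B where B: "\<And>x. \<bar>Q x\<bar> \<le> B" using q(3) by blast
  have mQ: "integrable torus (\<lambda>x. w x * Q x)" if "integrable torus w" for w :: "real^'d \<Rightarrow> real"
  proof (rule Bochner_Integration.integrable_bound)
    show "integrable torus (\<lambda>x. B * w x)" using that by simp
    show "(\<lambda>x. w x * Q x) \<in> borel_measurable torus" using that by (auto dest: borel_measurable_integrable)
    show "AE x in torus. norm (w x * Q x) \<le> norm (B * w x)"
    proof (rule AE_I2)
      fix x
      have "\<bar>w x\<bar> * \<bar>Q x\<bar> \<le> \<bar>w x\<bar> * \<bar>B\<bar>" using B[of x] by (intro mult_left_mono) auto
      thus "norm (w x * Q x) \<le> norm (B * w x)" by (simp add: abs_mult mult.commute)
    qed
  qed
  define D where "D x = W2 x - W1 x" for x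
  define R where "R x = W1 x - P x" for x
  have iD: "integrable torus D" and iR: "integrable torus R" unfolding D_def[abs_def] R_def[abs_def] using w2 pp W1 by auto
  have [measurable]: "D \<in> borel_measurable borel" "R \<in> borel_measurable borel" unfolding D_def[abs_def] R_def[abs_def] by measurable
  have RQ: "(\<integral>x. R x * Q x \<partial>torus) = 0"
  proof -
    have "(LINT x:cube|lborel. (W1 x - P x) * Q x) = 0" using P QE unfolding is_L2proj_def by blast
    thus ?thesis by (simp add: set_integral_cube R_def)
  qed
  have iQQ: "integrable torus (\<lambda>x. Q x * Q x)" by (rule mQ[OF q(4)])
  have QD: "Q x = D x + R x" for x by (simp add: Q_def D_def R_def)
  have QQ: "(\<integral>x. Q x * Q x \<partial>torus) = (\<integral>x. D x * Q x \<partial>torus)"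
  proof -
    have "(\<integral>x. Q x * Q x \<partial>torus) = (\<integral>x. D x * Q x + R x * Q x \<partial>torus)" by (simp add: QD distrib_right)
    also have "\<dots> = (\<integral>x. D x * Q x \<partial>torus) + (\<integral>x. R x * Q x \<partial>torus)" using mQ[OF iD] mQ[OF iR] by simp
    finally show ?thesis using RQ by simp
  qed
  have iRR: "integrable torus (\<lambda>x. (R x)^2)"
  proof -
    have "integrable torus (\<lambda>x. (D x)^2 - 2 * (D x * Q x) + Q x * Q x)"
      using True mQ[OF iD] iQQ by (simp add: D_def)
    moreover have "(\<lambda>x. (D x)^2 - 2 * (D x * Q x) + Q x * Q x) = (\<lambda>x. (R x)^2)"
      by (simp add: fun_eq_iff QD power2_eq_square algebra_simps)
    ultimately show ?thesis by simp
  qed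
  have pyth: "(\<integral>x. (D x)^2 \<partial>torus) = (\<integral>x. Q x * Q x \<partial>torus) + (\<integral>x. (R x)^2 \<partial>torus)"
  proof -
    have "(\<integral>x. (D x)^2 \<partial>torus) = (\<integral>x. Q x * Q x - 2 * (R x * Q x) + (R x)^2 \<partial>torus)"
      by (rule Bochner_Integration.integral_cong) (auto simp: QD power2_eq_square algebra_simps)
    also have "\<dots> = (\<integral>x. Q x * Q x \<partial>torus) - 2 * (\<integral>x. R x * Q x \<partial>torus) + (\<integral>x. (R x)^2 \<partial>torus)"
      using iQQ iRR mQ[OF iR] by simp
    finally show ?thesis using RQ by simp
  qed
  let ?F = "modes (real K) :: (int^'d) set"
  define \<omega> where "\<omega> k = fcoef W2 k - fcoef W1 k" for k
  have cD: "fcoef D k = \<omega> k" for k unfolding D_def[abs_def] \<omega>_def by (rule fcoef_diff[OF w2(4) W1])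
  have aQ: "abs_sum (fcoef Q)" by (rule abs_sum_finite_support[OF finite_modes[of "real K"] q(5)])
  define nQ where "nQ = sqrt (\<integral>x. Q x * Q x \<partial>torus)"
  have nQ2: "nQ^2 = (\<integral>x. Q x * Q x \<partial>torus)" unfolding nQ_def by simp
  have "nQ^2 = (nrm ?F (fcoef Q))^2"
  proof -
    have "((\<lambda>l. (cmod (fcoef Q l))^2) has_sum (\<integral>x. (Q x)^2 \<partial>torus)) UNIV"
      using parseval[OF q(4) aQ] by (simp add: set_integral_cube)
    moreover have "((\<lambda>l. (cmod (fcoef Q l))^2) has_sum (\<Sum>l\<in>?F. (cmod (fcoef Q l))^2)) UNIV"
      by (rule has_sum_finite_neutralI[OF finite_modes]) (use q(5) in auto)
    ultimately have "(\<integral>x. (Q x)^2 \<partial>torus) = (\<Sum>l\<in>?F. (cmod (fcoef Q l))^2)" by (rule has_sum_unique)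
    thus ?thesis unfolding nQ2 nrm_sq by (simp add: power2_eq_square)
  qed
  hence nQF: "nQ = nrm ?F (fcoef Q)" using power2_eq_iff_nonneg[of nQ "nrm ?F (fcoef Q)"] by (simp add: nQ_def)
  have "((\<lambda>l. fcoef Q l * fcoef D (0 - l)) has_sum fcoef (\<lambda>x. D x * Q x) 0) UNIV"
    by (rule fcoef_times_fser[OF iD _ aQ fourier_series[OF q(4) aQ]]) measurable
  moreover have "((\<lambda>l. fcoef Q l * fcoef D (0 - l)) has_sum (\<Sum>l\<in>?F. fcoef Q l * fcoef D (0 - l))) UNIV"
    by (rule has_sum_finite_neutralI[OF finite_modes]) (use q(5) in auto)
  ultimately have "fcoef (\<lambda>x. D x * Q x) 0 = (\<Sum>l\<in>?F. fcoef Q l * fcoef D (0 - l))" by (rule has_sum_unique)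
  hence "cmod (fcoef (\<lambda>x. D x * Q x) 0) \<le> (\<Sum>l\<in>?F. \<bar>cmod (fcoef Q l)\<bar> * \<bar>cmod (\<omega> (- l))\<bar>)"
    using norm_sum[of "\<lambda>l. fcoef Q l * fcoef D (0 - l)" ?F] by (simp add: norm_mult cD)
  also have "\<dots> \<le> nrm ?F (fcoef Q) * L2_set (\<lambda>l. cmod (\<omega> (- l))) ?F" by (rule L2_set_mult_ineq)
  also have "L2_set (\<lambda>l. cmod (\<omega> (- l))) ?F = nrm ?F \<omega>"
    unfolding L2_set_def
    by (rule arg_cong[where f = sqrt], rule sum.reindex_bij_witness[of _ uminus uminus]) (auto simp: kvec_minus)
  finally have DQ: "cmod (fcoef (\<lambda>x. D x * Q x) 0) \<le> nQ * nrm ?F \<omega>" unfolding nQF .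
  have "fcoef (\<lambda>x. D x * Q x) 0 = of_real (nQ^2)"
    unfolding nQ2 QQ by (subst fcoef_0_eq) (simp_all add: set_integral_cube)
  with DQ have nQn: "nQ * nQ \<le> nrm ?F \<omega> * nQ" by (simp add: norm_mult power2_eq_square mult.commute)
  have nQw: "nQ \<le> nrm ?F \<omega>"
  proof (cases "nQ \<le> 0")
    case True
    thus ?thesis by (rule order_trans) (rule L2_set_nonneg)
  next
    case False
    thus ?thesis using nQn by (intro mult_right_le_imp_le[of nQ nQ]) auto
  qed
  define nR where "nR = L2_norm (\<lambda>x. W1 x - P x)"
  have nR: "nR = sqrt (\<integral>x. (R x)^2 \<partial>torus)" by (simp add: nR_def L2_norm_def set_integral_cube R_def)
  have nR0: "0 \<le> nR" unfolding nR by simp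
  have nQ0: "0 \<le> nQ" by (simp add: nQ_def)
  have "(\<integral>x. (D x)^2 \<partial>torus) = nQ^2 + nR^2" unfolding pyth nQ2 nR by simp
  also have "\<dots> \<le> (nR + nQ)^2" using nR0 nQ0 by (simp add: power2_sum)
  finally have "sqrt (\<integral>x. (D x)^2 \<partial>torus) \<le> nR + nQ" using nR0 nQ0 by (intro real_le_lsqrt) auto
  moreover have "L2_norm (\<lambda>x. W2 x - W1 x) = sqrt (\<integral>x. (D x)^2 \<partial>torus)" by (simp add: L2_norm_def set_integral_cube D_def)
  ultimately show ?thesis using nQw by (simp add: nR_def \<omega>_def)
qed

section \<open>From weak solutions to the Fourier flow\<close>

lemma L2fun_integrable:
  assumes "L2fun (u :: real^'d \<Rightarrow> real)" shows "integrable torus u"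
proof -
  have m [measurable]: "u \<in> borel_measurable borel" using assms by (simp add: L2fun_def)
  have "integrable torus (\<lambda>x. (u x)^2)" using assms by (simp add: L2fun_def set_integrable_cube)
  moreover have "integrable torus (\<lambda>x::real^'d. 1::real)" by (rule integrable_torus_bounded[where B = 1]) auto
  ultimately have i: "integrable torus (\<lambda>x. 1 + (u x)^2)" by simp
  show ?thesis
  proof (rule Bochner_Integration.integrable_bound[OF i])
    show "AE x in torus. norm (u x) \<le> norm (1 + (u x)^2)"
    proof (rule AE_I2)
      fix x
      have "2 * \<bar>u x\<bar> \<le> 1 + (u x)^2" using zero_le_power2[of "\<bar>u x\<bar> - 1"] by (simp add: power2_diff)
      thus "norm (u x) \<le> norm (1 + (u x)^2)" by simp
    qed
  qed simp
qed

lemma japb_powr_double: "(1 + (norm (kvec k))^2) powr s = (japb k powr s)^2"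
proof -
  have "(1 + (norm (kvec k))^2) powr s = ((japb k)^2) powr s" by (simp only: japb_sq)
  also have "\<dots> = (japb k powr s)^2" using japb_pos[of k] by (simp add: powr_mult power2_eq_square less_imp_le)
  finally show ?thesis .
qed

lemma in_H_hbd:
  fixes u :: "real^'d \<Rightarrow> real"
  assumes "in_H s u"
  shows "hbd s (fcoef u) (H_norm s u)"
  unfolding hbd_def l2bd_def
proof (intro allI impI)
  fix F :: "(int^'d) set" assume F: "finite F"
  have "(\<Sum>k\<in>F. (1 + (norm (kvec k))^2) powr s * (cmod (fcoef u k))^2) \<le> (\<Sum>\<^sub>\<infinity>k. (1 + (norm (kvec k))^2) powr s * (cmod (fcoef u k))^2)"
    using assms F unfolding in_H_def by (intro finite_sum_le_infsum) auto
  thus "L2_set (\<lambda>m. japb m powr s * cmod (fcoef u m)) F \<le> H_norm s u"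
    unfolding L2_set_def H_norm_def by (simp add: japb_powr_double power_mult_distrib)
qed

lemma in_H_mono_hbd:
  fixes u :: "real^'d \<Rightarrow> real"
  assumes "in_H s u" "r \<le> s"
  shows "hbd r (fcoef u) (H_norm r u)"
proof (rule in_H_hbd)
  have "(\<lambda>k. (1 + (norm (kvec k))^2) powr r * (cmod (fcoef u k))^2) summable_on UNIV"
    by (rule summable_on_comparison_test[of "\<lambda>k. (1 + (norm (kvec k))^2) powr s * (cmod (fcoef u k))^2"])
      (use assms in \<open>auto simp: in_H_def intro!: mult_right_mono powr_mono\<close>)
  thus "in_H r u" using assms by (simp add: in_H_def)
qed

lemma hbd_abs_sum:
  fixes a :: "int^'d \<Rightarrow> complex"
  assumes "hbd (real CARD('d)) a R" shows "abs_sum a"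
proof (rule l1bd_summable)
  let ?s = "real CARD('d) - 1/4"
  have h: "hbd ?s a R" by (rule hbd_mono[OF assms]) auto
  have "l1bd (\<lambda>k. \<bar>japb k powr (- ?s)\<bar> * \<bar>japb k powr ?s * cmod (a k)\<bar>) (sigJ TYPE('d) * R)"
    by (rule l2bd_mult_l1[OF sigJ_l2bd]) (use h in \<open>simp only: hbd_def\<close>)
  moreover have "\<bar>japb k powr (- ?s)\<bar> * \<bar>japb k powr ?s * cmod (a k)\<bar> = cmod (a k)" for k
    by (simp add: abs_mult powr_minus field_simps japb_neq_0)
  ultimately show "l1bd (\<lambda>k. cmod (a k)) (sigJ TYPE('d) * R)" by (simp only:)
qed simp

text \<open>The quadratic form is the integral of \<phi> |p|^2 for p = sum of
  \<open>v l * ek l\<close>. The same identity with weight 1 gives the square sum of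
  \<open>v\<close>, so the pointwise lower bound carries over.\<close>

lemma coercive_fcoef:
  fixes \<phi> :: "real^'d \<Rightarrow> real"
  assumes \<phi>: "integrable torus \<phi>" and low: "\<And>x. c \<le> \<phi> x"
  shows "coercive (fcoef \<phi>) c"
  unfolding coercive_def
proof (intro allI impI)
  fix F :: "(int^'d) set" and v :: "int^'d \<Rightarrow> complex" assume F: "finite F"
  have [measurable]: "\<phi> \<in> borel_measurable borel" using \<phi> by (auto dest: borel_measurable_integrable)
  have ie: "integrable torus (\<lambda>x. of_real (w x) * (cnj (ek k x) * ek l x))" if "integrable torus w" for k l and w :: "real^'d \<Rightarrow> real"
    by (rule integrable_mult_bounded[of _ _ 1]) (use that in \<open>auto simp: norm_mult\<close>)
  define p where "p x = (\<Sum>l\<in>F. v l * ek l x)" for x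
  have expand: "(\<Sum>k\<in>F. \<Sum>l\<in>F. (\<integral>x. of_real (w x) * (cnj (ek k x) * ek l x) \<partial>torus) * v l * cnj (v k)) = (\<integral>x. of_real (w x * (cmod (p x))^2) \<partial>torus)"
    and intp: "integrable torus (\<lambda>x. w x * (cmod (p x))^2)"
    if w: "integrable torus w" for w :: "real^'d \<Rightarrow> real"
  proof -
    have pt: "(\<Sum>k\<in>F. \<Sum>l\<in>F. (of_real (w x) * (cnj (ek k x) * ek l x)) * (v l * cnj (v k))) = of_real (w x * (cmod (p x))^2)" for x
    proof -
      have "complex_of_real (w x * (cmod (p x))^2) = of_real (w x) * (p x * cnj (p x))" by (simp only: of_real_mult complex_norm_square)
      also have "\<dots> = (\<Sum>l\<in>F. \<Sum>k\<in>F. of_real (w x) * ((v l * ek l x) * cnj (v k * ek k x)))"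
        unfolding p_def cnj_sum sum_product by (simp only: sum_distrib_left)
      also have "\<dots> = (\<Sum>k\<in>F. \<Sum>l\<in>F. of_real (w x) * ((v l * ek l x) * cnj (v k * ek k x)))" by (rule sum.swap)
      also have "\<dots> = (\<Sum>k\<in>F. \<Sum>l\<in>F. (of_real (w x) * (cnj (ek k x) * ek l x)) * (v l * cnj (v k)))"
        by (simp add: mult_ac)
      finally show ?thesis by simp
    qed
    have i: "integrable torus (\<lambda>x. (of_real (w x) * (cnj (ek k x) * ek l x)) * (v l * cnj (v k)))" for k l
      using ie[OF w] by (rule integrable_mult_left)
    have "integrable torus (\<lambda>x. \<Sum>k\<in>F. \<Sum>l\<in>F. (of_real (w x) * (cnj (ek k x) * ek l x)) * (v l * cnj (v k)))"
      by (intro Bochner_Integration.integrable_sum i)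
    hence "integrable torus (\<lambda>x. complex_of_real (w x * (cmod (p x))^2))" unfolding pt .
    thus "integrable torus (\<lambda>x. w x * (cmod (p x))^2)" by (simp only: complex_of_real_integrable_eq)
    have "(\<integral>x. of_real (w x * (cmod (p x))^2) \<partial>torus) = (\<integral>x. (\<Sum>k\<in>F. \<Sum>l\<in>F. (of_real (w x) * (cnj (ek k x) * ek l x)) * (v l * cnj (v k))) \<partial>torus)"
      unfolding pt ..
    also have "\<dots> = (\<Sum>k\<in>F. \<Sum>l\<in>F. (\<integral>x. (of_real (w x) * (cnj (ek k x) * ek l x)) * (v l * cnj (v k)) \<partial>torus))"
      using i by (subst Bochner_Integration.integral_sum, simp, subst Bochner_Integration.integral_sum) auto
    also have "\<dots> = (\<Sum>k\<in>F. \<Sum>l\<in>F. (\<integral>x. of_real (w x) * (cnj (ek k x) * ek l x) \<partial>torus) * (v l * cnj (v k)))"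
      by (intro sum.cong refl integral_mult_left_zero)
    finally show "(\<Sum>k\<in>F. \<Sum>l\<in>F. (\<integral>x. of_real (w x) * (cnj (ek k x) * ek l x) \<partial>torus) * v l * cnj (v k)) = (\<integral>x. of_real (w x * (cmod (p x))^2) \<partial>torus)"
      by (simp only: mult.assoc)
  qed
  have one: "integrable torus (\<lambda>x::real^'d. 1::real)" by (rule integrable_torus_bounded[where B = 1]) auto
  have f\<phi>: "fcoef \<phi> (k - l) = (\<integral>x. of_real (\<phi> x) * (cnj (ek k x) * ek l x) \<partial>torus)" for k l
  proof -
    have "cnj (ek (k - l) x) = cnj (ek k x) * ek l x" for x
      using ek_add[of k "- l" x] by (simp add: ek_minus)
    thus ?thesis by (simp add: fcoef_eq)
  qed
  have "complex_of_real (\<Sum>k\<in>F. (cmod (v k))^2) = (\<Sum>k\<in>F. \<Sum>l\<in>F. (\<integral>x. of_real 1 * (cnj (ek k x) * ek l x) \<partial>torus) * v l * cnj (v k))"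
    unfolding of_real_1 mult_1_left integral_ek_cnj of_real_sum
  proof (rule sum.cong[OF refl])
    fix k assume k: "k \<in> F"
    have "(\<Sum>l\<in>F. (if l = k then 1 else 0) * v l * cnj (v k)) = (\<Sum>l\<in>F. if l = k then v k * cnj (v k) else 0)"
      by (intro sum.cong refl) auto
    also have "\<dots> = v k * cnj (v k)" using k F by simp
    finally show "complex_of_real ((cmod (v k))^2) = (\<Sum>l\<in>F. (if l = k then 1 else 0) * v l * cnj (v k))"
      by (simp only: complex_norm_square)
  qed
  also have "\<dots> = of_real (\<integral>x. 1 * (cmod (p x))^2 \<partial>torus)" unfolding expand[OF one] by (rule integral_complex_of_real)
  finally have s: "(\<Sum>k\<in>F. (cmod (v k))^2) = (\<integral>x. 1 * (cmod (p x))^2 \<partial>torus)" by (simp only: of_real_eq_iff)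
  have "c * (\<Sum>k\<in>F. (cmod (v k))^2) = (\<integral>x. c * (1 * (cmod (p x))^2) \<partial>torus)" unfolding s by simp
  also have "\<dots> \<le> (\<integral>x. \<phi> x * (cmod (p x))^2 \<partial>torus)"
  proof (rule integral_mono)
    show "integrable torus (\<lambda>x. c * (1 * (cmod (p x))^2))" using intp[OF one] by (rule integrable_mult_right)
    show "integrable torus (\<lambda>x. \<phi> x * (cmod (p x))^2)" by (rule intp[OF \<phi>])
    show "c * (1 * (cmod (p x))^2) \<le> \<phi> x * (cmod (p x))^2" for x using low[of x] by (simp add: mult_right_mono)
  qed
  also have "\<dots> = Re (\<integral>x. of_real (\<phi> x * (cmod (p x))^2) \<partial>torus)"
    by (simp only: integral_complex_of_real Re_complex_of_real)
  also have "\<dots> = Re (\<Sum>k\<in>F. \<Sum>l\<in>F. fcoef \<phi> (k - l) * v l * cnj (v k))"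
    unfolding f\<phi> expand[OF \<phi>] ..
  finally show "c * (\<Sum>k\<in>F. (cmod (v k))^2) \<le> Re (\<Sum>k\<in>F. \<Sum>l\<in>F. fcoef \<phi> (k - l) * v l * cnj (v k))" .
qed

text \<open>Cauchy--Schwarz in time bounds the increment of each coefficient; the bounds are then summed over \<open>k\<close>.\<close>

lemma tderiv_hbd:
  fixes u g :: "real \<Rightarrow> real^'d \<Rightarrow> real"
  assumes T: "0 < T" and s: "0 \<le> s" and g: "L2H T s g" and d: "tderiv T u g" and u0: "hbd s (fcoef (u 0)) C0"
  shows "\<exists>C. \<forall>t\<in>{0..T}. hbd s (fcoef (u t)) C"
proof -
  let ?L = "lebesgue_on {0..T}"
  define \<Gamma> where "\<Gamma> = integral\<^sup>L ?L (\<lambda>t. (H_norm s (g t))^2)"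
  have T_sets: "{0..T} \<in> sets lebesgue" by simp
  interpret finite_measure ?L by (rule finite_measure_lebesgue_on) simp
  have gm: "(\<lambda>t. fcoef (g t) k) \<in> borel_measurable ?L" for k using g by (simp add: L2H_def)
  have gH: "AE t in ?L. in_H s (g t)" and gi: "integrable ?L (\<lambda>t. (H_norm s (g t))^2)" using g by (auto simp: L2H_def)
  have pt: "AE t in ?L. \<forall>F. finite F \<longrightarrow> (\<Sum>k\<in>F. (japb k powr s)^2 * (cmod (fcoef (g t) k))^2) \<le> (H_norm s (g t))^2"
    using gH
  proof eventually_elim
    case (elim t)
    show ?case
    proof (intro allI impI)
      fix F :: "(int^'d) set" assume "finite F"
      have "L2_set (\<lambda>m. japb m powr s * cmod (fcoef (g t) m)) F \<le> H_norm s (g t)"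
        using in_H_hbd[OF elim] unfolding hbd_def by (rule l2bdD)
      hence "(L2_set (\<lambda>m. japb m powr s * cmod (fcoef (g t) m)) F)^2 \<le> (H_norm s (g t))^2" by (intro power_mono) auto
      thus "(\<Sum>k\<in>F. (japb k powr s)^2 * (cmod (fcoef (g t) k))^2) \<le> (H_norm s (g t))^2"
        by (simp add: L2_set_def sum_nonneg power_mult_distrib)
    qed
  qed
  have sq: "integrable ?L (\<lambda>t. (cmod (fcoef (g t) k))^2)" for k
  proof (rule Bochner_Integration.integrable_bound[OF gi])
    show "(\<lambda>t. (cmod (fcoef (g t) k))^2) \<in> borel_measurable ?L" using gm[of k] by measurable
    show "AE t in ?L. norm ((cmod (fcoef (g t) k))^2) \<le> norm ((H_norm s (g t))^2)"
      using pt
    proof eventually_elim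
      case (elim t)
      have "1 * (cmod (fcoef (g t) k))^2 \<le> (japb k powr s)^2 * (cmod (fcoef (g t) k))^2"
        using ge_one_powr_ge_zero[OF japb_ge_1[of k] s] by (intro mult_right_mono one_le_power) auto
      also have "\<dots> \<le> (H_norm s (g t))^2" using elim[rule_format, of "{k}"] by simp
      finally show ?case by simp
    qed
  qed
  have ab: "integrable ?L (\<lambda>t. cmod (fcoef (g t) k))" for k
  proof (rule Bochner_Integration.integrable_bound)
    show "integrable ?L (\<lambda>t. 1 + (cmod (fcoef (g t) k))^2)" using sq by simp
    show "(\<lambda>t. cmod (fcoef (g t) k)) \<in> borel_measurable ?L" using gm[of k] by measurable
    show "AE t in ?L. norm (cmod (fcoef (g t) k)) \<le> norm (1 + (cmod (fcoef (g t) k))^2)"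
    proof (rule AE_I2)
      fix t
      have "2 * cmod (fcoef (g t) k) \<le> 1 + (cmod (fcoef (g t) k))^2"
        using zero_le_power2[of "cmod (fcoef (g t) k) - 1"] by (simp add: power2_diff)
      hence "cmod (fcoef (g t) k) \<le> 1 + (cmod (fcoef (g t) k))^2" using norm_ge_zero[of "fcoef (g t) k"] by linarith
      thus "norm (cmod (fcoef (g t) k)) \<le> norm (1 + (cmod (fcoef (g t) k))^2)" by simp
    qed
  qed
  \<comment> \<open>The time derivative is integrated in the Henstock-Kurzweil sense in
    \<open>tderiv\<close> and in the Lebesgue sense in \<open>L2H\<close>; here integrability is
    carried from the latter to the former.\<close>
  note hi = integrable_on_lebesgue_on[OF sq T_sets] integrable_on_lebesgue_on[OF ab T_sets]
  have inc: "(cmod (fcoef (u t) k - fcoef (u 0) k))^2 \<le> T * integral\<^sup>L ?L (\<lambda>t. (cmod (fcoef (g t) k))^2)" if t: "t \<in> {0..T}" for t k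
  proof -
    have "(\<lambda>s. fcoef (g s) k) integrable_on {0..T}" and "fcoef (u t) k = fcoef (u 0) k + integral {0..t} (\<lambda>s. fcoef (g s) k)"
      using d t unfolding tderiv_def by blast+
    hence gk: "(\<lambda>s. fcoef (g s) k) integrable_on {0..T}" "fcoef (u t) k - fcoef (u 0) k = integral {0..t} (\<lambda>s. fcoef (g s) k)" by simp_all
    have sub: "{0..t} \<subseteq> {0..T}" using t by auto
    have "cmod (fcoef (u t) k - fcoef (u 0) k) \<le> integral {0..t} (\<lambda>s. cmod (fcoef (g s) k))"
      unfolding gk(2) by (rule integral_norm_bound_integral) (use integrable_on_subinterval[OF gk(1) sub] integrable_on_subinterval[OF hi(2) sub] in auto)
    also have "\<dots> \<le> integral {0..T} (\<lambda>s. cmod (fcoef (g s) k))"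
      by (rule integral_subset_le[OF sub integrable_on_subinterval[OF hi(2) sub] hi(2)]) simp
    also have "\<dots> \<le> sqrt T * sqrt (integral {0..T} (\<lambda>s. (cmod (fcoef (g s) k))^2))"
      by (rule integral_sq_bound[OF T hi(2,1)]) (simp_all add: integral_nonneg[OF hi(1)])
    finally have "(cmod (fcoef (u t) k - fcoef (u 0) k))^2 \<le> (sqrt T * sqrt (integral {0..T} (\<lambda>s. (cmod (fcoef (g s) k))^2)))^2"
      by (intro power_mono) auto
    also have "\<dots> = T * integral {0..T} (\<lambda>s. (cmod (fcoef (g s) k))^2)"
      using T integral_nonneg[OF hi(1)[of k]] by (simp add: power_mult_distrib)
    finally show ?thesis by (simp only: lebesgue_integral_eq_integral[OF sq T_sets])
  qed
  have \<Gamma>: "0 \<le> \<Gamma>" unfolding \<Gamma>_def by simp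
  have diff: "hbd s (\<lambda>k. fcoef (u t) k - fcoef (u 0) k) (sqrt (T * \<Gamma>))" if t: "t \<in> {0..T}" for t
    unfolding hbd_def l2bd_def
  proof (intro allI impI)
    fix F :: "(int^'d) set" assume F: "finite F"
    have "(\<Sum>k\<in>F. (japb k powr s)^2 * (cmod (fcoef (u t) k - fcoef (u 0) k))^2)
       \<le> (\<Sum>k\<in>F. (japb k powr s)^2 * (T * integral\<^sup>L ?L (\<lambda>t. (cmod (fcoef (g t) k))^2)))"
      by (intro sum_mono mult_left_mono inc t) auto
    also have "\<dots> = T * integral\<^sup>L ?L (\<lambda>t. \<Sum>k\<in>F. (japb k powr s)^2 * (cmod (fcoef (g t) k))^2)"
      using sq by (subst Bochner_Integration.integral_sum) (auto simp: sum_distrib_left mult.left_commute)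
    also have "\<dots> \<le> T * \<Gamma>"
      unfolding \<Gamma>_def
    proof (intro mult_left_mono integral_mono_AE gi)
      show "integrable ?L (\<lambda>t. \<Sum>k\<in>F. (japb k powr s)^2 * (cmod (fcoef (g t) k))^2)" using sq by auto
      show "AE t in ?L. (\<Sum>k\<in>F. (japb k powr s)^2 * (cmod (fcoef (g t) k))^2) \<le> (H_norm s (g t))^2"
        using pt by eventually_elim (use F in auto)
    qed (use T in auto)
    finally show "L2_set (\<lambda>m. japb m powr s * cmod (fcoef (u t) m - fcoef (u 0) m)) F \<le> sqrt (T * \<Gamma>)"
      unfolding L2_set_def by (simp add: power_mult_distrib)
  qed
  have "hbd s (fcoef (u t)) (sqrt (T * \<Gamma>) + C0)" if t: "t \<in> {0..T}" for t
  proof -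
    have "l2bd (\<lambda>m. japb m powr s * cmod (fcoef (u t) m - fcoef (u 0) m) + japb m powr s * cmod (fcoef (u 0) m)) (sqrt (T * \<Gamma>) + C0)"
      using diff[OF t] u0 unfolding hbd_def by (rule l2bd_add)
    thus ?thesis unfolding hbd_def
    proof (rule l2bd_mono)
      fix m :: "int^'d"
      have "cmod (fcoef (u t) m) \<le> cmod (fcoef (u t) m - fcoef (u 0) m) + cmod (fcoef (u 0) m)"
        using norm_triangle_ineq[of "fcoef (u t) m - fcoef (u 0) m" "fcoef (u 0) m"] by simp
      thus "\<bar>japb m powr s * cmod (fcoef (u t) m)\<bar> \<le> japb m powr s * cmod (fcoef (u t) m - fcoef (u 0) m) + japb m powr s * cmod (fcoef (u 0) m)"
        by (simp add: distrib_left[symmetric] mult_left_mono)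
    qed simp
  qed
  thus ?thesis by blast
qed

lemma AE_lebesgue_on_negligible:
  fixes S :: "'a::euclidean_space set"
  assumes "AE x in lebesgue_on S. P x" "S \<in> sets lebesgue"
  obtains N where "negligible N" "\<And>x. x \<in> S - N \<Longrightarrow> P x"
proof -
  from assms(1) obtain N where N: "{x \<in> space (lebesgue_on S). \<not> P x} \<subseteq> N" "emeasure (lebesgue_on S) N = 0" "N \<in> sets (lebesgue_on S)"
    by (rule AE_E)
  have "N \<in> null_sets (lebesgue_on S)" using N by (simp add: null_sets_def)
  hence "N \<in> null_sets lebesgue" using null_sets_restrict_space[OF assms(2)] by auto
  hence "negligible N" by (simp add: negligible_iff_null_sets)
  moreover have "P x" if "x \<in> S - N" for x using N(1) that by auto
  ultimately show thesis by (rule that)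
qed

lemma continuous_on_infsum:
  fixes f :: "'a \<Rightarrow> 'b::topological_space \<Rightarrow> 'c::banach"
  assumes "\<And>l t. t \<in> A \<Longrightarrow> norm (f l t) \<le> B l" "B summable_on UNIV" "\<And>l. continuous_on A (f l)"
  shows "continuous_on A (\<lambda>t. \<Sum>\<^sub>\<infinity>l. f l t)"
  by (rule uniform_limit_theorem[OF _ Weierstrass_m_test_general[of UNIV A f B]])
    (use assms in \<open>auto intro!: always_eventually continuous_on_sum\<close>)

lemma hbd_pointwise:
  assumes "hbd s a R" shows "cmod (a k) \<le> R * japb k powr (- s)"
proof -
  have "japb k powr s * cmod (a k) \<le> R"
    using assms unfolding hbd_def l2bd_def by (auto dest!: spec[of _ "{k}"])
  hence "cmod (a k) \<le> R / japb k powr s" using japb_neq_0[of k] by (simp add: pos_le_divide_eq mult.commute)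
  thus ?thesis by (simp add: powr_minus_divide)
qed

text \<open>Weierstrass M-test: one coefficient supplies the decay with exponent s > d, which is
  summable over the lattice, and the other one is merely bounded.\<close>

lemma rhs_continuous:
  fixes a :: "real \<Rightarrow> int^'d \<Rightarrow> complex"
  assumes W: "potbd W M" and s: "real CARD('d) < s" and a: "\<And>t. t \<in> A \<Longrightarrow> hbd s (a t) C"
    and c: "\<And>k. continuous_on A (\<lambda>t. a t k)"
  shows "continuous_on A (\<lambda>t. rhs W (a t) k)"
proof (cases "A = {}")
  case False
  then obtain t0 where "t0 \<in> A" by blast
  have C: "0 \<le> C" using a[OF \<open>t0 \<in> A\<close>] by (rule hbd_nonneg)
  have M: "0 \<le> M" using W by (rule potbd_nonneg)
  have "continuous_on A (\<lambda>t. \<Sum>\<^sub>\<infinity>l. of_real (kvec k \<bullet> kvec l) * a t (k - l) * (W l * a t l))"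
  proof (rule continuous_on_infsum)
    show "(\<lambda>l::int^'d. norm (kvec k) * (M / (2 * pi)) * (C * C) * japb l powr (- s)) summable_on UNIV"
      by (intro summable_on_cmult_right japb_powr_summable s)
    fix l :: "int^'d" 
    show "continuous_on A (\<lambda>t. of_real (kvec k \<bullet> kvec l) * a t (k - l) * (W l * a t l))"
      by (intro continuous_intros c)
    fix t assume t: "t \<in> A"
    have "cmod (a t (k - l)) \<le> C * japb (k - l) powr (- s)" by (rule hbd_pointwise[OF a[OF t]])
    also have "\<dots> \<le> C * 1"
      using C s japb_ge_1[of "k - l"] powr_mono[of "- s" 0 "japb (k - l)"] by (intro mult_left_mono) (simp_all add: japb_neq_0)
    finally have 1: "cmod (a t (k - l)) \<le> C" by simp
    have 2: "cmod (a t l) \<le> C * japb l powr (- s)" by (rule hbd_pointwise[OF a[OF t]])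
    have "cmod (of_real (kvec k \<bullet> kvec l) * a t (k - l) * (W l * a t l)) \<le> norm (kvec k) * (M / (2 * pi)) * (cmod (a t (k - l)) * cmod (a t l))"
      by (rule potbd_term[OF W])
    also have "\<dots> \<le> norm (kvec k) * (M / (2 * pi)) * (C * (C * japb l powr (- s)))"
      using 1 2 C M by (intro mult_left_mono mult_mono) auto
    finally show "norm (of_real (kvec k \<bullet> kvec l) * a t (k - l) * (W l * a t l)) \<le> norm (kvec k) * (M / (2 * pi)) * (C * C) * japb l powr (- s)"
      by (simp only: mult.assoc)
  qed
  thus ?thesis unfolding rhs_def Bl_def by (intro continuous_intros c)
qed simp

lemma fcoef_cong_AE:
  fixes u v :: "real^'d \<Rightarrow> real"
  assumes "u \<in> borel_measurable borel" "v \<in> borel_measurable borel" "AE x in lborel. x \<in> cube \<longrightarrow> u x = v x"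
  shows "fcoef u k = fcoef v k"
proof -
  have "AE x in torus. u x = v x" using assms(3) by (simp add: AE_torus)
  thus ?thesis using assms(1,2) unfolding fcoef_eq[OF assms(1)] fcoef_eq[OF assms(2)]
    by (intro integral_cong_AE) (auto intro!: borel_measurable_times)
qed

text \<open>The divergence and the gradient supply the factors 2 pi i k_j and 2 pi i l_j, whose
  products sum to - 4 pi^2 k . l; the convolution with the density gives the remaining product of
  coefficients.\<close>

lemma interaction_rhs:
  fixes W \<rho> :: "real^'d \<Rightarrow> real"
  assumes G: "\<And>j. wderiv W (axis j 1) (G j)" and W: "potbd (fcoef W) M"
    and \<rho>: "L2fun \<rho>" "abs_sum (fcoef \<rho>)" "hbd 0 (fcoef \<rho>) R"
  shows "- complex_of_real (4 * pi^2 * (norm (kvec k))^2) * fcoef \<rho> k + (\<Sum>j\<in>UNIV. 2 * pi * \<i> * of_int (k$j) *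
           fcoef (\<lambda>x. \<rho> x * (LINT y:cube|lborel. G j (x - y) * \<rho> y)) k) = rhs (fcoef W) (fcoef \<rho>) k"
proof -
  have \<rho>i: "integrable torus \<rho>" by (rule L2fun_integrable[OF \<rho>(1)])
  have fG: "fcoef (G j) l = 2 * pi * \<i> * of_int (l $ j) * fcoef W l" for j l by (rule wderiv_axis_coef[OF G])
  have Gi: "integrable torus (G j)" "periodic (G j)" for j using G[of j] by (auto simp: wderiv_def set_integrable_cube)
  have bG: "cmod (fcoef (G j) l) \<le> M" for j l
  proof -
    have "cmod (fcoef (G j) l) = 2 * pi * \<bar>kvec l $ j\<bar> * cmod (fcoef W l)" by (simp add: fG norm_mult kvec_nth)
    also have "\<dots> \<le> 2 * pi * norm (kvec l) * cmod (fcoef W l)" by (intro mult_right_mono mult_left_mono component_le_norm_cart) auto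
    also have "\<dots> \<le> M" using W by (simp add: potbd_def)
    finally show ?thesis .
  qed
  have B: "abs_sum (\<lambda>l. fcoef \<rho> l * fcoef (G j) l)" for j
    by (rule summable_on_comparison_test[OF summable_on_cmult_left[OF \<rho>(2), of M]])
      (auto simp: norm_mult intro!: mult_left_mono bG)
  define f where "f j l = 2 * pi * \<i> * of_int (k$j) * (fcoef \<rho> l * fcoef (G j) l * fcoef \<rho> (k - l))" for j l
  have hs: "(f j has_sum (2 * pi * \<i> * of_int (k$j) * fcoef (\<lambda>x. \<rho> x * (LINT y:cube|lborel. G j (x - y) * \<rho> y)) k)) UNIV" for j
    unfolding f_def by (intro has_sum_cmult_right fcoef_convolution_product Gi \<rho>i \<rho>(2) B)
  have "(\<Sum>j\<in>UNIV. 2 * pi * \<i> * of_int (k$j) * fcoef (\<lambda>x. \<rho> x * (LINT y:cube|lborel. G j (x - y) * \<rho> y)) k) = (\<Sum>j\<in>UNIV. infsum (f j) UNIV)"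
    by (intro sum.cong refl infsumI[symmetric] hs)
  also have "\<dots> = (\<Sum>\<^sub>\<infinity>l. \<Sum>j\<in>UNIV. f j l)"
    by (rule infsum_sum_swap(1)[symmetric]) (use hs in \<open>auto intro: has_sum_imp_summable\<close>)
  also have "(\<lambda>l. \<Sum>j\<in>UNIV. f j l) = (\<lambda>l. - of_real (4 * pi^2) * (of_real (kvec k \<bullet> kvec l) * fcoef \<rho> (k - l) * (fcoef W l * fcoef \<rho> l)))"
  proof
    fix l :: "int^'d"
    have "(\<Sum>j\<in>UNIV. f j l) = (\<Sum>j\<in>UNIV. - of_real (4 * pi^2) * (of_int (k$j * l$j) * (fcoef \<rho> (k - l) * (fcoef W l * fcoef \<rho> l))))"
      by (rule sum.cong[OF refl]) (simp add: f_def fG power2_eq_square algebra_simps)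
    also have "\<dots> = - of_real (4 * pi^2) * (of_int (\<Sum>j\<in>UNIV. k$j * l$j) * (fcoef \<rho> (k - l) * (fcoef W l * fcoef \<rho> l)))"
      by (simp only: of_int_sum sum_distrib_left sum_distrib_right)
    finally show "(\<Sum>j\<in>UNIV. f j l) = - of_real (4 * pi^2) * (of_real (kvec k \<bullet> kvec l) * fcoef \<rho> (k - l) * (fcoef W l * fcoef \<rho> l))"
      by (simp only: kvec_inner_int of_real_of_int_eq mult.assoc)
  qed
  also have "infsum \<dots> UNIV = - of_real (4 * pi^2) * Bl (fcoef \<rho>) (\<lambda>l. fcoef W l * fcoef \<rho> l) k"
    unfolding Bl_def by (rule infsum_cmult_right) (rule Bl_summable[OF W \<rho>(3,3)])
  finally show ?thesis unfolding rhs_def lam_def by simp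
qed

text \<open>The time derivative in H^(\<beta>-1) bounds the solution in that space at every time,
  and \<beta> - 1 > d makes the right-hand side continuous in time. The equation, known for almost
  every time, thereby becomes a differential equation valid at every time.\<close>

lemma solves_fourier_flow:
  fixes W \<phi> :: "real^'d \<Rightarrow> real"
  assumes T: "0 < T" and \<beta>: "real CARD('d) + 3 \<le> real \<beta>" and \<phi>: "in_H (real \<beta>) \<phi>"
    and ex: "\<And>j. \<exists>g. wderiv W (axis j 1) g" and W: "potbd (fcoef W) M"
    and sol: "solves \<beta> T W \<phi> \<rho> g"
  shows "fourier_flow T (fcoef W) (\<lambda>t. fcoef (\<rho> t))" "fcoef (\<rho> 0) = fcoef \<phi>"
    and "\<exists>C. \<forall>t\<in>{0..T}. hbd (real \<beta> - 1) (fcoef (\<rho> t)) C" "\<And>k. continuous_on {0..T} (\<lambda>t. fcoef (\<rho> t) k)"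
proof -
  define s where "s = real \<beta> - 1"
  have s: "real CARD('d) < s" using \<beta> by (simp add: s_def)
  have L2: "L2fun (\<rho> t)" if "t \<in> {0..T}" for t using sol that by (simp add: solves_def)
  have m: "\<rho> t \<in> borel_measurable borel" if "t \<in> {0..T}" for t using L2[OF that] by (simp add: L2fun_def)
  have td: "tderiv T \<rho> g" and gH: "L2H T s g" using sol by (simp_all add: solves_def s_def)
  have \<phi>m: "\<phi> \<in> borel_measurable borel" using \<phi> by (simp add: in_H_def L2fun_def)
  show init: "fcoef (\<rho> 0) = fcoef \<phi>"
    by (rule ext, rule fcoef_cong_AE[OF m \<phi>m]) (use T sol in \<open>auto simp: solves_def\<close>)
  have "hbd s (fcoef (\<rho> 0)) (H_norm s \<phi>)" unfolding init by (rule in_H_mono_hbd[OF \<phi>]) (simp add: s_def)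
  hence ex: "\<exists>C. \<forall>t\<in>{0..T}. hbd s (fcoef (\<rho> t)) C" using s by (intro tderiv_hbd[OF T _ gH td]) auto
  thus "\<exists>C. \<forall>t\<in>{0..T}. hbd (real \<beta> - 1) (fcoef (\<rho> t)) C" by (simp only: s_def)
  obtain C where C: "\<And>t. t \<in> {0..T} \<Longrightarrow> hbd s (fcoef (\<rho> t)) C" using ex by blast
  have gi: "(\<lambda>s. fcoef (g s) k) integrable_on {0..T}"
    and rep: "t \<in> {0..T} \<Longrightarrow> fcoef (\<rho> t) k = fcoef (\<rho> 0) k + integral {0..t} (\<lambda>s. fcoef (g s) k)" for t k
    using td unfolding tderiv_def by blast+
  show cont: "continuous_on {0..T} (\<lambda>t. fcoef (\<rho> t) k)" for k
  proof (rule continuous_on_eq)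
    show "continuous_on {0..T} (\<lambda>t. fcoef (\<rho> 0) k + integral {0..t} (\<lambda>s. fcoef (g s) k))"
      by (intro continuous_intros indefinite_integral_continuous_1 gi)
  qed (simp only: rep[symmetric])
  have rc: "continuous_on {0..T} (\<lambda>t. rhs (fcoef W) (fcoef (\<rho> t)) k)" for k
    by (rule rhs_continuous[OF W s C cont])
  obtain G where G: "\<And>j. wderiv W (axis j 1) (G j)" using assms(4) by metis
  have ae: "AE t in lebesgue_on {0..T}. \<forall>k. fcoef (g t) k =
            - complex_of_real (4 * pi^2 * (norm (kvec k))^2) * fcoef (\<rho> t) k
            + (\<Sum>j\<in>UNIV. 2 * pi * \<i> * of_int (k$j) *
                 fcoef (\<lambda>x. \<rho> t x * (LINT y:cube|lborel. G j (x - y) * \<rho> t y)) k)"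
    using sol G unfolding solves_def by blast
  have "{0..T} \<in> sets lebesgue" by simp
  from ae this obtain N where N: "negligible N" and eq: "\<And>t. t \<in> {0..T} - N \<Longrightarrow> \<forall>k. fcoef (g t) k =
            - complex_of_real (4 * pi^2 * (norm (kvec k))^2) * fcoef (\<rho> t) k
            + (\<Sum>j\<in>UNIV. 2 * pi * \<i> * of_int (k$j) *
                 fcoef (\<lambda>x. \<rho> t x * (LINT y:cube|lborel. G j (x - y) * \<rho> t y)) k)"
    by (rule AE_lebesgue_on_negligible) (rule that)
  have gr: "fcoef (g t) k = rhs (fcoef W) (fcoef (\<rho> t)) k" if t: "t \<in> {0..T} - N" for t k
    unfolding eq[OF t, rule_format]
  proof (rule interaction_rhs[OF G W L2])
    have t': "t \<in> {0..T}" using t by blast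
    thus "t \<in> {0..T}" .
    show "abs_sum (fcoef (\<rho> t))" by (rule hbd_abs_sum[OF hbd_mono[OF C[OF t'] _ order_refl]]) (use s in simp)
    show "hbd 0 (fcoef (\<rho> t)) C" by (rule hbd_mono[OF C[OF t'] _ order_refl]) (use s in simp)
  qed
  \<comment> \<open>The exceptional null set of times drops out of the integral. The new integrand
    is continuous, so the fundamental theorem of calculus yields the derivative everywhere,
    including one-sided derivatives at the end points.\<close>
  have rep': "fcoef (\<rho> t) k = fcoef (\<rho> 0) k + integral {0..t} (\<lambda>s. rhs (fcoef W) (fcoef (\<rho> s)) k)" if t: "t \<in> {0..T}" for t k
  proof -
    have "integral {0..t} (\<lambda>s. fcoef (g s) k) = integral {0..t} (\<lambda>s. rhs (fcoef W) (fcoef (\<rho> s)) k)"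
      by (rule integral_spike[OF N]) (use t gr in auto)
    thus ?thesis using rep[OF t, of k] by simp
  qed
  show "fourier_flow T (fcoef W) (\<lambda>t. fcoef (\<rho> t))"
    unfolding fourier_flow_def
  proof (intro conjI ballI allI)
    fix t k assume t: "t \<in> {0..T}"
    have "((\<lambda>t. fcoef (\<rho> 0) k + integral {0..t} (\<lambda>s. rhs (fcoef W) (fcoef (\<rho> s)) k)) has_vector_derivative 0 + rhs (fcoef W) (fcoef (\<rho> t)) k) (at t within {0..T})"
      by (intro has_vector_derivative_add has_vector_derivative_const integral_has_vector_derivative rc t)
    hence "((\<lambda>t. fcoef (\<rho> 0) k + integral {0..t} (\<lambda>s. rhs (fcoef W) (fcoef (\<rho> s)) k)) has_vector_derivative rhs (fcoef W) (fcoef (\<rho> t)) k) (at t within {0..T})"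
      by (simp only: add_0_left)
    thus "((\<lambda>t. fcoef (\<rho> t) k) has_vector_derivative rhs (fcoef W) (fcoef (\<rho> t)) k) (at t within {0..T})"
      by (rule has_vector_derivative_transform[OF t, rotated]) (erule rep')
  next
    fix t assume t: "t \<in> {0..T}"
    show "hermitian (fcoef (\<rho> t))" unfolding hermitian_def by (simp add: fcoef_herm[OF m[OF t]])
  next
    show "\<exists>C. \<forall>t\<in>{0..T}. hbd (real CARD('d)) (fcoef (\<rho> t)) C"
      by (rule exI[of _ C], intro ballI hbd_mono[OF C _ order_refl]) (use s in auto)
  qed
qed

section \<open>The L2 distance of two solutions\<close>

lemma L2_norm_nonneg [simp]: "0 \<le> L2_norm u"
  unfolding L2_norm_def set_lebesgue_integral_def by (intro real_sqrt_ge_zero integral_nonneg_AE) simp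

lemma L2_norm_fourier:
  fixes u v :: "real^'d \<Rightarrow> real"
  assumes "L2fun u" "L2fun v" and "hbd (real CARD('d)) (fcoef u) C1" "hbd (real CARD('d)) (fcoef v) C2"
  shows "((\<lambda>k. (cmod (fcoef u k - fcoef v k))^2) has_sum (L2_norm (\<lambda>x. u x - v x))^2) UNIV"
proof -
  have i: "integrable torus u" "integrable torus v" using assms by (simp_all add: L2fun_integrable)
  have f: "fcoef (\<lambda>x. u x - v x) = (\<lambda>k. fcoef u k - fcoef v k)" by (rule ext) (rule fcoef_diff[OF i])
  have "((\<lambda>k. (cmod (fcoef (\<lambda>x. u x - v x) k))^2) has_sum (LINT x:cube|lborel. (u x - v x)^2)) UNIV"
    by (rule parseval) (use i in \<open>simp_all add: f hbd_abs_sum[OF hbd_diff[OF assms(3,4)]]\<close>)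
  moreover have "0 \<le> (LINT x:cube|lborel. (u x - v x)^2)"
    unfolding set_lebesgue_integral_def by (rule integral_nonneg_AE) simp
  ultimately show ?thesis by (simp add: f L2_norm_def)
qed

lemma L2_norm_hbd:
  fixes u v :: "real^'d \<Rightarrow> real"
  assumes "L2fun u" "L2fun v" "hbd (real CARD('d)) (fcoef u) C1" "hbd (real CARD('d)) (fcoef v) C2"
  shows "hbd 0 (\<lambda>k. fcoef u k - fcoef v k) (L2_norm (\<lambda>x. u x - v x))"
  unfolding hbd_0 l2bd_def
proof (intro allI impI)
  fix F :: "(int^'d) set" assume F: "finite F"
  note hs = L2_norm_fourier[OF assms]
  have "(\<Sum>k\<in>F. (cmod (fcoef u k - fcoef v k))^2) \<le> (\<Sum>\<^sub>\<infinity>k. (cmod (fcoef u k - fcoef v k))^2)"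
    by (rule finite_sum_le_infsum[OF has_sum_imp_summable[OF hs] F]) auto
  also have "\<dots> = (L2_norm (\<lambda>x. u x - v x))^2" by (rule infsumI[OF hs])
  finally have "L2_set (\<lambda>k. cmod (fcoef u k - fcoef v k)) F \<le> sqrt ((L2_norm (\<lambda>x. u x - v x))^2)"
    unfolding L2_set_def by (rule real_sqrt_le_mono)
  thus "L2_set (\<lambda>k. cmod (fcoef u k - fcoef v k)) F \<le> L2_norm (\<lambda>x. u x - v x)"
    by simp
qed

text \<open>By Parseval the square is a series of continuous functions, dominated termwise by a
  multiple of the summable weights with exponent s > d. The continuity makes the distance admissible
  as \<open>Z\<close> in the stability of the flow.\<close>

lemma L2_norm_continuous:
  fixes u v :: "real \<Rightarrow> real^'d \<Rightarrow> real"
  assumes L: "\<And>t. t \<in> A \<Longrightarrow> L2fun (u t)" "\<And>t. t \<in> A \<Longrightarrow> L2fun (v t)" and s: "real CARD('d) < s"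
    and C: "\<And>t. t \<in> A \<Longrightarrow> hbd s (fcoef (u t)) C1" "\<And>t. t \<in> A \<Longrightarrow> hbd s (fcoef (v t)) C2"
    and cont: "\<And>k. continuous_on A (\<lambda>t. fcoef (u t) k)" "\<And>k. continuous_on A (\<lambda>t. fcoef (v t) k)"
  shows "continuous_on A (\<lambda>t. L2_norm (\<lambda>x. u t x - v t x))"
proof -
  have d: "hbd (real CARD('d)) (fcoef (u t)) C1" "hbd (real CARD('d)) (fcoef (v t)) C2" if "t \<in> A" for t
    using C[OF that] s by (auto intro: hbd_mono)
  have eq: "L2_norm (\<lambda>x. u t x - v t x) = sqrt (\<Sum>\<^sub>\<infinity>k. (cmod (fcoef (u t) k - fcoef (v t) k))^2)" if t: "t \<in> A" for t
    using infsumI[OF L2_norm_fourier[OF L[OF t] d[OF t]]] by simp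
  have "continuous_on A (\<lambda>t. \<Sum>\<^sub>\<infinity>k. (cmod (fcoef (u t) k - fcoef (v t) k))^2)"
  proof (rule continuous_on_infsum)
    show "(\<lambda>k::int^'d. (C1 + C2)^2 * japb k powr (- s)) summable_on UNIV"
      by (intro summable_on_cmult_right japb_powr_summable s)
    fix k :: "int^'d"
    show "continuous_on A (\<lambda>t. (cmod (fcoef (u t) k - fcoef (v t) k))^2)" by (intro continuous_intros cont)
    fix t assume t: "t \<in> A"
    have p: "japb k powr (- s) \<le> 1"
      using s japb_ge_1[of k] powr_mono[of "- s" 0 "japb k"] by (simp add: japb_neq_0)
    have "(cmod (fcoef (u t) k - fcoef (v t) k))^2 \<le> ((C1 + C2) * japb k powr (- s))^2"
      by (intro power_mono hbd_pointwise hbd_diff C t) simp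
    also have "\<dots> = (C1 + C2)^2 * (japb k powr (- s) * japb k powr (- s))" by (simp add: power2_eq_square mult_ac)
    also have "\<dots> \<le> (C1 + C2)^2 * (1 * japb k powr (- s))"
      by (intro mult_left_mono mult_right_mono p) auto
    finally show "norm ((cmod (fcoef (u t) k - fcoef (v t) k))^2) \<le> (C1 + C2)^2 * japb k powr (- s)" by simp
  qed
  hence "continuous_on A (\<lambda>t. sqrt (\<Sum>\<^sub>\<infinity>k. (cmod (fcoef (u t) k - fcoef (v t) k))^2))" by (rule continuous_on_real_sqrt)
  thus ?thesis by (rule continuous_on_eq) (simp only: eq)
qed

section \<open>The stability estimate for weak solutions\<close>

lemma axis_midx2: "axis j 1 \<in> midx2"
  by (simp add: midx2_def axis_def if_distrib cong: if_cong)

text \<open>Continuity makes the Lebesgue integral in the norm and the Henstock-Kurzweil integral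
  used for the flow agree.\<close>

lemma L2L2_norm_sq:
  fixes u :: "real \<Rightarrow> real^'d \<Rightarrow> real"
  assumes "continuous_on {0..T} (\<lambda>t. L2_norm (u t))"
  shows "integral {0..T} (\<lambda>t. (L2_norm (u t))^2) = (L2L2_norm T u)^2"
proof -
  have "set_integrable lborel {0..T} (\<lambda>t. (L2_norm (u t))^2)"
    unfolding set_integrable_def using assms
    by (intro borel_integrable_compact[of "{0..T}", unfolded real_scaleR_def[symmetric]] continuous_intros) auto
  hence "(LINT t:{0..T}|lborel. (L2_norm (u t))^2) = integral {0..T} (\<lambda>t. (L2_norm (u t))^2)"
    by (rule set_borel_integral_eq_integral)
  moreover have "0 \<le> (LINT t:{0..T}|lborel. (L2_norm (u t))^2)"
    unfolding set_lebesgue_integral_def by (rule integral_nonneg_AE) simp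
  ultimately show ?thesis by (simp add: L2L2_norm_def)
qed

theorem theorem2p5:
  fixes T M cstar phimin h :: real
  assumes "T > 0" and "M > 0" and "cstar > 0" and "phimin > 0"
  shows "\<exists>S>0. \<forall>(\<beta>::nat) (\<zeta>::real) (\<phi>::real^'d \<Rightarrow> real) (K::nat) W1 W2 P \<rho>1 g1 \<rho>2 g2.
    ( \<comment> \<open>(A1)\<close>
      even \<beta> \<and> real \<beta> \<ge> 3 + real CARD('d) \<and>
      \<phi> \<in> borel_measurable lborel \<and> periodic \<phi> \<and> (\<forall>x. \<phi> x \<ge> 0) \<and>
      (LINT x:cube|lborel. \<phi> x) = 1 \<and> in_H (real \<beta>) \<phi> \<and>
      \<comment> \<open>(A2)\<close>
      (\<forall>x. \<phi> x \<ge> phimin) \<and> \<zeta> > real \<beta> + real CARD('d) / 2 \<and>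
      (\<forall>k. k \<noteq> 0 \<longrightarrow> cmod (fcoef \<phi> k) \<ge> cstar * norm (kvec k) powr (- \<zeta>)) \<and>
      H_norm (real CARD('d)) \<phi> = h \<and>
      K \<ge> 1 \<and>
      W2inf W1 \<and> fcoef W1 0 = 0 \<and> W2 \<in> EK K \<and>
      W2inf_norm W1 \<le> M \<and> W2inf_norm W2 \<le> M \<and>
      is_L2proj K W1 P \<and>
      solves \<beta> T W1 \<phi> \<rho>1 g1 \<and> solves \<beta> T W2 \<phi> \<rho>2 g2)
    \<longrightarrow> L2_norm (\<lambda>x. W2 x - W1 x)
        \<le> L2_norm (\<lambda>x. W1 x - P x)
           + S * real K powr (3 * \<zeta> / 2) *
             (L2L2_norm T (\<lambda>t x. \<rho>2 t x - \<rho>1 t x)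
              + H1H_norm T (-2) (\<lambda>t x. \<rho>2 t x - \<rho>1 t x) (\<lambda>t x. g2 t x - g1 t x))"
proof -
  \<comment> \<open>The bound on the potentials is d * M, the form in which the \<open>W2inf\<close>
    norm controls the Fourier coefficients of the gradient.\<close>
  have card: "0 < real CARD('d) * M" using assms by simp
  \<comment> \<open>At the moment when \<open>S\<close> is chosen \<open>h\<close> is an arbitrary
    real number, so it is replaced by a positive upper bound.\<close>
  have "0 < max h 1" by simp
  from stability_fourier[OF assms(1) card assms(3,4) this, where 'd = 'd]
  obtain S where S: "0 < S" and st: "\<forall>\<zeta> K W1 W2 (a :: real \<Rightarrow> int^'d \<Rightarrow> complex) b Z E.
    2 < \<zeta> \<longrightarrow> 1 \<le> K \<longrightarrow> potbd W1 (real CARD('d) * M) \<longrightarrow> potbd W2 (real CARD('d) * M) \<longrightarrow> W1 0 = 0 \<longrightarrow> W2 0 = 0 \<longrightarrow> (\<forall>k. K < norm (kvec k) \<longrightarrow> W2 k = 0) \<longrightarrow>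
    fourier_flow T W1 a \<longrightarrow> fourier_flow T W2 b \<longrightarrow> a 0 = b 0 \<longrightarrow> hbd (real CARD('d)) (b 0) (max h 1) \<longrightarrow> coercive (b 0) phimin \<longrightarrow>
    (\<forall>k. k \<noteq> 0 \<longrightarrow> cstar * norm (kvec k) powr (- \<zeta>) \<le> cmod (b 0 k)) \<longrightarrow>
    continuous_on {0..T} Z \<longrightarrow> (\<forall>t\<in>{0..T}. hbd 0 (\<lambda>k. b t k - a t k) (Z t)) \<longrightarrow>
    integral {0..T} (\<lambda>t. (Z t)^2) \<le> E^2 \<longrightarrow> 0 \<le> E \<longrightarrow>
    nrm (modes K) (\<lambda>k. W2 k - W1 k) \<le> S * K powr (3 * \<zeta> / 2) * E"
    by (elim exE conjE) (rule that)
  note stab = st[rule_format]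
  show ?thesis
  proof (intro exI[of _ S] conjI S allI impI, elim conjE)
    fix \<beta> K :: nat and \<zeta> :: real and \<phi> W1 W2 P :: "real^'d \<Rightarrow> real" and \<rho>1 g1 \<rho>2 g2
    assume \<beta>: "3 + real CARD('d) \<le> real \<beta>" and \<phi>: "in_H (real \<beta>) \<phi>" and low: "\<forall>x. phimin \<le> \<phi> x"
      and \<zeta>: "real \<beta> + real CARD('d) / 2 < \<zeta>"
      and A2: "\<forall>k. k \<noteq> 0 \<longrightarrow> cstar * norm (kvec k) powr (- \<zeta>) \<le> cmod (fcoef \<phi> k)"
      and h: "H_norm (real CARD('d)) \<phi> = h" and K: "1 \<le> K"
      and W1: "W2inf W1" "fcoef W1 0 = 0" and W2: "W2 \<in> EK K"
      and M1: "W2inf_norm W1 \<le> M" and M2: "W2inf_norm W2 \<le> M" and P: "is_L2proj K W1 P"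
      and sol1: "solves \<beta> T W1 \<phi> \<rho>1 g1" and sol2: "solves \<beta> T W2 \<phi> \<rho>2 g2"
    have W1i: "integrable torus W1" using W1(1) unfolding W2inf_def by (auto simp: set_integrable_cube)
    have ex1: "\<exists>g C. wderiv W1 \<alpha> g \<and> (AE x in lborel. x \<in> cube \<longrightarrow> \<bar>g x\<bar> \<le> C)" if "\<alpha> \<in> midx2" for \<alpha>
      using W1 that by (simp add: W2inf_def)
    have ex2: "\<exists>g C. wderiv W2 \<alpha> g \<and> (AE x in lborel. x \<in> cube \<longrightarrow> \<bar>g x\<bar> \<le> C)" for \<alpha>
      by (rule trig_wderiv[OF trigp_EK[OF W2] finite_modes])
    note pot1 = W2inf_norm_potbd[OF ex1 M1] and pot2 = W2inf_norm_potbd[OF ex2 M2]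
    have ax: "\<exists>g. wderiv W1 (axis j 1) g" "\<exists>g. wderiv W2 (axis j 1) g" for j
      using ex1[OF axis_midx2[of j]] ex2[of "axis j 1"] by blast+
    have \<beta>': "real CARD('d) + 3 \<le> real \<beta>" using \<beta> by simp
    note f1 = solves_fourier_flow[OF assms(1) \<beta>' \<phi> ax(1) pot1 sol1]
    note f2 = solves_fourier_flow[OF assms(1) \<beta>' \<phi> ax(2) pot2 sol2]
    obtain C1 where C1: "\<And>t. t \<in> {0..T} \<Longrightarrow> hbd (real \<beta> - 1) (fcoef (\<rho>1 t)) C1" using f1(3) by blast
    obtain C2 where C2: "\<And>t. t \<in> {0..T} \<Longrightarrow> hbd (real \<beta> - 1) (fcoef (\<rho>2 t)) C2" using f2(3) by blast
    have L: "L2fun (\<rho>1 t)" "L2fun (\<rho>2 t)" if "t \<in> {0..T}" for t using sol1 sol2 that by (simp_all add: solves_def)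
    define Z where "Z t = L2_norm (\<lambda>x. \<rho>2 t x - \<rho>1 t x)" for t
    have s\<beta>: "real CARD('d) < real \<beta> - 1" using \<beta> by linarith
    have Zc: "continuous_on {0..T} Z"
      unfolding Z_def by (rule L2_norm_continuous[OF L(2,1) s\<beta> C2 C1 f2(4) f1(4)])
    define E where "E = L2L2_norm T (\<lambda>t x. \<rho>2 t x - \<rho>1 t x)"
    have ZE: "integral {0..T} (\<lambda>t. (Z t)^2) = E^2" unfolding Z_def E_def
      by (rule L2L2_norm_sq) (rule Zc[unfolded Z_def])
    have E0: "0 \<le> E" unfolding E_def L2L2_norm_def set_lebesgue_integral_def
      by (intro real_sqrt_ge_zero integral_nonneg_AE) simp
    have \<phi>i: "integrable torus \<phi>" using \<phi> by (simp add: in_H_def L2fun_integrable)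
    have "nrm (modes (real K)) (\<lambda>k. fcoef W2 k - fcoef W1 k) \<le> S * real K powr (3 * \<zeta> / 2) * E"
    proof (rule stab[OF _ _ pot1 pot2 W1(2) _ _ f1(1) f2(1) _ _ _ _ Zc])
      show "2 < \<zeta>" using \<zeta> \<beta> card_d_ge_1[where 'd = 'd] by linarith
      show "fcoef W2 0 = 0" by (rule real_trigp(5)[OF trigp_EK[OF W2]]) (simp add: kvec_zero)
      show "fcoef W2 k = 0" if "real K < norm (kvec k)" for k using that real_trigp(5)[OF trigp_EK[OF W2]] by auto
      show "hbd (real CARD('d)) (fcoef (\<rho>2 0)) (max h 1)"
        unfolding f2(2) by (rule hbd_mono[OF in_H_mono_hbd[OF \<phi>] order_refl]) (use \<beta> h in auto)
      show "coercive (fcoef (\<rho>2 0)) phimin" unfolding f2(2) by (rule coercive_fcoef[OF \<phi>i]) (use low in blast)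
      show "hbd 0 (\<lambda>k. fcoef (\<rho>2 t) k - fcoef (\<rho>1 t) k) (Z t)" if t: "t \<in> {0..T}" for t
        unfolding Z_def
        by (rule L2_norm_hbd[OF L(2)[OF t] L(1)[OF t] hbd_mono[OF C2[OF t] _ order_refl] hbd_mono[OF C1[OF t] _ order_refl]])
          (use \<beta> in auto)
    qed (use K A2 ZE E0 in \<open>auto simp: f1(2) f2(2)\<close>)
    moreover have "L2_norm (\<lambda>x. W2 x - W1 x) \<le> L2_norm (\<lambda>x. W1 x - P x) + nrm (modes (real K)) (\<lambda>k. fcoef W2 k - fcoef W1 k)"
      by (rule projection_bound[OF W2 W1i P])
    moreover have "S * real K powr (3 * \<zeta> / 2) * E
      \<le> S * real K powr (3 * \<zeta> / 2) * (E + H1H_norm T (-2) (\<lambda>t x. \<rho>2 t x - \<rho>1 t x) (\<lambda>t x. g2 t x - g1 t x))"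
    proof (rule mult_left_mono)
      have "0 \<le> H1H_norm T (-2) (\<lambda>t x. \<rho>2 t x - \<rho>1 t x) (\<lambda>t x. g2 t x - g1 t x)"
        unfolding H1H_norm_def set_lebesgue_integral_def by (intro real_sqrt_ge_zero integral_nonneg_AE) simp
      thus "E \<le> E + H1H_norm T (-2) (\<lambda>t x. \<rho>2 t x - \<rho>1 t x) (\<lambda>t x. g2 t x - g1 t x)" by simp
    qed (use S in simp)
    ultimately show "L2_norm (\<lambda>x. W2 x - W1 x) \<le> L2_norm (\<lambda>x. W1 x - P x) + S * real K powr (3 * \<zeta> / 2) *
        (L2L2_norm T (\<lambda>t x. \<rho>2 t x - \<rho>1 t x) + H1H_norm T (-2) (\<lambda>t x. \<rho>2 t x - \<rho>1 t x) (\<lambda>t x. g2 t x - g1 t x))"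
      unfolding E_def by linarith
  qed
qed

end
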